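(* Let $X \subset \mathbb{P}^{n+2}$ be a nonsingular intersection of two quadric hypersurfaces with $n>4$. Let $\widetilde{\mu}^X: X^{\rm reg} \to \widetilde{\mathcal{M}}_n^{\rm PQ}$ be the refined moduli map of second fundamental forms on $X$. Denote by $X^{\rm good}$ the subset $\{x\in X^{\rm reg} \mid \mathrm{Ker}(\mathrm{d}_x\widetilde{\mu}^X)=0\}\subset X^{\rm reg}$. Then $X^{\rm good}$ is nonempty.
   Context: Everything is over $\mathbb{C}$. Let $W$ be a complex vector space of dimension $n\ge 3$. A pencil of quadrics on $W$ is a line $\Phi$ in $\mathbb{P}(\mathrm{Sym}^2(W^* ))$. A quadratic form is degenerate if its symmetric bilinear form has nontrivial kernel; let $D\subset\mathbb{P}(\mathrm{Sym}^2(W^* ))$ be the hypersurface (of degree $n$) of degenerate forms. A pencil $\Phi$ is nonsingular if its general elements are nondegenerate and $\Phi$ meets $D$ in $n$ distinct points. $\mathrm{PGL}(W)$ acts on pencils by pull-back, and $\mathcal{M}^{\rm PQ}_n$ is the orbit space of nonsingular pencils modulo $\mathrm{PGL}(W)$ (a Zariski open subset of the GIT quotient; independent of the choice of $W$). The refined moduli space $\widetilde{\mathcal{M}}^{\rm PQ}_n$ is the orbit space of pairs $(\Phi,P)$, with $\Phi$ a nonsingular pencil on $W$ and $P\in\mathrm{Gr}(3,W)$ a three-dimensional vector subspace, modulo the action $T\cdot(\Phi,P)=(T^*(\Phi),T^{-1}(P))$ of $\mathrm{PGL}(W)$; it is likewise independent of $W$. Let $X\subset\mathbb{P}^{n+2}=\mathbb{P}(V)$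 be a nonsingular intersection of two quadric hypersurfaces (so $\dim X=n$), with pencil $\Phi_X$ of quadratic forms vanishing on $X$. One can choose linearly independent nondegenerate forms $\varphi_1,\varphi_2$ spanning $\Phi_X$ and a basis $\mathbf e_1,\dots,\mathbf e_{n+3}$ of $V$ with $\varphi_1(\sum z_i\mathbf e_i)=\sum\lambda_iz_i^2$, $\varphi_2(\sum z_i\mathbf e_i)=\sum z_i^2$, where $\lambda_1,\dots,\lambda_{n+3}$ are distinct nonzero complex numbers; fix such a choice. For $x\in X$ let $\widehat{x}\subset V$ be its line, $x^\perp\subset V$ the set of vectors orthogonal to $\widehat{x}$ for the bilinear forms of both $\varphi_1,\varphi_2$, and $W_x$ a complement of $\widehat{x}$ in $x^\perp$, identified with $T_x(X)$. The second fundamental form $II_{X,x}$ is the linear system of quadrics on $T_x(X)$ generated by $\varphi_1|_{W_x},\varphi_2|_{W_x}$. Let $X^o\subset X$ be the Zariski open subset where $II_{X,x}$ is a nonsingular pencil; the moduli map is $\mu^X:X^o\to\mathcal{M}^{\rm PQ}_n$, $x\mapsto[II_{X,x}]$. $X^{\rm reg}\subset X$ is the set of regular points, i.e. points $x=[x_1:\cdots:x_{n+3}]$ such that: (i) all $x_i\ne0$; (ii) $II_{X,x}$ is a nonsingular pencil; (iii) the identity is the only projective automorphism of $II_{X,x}\cong\mathbb{P}^1$ preserving its set of $n$ degenerate elements; (iv) the quadratic forms induced by $\varphi_1,\varphi_2$ on $T_x(X)$ are nondegenerate. For $x\in X^{\rm reg}$, $\mathcal{P}_x:=\mathrm{Ker}(\mathrm{d}_x\mu^X)\subset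 T_x(X)$ is a three-dimensional subspace. The refined moduli map $\widetilde{\mu}^X:X^{\rm reg}\to\widetilde{\mathcal{M}}^{\rm PQ}_n$ sends $x$ to the class of the pair $(II_{X,x},\mathcal{P}_x)$ (taking $W=T_x(X)$). *)

theory Defs
  imports "HOL-Analysis.Analysis"
begin

text \<open>
  Conventions.  A quadratic form on \<open>\<complex>\<^sup>m\<close> is represented by its symmetric matrix, a point of
  projective space by any of its homogeneous coordinate vectors (a nonzero vector), so that
  subsets of projective space are represented by punctured affine cones.
\<close>

section \<open>Quadratic forms and pencils\<close>

definition bil :: "complex^'m^'m \<Rightarrow> complex^'m \<Rightarrow> complex^'m \<Rightarrow> complex" where
  "bil S u v = (\<Sum>i\<in>UNIV. u $ i * (S *v v) $ i)"

definition quad :: "complex^'m^'m \<Rightarrow> complex^'m \<Rightarrow> complex" where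
  "quad S v = bil S v v"

definition forms :: "(complex^'m^'m) set" where
  "forms = {S. transpose S = S}"

definition degenerate :: "complex^'m^'m \<Rightarrow> bool" where
  "degenerate S \<longleftrightarrow> (\<exists>v. v \<noteq> 0 \<and> (\<forall>u. bil S u v = 0))"

definition mscale :: "complex \<Rightarrow> complex^'m^'k \<Rightarrow> complex^'m^'k" where
  "mscale c A = (\<chi> i j. c * A $ i $ j)"

definition form_span :: "complex^'m^'m \<Rightarrow> complex^'m^'m \<Rightarrow> (complex^'m^'m) set" where
  "form_span A B = {mscale a A + mscale b B | a b. True}"

definition forms_independent :: "complex^'m^'m \<Rightarrow> complex^'m^'m \<Rightarrow> bool" where
  "forms_independent A B \<longleftrightarrow> (\<forall>a b. mscale a A + mscale b B = 0 \<longrightarrow> a = 0 \<and> b = 0)"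

text \<open>A pencil (a line in the projective space of forms) is represented by the two-dimensional
  space of forms lying over it.\<close>

definition is_pencil :: "(complex^'m^'m) set \<Rightarrow> bool" where
  "is_pencil \<Phi> \<longleftrightarrow> (\<exists>A\<in>forms. \<exists>B\<in>forms. forms_independent A B \<and> \<Phi> = form_span A B)"

text \<open>The points in which the projective line over \<open>\<Phi>\<close> meets the discriminant hypersurface;
  here a point is the line \<open>\<complex> A\<close>.\<close>

definition degenerate_elements :: "(complex^'m^'m) set \<Rightarrow> (complex^'m^'m) set set" where
  "degenerate_elements \<Phi> = {range (\<lambda>c. mscale c A) | A. A \<in> \<Phi> \<and> A \<noteq> 0 \<and> degenerate A}"

text \<open>Degeneracy is a Zariski closed condition, so the general element of a pencil is
  nondegenerate as soon as one element is.\<close>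

definition nonsingular_pencil :: "(complex^'m^'m) set \<Rightarrow> bool" where
  "nonsingular_pencil \<Phi> \<longleftrightarrow>
     is_pencil \<Phi> \<and> (\<exists>A\<in>\<Phi>. \<not> degenerate A) \<and>
     finite (degenerate_elements \<Phi>) \<and> card (degenerate_elements \<Phi>) = CARD('m)"

text \<open>The identity is the only projective automorphism of the projective line over \<open>\<Phi>\<close> that
  preserves the set of degenerate elements; a projective automorphism is the class of a linear
  automorphism \<open>T\<close> modulo scalars.\<close>

definition rigid_pencil :: "(complex^'m^'m) set \<Rightarrow> bool" where
  "rigid_pencil \<Phi> \<longleftrightarrow>
     (\<forall>T. bij_betw T \<Phi> \<Phi> \<and>
          (\<forall>A\<in>\<Phi>. \<forall>B\<in>\<Phi>. \<forall>a b. T (mscale a A + mscale b B) = mscale a (T A) + mscale b (T B)) \<and>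
          (\<forall>A\<in>\<Phi>. degenerate (T A) \<longleftrightarrow> degenerate A)
        \<longrightarrow> (\<exists>c. \<forall>A\<in>\<Phi>. T A = mscale c A))"

text \<open>The form \<open>w \<mapsto> S(E w)\<close>, for a linear map \<open>E\<close>.\<close>

definition pull :: "complex^'n^'m \<Rightarrow> complex^'m^'m \<Rightarrow> complex^'n^'n" where
  "pull E S = transpose E ** S ** E"


section \<open>Moduli of nonsingular pencils\<close>

text \<open>Orbits under the projective linear group coincide with orbits under the general linear
  group, scalars acting trivially on pencils and on subspaces.  The model space is
  \<open>W = \<complex>\<^sup>n\<close>.\<close>

definition pencil_class :: "(complex^'n^'n) set \<Rightarrow> (complex^'n^'n) set set" where
  "pencil_class \<Phi> = {pull T ` \<Phi> | T. invertible T}"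

definition pair_class ::
  "(complex^'n^'n) set \<Rightarrow> (complex^'n) set \<Rightarrow> ((complex^'n^'n) set \<times> (complex^'n) set) set" where
  "pair_class \<Phi> P = {(pull T ` \<Phi>, {w. T *v w \<in> P}) | T. invertible T}"

definition MPQ :: "(complex^'n^'n) set set set" where
  "MPQ = {pencil_class \<Phi> | \<Phi>. nonsingular_pencil \<Phi>}"

definition refined_MPQ :: "((complex^'n^'n) set \<times> (complex^'n) set) set set" where
  "refined_MPQ = {pair_class \<Phi> P | \<Phi> P.
      nonsingular_pencil \<Phi> \<and> vec.subspace P \<and> vec.dim P = 3}"

text \<open>Holomorphy of a function on a relatively open subset \<open>F\<close> of a complex linear subspace \<open>S\<close>;
  the argument \<open>sc\<close> is the complex scalar multiplication of the ambient space.\<close>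

definition holo_on_open ::
  "(complex \<Rightarrow> 'a::real_normed_vector \<Rightarrow> 'a) \<Rightarrow> 'a set \<Rightarrow> ('a \<Rightarrow> complex) \<Rightarrow> 'a set \<Rightarrow> bool" where
  "holo_on_open sc S f F \<longleftrightarrow> openin (top_of_set S) F \<and>
     (\<forall>u\<in>F. \<exists>D. (f has_derivative D) (at u within S) \<and> (\<forall>c h. D (sc c h) = c * D h))"

text \<open>The orbit spaces carry the quotient complex structure: a set \<open>U\<close> of orbits is open, and a
  function \<open>h\<close> on it is holomorphic, iff its preimage in (respectively its pull-back to) the space
  of pencils, respectively of pairs, is.  Points of the Grassmannians of pencils and of
  three-dimensional subspaces are in turn parametrized by their bases, that is \<open>(A, B)\<close> for
  \<open>form_span A B\<close> and the rows of \<open>p\<close> for \<open>P\<close>; the Grassmannians are quotients of the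
  spaces of bases by holomorphic submersions.\<close>

definition MPQ_holo :: "((complex^'n^'n) set set \<Rightarrow> complex) \<Rightarrow> (complex^'n^'n) set set set \<Rightarrow> bool" where
  "MPQ_holo h U \<longleftrightarrow> U \<subseteq> MPQ \<and>
     holo_on_open (\<lambda>c (A, B). (mscale c A, mscale c B)) (forms \<times> forms)
       (\<lambda>(A, B). h (pencil_class (form_span A B)))
       {(A, B). A \<in> forms \<and> B \<in> forms \<and> nonsingular_pencil (form_span A B) \<and> forms_independent A B \<and>
          pencil_class (form_span A B) \<in> U}"

definition refined_MPQ_holo ::
  "(((complex^'n^'n) set \<times> (complex^'n) set) set \<Rightarrow> complex) \<Rightarrow>
   ((complex^'n^'n) set \<times> (complex^'n) set) set set \<Rightarrow> bool" where
  "refined_MPQ_holo h U \<longleftrightarrow> U \<subseteq> refined_MPQ \<and>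
     holo_on_open (\<lambda>c (A, B, p). (mscale c A, mscale c B, mscale c p))
       (forms \<times> forms \<times> (UNIV :: (complex^'n^3) set))
       (\<lambda>(A, B, p). h (pair_class (form_span A B) (vec.span (rows p))))
       {(A, B, p). A \<in> forms \<and> B \<in> forms \<and> nonsingular_pencil (form_span A B) \<and> forms_independent A B \<and>
          vec.dim (vec.span (rows p)) = 3 \<and>
          pair_class (form_span A B) (vec.span (rows p)) \<in> U}"


section \<open>Intersections of two quadrics and their second fundamental forms\<close>

text \<open>Scheme-theoretic nonsingularity is expressed by the Jacobian criterion: at every point the
  gradients \<open>2 Q\<^sub>1 x\<close> and \<open>2 Q\<^sub>2 x\<close> of the two equations are linearly independent.\<close>

definition nonsingular_intersection_of_two_quadrics :: "(complex^'v) set \<Rightarrow> bool" where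
  "nonsingular_intersection_of_two_quadrics X \<longleftrightarrow>
     (\<exists>Q1\<in>forms. \<exists>Q2\<in>forms. X = {x. x \<noteq> 0 \<and> quad Q1 x = 0 \<and> quad Q2 x = 0} \<and>
        (\<forall>x\<in>X. \<forall>a b. a *s (Q1 *v x) + b *s (Q2 *v x) = 0 \<longrightarrow> a = 0 \<and> b = 0))"

definition vanishing_forms :: "(complex^'v) set \<Rightarrow> (complex^'v^'v) set" where
  "vanishing_forms X = {S\<in>forms. \<forall>x\<in>X. quad S x = 0}"

definition diagonalizing_choice ::
  "(complex^'v) set \<Rightarrow> complex^'v^'v \<Rightarrow> complex^'v^'v \<Rightarrow> ('v \<Rightarrow> complex^'v) \<Rightarrow> ('v \<Rightarrow> complex) \<Rightarrow> bool" where
  "diagonalizing_choice X \<phi>1 \<phi>2 e lam \<longleftrightarrow>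
     \<phi>1 \<in> forms \<and> \<phi>2 \<in> forms \<and> \<not> degenerate \<phi>1 \<and> \<not> degenerate \<phi>2 \<and>
     forms_independent \<phi>1 \<phi>2 \<and> form_span \<phi>1 \<phi>2 = vanishing_forms X \<and>
     inj e \<and> vec.independent (range e) \<and> vec.span (range e) = UNIV \<and>
     inj lam \<and> (\<forall>i. lam i \<noteq> 0) \<and>
     (\<forall>z. quad \<phi>1 (\<Sum>i\<in>UNIV. z i *s e i) = (\<Sum>i\<in>UNIV. lam i * (z i)\<^sup>2)) \<and>
     (\<forall>z. quad \<phi>2 (\<Sum>i\<in>UNIV. z i *s e i) = (\<Sum>i\<in>UNIV. (z i)\<^sup>2))"

definition perp :: "complex^'v^'v \<Rightarrow> complex^'v^'v \<Rightarrow> complex^'v \<Rightarrow> (complex^'v) set" where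
  "perp \<phi>1 \<phi>2 x = {v. bil \<phi>1 x v = 0 \<and> bil \<phi>2 x v = 0}"

text \<open>An isomorphism \<open>E\<close> of \<open>\<complex>\<^sup>n\<close> with a complement \<open>W\<^sub>x\<close> of the line \<open>\<complex> x\<close> in \<open>perp \<phi>1 \<phi>2 x\<close>,
  that is, with the tangent space \<open>T\<^sub>x(X) = perp \<phi>1 \<phi>2 x / \<complex> x\<close>.\<close>

definition tangent_frame ::
  "complex^'v^'v \<Rightarrow> complex^'v^'v \<Rightarrow> complex^'v \<Rightarrow> complex^'n^'v \<Rightarrow> bool" where
  "tangent_frame \<phi>1 \<phi>2 x E \<longleftrightarrow>
     bij_betw (\<lambda>(w, c). E *v w + c *s x) UNIV (perp \<phi>1 \<phi>2 x)"

definition II :: "complex^'v^'v \<Rightarrow> complex^'v^'v \<Rightarrow> complex^'n^'v \<Rightarrow> (complex^'n^'n) set" where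
  "II \<phi>1 \<phi>2 E = form_span (pull E \<phi>1) (pull E \<phi>2)"

definition X_o ::
  "'n::finite itself \<Rightarrow> (complex^'v) set \<Rightarrow> complex^'v^'v \<Rightarrow> complex^'v^'v \<Rightarrow> (complex^'v) set" where
  "X_o _ X \<phi>1 \<phi>2 = {x\<in>X. \<exists>E :: complex^'n^'v. tangent_frame \<phi>1 \<phi>2 x E \<and>
      nonsingular_pencil (II \<phi>1 \<phi>2 E)}"

text \<open>The frames at \<open>x\<close> form one orbit of the general linear group up to changing the complement
  \<open>W\<^sub>x\<close>, which does not affect the second fundamental form; hence the set below is the class of
  \<open>II \<phi>1 \<phi>2 E\<close> for any single frame \<open>E\<close>.\<close>

definition moduli_map ::
  "complex^'v^'v \<Rightarrow> complex^'v^'v \<Rightarrow> complex^'v \<Rightarrow> (complex^'n^'n) set set" where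
  "moduli_map \<phi>1 \<phi>2 x = {II \<phi>1 \<phi>2 E | E. tangent_frame \<phi>1 \<phi>2 x E}"

text \<open>Holomorphic arcs \<open>\<gamma>\<close> in the punctured cone over (a subset \<open>Y\<close> of) \<open>X\<close> with
  \<open>\<gamma>(0) = x\<close> and \<open>\<gamma>'(0) = v\<close>.\<close>

definition arc_in :: "(complex^'v) set \<Rightarrow> complex^'v \<Rightarrow> complex^'v \<Rightarrow> (complex \<Rightarrow> complex^'v) \<Rightarrow> bool" where
  "arc_in Y x v \<gamma> \<longleftrightarrow> \<gamma> 0 = x \<and>
     (\<exists>r>0. (\<forall>z\<in>ball 0 r. \<gamma> z \<in> Y) \<and> (\<forall>i. (\<lambda>z. \<gamma> z $ i) holomorphic_on ball 0 r)) \<and>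
     (\<forall>i. ((\<lambda>z. \<gamma> z $ i) has_field_derivative v $ i) (at 0))"

text \<open>The preimage in \<open>perp \<phi>1 \<phi>2 x\<close> of \<open>Ker d\<^sub>x \<mu> \<subseteq> perp \<phi>1 \<phi>2 x / \<complex> x\<close>, for the moduli map \<open>\<mu>\<close>:
  a tangent vector is in the kernel iff it annihilates \<open>h \<circ> \<mu>\<close> for all germs \<open>h\<close> of holomorphic
  functions on the orbit space at \<open>\<mu>(x)\<close>.  This is the differential with values in the
  Zariski tangent space of the orbit space.\<close>

definition ker_moduli_map ::
  "'n::finite itself \<Rightarrow> (complex^'v) set \<Rightarrow> complex^'v^'v \<Rightarrow> complex^'v^'v \<Rightarrow> complex^'v \<Rightarrow> (complex^'v) set" where
  "ker_moduli_map N X \<phi>1 \<phi>2 x = {v \<in> perp \<phi>1 \<phi>2 x.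
     \<forall>(h :: (complex^'n^'n) set set \<Rightarrow> complex) U \<gamma>.
       MPQ_holo h U \<and> moduli_map \<phi>1 \<phi>2 x \<in> U \<and> arc_in (X_o N X \<phi>1 \<phi>2) x v \<gamma> \<longrightarrow>
       ((\<lambda>z. h (moduli_map \<phi>1 \<phi>2 (\<gamma> z))) has_field_derivative 0) (at 0)}"

definition X_reg ::
  "'n::finite itself \<Rightarrow> (complex^'v) set \<Rightarrow> complex^'v^'v \<Rightarrow> complex^'v^'v \<Rightarrow> ('v \<Rightarrow> complex^'v)
     \<Rightarrow> (complex^'v) set" where
  "X_reg _ X \<phi>1 \<phi>2 e = {x\<in>X.
     (\<exists>z. x = (\<Sum>i\<in>UNIV. z i *s e i) \<and> (\<forall>i. z i \<noteq> 0)) \<and>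
     (\<exists>E :: complex^'n^'v. tangent_frame \<phi>1 \<phi>2 x E \<and>
        nonsingular_pencil (II \<phi>1 \<phi>2 E) \<and> rigid_pencil (II \<phi>1 \<phi>2 E) \<and>
        \<not> degenerate (pull E \<phi>1) \<and> \<not> degenerate (pull E \<phi>2))}"

text \<open>The class of \<open>(II\<^sub>x, P\<^sub>x)\<close> with \<open>P\<^sub>x = Ker d\<^sub>x \<mu>\<close>, transported to the model space by all
  frames.\<close>

definition refined_moduli_map ::
  "(complex^'v) set \<Rightarrow> complex^'v^'v \<Rightarrow> complex^'v^'v \<Rightarrow> complex^'v
     \<Rightarrow> ((complex^'n^'n) set \<times> (complex^'n) set) set" where
  "refined_moduli_map X \<phi>1 \<phi>2 x =
     {(II \<phi>1 \<phi>2 E, {w. E *v w \<in> ker_moduli_map TYPE('n) X \<phi>1 \<phi>2 x}) | E. tangent_frame \<phi>1 \<phi>2 x E}"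

definition ker_refined_moduli_map ::
  "'n::finite itself \<Rightarrow> (complex^'v) set \<Rightarrow> complex^'v^'v \<Rightarrow> complex^'v^'v \<Rightarrow> ('v \<Rightarrow> complex^'v)
     \<Rightarrow> complex^'v \<Rightarrow> (complex^'v) set" where
  "ker_refined_moduli_map N X \<phi>1 \<phi>2 e x = {v \<in> perp \<phi>1 \<phi>2 x.
     \<forall>(h :: ((complex^'n^'n) set \<times> (complex^'n) set) set \<Rightarrow> complex) U \<gamma>.
       refined_MPQ_holo h U \<and> refined_moduli_map X \<phi>1 \<phi>2 x \<in> U \<and>
       arc_in (X_reg N X \<phi>1 \<phi>2 e) x v \<gamma> \<longrightarrow>
       ((\<lambda>z. h (refined_moduli_map X \<phi>1 \<phi>2 (\<gamma> z))) has_field_derivative 0) (at 0)}"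

text \<open>As \<open>ker_refined_moduli_map\<close> is a preimage under \<open>perp \<phi>1 \<phi>2 x \<rightarrow> T\<^sub>x(X)\<close>, the kernel
  vanishes iff this preimage is the line \<open>\<complex> x\<close>.\<close>

definition X_good ::
  "'n::finite itself \<Rightarrow> (complex^'v) set \<Rightarrow> complex^'v^'v \<Rightarrow> complex^'v^'v \<Rightarrow> ('v \<Rightarrow> complex^'v)
     \<Rightarrow> (complex^'v) set" where
  "X_good N X \<phi>1 \<phi>2 e =
     {x \<in> X_reg N X \<phi>1 \<phi>2 e. ker_refined_moduli_map N X \<phi>1 \<phi>2 e x = vec.span {x}}"

end

theory Submission
  imports Defs
begin

text \<open>The quadrics are diagonalized, so that \<open>X\<close> is given by \<open>\<Sum>\<^sub>i x\<^sub>i\<^sup>2 = \<Sum>\<^sub>i lam\<^sub>i x\<^sub>i\<^sup>2 = 0\<close>.  By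
  Lagrange interpolation these two equations say that the polynomial with value \<open>x\<^sub>i\<^sup>2 L\<^sub>i\<close> at
  \<open>lam\<^sub>i\<close>, where \<open>L\<^sub>i\<close> is the product of the \<open>lam\<^sub>i - lam\<^sub>j\<close> for \<open>j \<noteq> i\<close>, has degree at most \<open>n\<close>.
  At a regular point this polynomial is \<open>C \<Prod>\<^sub>k (s - t\<^sub>k)\<close> with distinct roots \<open>t\<^sub>k\<close>, which are the
  parameters of the \<open>n\<close> degenerate elements of the second fundamental form (\<open>in_X_reg\<close>, \<open>X_regD\<close>).
  The vectors \<open>w\<^sub>k = (x\<^sub>i / (lam\<^sub>i - t\<^sub>k))\<^sub>i\<close> form a frame of the tangent space that diagonalizes both
  forms (\<open>W_frame\<close>, \<open>pull_W_D1\<close>, \<open>pull_W_D2\<close>).  So the second fundamental form has the moduli of the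
  set of the \<open>t\<^sub>k\<close> up to projective transformations.  The roots may be moved freely, and moving them
  with velocity \<open>\<sigma>\<^sub>k\<close> moves \<open>x\<close> in the direction \<open>- \<Sum>\<^sub>k \<sigma>\<^sub>k w\<^sub>k / 2\<close> (\<open>root_arc\<close>).

  The differential of the moduli map is controlled by cross ratios of the roots.  They depend on a
  labelling of the roots, but close to a configuration without projective symmetries there is only
  one labelling close to the given one, so they descend to functions on an open subset of the orbit
  space; these are holomorphic since a frame diagonalizing a pencil can be chosen to depend
  holomorphically on the pencil, by the inverse function theorem (\<open>local_diagonalization\<close>,
  \<open>cross_ratio_MPQ_holo\<close>).  Hence the kernel consists of the velocities preserving all cross ratios,
  which are the quadratic ones, \<open>\<sigma>\<^sub>k = q(t\<^sub>k)\<close> with \<open>deg q \<le> 2\<close> (\<open>ker_moduli_map_eq\<close>).  In the frame of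
  the \<open>w\<^sub>k\<close>, the subspace \<open>P\<^sub>x\<close> is therefore the row space of the Vandermonde matrix with rows \<open>1\<close>,
  \<open>t\<^sub>k\<close>, \<open>t\<^sub>k\<^sup>2\<close>.

  A pair of a diagonal pencil, spanned by diagonal forms \<open>a\<close> and \<open>b\<close>, and a subspace has further
  invariants: if \<open>m\<^sub>i\<^sub>j\<^sub>k\<close> are the maximal minors of a basis of the subspace and
  \<open>d\<^sub>i\<^sub>j = a\<^sub>i b\<^sub>j - a\<^sub>j b\<^sub>i\<close>, then \<open>m\<^sub>i\<^sub>j\<^sub>k\<^sup>2 d\<^sub>i\<^sub>j / (m\<^sub>l\<^sub>j\<^sub>k\<^sup>2 d\<^sub>l\<^sub>j)\<close> is unchanged by rescaling the coordinates and by
  all changes of basis (\<open>minor_ratio_pair_invariant\<close>).  A vector in the kernel of the refined moduli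
  map comes from some quadratic \<open>q = a + b s + c s\<^sup>2\<close>, and logarithmic differentiation of these
  invariants along the corresponding projective motion of the roots shows that
  \<open>q(t\<^sub>k) \<Lambda>'(t\<^sub>k) / \<Lambda>(t\<^sub>k) - (n + 3) c t\<^sub>k\<close> is independent of \<open>k\<close>, where \<open>\<Lambda>\<close> is the product of the
  \<open>s - lam\<^sub>i\<close> (\<open>ker_refined_quadratic_constraint\<close>).  For given \<open>s = t\<^sub>k\<close> this is a linear condition on
  \<open>a\<close>, \<open>b\<close>, \<open>c\<close> and the common value; the residues at the \<open>lam\<^sub>i\<close> show that the conditions for all
  \<open>s\<close> together have only the trivial solution, so four suitable values of \<open>s\<close> suffice.  Since
  \<open>n > 4\<close>, four roots can be used for this purpose, and there is still a root left to make the
  configuration free of symmetries (\<open>exists_good_roots\<close>).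

  That the kernel contains the line spanned by \<open>x\<close> needs an argument as well, because all arcs in
  that direction have to be considered: the derivative along an arc only depends on its tangent
  vector (\<open>refined_chain_rule\<close>), and along \<open>(1 + c z) x\<close> nothing changes.  For this the subspace
  \<open>P\<^sub>y\<close> is described by a basis that is rational in \<open>y\<close> and does not refer to the roots
  (\<open>kernel_basis_eq\<close>).\<close>

section \<open>Forms, pull-backs and diagonal pencils\<close>

lemma mat_vec_axis: "(A :: complex^'n^'m) *v axis k 1 = column k A"
proof -
  have "(A *v axis k 1) $ i = (\<Sum>j\<in>UNIV. if j = k then A $ i $ k else 0)" for i
    unfolding matrix_vector_mult_def vec_lambda_beta by (rule sum.cong) (auto simp: axis_def)
  then show ?thesis by (simp add: vec_eq_iff column_def)
qed

lemma bil_pull: "bil (pull E S) u v = bil S (E *v u) (E *v v)"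
proof -
  have dot: "(\<Sum>i\<in>UNIV. a $ i * (transpose E *v b) $ i) = (\<Sum>i\<in>UNIV. (E *v a) $ i * b $ i)" for a b
    unfolding matrix_vector_mult_def transpose_def
    by (simp add: sum_distrib_left sum_distrib_right mult_ac, subst sum.swap, simp)
  have "pull E S *v v = transpose E *v (S *v (E *v v))"
    by (simp add: pull_def matrix_vector_mul_assoc matrix_mul_assoc del: transpose_matrix_vector)
  then show ?thesis by (simp add: bil_def dot del: transpose_matrix_vector)
qed

lemma mscale_component [simp]: "mscale c A $ i $ j = c * A $ i $ j"
  by (simp add: mscale_def)

lemma mscale_mult_vec: "mscale c A *v v = c *s (A *v v)"
  by (simp add: vec_eq_iff matrix_vector_mult_def sum_distrib_left mult_ac)

lemma bil_comb: "bil (mscale a A + mscale b B) u v = a * bil A u v + b * bil B u v"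
  by (simp add: bil_def mscale_mult_vec matrix_vector_mult_add_rdistrib sum.distrib sum_distrib_left algebra_simps)

lemma mscale_mult_left: "mscale c A ** B = mscale c (A ** B)"
  by (simp add: vec_eq_iff matrix_matrix_mult_def sum_distrib_left mult_ac)

lemma mscale_mult_right: "B ** mscale c A = mscale c (B ** A)"
  by (simp add: vec_eq_iff matrix_matrix_mult_def sum_distrib_left mult_ac)

lemma matrix_add_mult_right: "(A + B) ** C = A ** C + B ** (C :: complex^'c^'b)" for A B :: "complex^'b^'a"
  by (simp add: vec_eq_iff matrix_matrix_mult_def sum.distrib algebra_simps)

lemma pull_comb: "pull E (mscale a A + mscale b B) = mscale a (pull E A) + mscale b (pull E B)"
  by (simp add: pull_def matrix_add_ldistrib matrix_add_mult_right mscale_mult_left mscale_mult_right)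

lemma pull_mscale: "pull E (mscale a A) = mscale a (pull E A)"
  by (simp add: pull_def mscale_mult_left mscale_mult_right)

lemma pull_zero [simp]: "pull E 0 = 0"
  by (simp add: pull_def matrix_matrix_mult_def vec_eq_iff)

lemma pull_pull: "pull E (pull F S) = pull (F ** E) S"
  by (simp add: pull_def matrix_transpose_mul matrix_mul_assoc)

lemma pull_mat_1 [simp]: "pull (mat 1) S = S"
  by (simp add: pull_def transpose_mat)

lemma pull_forms: "S \<in> forms \<Longrightarrow> pull E S \<in> forms"
  by (simp add: forms_def pull_def matrix_transpose_mul matrix_mul_assoc)

lemma pull_component: "pull E S $ j $ k = bil S (column j E) (column k E)"
proof -
  have "pull E S $ j $ k = (\<Sum>i\<in>UNIV. (\<Sum>l\<in>UNIV. E$l$j * S$l$i) * E$i$k)"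
    by (simp add: pull_def matrix_matrix_mult_def transpose_def)
  also have "\<dots> = (\<Sum>i\<in>UNIV. \<Sum>l\<in>UNIV. E$l$j * S$l$i * E$i$k)"
    by (simp add: sum_distrib_right)
  also have "\<dots> = (\<Sum>l\<in>UNIV. \<Sum>i\<in>UNIV. E$l$j * S$l$i * E$i$k)" by (rule sum.swap)
  also have "\<dots> = bil S (column j E) (column k E)"
    by (simp add: bil_def column_def matrix_vector_mult_def sum_distrib_left mult_ac)
  finally show ?thesis .
qed

lemma pull_form_span: "pull E ` form_span A B = form_span (pull E A) (pull E B)"
proof -
  have "pull E ` form_span A B = {pull E (mscale a A + mscale b B) | a b. True}"
    by (auto simp: form_span_def)
  then show ?thesis by (simp add: pull_comb form_span_def)
qed

lemma pull_inverse:
  assumes "invertible T" obtains T' where "invertible T'" "\<And>S. pull T' (pull T S) = S" "\<And>S. pull T (pull T' S) = S"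
    "T ** T' = mat 1" "T' ** T = mat 1"
proof -
  obtain T' where T': "T ** T' = mat 1" "T' ** T = mat 1" using assms by (auto simp: invertible_def)
  then have "invertible T'" by (auto simp: invertible_def)
  then show ?thesis using T' by (auto intro!: that simp: pull_pull)
qed

lemma degenerate_iff: "degenerate S \<longleftrightarrow> (\<exists>v. v \<noteq> 0 \<and> S *v v = 0)"
proof -
  have "(\<forall>u. bil S u v = 0) \<longleftrightarrow> S *v v = 0" for v
  proof
    assume *: "\<forall>u. bil S u v = 0"
    have "(S *v v) $ i = 0" for i
    proof -
      have "bil S (axis i 1) v = (\<Sum>j\<in>UNIV. if j = i then (S *v v) $ j else 0)"
        unfolding bil_def by (rule sum.cong) (auto simp: axis_def)
      with * show ?thesis by simp
    qed
    then show "S *v v = 0" by (simp add: vec_eq_iff)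
  qed (simp add: bil_def)
  then show ?thesis by (simp add: degenerate_def)
qed

lemma degenerate_pull:
  assumes "invertible T" shows "degenerate (pull T S) \<longleftrightarrow> degenerate S"
proof -
  have *: "degenerate S \<Longrightarrow> degenerate (pull T S)" if T: "invertible T" for T and S :: "complex^'m^'m"
  proof -
    assume "degenerate S"
    then obtain v where v: "v \<noteq> 0" "\<And>u. bil S u v = 0" by (auto simp: degenerate_def)
    obtain T' where T': "T ** T' = mat 1" using T by (auto simp: invertible_def)
    have "T *v (T' *v v) = v" by (simp add: matrix_vector_mul_assoc T')
    then show ?thesis unfolding degenerate_def using v
      by (intro exI[of _ "T' *v v"]) (auto simp: bil_pull)
  qed
  obtain T' where T': "invertible T'" "\<And>S. pull T' (pull T S) = S"
    using pull_inverse[OF assms] by metis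
  show ?thesis using *[OF assms, of S] *[OF T'(1), of "pull T S"] T'(2) by auto
qed

lemma forms_independent_pull:
  assumes "invertible T" shows "forms_independent (pull T A) (pull T B) \<longleftrightarrow> forms_independent A B"
proof -
  obtain T' where T': "invertible T'" "\<And>S. pull T' (pull T S) = S"
    using pull_inverse[OF assms] by metis
  have "mscale a (pull T A) + mscale b (pull T B) = 0 \<longleftrightarrow> mscale a A + mscale b B = 0" for a b
    by (metis T'(2) pull_comb pull_zero)
  then show ?thesis by (simp add: forms_independent_def)
qed

lemma nonsingular_pencil_pull:
  fixes T :: "complex^'m^'m"
  assumes T: "invertible T" and ns: "nonsingular_pencil \<Phi>"
  shows "nonsingular_pencil (pull T ` \<Phi>)"
proof -
  obtain T' where T': "invertible T'" "\<And>S. pull T' (pull T S) = S" "\<And>S. pull T (pull T' S) = S"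
    using pull_inverse[OF T] by metis
  have inj: "inj (pull T)" using T'(2) by (metis injI)
  have r: "range (\<lambda>c. mscale c (pull T A)) = pull T ` range (\<lambda>c. mscale c A)" for A
    by (simp add: pull_mscale[symmetric] image_image)
  have z: "pull T A = 0 \<longleftrightarrow> A = 0" for A using T'(2) by (metis pull_zero)
  have de: "degenerate_elements (pull T ` \<Phi>) = (image (pull T)) ` degenerate_elements \<Phi>"
  proof
    show "degenerate_elements (pull T ` \<Phi>) \<subseteq> (image (pull T)) ` degenerate_elements \<Phi>"
    proof
      fix z' assume "z' \<in> degenerate_elements (pull T ` \<Phi>)"
      then obtain A where A: "z' = range (\<lambda>c. mscale c (pull T A))" "A \<in> \<Phi>" "A \<noteq> 0" "degenerate A"
        unfolding degenerate_elements_def using degenerate_pull[OF T] z by auto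
      then show "z' \<in> (image (pull T)) ` degenerate_elements \<Phi>"
        unfolding degenerate_elements_def r by blast
    qed
    show "(image (pull T)) ` degenerate_elements \<Phi> \<subseteq> degenerate_elements (pull T ` \<Phi>)"
    proof
      fix z' assume "z' \<in> (image (pull T)) ` degenerate_elements \<Phi>"
      then obtain A where A: "z' = pull T ` range (\<lambda>c. mscale c A)" "A \<in> \<Phi>" "A \<noteq> 0" "degenerate A"
        unfolding degenerate_elements_def by auto
      then show "z' \<in> degenerate_elements (pull T ` \<Phi>)"
        unfolding degenerate_elements_def using r[symmetric] z degenerate_pull[OF T]
        by (auto intro!: exI[of _ "pull T A"])
    qed
  qed
  have "card (degenerate_elements (pull T ` \<Phi>)) = card (degenerate_elements \<Phi>)"
    unfolding de by (rule card_image) (rule inj_on_subset[OF inj_on_image, of _ UNIV], insert inj, auto intro: inj_on_subset)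
  moreover have "is_pencil (pull T ` \<Phi>)"
    using ns unfolding nonsingular_pencil_def is_pencil_def
    by (metis forms_independent_pull[OF T] pull_form_span pull_forms)
  moreover have "\<exists>A\<in>pull T ` \<Phi>. \<not> degenerate A"
    using ns degenerate_pull[OF T] by (auto simp: nonsingular_pencil_def)
  ultimately show ?thesis using ns de by (simp add: nonsingular_pencil_def)
qed

lemma pencil_class_pull:
  assumes "invertible T" shows "pencil_class (pull T ` \<Phi>) = pencil_class \<Phi>"
proof -
  have *: "pencil_class (pull T ` \<Phi>) \<subseteq> pencil_class \<Phi>" if "invertible T" for T and \<Phi> :: "(complex^'m^'m) set"
    using that by (auto simp: pencil_class_def image_image pull_pull intro: invertible_mult)
  obtain T' where T': "invertible T'" "\<And>S. pull T' (pull T S) = S"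
    using pull_inverse[OF assms] by metis
  have "pencil_class \<Phi> = pencil_class (pull T' ` pull T ` \<Phi>)" by (simp add: image_image T')
  then show ?thesis using *[OF assms, of \<Phi>] *[OF T'(1), of "pull T ` \<Phi>"] by blast
qed

lemma pencil_class_self: "\<Phi> \<in> pencil_class \<Phi>"
  unfolding pencil_class_def by (auto intro!: exI[of _ "mat 1"] simp: invertible_def)

lemma pencil_class_eqD:
  assumes "pencil_class \<Phi> = pencil_class \<Psi>" obtains T where "invertible T" "\<Psi> = pull T ` \<Phi>"
proof -
  have "\<Psi> \<in> pencil_class \<Phi>" using pencil_class_self[of \<Psi>] assms by simp
  then show ?thesis using that by (auto simp: pencil_class_def)
qed

lemma pair_class_pull:
  assumes "invertible T" shows "pair_class (pull T ` \<Phi>) {w. T *v w \<in> P} = pair_class \<Phi> P"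
proof -
  have *: "pair_class (pull T ` \<Phi>) {w. T *v w \<in> P} \<subseteq> pair_class \<Phi> P" if "invertible T"
    for T and \<Phi> :: "(complex^'m^'m) set" and P
    using that by (fastforce simp: pair_class_def image_image pull_pull matrix_vector_mul_assoc intro: invertible_mult)
  obtain T' where T': "invertible T'" "\<And>S. pull T' (pull T S) = S" "T ** T' = mat 1"
    using pull_inverse[OF assms] by metis
  have "pair_class \<Phi> P = pair_class (pull T' ` pull T ` \<Phi>) {w. T' *v w \<in> {w. T *v w \<in> P}}"
    by (simp add: image_image T' matrix_vector_mul_assoc)
  then show ?thesis using *[OF assms, of \<Phi>] *[OF T'(1), of "pull T ` \<Phi>"] by blast
qed

lemma pair_class_self: "(\<Phi>, P) \<in> pair_class \<Phi> P"
  unfolding pair_class_def by (auto intro!: exI[of _ "mat 1"] simp: invertible_def)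

lemma pair_class_eqD:
  assumes "pair_class \<Phi> P = pair_class \<Psi> R" obtains T where "invertible T" "\<Psi> = pull T ` \<Phi>" "R = {w. T *v w \<in> P}"
proof -
  have "(\<Psi>, R) \<in> pair_class \<Phi> P" using pair_class_self[of \<Psi> R] assms by simp
  then show ?thesis using that by (auto simp: pair_class_def)
qed

definition diagm :: "('m \<Rightarrow> complex) \<Rightarrow> complex^'m^'m" where
  "diagm a = (\<chi> i j. if i = j then a i else 0)"

lemma diagm_component: "diagm a $ i $ j = (if i = j then a i else 0)"
  by (simp add: diagm_def)

lemma diagm_vec: "(diagm a *v v) $ i = a i * v $ i"
proof -
  have "(diagm a *v v) $ i = (\<Sum>j\<in>UNIV. if j = i then a i * v $ i else 0)"
    unfolding matrix_vector_mult_def vec_lambda_beta by (rule sum.cong) (auto simp: diagm_component)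
  then show ?thesis by simp
qed

lemma bil_diagm: "bil (diagm a) u v = (\<Sum>i\<in>UNIV. a i * u $ i * v $ i)"
  by (simp add: bil_def diagm_vec mult_ac)

lemma diagm_forms [simp]: "diagm a \<in> forms"
  by (simp add: forms_def transpose_def vec_eq_iff diagm_component)

lemma diagm_comb: "mscale s (diagm a) + mscale u (diagm b) = diagm (\<lambda>i. s * a i + u * b i)"
  by (simp add: vec_eq_iff diagm_component)

lemma diagm_mscale: "mscale s (diagm a) = diagm (\<lambda>i. s * a i)"
  by (simp add: vec_eq_iff diagm_component)

lemma diagm_eq_iff: "diagm a = diagm b \<longleftrightarrow> a = b"
  by (auto simp: vec_eq_iff diagm_component fun_eq_iff)

lemma diagm_zero: "diagm a = 0 \<longleftrightarrow> (\<forall>i. a i = 0)"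
  by (auto simp: vec_eq_iff diagm_component)

lemma degenerate_diagm: "degenerate (diagm a) \<longleftrightarrow> (\<exists>k. a k = 0)"
proof
  assume "degenerate (diagm a)"
  then obtain v where "v \<noteq> 0" "diagm a *v v = 0" by (auto simp: degenerate_iff)
  then show "\<exists>k. a k = 0" by (metis diagm_vec mult_eq_0_iff vec_eq_iff zero_index)
next
  assume "\<exists>k. a k = 0"
  then obtain k where k: "a k = 0" by blast
  have "diagm a *v axis k 1 = 0" by (simp add: vec_eq_iff diagm_vec axis_def k)
  then show "degenerate (diagm a)" unfolding degenerate_iff
    by (intro exI[of _ "axis k 1"]) (simp add: axis_eq_0_iff)
qed

lemma pull_diagm_component: "pull E (diagm a) $ j $ k = (\<Sum>i\<in>UNIV. a i * E $ i $ j * E $ i $ k)"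
  by (simp add: pull_component bil_diagm column_def)

lemma pull_diagm_diagm: "pull (diagm c) (diagm a) = diagm (\<lambda>k. (c k)\<^sup>2 * a k)"
proof -
  have "pull (diagm c) (diagm a) $ j $ k = diagm (\<lambda>k. (c k)\<^sup>2 * a k) $ j $ k" for j k
  proof -
    have "pull (diagm c) (diagm a) $ j $ k = (\<Sum>i\<in>UNIV. if i = j then (if j = k then (c k)\<^sup>2 * a k else 0) else 0)"
      unfolding pull_diagm_component by (rule sum.cong) (auto simp: diagm_component power2_eq_square)
    then show ?thesis by (simp add: diagm_component)
  qed
  then show ?thesis by (simp add: vec_eq_iff)
qed

lemma invertible_diagm: "(\<And>k. c k \<noteq> 0) \<Longrightarrow> invertible (diagm c)"
  unfolding invertible_def
proof (intro exI[of _ "diagm (\<lambda>k. inverse (c k))"] conjI)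
  have *: "diagm p ** diagm q = mat 1" if "\<And>k. p k * q k = 1" for p q :: "'a \<Rightarrow> complex"
  proof -
    have "(diagm p ** diagm q) $ j $ k = (mat 1 :: complex^'a^'a) $ j $ k" for j k
    proof -
      have "(diagm p ** diagm q) $ j $ k = (\<Sum>i\<in>UNIV. if i = j then (if j = k then p k * q k else 0) else 0)"
        unfolding matrix_matrix_mult_def vec_lambda_beta by (rule sum.cong) (auto simp: diagm_component)
      then show ?thesis by (simp add: mat_def that)
    qed
    then show ?thesis by (simp add: vec_eq_iff)
  qed
  assume "\<And>k. c k \<noteq> 0"
  then show "diagm c ** diagm (\<lambda>k. inverse (c k)) = mat 1" "diagm (\<lambda>k. inverse (c k)) ** diagm c = mat 1"
    by (auto intro!: *)
qed

definition det2 :: "('m \<Rightarrow> complex) \<Rightarrow> ('m \<Rightarrow> complex) \<Rightarrow> 'm \<Rightarrow> 'm \<Rightarrow> complex" where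
  "det2 a b i j = a i * b j - a j * b i"

text \<open>Pairwise distinctness of the points \<open>(a\<^sub>i : b\<^sub>i)\<close> of the projective line.\<close>

definition separated :: "('m \<Rightarrow> complex) \<Rightarrow> ('m \<Rightarrow> complex) \<Rightarrow> bool" where
  "separated a b \<longleftrightarrow> (\<forall>i j. i \<noteq> j \<longrightarrow> det2 a b i j \<noteq> 0)"

abbreviation Pen :: "('m \<Rightarrow> complex) \<Rightarrow> ('m \<Rightarrow> complex) \<Rightarrow> (complex^'m^'m) set" where
  "Pen a b \<equiv> form_span (diagm a) (diagm b)"

lemma exists_other_index:
  assumes "CARD('m::finite) > 1" shows "\<exists>j::'m. j \<noteq> k"
proof (rule ccontr)
  assume "\<nexists>j::'m. j \<noteq> k"
  then have "(UNIV :: 'm set) = {k}" by auto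
  then have "CARD('m) = card {k}" by (rule arg_cong)
  then show False using assms by simp
qed

lemma separated_nonzero:
  fixes a b :: "'m::finite \<Rightarrow> complex"
  assumes "separated a b" "CARD('m) > 1" shows "a k \<noteq> 0 \<or> b k \<noteq> 0"
proof -
  obtain j :: 'm where "j \<noteq> k" using exists_other_index[OF assms(2)] by blast
  then have "det2 a b k j \<noteq> 0" using assms by (auto simp: separated_def)
  then show ?thesis by (auto simp: det2_def)
qed

text \<open>This provides a nondegenerate element of a diagonal pencil.\<close>

lemma exists_nonvanishing_comb:
  fixes a b :: "'m::finite \<Rightarrow> complex"
  assumes "\<And>k. a k \<noteq> 0 \<or> b k \<noteq> 0" shows "\<exists>s. \<forall>k. s * a k + b k \<noteq> 0"
proof -
  have "finite (\<Union>k. {s. s * a k + b k = 0})"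
  proof (rule finite_UN_I)
    fix k
    have "s = - b k / a k" if "s * a k + b k = 0" for s
    proof -
      have "a k \<noteq> 0" using that assms[of k] by auto
      then show ?thesis using that by (simp add: field_simps eq_neg_iff_add_eq_0)
    qed
    then have "{s. s * a k + b k = 0} \<subseteq> {- b k / a k}" by auto
    then show "finite {s. s * a k + b k = 0}" by (rule finite_subset) simp
  qed simp
  then obtain s where "s \<notin> (\<Union>k. {s. s * a k + b k = 0})"
    using ex_new_if_finite infinite_UNIV_char_0 by blast
  then show ?thesis by auto
qed

lemma diagm_independent:
  fixes a b :: "'m::finite \<Rightarrow> complex"
  assumes "separated a b" "CARD('m) > 1" shows "forms_independent (diagm a) (diagm b)"
proof -
  obtain i j :: 'm where ij: "i \<noteq> j" using exists_other_index[OF assms(2)] by metis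
  show ?thesis unfolding forms_independent_def diagm_comb diagm_zero
  proof (intro allI impI)
    fix s u assume *: "\<forall>k. s * a k + u * b k = 0"
    have "s * det2 a b i j = 0" "u * det2 a b i j = 0"
      using *[rule_format, of i] *[rule_format, of j] unfolding det2_def by algebra+
    then show "s = 0 \<and> u = 0" using assms(1) ij by (auto simp: separated_def)
  qed
qed

lemma range_mscale: "s \<noteq> 0 \<Longrightarrow> range (\<lambda>c. mscale c (mscale s A)) = range (\<lambda>c. mscale c A)"
proof -
  assume s: "s \<noteq> 0"
  have "mscale c (mscale s A) = mscale (c * s) A" for c by (simp add: vec_eq_iff)
  moreover have "mscale c A = mscale (c / s) (mscale s A)" for c using s by (simp add: vec_eq_iff)
  ultimately show ?thesis by (metis (no_types, lifting) image_cong image_eqI subsetI subset_antisym rangeE rangeI)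
qed

text \<open>The degenerate elements are spanned by the forms \<open>b\<^sub>k a - a\<^sub>k b\<close>, one for each \<open>k\<close>: by
  separatedness such a form vanishes at position \<open>k\<close> only, which also makes these lines distinct.\<close>

lemma diagm_nonsingular:
  fixes a b :: "'m::finite \<Rightarrow> complex"
  assumes sep: "separated a b" and c: "CARD('m) > 1" shows "nonsingular_pencil (Pen a b)"
proof -
  note nz = separated_nonzero[OF sep c]
  define F where "F k = range (\<lambda>c. mscale c (diagm (\<lambda>i. det2 a b i k)))" for k
  have "degenerate_elements (Pen a b) = range F"
  proof
    show "degenerate_elements (Pen a b) \<subseteq> range F"
    proof
      fix z assume "z \<in> degenerate_elements (Pen a b)"
      then obtain s u where z: "z = range (\<lambda>c. mscale c (diagm (\<lambda>i. s * a i + u * b i)))"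
          and nz1: "diagm (\<lambda>i. s * a i + u * b i) \<noteq> 0" and dg: "degenerate (diagm (\<lambda>i. s * a i + u * b i))"
        by (auto simp: degenerate_elements_def form_span_def diagm_comb)
      then obtain k where k: "s * a k + u * b k = 0" by (auto simp: degenerate_diagm)
      obtain r where r: "s = r * b k" "u = - r * a k"
      proof (cases "b k = 0")
        case True
        then have "a k \<noteq> 0" "s = 0" using nz[of k] k by auto
        then show ?thesis using True that[of "- u / a k"] by simp
      next
        case False
        then have "u = - (s / b k) * a k" using k by (simp add: field_simps eq_neg_iff_add_eq_0 add.commute)
          then show ?thesis using False that[of "s / b k"] by simp
      qed
      have e: "diagm (\<lambda>i. s * a i + u * b i) = mscale r (diagm (\<lambda>i. det2 a b i k))"
        by (simp add: r diagm_mscale det2_def algebra_simps)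
      have "r \<noteq> 0" using nz1 r by (auto simp: diagm_zero)
      then have "z = F k" unfolding z e F_def by (rule range_mscale)
      then show "z \<in> range F" by simp
    qed
    show "range F \<subseteq> degenerate_elements (Pen a b)"
    proof clarsimp
      fix k :: 'm
      obtain j where "j \<noteq> k" using exists_other_index[OF c] by blast
      then have nz2: "diagm (\<lambda>i. det2 a b i k) \<noteq> 0" using sep by (auto simp: diagm_zero separated_def)
      have "diagm (\<lambda>i. det2 a b i k) = mscale (b k) (diagm a) + mscale (- a k) (diagm b)"
        by (simp add: diagm_comb det2_def mult_ac)
      then have "diagm (\<lambda>i. det2 a b i k) \<in> Pen a b" unfolding form_span_def by blast
      moreover have "degenerate (diagm (\<lambda>i. det2 a b i k))" by (auto simp: degenerate_diagm det2_def intro!: exI[of _ k])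
      ultimately show "F k \<in> degenerate_elements (Pen a b)"
        unfolding degenerate_elements_def F_def using nz2 by blast
    qed
  qed
  moreover have "inj F"
  proof (rule injI, rule ccontr)
    fix j k assume jk: "F j = F k" "j \<noteq> k"
    have "diagm (\<lambda>i. det2 a b i k) \<in> F k" unfolding F_def by (rule image_eqI[of _ _ 1]) (simp_all add: vec_eq_iff)
    then obtain c where "diagm (\<lambda>i. det2 a b i k) = mscale c (diagm (\<lambda>i. det2 a b i j))"
      using jk by (auto simp: F_def)
    then have "det2 a b j k = c * det2 a b j j" by (auto simp: diagm_mscale diagm_eq_iff fun_eq_iff)
    then show False using jk sep by (auto simp: det2_def separated_def)
  qed
  ultimately have "finite (degenerate_elements (Pen a b))" "card (degenerate_elements (Pen a b)) = CARD('m)"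
    by (auto simp: card_image)
  moreover have "is_pencil (Pen a b)" unfolding is_pencil_def
    using diagm_independent[OF sep c] by (intro bexI[of _ "diagm a"] bexI[of _ "diagm b"]) auto
  moreover have "\<exists>A\<in>Pen a b. \<not> degenerate A"
  proof -
    obtain s where s: "\<forall>k. s * a k + b k \<noteq> 0" using exists_nonvanishing_comb nz by blast
    have "diagm (\<lambda>k. s * a k + b k) = mscale s (diagm a) + mscale 1 (diagm b)"
      by (simp add: diagm_comb)
    then have "diagm (\<lambda>k. s * a k + b k) \<in> Pen a b" unfolding form_span_def by blast
    then show ?thesis using s degenerate_diagm[of "\<lambda>k. s * a k + b k"] by blast
  qed
  ultimately show ?thesis by (simp add: nonsingular_pencil_def)
qed

text \<open>The kernel of the degenerate element vanishing at position \<open>k\<close> is the \<open>k\<close>-th coordinate axis, so an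
  equivalence \<open>T\<close> of two such pencils permutes the coordinate axes, that is, \<open>T\<close> is a monomial
  matrix with some permutation \<open>\<sigma>\<close> and entries \<open>c\<^sub>k\<close>.  Comparing diagonal entries then relates the
  coefficients.\<close>

lemma diagonal_pencils_monomial:
  fixes a b a' b' :: "'m::finite \<Rightarrow> complex" and T :: "complex^'m^'m"
  assumes sep: "separated a b" and sep': "separated a' b'" and c: "CARD('m) > 1"
    and T: "invertible T" and eq: "pull T ` Pen a b = Pen a' b'"
  obtains \<sigma> c \<alpha> \<beta> \<gamma> \<delta> where "bij \<sigma>" "\<And>k. c k \<noteq> 0" "\<And>j k. T $ j $ k = (if j = \<sigma> k then c k else 0)"
    "\<alpha> * \<delta> - \<beta> * \<gamma> \<noteq> 0" "\<And>k. a' k = (c k)\<^sup>2 * (\<alpha> * a (\<sigma> k) + \<beta> * b (\<sigma> k))"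
    "\<And>k. b' k = (c k)\<^sup>2 * (\<gamma> * a (\<sigma> k) + \<delta> * b (\<sigma> k))"
proof -
  have "diagm a' = mscale 1 (diagm a') + mscale 0 (diagm b')" "diagm b' = mscale 0 (diagm a') + mscale 1 (diagm b')"
    by (simp_all add: diagm_comb)
  then have "diagm a' \<in> Pen a' b'" "diagm b' \<in> Pen a' b'"
    unfolding form_span_def by blast+
  then have "diagm a' \<in> pull T ` Pen a b" "diagm b' \<in> pull T ` Pen a b"
    using eq by auto
  then obtain \<alpha> \<beta> \<gamma> \<delta> where A: "diagm a' = pull T (diagm (\<lambda>i. \<alpha> * a i + \<beta> * b i))"
      and B: "diagm b' = pull T (diagm (\<lambda>i. \<gamma> * a i + \<delta> * b i))"
    by (auto simp: form_span_def diagm_comb)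
  obtain T' where T': "\<And>S. pull T (pull T' S) = S" "\<And>S. pull T' (pull T S) = S" "T ** T' = mat 1" "T' ** T = mat 1"
    using pull_inverse[OF T] by metis
  note nz' = separated_nonzero[OF sep' c]
  define D where "D = \<alpha> * \<delta> - \<beta> * \<gamma>"
  have D: "D \<noteq> 0"
  proof
    assume D0: "D = 0"
    have *: "p = 0 \<and> q = 0" if "\<And>i. p * (\<alpha> * a i + \<beta> * b i) + q * (\<gamma> * a i + \<delta> * b i) = 0" for p q
    proof -
      have "pull T (mscale p (diagm (\<lambda>i. \<alpha> * a i + \<beta> * b i)) + mscale q (diagm (\<lambda>i. \<gamma> * a i + \<delta> * b i))) = 0"
        using that by (simp add: diagm_comb diagm_zero[THEN iffD2])
      then have "mscale p (diagm a') + mscale q (diagm b') = 0" by (simp add: pull_comb A B)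
      then show ?thesis using diagm_independent[OF sep' c] by (simp add: forms_independent_def)
    qed
    have "\<gamma> = 0 \<and> -\<alpha> = 0" using D0 unfolding D_def by (intro *) algebra
    moreover have "\<delta> = 0 \<and> -\<beta> = 0" using D0 unfolding D_def by (intro *) algebra
    ultimately have "diagm a' = 0" using A by (simp add: diagm_zero[THEN iffD2])
    moreover have "diagm b' = 0" using B \<open>\<gamma> = 0 \<and> -\<alpha> = 0\<close> \<open>\<delta> = 0 \<and> -\<beta> = 0\<close> by (simp add: diagm_zero[THEN iffD2])
    ultimately show False using nz' by (auto simp: diagm_zero)
  qed
  \<comment> \<open>The element \<open>b'\<^sub>k A - a'\<^sub>k B\<close> of the second pencil kills the \<open>k\<close>-th axis, so its counterpart in the
     first pencil, a diagonal form, kills the \<open>k\<close>-th column of \<open>T\<close>.\<close>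
  have col: "(b' k * (\<alpha> * a j + \<beta> * b j) - a' k * (\<gamma> * a j + \<delta> * b j)) * T $ j $ k = 0" for j k
  proof -
    define S where "S = diagm (\<lambda>j. b' k * (\<alpha> * a j + \<beta> * b j) - a' k * (\<gamma> * a j + \<delta> * b j))"
    have S: "S = mscale (b' k) (diagm (\<lambda>i. \<alpha> * a i + \<beta> * b i)) + mscale (- a' k) (diagm (\<lambda>i. \<gamma> * a i + \<delta> * b i))"
      unfolding S_def diagm_comb by (simp add: algebra_simps)
    have "pull T S = diagm (\<lambda>i. b' k * a' i - a' k * b' i)"
      unfolding S pull_comb A[symmetric] B[symmetric] by (simp add: diagm_comb)
    then have "pull T S *v axis k 1 = diagm (\<lambda>i. b' k * a' i - a' k * b' i) *v axis k 1" by simp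
    then have "pull T S *v axis k 1 = 0"
      by (auto simp: vec_eq_iff diagm_vec axis_def)
    then have "transpose T *v (S *v (T *v axis k 1)) = 0"
      by (simp add: pull_def matrix_vector_mul_assoc matrix_mul_assoc)
    then have "transpose T' *v (transpose T *v (S *v (T *v axis k 1))) = 0" by simp
    moreover have "transpose T' ** transpose T = mat 1"
      by (simp add: matrix_transpose_mul[symmetric] T' transpose_mat)
    ultimately have "S *v (T *v axis k 1) = 0"
      by (metis matrix_vector_mul_assoc matrix_vector_mul_lid)
    then have "(S *v (T *v axis k 1)) $ j = 0" by simp
    then show ?thesis unfolding S_def diagm_vec by (simp add: mat_vec_axis column_def)
  qed
  \<comment> \<open>That diagonal form vanishes at one position only.\<close>
  have uniq: "j = j'" if "T $ j $ k \<noteq> 0" "T $ j' $ k \<noteq> 0" for j j' k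
  proof (rule ccontr)
    assume "j \<noteq> j'"
    have 1: "b' k * (\<alpha> * a j + \<beta> * b j) = a' k * (\<gamma> * a j + \<delta> * b j)"
      "b' k * (\<alpha> * a j' + \<beta> * b j') = a' k * (\<gamma> * a j' + \<delta> * b j')"
      using col[of k j] col[of k j'] that by auto
    have "a' k * (D * det2 a b j j') = 0" "b' k * (D * det2 a b j j') = 0"
      using 1 unfolding D_def det2_def by algebra+
    then show False using D nz'[of k] sep \<open>j \<noteq> j'\<close> by (auto simp: separated_def)
  qed
  have ex: "\<exists>j. T $ j $ k \<noteq> 0" for k
  proof (rule ccontr)
    assume "\<nexists>j. T $ j $ k \<noteq> 0"
    then have "T *v axis k 1 = 0" by (simp add: mat_vec_axis column_def vec_eq_iff)
    then have "T' *v (T *v axis k 1) = 0" by simp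
    then show False by (simp add: matrix_vector_mul_assoc T' axis_eq_0_iff)
  qed
  define \<sigma> where "\<sigma> k = (SOME j. T $ j $ k \<noteq> 0)" for k
  define c where "c k = T $ (\<sigma> k) $ k" for k
  have cnz: "c k \<noteq> 0" for k unfolding c_def \<sigma>_def using someI_ex[OF ex[of k]] .
  have Tjk: "T $ j $ k = (if j = \<sigma> k then c k else 0)" for j k
  proof (cases "j = \<sigma> k")
    case False
    then have "\<not> T $ j $ k \<noteq> 0" using uniq[of j k "\<sigma> k"] cnz[of k] unfolding c_def by blast
    then show ?thesis using False by simp
  qed (simp add: c_def)
  have "inj \<sigma>"
  proof (rule injI, rule ccontr)
    fix k k' assume kk: "\<sigma> k = \<sigma> k'" "k \<noteq> k'"
    have "T *v (c k' *s axis k 1 - c k *s axis k' 1) = c k' *s column k T - c k *s column k' T"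
      by (simp add: matrix_vector_mult_diff_distrib vector_scalar_commute mat_vec_axis)
    also have "\<dots> = 0" by (simp add: column_def vec_eq_iff Tjk kk)
    finally have "T *v (c k' *s axis k 1 - c k *s axis k' 1) = 0" .
    then have "T' *v (T *v (c k' *s axis k 1 - c k *s axis k' 1)) = 0" by simp
    then have "c k' *s axis k 1 - c k *s axis k' 1 = 0" by (simp add: matrix_vector_mul_assoc T')
    then have "(c k' *s axis k 1 - c k *s axis k' 1 :: complex^'m) $ k = 0" by simp
    then show False using kk cnz by (simp add: axis_def)
  qed
  then have bij: "bij \<sigma>" by (simp add: finite_UNIV_inj_surj bij_def)
  have diag: "pull T (diagm f) $ k $ k = (c k)\<^sup>2 * f (\<sigma> k)" for f k
  proof -
    have "pull T (diagm f) $ k $ k = (\<Sum>i\<in>UNIV. if i = \<sigma> k then (c k)\<^sup>2 * f (\<sigma> k) else 0)"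
      unfolding pull_diagm_component by (rule sum.cong) (auto simp: Tjk power2_eq_square)
    then show ?thesis by simp
  qed
  have "a' k = (c k)\<^sup>2 * (\<alpha> * a (\<sigma> k) + \<beta> * b (\<sigma> k))" for k
    using arg_cong[OF A, of "\<lambda>S. S $ k $ k"] by (simp add: diag diagm_component)
  moreover have "b' k = (c k)\<^sup>2 * (\<gamma> * a (\<sigma> k) + \<delta> * b (\<sigma> k))" for k
    using arg_cong[OF B, of "\<lambda>S. S $ k $ k"] by (simp add: diag diagm_component)
  ultimately show ?thesis using that[of \<sigma> c \<alpha> \<delta> \<beta> \<gamma>] bij cnz Tjk D[unfolded D_def] by blast
qed

section \<open>Cross ratios of labelled diagonal pencils\<close>

lemma form_span_change:
  assumes "\<alpha> * \<delta> - \<beta> * \<gamma> \<noteq> 0"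
  shows "form_span (mscale \<alpha> A + mscale \<beta> B) (mscale \<gamma> A + mscale \<delta> B) = form_span A B"
proof -
  define \<Delta> where "\<Delta> = \<alpha> * \<delta> - \<beta> * \<gamma>"
  have D: "\<Delta> \<noteq> 0" using assms by (simp add: \<Delta>_def)
  have 1: "mscale s (mscale \<alpha> A + mscale \<beta> B) + mscale u (mscale \<gamma> A + mscale \<delta> B)
      = mscale (s * \<alpha> + u * \<gamma>) A + mscale (s * \<beta> + u * \<delta>) B" for s u
    by (simp add: vec_eq_iff algebra_simps)
  have 2: "mscale s A + mscale u B = mscale (((s * \<delta> - u * \<gamma>) / \<Delta>) * \<alpha> + ((u * \<alpha> - s * \<beta>) / \<Delta>) * \<gamma>) A
      + mscale (((s * \<delta> - u * \<gamma>) / \<Delta>) * \<beta> + ((u * \<alpha> - s * \<beta>) / \<Delta>) * \<delta>) B" for s u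
  proof -
    have "((s * \<delta> - u * \<gamma>) / \<Delta>) * \<alpha> + ((u * \<alpha> - s * \<beta>) / \<Delta>) * \<gamma> = s * (\<Delta> / \<Delta>)"
      unfolding add_divide_distrib[symmetric] times_divide_eq_left times_divide_eq_right
      by (simp add: \<Delta>_def algebra_simps)
    moreover have "((s * \<delta> - u * \<gamma>) / \<Delta>) * \<beta> + ((u * \<alpha> - s * \<beta>) / \<Delta>) * \<delta> = u * (\<Delta> / \<Delta>)"
      unfolding add_divide_distrib[symmetric] times_divide_eq_left times_divide_eq_right
      by (simp add: \<Delta>_def algebra_simps)
    ultimately show ?thesis using D by simp
  qed
  show ?thesis
  proof
    show "form_span (mscale \<alpha> A + mscale \<beta> B) (mscale \<gamma> A + mscale \<delta> B) \<subseteq> form_span A B"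
      unfolding form_span_def 1 by blast
    show "form_span A B \<subseteq> form_span (mscale \<alpha> A + mscale \<beta> B) (mscale \<gamma> A + mscale \<delta> B)"
      unfolding form_span_def 1 using 2 by blast
  qed
qed

lemma Pen_pull_diagm:
  assumes "\<alpha> * \<delta> - \<beta> * \<gamma> \<noteq> 0"
    and a': "\<And>k. a' k = (c k)\<^sup>2 * (\<alpha> * a k + \<beta> * b k)" and b': "\<And>k. b' k = (c k)\<^sup>2 * (\<gamma> * a k + \<delta> * b k)"
  shows "Pen a' b' = pull (diagm c) ` Pen a b"
proof -
  have "Pen a' b' = form_span (pull (diagm c) (diagm (\<lambda>k. \<alpha> * a k + \<beta> * b k))) (pull (diagm c) (diagm (\<lambda>k. \<gamma> * a k + \<delta> * b k)))"
    unfolding pull_diagm_diagm a'[symmetric] b'[symmetric] by simp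
  also have "\<dots> = pull (diagm c) ` form_span (mscale \<alpha> (diagm a) + mscale \<beta> (diagm b)) (mscale \<gamma> (diagm a) + mscale \<delta> (diagm b))"
    by (simp add: pull_form_span diagm_comb)
  finally show ?thesis by (simp add: form_span_change[OF assms(1)])
qed

text \<open>The cross ratio of four of the points \<open>(a\<^sub>i : b\<^sub>i)\<close> of the projective line.\<close>

definition cross_ratio :: "('m \<Rightarrow> complex) \<Rightarrow> ('m \<Rightarrow> complex) \<Rightarrow> 'm \<Rightarrow> 'm \<Rightarrow> 'm \<Rightarrow> 'm \<Rightarrow> complex" where
  "cross_ratio a b i j k l = det2 a b i j * det2 a b k l / (det2 a b i k * det2 a b j l)"

text \<open>For pairwise distinct points, a permutation preserves all cross ratios iff it is induced by a projective
  transformation of the line; so the points have no projective symmetry.\<close>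

definition rigid_config :: "('m \<Rightarrow> complex) \<Rightarrow> ('m \<Rightarrow> complex) \<Rightarrow> bool" where
  "rigid_config a b \<longleftrightarrow> (\<forall>\<sigma>. bij \<sigma> \<and> (\<forall>i j k l. distinct [i, j, k, l] \<longrightarrow>
     cross_ratio a b (\<sigma> i) (\<sigma> j) (\<sigma> k) (\<sigma> l) = cross_ratio a b i j k l) \<longrightarrow> \<sigma> = id)"

lemma det2_transform:
  assumes "\<And>k. a' k = (c k)\<^sup>2 * (\<alpha> * a (\<sigma> k) + \<beta> * b (\<sigma> k))" "\<And>k. b' k = (c k)\<^sup>2 * (\<gamma> * a (\<sigma> k) + \<delta> * b (\<sigma> k))"
  shows "det2 a' b' i j = (c i)\<^sup>2 * (c j)\<^sup>2 * (\<alpha> * \<delta> - \<beta> * \<gamma>) * det2 a b (\<sigma> i) (\<sigma> j)"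
  unfolding det2_def assms by (simp add: algebra_simps)

lemma cross_ratio_transform:
  assumes "\<And>k. a' k = (c k)\<^sup>2 * (\<alpha> * a (\<sigma> k) + \<beta> * b (\<sigma> k))" "\<And>k. b' k = (c k)\<^sup>2 * (\<gamma> * a (\<sigma> k) + \<delta> * b (\<sigma> k))"
    and "\<And>k. c k \<noteq> 0" "\<alpha> * \<delta> - \<beta> * \<gamma> \<noteq> 0"
  shows "cross_ratio a' b' i j k l = cross_ratio a b (\<sigma> i) (\<sigma> j) (\<sigma> k) (\<sigma> l)"
proof -
  define e where "e = (c i)\<^sup>2 * (c j)\<^sup>2 * (c k)\<^sup>2 * (c l)\<^sup>2 * (\<alpha> * \<delta> - \<beta> * \<gamma>)\<^sup>2"
  have e: "e \<noteq> 0" using assms(3,4) by (simp add: e_def)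
  have "cross_ratio a' b' i j k l = (e * (det2 a b (\<sigma> i) (\<sigma> j) * det2 a b (\<sigma> k) (\<sigma> l))) / (e * (det2 a b (\<sigma> i) (\<sigma> k) * det2 a b (\<sigma> j) (\<sigma> l)))"
    unfolding cross_ratio_def det2_transform[where a = a and b = b and c = c and \<sigma> = \<sigma>, OF assms(1) assms(2)]
      e_def power2_eq_square by (simp only: mult_ac)
  then show ?thesis using e by (simp add: cross_ratio_def)
qed

text \<open>Closeness is measured by cross ratios, rather than by coefficients, so that it is insensitive to
  rescaling the coordinates and to the choice of a basis of the pencil.\<close>

definition near_config :: "real \<Rightarrow> ('m \<Rightarrow> complex) \<Rightarrow> ('m \<Rightarrow> complex) \<Rightarrow> ('m \<Rightarrow> complex) \<Rightarrow> ('m \<Rightarrow> complex) \<Rightarrow> bool" where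
  "near_config \<epsilon> a0 b0 a b \<longleftrightarrow> separated a b \<and>
     (\<forall>i j k l. distinct [i, j, k, l] \<longrightarrow> cmod (cross_ratio a b i j k l - cross_ratio a0 b0 i j k l) < \<epsilon>)"

text \<open>Distinct cross ratios of the rigid configuration differ by a definite amount.  If two labellings of
  the same points are both close to it, then cross ratios of the configuration that correspond under
  \<open>\<sigma>\<close> differ by less than this amount, hence agree, and rigidity applies.\<close>

lemma near_config_label_unique:
  fixes a0 b0 :: "'m::finite \<Rightarrow> complex"
  assumes "rigid_config a0 b0"
  obtains \<epsilon> where "\<epsilon> > 0" "\<And>a b a' b' \<sigma>. near_config \<epsilon> a0 b0 a b \<Longrightarrow> near_config \<epsilon> a0 b0 a' b' \<Longrightarrow> bij \<sigma> \<Longrightarrow>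
    (\<And>i j k l. cross_ratio a' b' i j k l = cross_ratio a b (\<sigma> i) (\<sigma> j) (\<sigma> k) (\<sigma> l)) \<Longrightarrow> \<sigma> = id"
proof -
  define S where "S = range (\<lambda>((i,j,k,l),(i',j',k',l')). cmod (cross_ratio a0 b0 i' j' k' l' - cross_ratio a0 b0 i j k l)) - {0}"
  have fin: "finite (insert 1 S)" unfolding S_def by auto
  \<comment> \<open>The element \<open>1\<close> makes the set nonempty.  Half of the gap is taken since two errors add up below.\<close>
  define \<epsilon> where "\<epsilon> = Min (insert 1 S) / 2"
  have pos: "s > 0" if "s \<in> insert 1 S" for s using that by (auto simp: S_def)
  have e0: "\<epsilon> > 0" unfolding \<epsilon>_def using fin pos Min_in[OF fin] by auto
  have gap: "cross_ratio a0 b0 i' j' k' l' = cross_ratio a0 b0 i j k l" if "cmod (cross_ratio a0 b0 i' j' k' l' - cross_ratio a0 b0 i j k l) < 2 * \<epsilon>" for i j k l i' j' k' l'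
  proof (rule ccontr)
    assume ne: "cross_ratio a0 b0 i' j' k' l' \<noteq> cross_ratio a0 b0 i j k l"
    have "cmod (cross_ratio a0 b0 i' j' k' l' - cross_ratio a0 b0 i j k l) \<in> S"
      unfolding S_def using ne by (auto intro!: image_eqI[of _ _ "((i,j,k,l),(i',j',k',l'))"])
    then have "2 * \<epsilon> \<le> cmod (cross_ratio a0 b0 i' j' k' l' - cross_ratio a0 b0 i j k l)"
      unfolding \<epsilon>_def using Min_le[OF fin] by auto
    then show False using that by simp
  qed
  show thesis
  proof (rule that[OF e0])
    fix a b a' b' :: "'m \<Rightarrow> complex" and \<sigma> :: "'m \<Rightarrow> 'm"
    assume n: "near_config \<epsilon> a0 b0 a b" "near_config \<epsilon> a0 b0 a' b'" and s: "bij \<sigma>"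
      and eq: "\<And>i j k l. cross_ratio a' b' i j k l = cross_ratio a b (\<sigma> i) (\<sigma> j) (\<sigma> k) (\<sigma> l)"
    have "cross_ratio a0 b0 (\<sigma> i) (\<sigma> j) (\<sigma> k) (\<sigma> l) = cross_ratio a0 b0 i j k l" if d: "distinct [i, j, k, l]" for i j k l
    proof (rule gap)
      have d': "distinct [\<sigma> i, \<sigma> j, \<sigma> k, \<sigma> l]" using d s by (auto simp: bij_def inj_eq)
      let ?x = "cross_ratio a b (\<sigma> i) (\<sigma> j) (\<sigma> k) (\<sigma> l)"
      have "cmod (?x - cross_ratio a0 b0 (\<sigma> i) (\<sigma> j) (\<sigma> k) (\<sigma> l)) < \<epsilon>" using n(1) d' by (auto simp: near_config_def)
      moreover have "cmod (?x - cross_ratio a0 b0 i j k l) < \<epsilon>" using n(2) d by (auto simp: near_config_def eq)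
      ultimately show "cmod (cross_ratio a0 b0 (\<sigma> i) (\<sigma> j) (\<sigma> k) (\<sigma> l) - cross_ratio a0 b0 i j k l) < 2 * \<epsilon>"
        using norm_triangle_ineq4[of "?x - cross_ratio a0 b0 i j k l" "?x - cross_ratio a0 b0 (\<sigma> i) (\<sigma> j) (\<sigma> k) (\<sigma> l)"] by simp
    qed
    then show "\<sigma> = id" using assms s unfolding rigid_config_def by blast
  qed
qed

text \<open>The permutation of a monomial equivalence relabels the points without changing cross ratios, so it
  is trivial by uniqueness of the labelling.\<close>

lemma near_config_equivalence_diagonal:
  fixes a0 b0 :: "'m::finite \<Rightarrow> complex"
  assumes "rigid_config a0 b0" and c: "CARD('m) > 1"
  obtains \<epsilon> where "\<epsilon> > 0" "\<And>a b a' b' T. near_config \<epsilon> a0 b0 a b \<Longrightarrow> near_config \<epsilon> a0 b0 a' b' \<Longrightarrow> invertible T \<Longrightarrow>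
    pull T ` Pen a b = Pen a' b' \<Longrightarrow> \<exists>c \<alpha> \<beta> \<gamma> \<delta>. T = diagm c \<and> (\<forall>k. c k \<noteq> 0) \<and> \<alpha> * \<delta> - \<beta> * \<gamma> \<noteq> 0 \<and>
      (\<forall>k. a' k = (c k)\<^sup>2 * (\<alpha> * a k + \<beta> * b k)) \<and> (\<forall>k. b' k = (c k)\<^sup>2 * (\<gamma> * a k + \<delta> * b k))"
proof -
  obtain \<epsilon> where e: "\<epsilon> > 0" "\<And>a b a' b' \<sigma>. near_config \<epsilon> a0 b0 a b \<Longrightarrow> near_config \<epsilon> a0 b0 a' b' \<Longrightarrow> bij \<sigma> \<Longrightarrow>
    (\<And>i j k l. cross_ratio a' b' i j k l = cross_ratio a b (\<sigma> i) (\<sigma> j) (\<sigma> k) (\<sigma> l)) \<Longrightarrow> \<sigma> = id"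
    using near_config_label_unique[OF assms(1)] by metis
  show thesis
  proof (rule that[OF e(1)])
    fix a b a' b' :: "'m \<Rightarrow> complex" and T :: "complex^'m^'m"
    assume n: "near_config \<epsilon> a0 b0 a b" "near_config \<epsilon> a0 b0 a' b'" and T: "invertible T" "pull T ` Pen a b = Pen a' b'"
    from n have sep: "separated a b" "separated a' b'" by (auto simp: near_config_def)
    obtain \<sigma> c \<alpha> \<beta> \<gamma> \<delta> where s: "bij \<sigma>" and cnz: "\<And>k. c k \<noteq> 0" and Tjk: "\<And>j k. T $ j $ k = (if j = \<sigma> k then c k else 0)"
      and D: "\<alpha> * \<delta> - \<beta> * \<gamma> \<noteq> 0" and a': "\<And>k. a' k = (c k)\<^sup>2 * (\<alpha> * a (\<sigma> k) + \<beta> * b (\<sigma> k))"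
      and b': "\<And>k. b' k = (c k)\<^sup>2 * (\<gamma> * a (\<sigma> k) + \<delta> * b (\<sigma> k))"
      by (rule diagonal_pencils_monomial[OF sep c T]) blast
    have id: "\<sigma> = id" using e(2)[OF n s]
      cross_ratio_transform[where a = a and b = b and a' = a' and b' = b' and c = c and \<sigma> = \<sigma>, OF a' b' cnz D] by blast
    have "T = diagm c" by (auto simp: vec_eq_iff Tjk id diagm_component)
    then show "\<exists>c \<alpha> \<beta> \<gamma> \<delta>. T = diagm c \<and> (\<forall>k. c k \<noteq> 0) \<and> \<alpha> * \<delta> - \<beta> * \<gamma> \<noteq> 0 \<and>
      (\<forall>k. a' k = (c k)\<^sup>2 * (\<alpha> * a k + \<beta> * b k)) \<and> (\<forall>k. b' k = (c k)\<^sup>2 * (\<gamma> * a k + \<delta> * b k))"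
      using cnz D a' b' unfolding id id_def by blast
  qed
qed

section \<open>Complex differentiability relative to a subspace\<close>

text \<open>The differentiability clause of \<open>holo_on_open\<close>, at a single point.  The derivative within \<open>S\<close> need not
  be unique, so complex linearity is required of some derivative.\<close>

definition cdiff :: "(complex \<Rightarrow> 'a::real_normed_vector \<Rightarrow> 'a) \<Rightarrow> 'a set \<Rightarrow> ('a \<Rightarrow> complex) \<Rightarrow> 'a \<Rightarrow> bool" where
  "cdiff sc S f u \<longleftrightarrow> (\<exists>D. (f has_derivative D) (at u within S) \<and> (\<forall>c h. D (sc c h) = c * D h))"

lemma cdiff_const: "cdiff sc S (\<lambda>_. z) u"
  unfolding cdiff_def by (intro exI[of _ "\<lambda>_. 0"]) auto

lemma cdiff_add: assumes "cdiff sc S f u" "cdiff sc S g u" shows "cdiff sc S (\<lambda>x. f x + g x) u"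
  using assms unfolding cdiff_def
proof clarify
  fix D E assume "(f has_derivative D) (at u within S)" "\<forall>c h. D (sc c h) = c * D h"
    "(g has_derivative E) (at u within S)" "\<forall>c h. E (sc c h) = c * E h"
  then show "\<exists>D. ((\<lambda>x. f x + g x) has_derivative D) (at u within S) \<and> (\<forall>c h. D (sc c h) = c * D h)"
    by (intro exI[of _ "\<lambda>h. D h + E h"]) (auto intro!: derivative_eq_intros simp: algebra_simps)
qed

lemma cdiff_mult: assumes "cdiff sc S f u" "cdiff sc S g u" shows "cdiff sc S (\<lambda>x. f x * g x) u"
  using assms unfolding cdiff_def
proof clarify
  fix D E assume "(f has_derivative D) (at u within S)" "\<forall>c h. D (sc c h) = c * D h"
    "(g has_derivative E) (at u within S)" "\<forall>c h. E (sc c h) = c * E h"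
  then show "\<exists>D. ((\<lambda>x. f x * g x) has_derivative D) (at u within S) \<and> (\<forall>c h. D (sc c h) = c * D h)"
    by (intro exI[of _ "\<lambda>h. f u * E h + D h * g u"]) (auto intro!: derivative_eq_intros simp: algebra_simps)
qed

lemma cdiff_inverse: assumes "cdiff sc S f u" "f u \<noteq> 0" shows "cdiff sc S (\<lambda>x. inverse (f x)) u"
  using assms unfolding cdiff_def
proof clarify
  fix D assume "(f has_derivative D) (at u within S)" "\<forall>c h. D (sc c h) = c * D h" "f u \<noteq> 0"
  then show "\<exists>D. ((\<lambda>x. inverse (f x)) has_derivative D) (at u within S) \<and> (\<forall>c h. D (sc c h) = c * D h)"
    by (intro exI[of _ "\<lambda>h. - (inverse (f u) * D h * inverse (f u))"]) (auto intro!: derivative_eq_intros simp: algebra_simps)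
qed

lemma cdiff_diff: assumes "cdiff sc S f u" "cdiff sc S g u" shows "cdiff sc S (\<lambda>x. f x - g x) u"
  using cdiff_add[OF assms(1) cdiff_mult[OF cdiff_const[of sc S "-1" u] assms(2)]] by simp

lemma cdiff_divide: assumes "cdiff sc S f u" "cdiff sc S g u" "g u \<noteq> 0" shows "cdiff sc S (\<lambda>x. f x / g x) u"
  using cdiff_mult[OF assms(1) cdiff_inverse[OF assms(2,3)]] by (simp add: divide_inverse)

lemma cdiff_power: assumes "cdiff sc S f u" shows "cdiff sc S (\<lambda>x. f x ^ n) u"
  by (induction n) (auto intro: cdiff_const cdiff_mult assms)

lemma cdiff_sum: assumes "\<And>i. i \<in> I \<Longrightarrow> cdiff sc S (f i) u" shows "cdiff sc S (\<lambda>x. \<Sum>i\<in>I. f i x) u"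
  using assms by (induction I rule: infinite_finite_induct) (auto intro: cdiff_const cdiff_add)

lemma cdiff_subset: assumes "cdiff sc S f u" "S' \<subseteq> S" shows "cdiff sc S' f u"
  using assms has_derivative_subset unfolding cdiff_def by blast

lemma cdiff_linear: assumes "bounded_linear f" "\<And>c h. f (sc c h) = c * f h" shows "cdiff sc S f u"
  unfolding cdiff_def using assms bounded_linear_imp_has_derivative by blast

lemma cdiff_tendsto: "cdiff sc S f u \<Longrightarrow> (f \<longlongrightarrow> f u) (at u within S)"
  unfolding cdiff_def using has_derivative_continuous continuous_within by blast

lemma cdiff_compose_linear:
  assumes "cdiff sc' S' f (L u)" "bounded_linear L" "\<And>c h. L (sc c h) = sc' c (L h)" "L ` S \<subseteq> S'"
  shows "cdiff sc S (\<lambda>x. f (L x)) u"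
proof -
  obtain D where D: "(f has_derivative D) (at (L u) within S')" "\<forall>c h. D (sc' c h) = c * D h"
    using assms(1) by (auto simp: cdiff_def)
  have "((\<lambda>x. f (L x)) has_derivative (\<lambda>h. D (L h))) (at u within S)"
    by (rule has_derivative_in_compose[OF bounded_linear_imp_has_derivative[OF assms(2)]])
      (rule has_derivative_subset[OF D(1) assms(4)])
  then show ?thesis unfolding cdiff_def using D(2) assms(3) by (intro exI[of _ "\<lambda>h. D (L h)"]) auto
qed

lemma cdiff_transform_eventually:
  assumes "cdiff sc S f u" "eventually (\<lambda>x. f x = g x) (at u within S)" "f u = g u" "u \<in> S"
  shows "cdiff sc S g u"
proof -
  obtain D where D: "(f has_derivative D) (at u within S)" "\<forall>c h. D (sc c h) = c * D h"
    using assms(1) by (auto simp: cdiff_def)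
  have "(g has_derivative D) (at u within S)"
    using has_derivative_transform_eventually[OF D(1) assms(2,3,4)] .
  then show ?thesis using D(2) by (auto simp: cdiff_def)
qed

section \<open>Local simultaneous diagonalization\<close>

lemma has_derivative_vec_lambda:
  fixes f :: "'n::finite \<Rightarrow> 'a::real_normed_vector \<Rightarrow> 'b::euclidean_space"
  assumes "\<And>i. (f i has_derivative f' i) F"
  shows "((\<lambda>x. \<chi> i. f i x) has_derivative (\<lambda>h. \<chi> i. f' i h)) F"
proof -
  have ax: "bounded_linear (axis i :: 'b \<Rightarrow> 'b^'n)" for i
    unfolding linear_conv_bounded_linear[symmetric]
    by (rule linearI) (auto simp: axis_def vec_eq_iff)
  have eq: "(\<chi> i. g i) = (\<Sum>i\<in>UNIV. axis i (g i))" for g :: "'n \<Rightarrow> 'b"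
  proof -
    have "(\<Sum>i\<in>UNIV. axis i (g i)) $ j = (\<Sum>i\<in>UNIV. if i = j then g j else 0)" for j
      unfolding sum_component by (rule sum.cong) (auto simp: axis_def)
    then show ?thesis by (simp add: vec_eq_iff)
  qed
  show ?thesis unfolding eq
    by (rule has_derivative_sum) (rule bounded_linear.has_derivative[OF ax assms])
qed

lemma pull_entry: "pull Q A $ j $ k = (\<Sum>i\<in>UNIV. \<Sum>l\<in>UNIV. Q $ i $ j * A $ i $ l * Q $ l $ k)"
  by (simp add: pull_component bil_def column_def matrix_vector_mult_def sum_distrib_left mult_ac)

text \<open>The derivative of \<open>(Q, A) \<mapsto> Q\<^sup>TAQ\<close> in the direction \<open>(K, M)\<close>, entry by entry.\<close>

definition pull_deriv :: "complex^'n^'n \<Rightarrow> complex^'n^'n \<Rightarrow> complex^'n^'n \<Rightarrow> complex^'n^'n \<Rightarrow> 'n \<Rightarrow> 'n \<Rightarrow> complex" where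
  "pull_deriv Q A K M j k = (\<Sum>i\<in>UNIV. \<Sum>l\<in>UNIV. K $ i $ j * A $ i $ l * Q $ l $ k
     + Q $ i $ j * M $ i $ l * Q $ l $ k + Q $ i $ j * A $ i $ l * K $ l $ k)"

lemma has_derivative_pull_entry:
  assumes "\<And>i j. ((\<lambda>x. Q x $ i $ j) has_derivative (\<lambda>h. K h $ i $ j)) F"
    "\<And>i j. ((\<lambda>x. A x $ i $ j) has_derivative (\<lambda>h. M h $ i $ j)) F"
  assumes "F = at u within S"
  shows "((\<lambda>x. pull (Q x) (A x) $ j $ k) has_derivative (\<lambda>h. pull_deriv (Q u) (A u) (K h) (M h) j k)) F"
  unfolding pull_entry pull_deriv_def assms(3)
  by (rule has_derivative_sum)+
    (auto intro!: derivative_eq_intros assms(1,2)[unfolded assms(3)] simp: algebra_simps)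

lemma pull_deriv_diag: "pull_deriv (mat 1) (diagm a) K M j k = K $ k $ j * a k + M $ j $ k + a j * K $ j $ k"
proof -
  have s: "(\<Sum>i\<in>UNIV. \<Sum>l\<in>UNIV. if i = i0 \<and> l = l0 then z else 0) = z" for i0 :: 'a and l0 :: 'a and z :: complex
  proof -
    have "(\<Sum>i\<in>UNIV. \<Sum>l\<in>UNIV. if i = i0 \<and> l = l0 then z else 0)
        = (\<Sum>i\<in>UNIV. if i = i0 then (\<Sum>l\<in>UNIV. if l = l0 then z else 0) else 0)"
      by (rule sum.cong) auto
    then show ?thesis by simp
  qed
  have "pull_deriv (mat 1) (diagm a) K M j k = (\<Sum>i\<in>UNIV. \<Sum>l\<in>UNIV. (if i = k \<and> l = k then K $ k $ j * a k else 0)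
      + (if i = j \<and> l = k then M $ j $ k else 0) + (if i = j \<and> l = j then a j * K $ j $ k else 0))"
    unfolding pull_deriv_def by (intro sum.cong refl) (auto simp: mat_def diagm_component)
  then show ?thesis by (simp add: sum.distrib s)
qed

text \<open>The equations \<open>b\<^sub>j (Q\<^sup>TAQ)\<^sub>j\<^sub>k = a\<^sub>j (Q\<^sup>TBQ)\<^sub>j\<^sub>k\<close> for \<open>(j, k)\<close> and for \<open>(k, j)\<close> together say that the entries of
  both symmetric matrices at \<open>(j, k)\<close> vanish, since \<open>a\<^sub>j b\<^sub>k \<noteq> a\<^sub>k b\<^sub>j\<close>.  Their linearization at
  \<open>Q = 1\<close>, \<open>A = diag a\<close>, \<open>B = diag b\<close> involves only the single entry \<open>Q\<^sub>k\<^sub>j\<close> of \<open>Q\<close>, with a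
  nonzero coefficient.  Normalizing the diagonal of \<open>Q\<close> to \<open>1\<close>, the inverse function theorem solves
  for \<open>Q\<close>.\<close>

lemma local_diagonalization:
  fixes a b :: "'n::finite \<Rightarrow> complex"
  assumes sep: "separated a b"
  obtains Q :: "(complex^'n^'n) \<times> (complex^'n^'n) \<Rightarrow> complex^'n^'n" where
    "Q (diagm a, diagm b) = mat 1"
    "\<And>i j. cdiff (\<lambda>c (A, B). (mscale c A, mscale c B)) UNIV (\<lambda>u. Q u $ i $ j) (diagm a, diagm b)"
    "eventually (\<lambda>(A, B). \<forall>j k. A \<in> forms \<longrightarrow> B \<in> forms \<longrightarrow> j \<noteq> k \<longrightarrow>
        pull (Q (A, B)) A $ j $ k = 0 \<and> pull (Q (A, B)) B $ j $ k = 0) (nhds (diagm a, diagm b))"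
proof -
  \<comment> \<open>\<open>F\<close> carries \<open>(A, B)\<close> along, so that inverting \<open>F\<close> solves the equations for \<open>Q\<close>; \<open>F'\<close> is its derivative
     and \<open>G\<close> the inverse of the derivative at the base point.\<close>
  define F :: "(complex^'n^'n) \<times> (complex^'n^'n) \<times> (complex^'n^'n) \<Rightarrow> (complex^'n^'n) \<times> (complex^'n^'n) \<times> (complex^'n^'n)"
    where "F x = (\<chi> j k. if j = k then fst x $ j $ k
      else b j * pull (fst x) (fst (snd x)) $ j $ k - a j * pull (fst x) (snd (snd x)) $ j $ k, snd x)" for x
  define F' :: "(complex^'n^'n) \<times> (complex^'n^'n) \<times> (complex^'n^'n) \<Rightarrow> (complex^'n^'n) \<times> (complex^'n^'n) \<times> (complex^'n^'n) \<Rightarrow> (complex^'n^'n) \<times> (complex^'n^'n) \<times> (complex^'n^'n)"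
    where "F' x h = (\<chi> j k. if j = k then fst h $ j $ k
      else b j * pull_deriv (fst x) (fst (snd x)) (fst h) (fst (snd h)) j k
         - a j * pull_deriv (fst x) (snd (snd x)) (fst h) (snd (snd h)) j k, snd h)" for x h
  define G :: "(complex^'n^'n) \<times> (complex^'n^'n) \<times> (complex^'n^'n) \<Rightarrow> (complex^'n^'n) \<times> (complex^'n^'n) \<times> (complex^'n^'n)"
    where "G r = (\<chi> k j. if j = k then fst r $ k $ j
      else (fst r $ j $ k - b j * fst (snd r) $ j $ k + a j * snd (snd r) $ j $ k) / det2 a b k j, snd r)" for r
  have c1: "((\<lambda>x. fst x $ i $ j) has_derivative (\<lambda>h. fst h $ i $ j)) (at x)" for i j and x :: "(complex^'n^'n) \<times> (complex^'n^'n) \<times> (complex^'n^'n)"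
    by (intro bounded_linear_imp_has_derivative bounded_linear_compose[OF bounded_linear_vec_nth]
        bounded_linear_compose[OF bounded_linear_vec_nth bounded_linear_fst])
  have c2: "((\<lambda>x. fst (snd x) $ i $ j) has_derivative (\<lambda>h. fst (snd h) $ i $ j)) (at x)" for i j and x :: "(complex^'n^'n) \<times> (complex^'n^'n) \<times> (complex^'n^'n)"
    by (intro bounded_linear_imp_has_derivative bounded_linear_compose[OF bounded_linear_vec_nth]
        bounded_linear_compose[OF bounded_linear_fst bounded_linear_snd])
  have c3: "((\<lambda>x. snd (snd x) $ i $ j) has_derivative (\<lambda>h. snd (snd h) $ i $ j)) (at x)" for i j and x :: "(complex^'n^'n) \<times> (complex^'n^'n) \<times> (complex^'n^'n)"
    by (intro bounded_linear_imp_has_derivative bounded_linear_compose[OF bounded_linear_vec_nth]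
        bounded_linear_compose[OF bounded_linear_snd bounded_linear_snd])
  have der: "(F has_derivative F' x) (at x)" for x
  proof -
    have e: "((\<lambda>x. if j = k then fst x $ j $ k
      else b j * pull (fst x) (fst (snd x)) $ j $ k - a j * pull (fst x) (snd (snd x)) $ j $ k) has_derivative
      (\<lambda>h. if j = k then fst h $ j $ k
      else b j * pull_deriv (fst x) (fst (snd x)) (fst h) (fst (snd h)) j k
         - a j * pull_deriv (fst x) (snd (snd x)) (fst h) (snd (snd h)) j k)) (at x)" for j k
    proof (cases "j = k")
      case True
      then show ?thesis by (simp add: c1)
    next
      case False
      have p1: "((\<lambda>x. pull (fst x) (fst (snd x)) $ j $ k) has_derivative
          (\<lambda>h. pull_deriv (fst x) (fst (snd x)) (fst h) (fst (snd h)) j k)) (at x)"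
        by (rule has_derivative_pull_entry[OF c1 c2]) simp
      have p2: "((\<lambda>x. pull (fst x) (snd (snd x)) $ j $ k) has_derivative
          (\<lambda>h. pull_deriv (fst x) (snd (snd x)) (fst h) (snd (snd h)) j k)) (at x)"
        by (rule has_derivative_pull_entry[OF c1 c3]) simp
      show ?thesis using False
        by (simp, intro has_derivative_diff has_derivative_mult_right p1 p2)
    qed
    show ?thesis unfolding F_def F'_def
      by (intro has_derivative_Pair has_derivative_vec_lambda e bounded_linear_imp_has_derivative bounded_linear_snd)
  qed
  then have bl: "bounded_linear (F' x)" for x using has_derivative_bounded_linear by blast
  define f' where "f' x = Blinfun (F' x)" for x
  have f'_apply: "blinfun_apply (f' x) = F' x" for x
    unfolding f'_def by (rule bounded_linear_Blinfun_apply[OF bl])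
  have cont: "continuous_on UNIV f'"
  proof (rule continuous_on_blinfun_componentwise)
    fix h :: "(complex^'n^'n) \<times> (complex^'n^'n) \<times> (complex^'n^'n)"
    have cp: "continuous_on UNIV (\<lambda>x. pull_deriv (Q x) (A x) K M j k)"
      if "continuous_on UNIV Q" "continuous_on UNIV A"
      for Q A :: "(complex^'n^'n) \<times> (complex^'n^'n) \<times> (complex^'n^'n) \<Rightarrow> complex^'n^'n" and K M and j k :: 'n
      unfolding pull_deriv_def using that by (intro continuous_intros)
    have ce: "continuous_on UNIV (\<lambda>x. if j = k then fst h $ j $ k
      else b j * pull_deriv (fst x) (fst (snd x)) (fst h) (fst (snd h)) j k
         - a j * pull_deriv (fst x) (snd (snd x)) (fst h) (snd (snd h)) j k)" for j k
      by (cases "j = k"; simp) (intro continuous_intros cp)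
    show "continuous_on UNIV (\<lambda>x. blinfun_apply (f' x) h)"
      unfolding f'_apply F'_def by (intro continuous_on_Pair continuous_on_vec_lambda ce continuous_on_const)
  qed
  define x0 where "x0 = (mat 1 :: complex^'n^'n, diagm a, diagm b)"
  have F'0: "F' x0 h = (\<chi> j k. if j = k then fst h $ j $ k
      else det2 a b k j * fst h $ k $ j + b j * fst (snd h) $ j $ k - a j * snd (snd h) $ j $ k, snd h)" for h
    unfolding F'_def x0_def by (auto simp: pull_deriv_diag vec_eq_iff det2_def algebra_simps)
  have GF: "G (F' x0 h) = h" for h
    unfolding F'0 G_def using sep by (auto simp: vec_eq_iff separated_def prod_eq_iff)
  have FG: "F' x0 (G r) = r" for r
    unfolding F'0 G_def using sep by (auto simp: vec_eq_iff separated_def prod_eq_iff)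
  have blG: "bounded_linear G"
  proof -
    have sr: "r *\<^sub>R z = of_real r * z" for r and z :: complex by (rule scaleR_conv_of_real)
    have "linear G"
      by (rule linearI) (auto simp: G_def vec_eq_iff add_divide_distrib diff_divide_distrib sr algebra_simps prod_eq_iff)
    then show ?thesis by (simp add: linear_conv_bounded_linear)
  qed
  have inv0: "Blinfun G o\<^sub>L f' x0 = id_blinfun"
    by (rule blinfun_eqI) (simp add: bounded_linear_Blinfun_apply[OF blG] f'_apply GF)
  have Fx0: "F x0 = (mat 1, diagm a, diagm b)"
    unfolding F_def x0_def fst_conv snd_conv pull_mat_1 by (simp add: vec_eq_iff mat_def diagm_component)
  obtain U' V g g' where UV: "open U'" "x0 \<in> U'" "open V" "F x0 \<in> V" "homeomorphism U' V F g"
      and g: "\<And>y. y \<in> V \<Longrightarrow> (g has_derivative (g' y)) (at y)" "\<And>y. y \<in> V \<Longrightarrow> g' y = inv (blinfun_apply (f' (g y)))"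
    by (rule inverse_function_theorem[of UNIV F f' x0 "Blinfun G"])
      (use der cont inv0 in \<open>auto simp: f'_apply\<close>)+
  have gx0: "g (F x0) = x0" using UV by (auto simp: homeomorphism_def)
  have "inv (F' x0) = G" using GF FG by (intro inv_unique_comp) (auto simp: fun_eq_iff)
  then have g0: "(g has_derivative G) (at (mat 1, diagm a, diagm b))"
    using g(1)[OF UV(4)] g(2)[OF UV(4)] by (simp add: gx0[unfolded Fx0] f'_apply Fx0)
  define Q where "Q u = fst (g (mat 1, u))" for u
  have d1: "((\<lambda>u. (mat 1 :: complex^'n^'n, u)) has_derivative (\<lambda>h. (0, h))) (at (diagm a, diagm b))"
    by (auto intro!: derivative_eq_intros)
  have "((\<lambda>u. g (mat 1, u)) has_derivative (\<lambda>h. G (0, h))) (at (diagm a, diagm b))"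
    using has_derivative_compose[OF d1 g0] by simp
  then have dQ: "((\<lambda>u. Q u $ i $ j) has_derivative (\<lambda>h. fst (G (0, h)) $ i $ j)) (at (diagm a, diagm b))" for i j
    unfolding Q_def
    by (intro bounded_linear.has_derivative[OF bounded_linear_vec_nth] bounded_linear.has_derivative[OF bounded_linear_fst])
  show thesis
  proof (rule that[of Q])
    show "Q (diagm a, diagm b) = mat 1" using gx0[unfolded Fx0] by (simp add: Q_def x0_def)
    show "cdiff (\<lambda>c (A, B). (mscale c A, mscale c B)) UNIV (\<lambda>u. Q u $ i $ j) (diagm a, diagm b)" for i j
      unfolding cdiff_def
      by (intro exI[of _ "\<lambda>h. fst (G (0, h)) $ i $ j"] conjI dQ)
        (auto simp: G_def divide_simps algebra_simps)
    have "open ((\<lambda>u. (mat 1 :: complex^'n^'n, u)) -` V)"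
      by (rule open_vimage[OF UV(3)]) (intro continuous_intros)
    moreover have "(diagm a, diagm b) \<in> (\<lambda>u. (mat 1 :: complex^'n^'n, u)) -` V" using UV(4) Fx0 by simp
    ultimately have "eventually (\<lambda>u. u \<in> (\<lambda>u. (mat 1 :: complex^'n^'n, u)) -` V) (nhds (diagm a, diagm b))"
      by (rule eventually_nhds_in_open)
    then show "eventually (\<lambda>(A, B). \<forall>j k. A \<in> forms \<longrightarrow> B \<in> forms \<longrightarrow> j \<noteq> k \<longrightarrow>
        pull (Q (A, B)) A $ j $ k = 0 \<and> pull (Q (A, B)) B $ j $ k = 0) (nhds (diagm a, diagm b))"
    proof (rule eventually_mono, clarify)
      fix A B and j k :: 'n
      assume V: "(mat 1, A, B) \<in> V" and AB: "A \<in> forms" "B \<in> forms" and jk: "j \<noteq> k"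
      have e: "F (g (mat 1, A, B)) = (mat 1, A, B)" using V UV(5) by (auto simp: homeomorphism_def)
      then have s: "snd (g (mat 1, A, B)) = (A, B)" by (simp add: F_def)
      have off: "b j * pull (Q (A, B)) A $ j $ k - a j * pull (Q (A, B)) B $ j $ k = 0" if "j \<noteq> k" for j k
      proof -
        have "fst (F (g (mat 1, A, B))) $ j $ k = 0" using e that by (simp add: mat_def)
        then show ?thesis using that s by (simp add: F_def Q_def)
      qed
      have sym: "pull R S $ k $ j = pull R S $ j $ k" if "S \<in> forms" for R S :: "complex^'n^'n"
        using pull_forms[OF that, of R] by (metis (mono_tags) forms_def mem_Collect_eq transpose_def vec_lambda_beta)
      let ?x = "pull (Q (A, B)) A $ j $ k" and ?y = "pull (Q (A, B)) B $ j $ k"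
      have 1: "b j * ?x = a j * ?y" "b k * ?x = a k * ?y"
        using off[OF jk] off[of k j] jk sym[OF AB(1)] sym[OF AB(2)] by auto
      have "det2 a b j k * ?x = 0" "det2 a b j k * ?y = 0" using 1 unfolding det2_def by algebra+
      then show "?x = 0 \<and> ?y = 0" using sep jk by (auto simp: separated_def)
    qed
  qed
qed

lemma eventually_all_finite_type:
  assumes "\<And>i :: 'i::finite. eventually (P i) F" shows "eventually (\<lambda>x. \<forall>i. P i x) F"
proof -
  have "eventually (\<lambda>x. \<forall>i\<in>UNIV. P i x) F" by (rule eventually_ball_finite) (use assms in auto)
  then show ?thesis by simp
qed

lemma openin_if_eventually:
  assumes "F \<subseteq> S" "\<And>u. u \<in> F \<Longrightarrow> eventually (\<lambda>x. x \<in> S \<longrightarrow> x \<in> F) (nhds u)"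
  shows "openin (top_of_set S) F"
proof (subst openin_subopen, intro ballI)
  fix u assume u: "u \<in> F"
  obtain W where W: "open W" "u \<in> W" "\<forall>x\<in>W. x \<in> S \<longrightarrow> x \<in> F"
    using assms(2)[OF u] by (auto simp: eventually_nhds)
  show "\<exists>T. openin (top_of_set S) T \<and> u \<in> T \<and> T \<subseteq> F"
    by (rule exI[of _ "S \<inter> W"]) (use W u assms(1) in \<open>auto simp: openin_open\<close>)
qed

lemma cdiff_tendsto_nhds: "cdiff sc UNIV f u \<Longrightarrow> (f \<longlongrightarrow> f u) (nhds u)"
  using cdiff_tendsto[of sc UNIV f u] by (simp add: tendsto_at_iff_tendsto_nhds)

lemma eventually_at_within_if_nhds: "eventually P (nhds u) \<Longrightarrow> eventually P (at u within S)"
  unfolding eventually_at_filter by (erule eventually_mono) simp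

text \<open>The scalar multiplication of the pairs in \<open>MPQ_holo\<close>.\<close>

abbreviation sc2 :: "complex \<Rightarrow> (complex^'m^'k) \<times> (complex^'m^'k) \<Rightarrow> (complex^'m^'k) \<times> (complex^'m^'k)" where
  "sc2 \<equiv> (\<lambda>c (A, B). (mscale c A, mscale c B))"

lemma pull_add: "pull T (A + B) = pull T A + pull T B"
  by (simp add: pull_def matrix_add_ldistrib matrix_add_mult_right)

lemma scaleR_mscale: "r *\<^sub>R A = mscale (of_real r) A"
  by (simp add: vec_eq_iff scaleR_conv_of_real[where 'a = complex])

lemma bounded_linear_pull: "bounded_linear (pull T)"
proof -
  have "linear (pull T)" by (rule linearI) (simp_all add: pull_add scaleR_mscale pull_mscale)
  then show ?thesis by (simp add: linear_conv_bounded_linear)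
qed

lemma cdiff_entry_fst: "cdiff sc2 S (\<lambda>u. fst u $ i $ j) u0"
proof (rule cdiff_linear)
  show "bounded_linear (\<lambda>u. fst u $ i $ j)"
    by (intro bounded_linear_compose[OF bounded_linear_vec_nth] bounded_linear_compose[OF bounded_linear_vec_nth bounded_linear_fst])
qed auto

lemma cdiff_entry_snd: "cdiff sc2 S (\<lambda>u. snd u $ i $ j) u0"
proof (rule cdiff_linear)
  show "bounded_linear (\<lambda>u. snd u $ i $ j)"
    by (intro bounded_linear_compose[OF bounded_linear_vec_nth] bounded_linear_compose[OF bounded_linear_vec_nth bounded_linear_snd])
qed auto

lemma cdiff_pull_entry:
  assumes "\<And>i j. cdiff sc S (\<lambda>x. Q x $ i $ j) u" "\<And>i j. cdiff sc S (\<lambda>x. A x $ i $ j) u"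
  shows "cdiff sc S (\<lambda>x. pull (Q x) (A x) $ j $ k) u"
  unfolding pull_entry by (intro cdiff_sum cdiff_mult assms)

lemma cdiff_det2: assumes "\<And>k. cdiff sc S (\<lambda>x. a x k) u" "\<And>k. cdiff sc S (\<lambda>x. b x k) u"
  shows "cdiff sc S (\<lambda>x. det2 (a x) (b x) i j) u"
  unfolding det2_def by (intro cdiff_diff cdiff_mult assms)

lemma cdiff_cross_ratio: assumes "\<And>k. cdiff sc S (\<lambda>x. a x k) u" "\<And>k. cdiff sc S (\<lambda>x. b x k) u"
    "separated (a u) (b u)" "distinct [i, j, k, l]"
  shows "cdiff sc S (\<lambda>x. cross_ratio (a x) (b x) i j k l) u"
  unfolding cross_ratio_def using assms(3,4)
  by (intro cdiff_divide cdiff_mult cdiff_det2 assms(1,2)) (auto simp: separated_def)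

text \<open>The case of a general base point is reduced to diagonal forms by the fixed matrix \<open>T\<^sub>0\<close>.\<close>

lemma local_frames:
  fixes A0 B0 :: "complex^'n^'n"
  assumes sep: "separated a b" and T0: "invertible T0" and A0: "pull T0 A0 = diagm a" and B0: "pull T0 B0 = diagm b"
  obtains T :: "(complex^'n^'n) \<times> (complex^'n^'n) \<Rightarrow> complex^'n^'n" where "T (A0, B0) = T0"
    "\<And>i j. cdiff sc2 UNIV (\<lambda>u. T u $ i $ j) (A0, B0)"
    "eventually (\<lambda>u. invertible (T u)) (nhds (A0, B0))"
    "eventually (\<lambda>u. fst u \<in> forms \<longrightarrow> snd u \<in> forms \<longrightarrow>
       pull (T u) (fst u) = diagm (\<lambda>k. pull (T u) (fst u) $ k $ k) \<and>
       pull (T u) (snd u) = diagm (\<lambda>k. pull (T u) (snd u) $ k $ k)) (nhds (A0, B0))"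
proof -
  obtain Q :: "(complex^'n^'n) \<times> (complex^'n^'n) \<Rightarrow> complex^'n^'n" where Q0: "Q (diagm a, diagm b) = mat 1"
    and Qd: "\<And>i j. cdiff sc2 UNIV (\<lambda>u. Q u $ i $ j) (diagm a, diagm b)"
    and Qe: "eventually (\<lambda>(A, B). \<forall>j k. A \<in> forms \<longrightarrow> B \<in> forms \<longrightarrow> j \<noteq> k \<longrightarrow>
        pull (Q (A, B)) A $ j $ k = 0 \<and> pull (Q (A, B)) B $ j $ k = 0) (nhds (diagm a, diagm b))"
    by (rule local_diagonalization[OF sep]) (rule that)
  define L where "L u = (pull T0 (fst u), pull T0 (snd u))" for u
  have L0: "L (A0, B0) = (diagm a, diagm b)" by (simp add: L_def A0 B0)
  have Lbl: "bounded_linear L" unfolding L_def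
    by (intro bounded_linear_Pair bounded_linear_compose[OF bounded_linear_pull] bounded_linear_fst bounded_linear_snd)
  define T where "T u = T0 ** Q (L u)" for u
  have QLd: "cdiff sc2 UNIV (\<lambda>u. Q (L u) $ i $ j) (A0, B0)" for i j
  proof (rule cdiff_compose_linear[where sc' = sc2 and S' = UNIV and L = L])
    show "cdiff sc2 UNIV (\<lambda>u. Q u $ i $ j) (L (A0, B0))" unfolding L0 by (rule Qd)
    show "L (sc2 c h) = sc2 c (L h)" for c h by (cases h) (simp add: L_def pull_mscale)
  qed (simp_all add: Lbl)
  have Td: "cdiff sc2 UNIV (\<lambda>u. T u $ i $ j) (A0, B0)" for i j
    unfolding T_def matrix_matrix_mult_def vec_lambda_beta by (intro cdiff_sum cdiff_mult cdiff_const QLd)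
  have Tt: "((\<lambda>u. T u $ i $ j) \<longlongrightarrow> T (A0, B0) $ i $ j) (nhds (A0, B0))" for i j
    by (rule cdiff_tendsto_nhds[OF Td])
  have T00: "T (A0, B0) = T0" by (simp add: T_def L0 Q0)
  have "((\<lambda>u. det (T u)) \<longlongrightarrow> det (T (A0, B0))) (nhds (A0, B0))"
    unfolding det_def by (intro tendsto_sum tendsto_mult tendsto_const tendsto_prod Tt)
  moreover have "det (T (A0, B0)) \<noteq> 0" using T0 T00 by (simp add: invertible_det_nz)
  ultimately have "eventually (\<lambda>u. det (T u) \<noteq> 0) (nhds (A0, B0))" by (rule tendsto_imp_eventually_ne)
  then have inv: "eventually (\<lambda>u. invertible (T u)) (nhds (A0, B0))" by (simp add: invertible_det_nz)
  have "filterlim L (nhds (L (A0, B0))) (nhds (A0, B0))"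
    using linear_continuous_at[OF Lbl] by (simp add: isCont_def tendsto_at_iff_tendsto_nhds)
  then have "eventually (\<lambda>u. (\<lambda>(A, B). \<forall>j k. A \<in> forms \<longrightarrow> B \<in> forms \<longrightarrow> j \<noteq> k \<longrightarrow>
        pull (Q (A, B)) A $ j $ k = 0 \<and> pull (Q (A, B)) B $ j $ k = 0) (L u)) (nhds (A0, B0))"
    using Qe unfolding filterlim_iff L0 by blast
  then have "eventually (\<lambda>u. fst u \<in> forms \<longrightarrow> snd u \<in> forms \<longrightarrow>
       pull (T u) (fst u) = diagm (\<lambda>k. pull (T u) (fst u) $ k $ k) \<and>
       pull (T u) (snd u) = diagm (\<lambda>k. pull (T u) (snd u) $ k $ k)) (nhds (A0, B0))"
  proof (rule eventually_mono, intro impI)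
    fix u :: "(complex^'n^'n) \<times> (complex^'n^'n)"
    assume *: "(\<lambda>(A, B). \<forall>j k. A \<in> forms \<longrightarrow> B \<in> forms \<longrightarrow> j \<noteq> k \<longrightarrow>
        pull (Q (A, B)) A $ j $ k = 0 \<and> pull (Q (A, B)) B $ j $ k = 0) (L u)" and f: "fst u \<in> forms" "snd u \<in> forms"
    have e: "pull (Q (pull T0 (fst u), pull T0 (snd u))) (pull T0 S) = pull (T u) S" for S
      by (simp add: T_def L_def pull_pull)
    have z: "pull (T u) (fst u) $ j $ k = 0 \<and> pull (T u) (snd u) $ j $ k = 0" if "j \<noteq> k" for j k
      using * f that by (simp add: L_def e pull_forms)
    show "pull (T u) (fst u) = diagm (\<lambda>k. pull (T u) (fst u) $ k $ k) \<and>
       pull (T u) (snd u) = diagm (\<lambda>k. pull (T u) (snd u) $ k $ k)"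
      using z by (auto simp: vec_eq_iff diagm_component)
  qed
  then show ?thesis using that[of T] T00 Td inv by blast
qed

text \<open>All bases of a pencil of diagonal forms consist of diagonal forms and have the same cross ratios.\<close>

lemma Pen_basis_change:
  fixes A B :: "complex^'n^'n"
  assumes eq: "form_span A B = Pen a b" and n: "near_config \<epsilon> a0 b0 a b" and c: "CARD('n) > 1"
  obtains a1 b1 where "A = diagm a1" "B = diagm b1" "near_config \<epsilon> a0 b0 a1 b1"
proof -
  have "A = mscale 1 A + mscale 0 B" "B = mscale 0 A + mscale 1 B" by (simp_all add: vec_eq_iff)
  then have "A \<in> form_span A B" "B \<in> form_span A B" unfolding form_span_def by blast+
  then have "A \<in> Pen a b" "B \<in> Pen a b" unfolding eq by blast+
  then obtain a1 b1 where A: "A = diagm a1" and B: "B = diagm b1"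
    by (auto simp: form_span_def diagm_comb)
  have "diagm a = mscale 1 (diagm a) + mscale 0 (diagm b)" "diagm b = mscale 0 (diagm a) + mscale 1 (diagm b)"
    by (simp_all add: vec_eq_iff)
  then have "diagm a \<in> Pen a b" "diagm b \<in> Pen a b" unfolding form_span_def by blast+
  then have "diagm a \<in> form_span A B" "diagm b \<in> form_span A B" unfolding eq by blast+
  then obtain \<alpha> \<beta> \<gamma> \<delta> where a: "a = (\<lambda>k. \<alpha> * a1 k + \<beta> * b1 k)" and b: "b = (\<lambda>k. \<gamma> * a1 k + \<delta> * b1 k)"
    by (auto simp: form_span_def diagm_comb A B diagm_eq_iff)
  have d: "det2 a b i j = (\<alpha> * \<delta> - \<beta> * \<gamma>) * det2 a1 b1 i j" for i j by (simp add: a b det2_def algebra_simps)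
  have sep: "separated a b" using n by (simp add: near_config_def)
  obtain i j :: 'n where "i \<noteq> j" using exists_other_index[OF c] by metis
  then have D: "\<alpha> * \<delta> - \<beta> * \<gamma> \<noteq> 0" using sep d by (auto simp: separated_def)
  have "separated a1 b1" using sep d by (auto simp: separated_def)
  moreover have "cross_ratio a1 b1 i j k l = cross_ratio a b i j k l" for i j k l
    using D by (simp add: cross_ratio_def d)
  ultimately have "near_config \<epsilon> a0 b0 a1 b1" using n by (simp add: near_config_def)
  then show ?thesis using that A B by blast
qed

text \<open>Simultaneous diagonalization varies holomorphically, and so do the resulting labelled
  diagonal entries, which therefore stay close to a given configuration.\<close>

lemma local_chart:
  fixes A0 B0 :: "complex^'n^'n"
  assumes eq: "pull T0 ` form_span A0 B0 = Pen a b" and n: "near_config \<epsilon> a0 b0 a b" and c: "CARD('n) > 1"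
    and T0: "invertible T0"
  obtains T :: "(complex^'n^'n) \<times> (complex^'n^'n) \<Rightarrow> complex^'n^'n" and a' b' where "T (A0, B0) = T0"
    "\<And>i j. cdiff sc2 UNIV (\<lambda>u. T u $ i $ j) (A0, B0)"
    "\<And>k. cdiff sc2 UNIV (\<lambda>u. a' u k) (A0, B0)" "\<And>k. cdiff sc2 UNIV (\<lambda>u. b' u k) (A0, B0)"
    "separated (a' (A0, B0)) (b' (A0, B0))"
    "eventually (\<lambda>u. invertible (T u) \<and> near_config \<epsilon> a0 b0 (a' u) (b' u) \<and> (fst u \<in> forms \<longrightarrow> snd u \<in> forms \<longrightarrow>
       pull (T u) (fst u) = diagm (a' u) \<and> pull (T u) (snd u) = diagm (b' u))) (nhds (A0, B0))"
proof -
  obtain a1 b1 where a1: "pull T0 A0 = diagm a1" and b1: "pull T0 B0 = diagm b1" and n1: "near_config \<epsilon> a0 b0 a1 b1"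
    using Pen_basis_change[OF eq[unfolded pull_form_span] n c] by metis
  have sep1: "separated a1 b1" using n1 by (simp add: near_config_def)
  obtain T :: "(complex^'n^'n) \<times> (complex^'n^'n) \<Rightarrow> complex^'n^'n" where T: "T (A0, B0) = T0"
    "\<And>i j. cdiff sc2 UNIV (\<lambda>u. T u $ i $ j) (A0, B0)"
    "eventually (\<lambda>u. invertible (T u)) (nhds (A0, B0))"
    "eventually (\<lambda>u. fst u \<in> forms \<longrightarrow> snd u \<in> forms \<longrightarrow>
       pull (T u) (fst u) = diagm (\<lambda>k. pull (T u) (fst u) $ k $ k) \<and>
       pull (T u) (snd u) = diagm (\<lambda>k. pull (T u) (snd u) $ k $ k)) (nhds (A0, B0))"
    by (rule local_frames[OF sep1 T0 a1 b1]) (rule that)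
  define a' where "a' u k = pull (T u) (fst u) $ k $ k" for u k
  define b' where "b' u k = pull (T u) (snd u) $ k $ k" for u k
  have ad: "cdiff sc2 UNIV (\<lambda>u. a' u k) (A0, B0)" for k
    unfolding a'_def by (intro cdiff_pull_entry T(2) cdiff_entry_fst)
  have bd: "cdiff sc2 UNIV (\<lambda>u. b' u k) (A0, B0)" for k
    unfolding b'_def by (intro cdiff_pull_entry T(2) cdiff_entry_snd)
  have a'0: "a' (A0, B0) = a1" and b'0: "b' (A0, B0) = b1"
    by (simp_all add: a'_def b'_def T(1) a1 b1 diagm_component fun_eq_iff)
  have ne: "eventually (\<lambda>u. i \<noteq> j \<longrightarrow> det2 (a' u) (b' u) i j \<noteq> 0) (nhds (A0, B0))" for i j
  proof (cases "i = j")
    case False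
    have "((\<lambda>u. det2 (a' u) (b' u) i j) \<longlongrightarrow> det2 (a' (A0, B0)) (b' (A0, B0)) i j) (nhds (A0, B0))"
      by (intro cdiff_tendsto_nhds[of sc2] cdiff_det2 ad bd)
    moreover have "det2 (a' (A0, B0)) (b' (A0, B0)) i j \<noteq> 0" using False sep1 by (simp add: a'0 b'0 separated_def)
    ultimately have "eventually (\<lambda>u. det2 (a' u) (b' u) i j \<noteq> 0) (nhds (A0, B0))" by (rule tendsto_imp_eventually_ne)
    then show ?thesis by (rule eventually_mono) simp
  qed simp
  have ce: "eventually (\<lambda>u. distinct [i, j, k, l] \<longrightarrow> cmod (cross_ratio (a' u) (b' u) i j k l - cross_ratio a0 b0 i j k l) < \<epsilon>) (nhds (A0, B0))" for i j k l
  proof (cases "distinct [i, j, k, l]")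
    case True
    have "((\<lambda>u. cross_ratio (a' u) (b' u) i j k l) \<longlongrightarrow> cross_ratio (a' (A0, B0)) (b' (A0, B0)) i j k l) (nhds (A0, B0))"
      by (intro cdiff_tendsto_nhds[of sc2] cdiff_cross_ratio ad bd True) (simp add: a'0 b'0 sep1)
    then have "((\<lambda>u. cmod (cross_ratio (a' u) (b' u) i j k l - cross_ratio a0 b0 i j k l)) \<longlongrightarrow> cmod (cross_ratio a1 b1 i j k l - cross_ratio a0 b0 i j k l)) (nhds (A0, B0))"
      unfolding a'0 b'0 by (intro tendsto_intros)
    moreover have "cmod (cross_ratio a1 b1 i j k l - cross_ratio a0 b0 i j k l) < \<epsilon>" using n1 True by (simp add: near_config_def)
    ultimately have "eventually (\<lambda>u. cmod (cross_ratio (a' u) (b' u) i j k l - cross_ratio a0 b0 i j k l) < \<epsilon>) (nhds (A0, B0))"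
      by (rule order_tendstoD(2))
    then show ?thesis by (rule eventually_mono) simp
  qed (rule always_eventually, auto)
  have near: "eventually (\<lambda>u. near_config \<epsilon> a0 b0 (a' u) (b' u)) (nhds (A0, B0))"
    unfolding near_config_def separated_def
    by (intro eventually_conj eventually_all_finite_type ne ce)
  show thesis
  proof (rule that[OF T(1,2) ad bd])
    show "separated (a' (A0, B0)) (b' (A0, B0))" by (simp add: a'0 b'0 sep1)
    show "eventually (\<lambda>u. invertible (T u) \<and> near_config \<epsilon> a0 b0 (a' u) (b' u) \<and> (fst u \<in> forms \<longrightarrow> snd u \<in> forms \<longrightarrow>
       pull (T u) (fst u) = diagm (a' u) \<and> pull (T u) (snd u) = diagm (b' u))) (nhds (A0, B0))"
      using T(3) near T(4) unfolding a'_def[abs_def] b'_def[abs_def] by eventually_elim blast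
  qed
qed

lemma diagonalizable_nonsingular:
  fixes A B T :: "complex^'n^'n"
  assumes "invertible T" "pull T A = diagm a" "pull T B = diagm b" "separated a b" "CARD('n) > 1"
  shows "nonsingular_pencil (form_span A B)" "forms_independent A B"
    "pencil_class (form_span A B) = pencil_class (Pen a b)"
proof -
  obtain T' where T': "invertible T'" "\<And>S. pull T' (pull T S) = S" using pull_inverse[OF assms(1)] by metis
  have e: "pull T' (diagm a) = A" "pull T' (diagm b) = B" using T'(2) assms(2,3) by metis+
  then have e2: "form_span A B = pull T' ` Pen a b" by (simp add: pull_form_span)
  show "nonsingular_pencil (form_span A B)" unfolding e2
    by (intro nonsingular_pencil_pull T'(1) diagm_nonsingular assms)
  show "forms_independent A B"
    using forms_independent_pull[OF T'(1)] diagm_independent[OF assms(4,5)] e by metis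
  show "pencil_class (form_span A B) = pencil_class (Pen a b)"
    unfolding e2 by (rule pencil_class_pull[OF T'(1)])
qed

section \<open>Cross ratios as local functions on the moduli space\<close>

text \<open>The diagonal representatives of a class that are close to the rigid configuration differ by diagonal
  matrices, so they have the same labelled cross ratios; picking any of them defines \<open>h\<close>.  In a local
  chart of frames, \<open>h\<close> is the cross ratio of the diagonal entries, hence holomorphic.\<close>

lemma cross_ratio_MPQ_holo:
  fixes a0 b0 :: "'n::finite \<Rightarrow> complex"
  assumes rig: "rigid_config a0 b0" and c: "CARD('n) > 1" and d: "distinct [i, j, k, l]"
  obtains h U \<epsilon> where "\<epsilon> > 0" "MPQ_holo h (U :: (complex^'n^'n) set set set)"
    "\<And>a b. near_config \<epsilon> a0 b0 a b \<Longrightarrow> pencil_class (Pen a b) \<in> U"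
    "\<And>a b. near_config \<epsilon> a0 b0 a b \<Longrightarrow> h (pencil_class (Pen a b)) = cross_ratio a b i j k l"
proof -
  obtain \<epsilon> where e: "\<epsilon> > 0" "\<And>a b a' b' T. near_config \<epsilon> a0 b0 a b \<Longrightarrow> near_config \<epsilon> a0 b0 a' b' \<Longrightarrow> invertible T \<Longrightarrow>
    pull T ` Pen a b = Pen a' b' \<Longrightarrow> \<exists>c \<alpha> \<beta> \<gamma> \<delta>. T = diagm c \<and> (\<forall>k. c k \<noteq> 0) \<and> \<alpha> * \<delta> - \<beta> * \<gamma> \<noteq> 0 \<and>
      (\<forall>k. a' k = (c k)\<^sup>2 * (\<alpha> * a k + \<beta> * b k)) \<and> (\<forall>k. b' k = (c k)\<^sup>2 * (\<gamma> * a k + \<delta> * b k))"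
    using near_config_equivalence_diagonal[OF rig c] by metis
  define U where "U = {pencil_class (Pen a b) | a b. near_config \<epsilon> a0 b0 a b}"
  define R where "R C = (SOME p. near_config \<epsilon> a0 b0 (fst p) (snd p) \<and> C = pencil_class (Pen (fst p) (snd p)))"
    for C :: "(complex^'n^'n) set set"
  define h where "h C = cross_ratio (fst (R C)) (snd (R C)) i j k l" for C
  have hU: "h (pencil_class (Pen a b)) = cross_ratio a b i j k l" if n: "near_config \<epsilon> a0 b0 a b" for a b
  proof -
    let ?C = "pencil_class (Pen a b)"
    have "near_config \<epsilon> a0 b0 (fst (R ?C)) (snd (R ?C)) \<and> ?C = pencil_class (Pen (fst (R ?C)) (snd (R ?C)))"
      unfolding R_def by (rule someI[of _ "(a, b)"]) (simp add: n)
    then obtain a' b' where ab: "R ?C = (a', b')" "near_config \<epsilon> a0 b0 a' b'" "?C = pencil_class (Pen a' b')"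
      by (metis prod.collapse)
    obtain T where T: "invertible T" "Pen a' b' = pull T ` Pen a b" using pencil_class_eqD[OF ab(3)] by metis
    obtain c \<alpha> \<beta> \<gamma> \<delta> where "\<And>k. c k \<noteq> 0" "\<alpha> * \<delta> - \<beta> * \<gamma> \<noteq> 0"
      "\<And>k. a' k = (c k)\<^sup>2 * (\<alpha> * a k + \<beta> * b k)" "\<And>k. b' k = (c k)\<^sup>2 * (\<gamma> * a k + \<delta> * b k)"
      using e(2)[OF n ab(2) T(1) T(2)[symmetric]] by metis
    then have "cross_ratio a' b' i j k l = cross_ratio a b i j k l"
      using cross_ratio_transform[where a = a and b = b and \<sigma> = "\<lambda>x. x" and c = c and a' = a' and b' = b'] by blast
    then show ?thesis by (simp add: h_def ab(1))
  qed
  define F where "F = {(A, B). A \<in> forms \<and> B \<in> forms \<and> nonsingular_pencil (form_span A B) \<and> forms_independent A B \<and>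
          pencil_class (form_span A B) \<in> U}"
  have chart: "cdiff sc2 (forms \<times> forms) (\<lambda>(A, B). h (pencil_class (form_span A B))) u0 \<and>
     eventually (\<lambda>u. u \<in> forms \<times> forms \<longrightarrow> u \<in> F) (nhds u0)" if "u0 \<in> F" for u0
  proof -
    obtain A0 B0 where u0: "u0 = (A0, B0)" and AB: "A0 \<in> forms" "B0 \<in> forms" and cl: "pencil_class (form_span A0 B0) \<in> U"
      using \<open>u0 \<in> F\<close> by (auto simp: F_def)
    obtain a b where ab: "near_config \<epsilon> a0 b0 a b" "pencil_class (form_span A0 B0) = pencil_class (Pen a b)"
      using cl by (auto simp: U_def)
    obtain T0 where T0: "invertible T0" "Pen a b = pull T0 ` form_span A0 B0" using pencil_class_eqD[OF ab(2)] by metis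
    obtain T :: "(complex^'n^'n) \<times> (complex^'n^'n) \<Rightarrow> complex^'n^'n" and a' b' where
      ad: "\<And>k. cdiff sc2 UNIV (\<lambda>u. a' u k) (A0, B0)" and bd: "\<And>k. cdiff sc2 UNIV (\<lambda>u. b' u k) (A0, B0)"
      and sep: "separated (a' (A0, B0)) (b' (A0, B0))"
      and ev: "eventually (\<lambda>u. invertible (T u) \<and> near_config \<epsilon> a0 b0 (a' u) (b' u) \<and> (fst u \<in> forms \<longrightarrow> snd u \<in> forms \<longrightarrow>
       pull (T u) (fst u) = diagm (a' u) \<and> pull (T u) (snd u) = diagm (b' u))) (nhds (A0, B0))"
      by (rule local_chart[OF T0(2)[symmetric] ab(1) c T0(1)]) (rule that)
    have good: "(A, B) \<in> F \<and> h (pencil_class (form_span A B)) = cross_ratio (a' (A, B)) (b' (A, B)) i j k l"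
      if *: "invertible (T (A, B)) \<and> near_config \<epsilon> a0 b0 (a' (A, B)) (b' (A, B)) \<and> (fst (A, B) \<in> forms \<longrightarrow> snd (A, B) \<in> forms \<longrightarrow>
       pull (T (A, B)) (fst (A, B)) = diagm (a' (A, B)) \<and> pull (T (A, B)) (snd (A, B)) = diagm (b' (A, B)))"
        and f: "A \<in> forms" "B \<in> forms" for A B
    proof -
      have inv: "invertible (T (A, B))" and n: "near_config \<epsilon> a0 b0 (a' (A, B)) (b' (A, B))"
        and p: "pull (T (A, B)) A = diagm (a' (A, B))" "pull (T (A, B)) B = diagm (b' (A, B))"
        using * f by auto
      have "separated (a' (A, B)) (b' (A, B))" using n by (simp add: near_config_def)
      from diagonalizable_nonsingular[OF inv p this c] show ?thesis
        using f n hU[OF n] by (auto simp: F_def U_def)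
    qed
    have ev2: "eventually (\<lambda>u. u \<in> forms \<times> forms \<longrightarrow> u \<in> F \<and>
        (\<lambda>(A, B). h (pencil_class (form_span A B))) u = cross_ratio (a' u) (b' u) i j k l) (nhds u0)"
      unfolding u0 using ev
    proof (rule eventually_mono, clarify)
      fix A B :: "complex^'n^'n"
      assume "invertible (T (A, B))" "near_config \<epsilon> a0 b0 (a' (A, B)) (b' (A, B))" "fst (A, B) \<in> forms \<longrightarrow>
         snd (A, B) \<in> forms \<longrightarrow> pull (T (A, B)) (fst (A, B)) = diagm (a' (A, B)) \<and> pull (T (A, B)) (snd (A, B)) = diagm (b' (A, B))"
        "A \<in> forms" "B \<in> forms"
      then show "(A, B) \<in> F \<and> h (pencil_class (form_span A B)) = cross_ratio (a' (A, B)) (b' (A, B)) i j k l"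
        using good[of A B] by blast
    qed
    have 1: "cdiff sc2 (forms \<times> forms) (\<lambda>u. cross_ratio (a' u) (b' u) i j k l) u0"
      unfolding u0 by (rule cdiff_subset[of _ UNIV]) (intro cdiff_cross_ratio ad bd sep d, simp)
    have "cdiff sc2 (forms \<times> forms) (\<lambda>(A, B). h (pencil_class (form_span A B))) u0"
    proof (rule cdiff_transform_eventually[OF 1])
      show "eventually (\<lambda>u. cross_ratio (a' u) (b' u) i j k l = (\<lambda>(A, B). h (pencil_class (form_span A B))) u) (at u0 within forms \<times> forms)"
        using ev2 unfolding eventually_at_filter by eventually_elim auto
      show "u0 \<in> forms \<times> forms" using u0 AB by simp
      then show "cross_ratio (a' u0) (b' u0) i j k l = (\<lambda>(A, B). h (pencil_class (form_span A B))) u0"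
        using eventually_nhds_x_imp_x[OF ev2] by auto
    qed
    moreover have "eventually (\<lambda>u. u \<in> forms \<times> forms \<longrightarrow> u \<in> F) (nhds u0)"
      using ev2 by eventually_elim auto
    ultimately show ?thesis by blast
  qed
  have "U \<subseteq> MPQ"
    unfolding U_def MPQ_def using diagm_nonsingular[OF _ c] by (auto simp: near_config_def)
  moreover have "openin (top_of_set (forms \<times> forms)) F"
    by (rule openin_if_eventually) (use chart in \<open>auto simp: F_def\<close>)
  ultimately have "MPQ_holo h U"
    unfolding MPQ_holo_def holo_on_open_def F_def[symmetric] using chart by (auto simp: cdiff_def)
  then show thesis using that[of \<epsilon> h U] e(1) hU by (auto simp: U_def)
qed

section \<open>Invariants of a pencil together with a three-dimensional subspace\<close>

definition minor :: "complex^'n^3 \<Rightarrow> 'n \<Rightarrow> 'n \<Rightarrow> 'n \<Rightarrow> complex" where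
  "minor p i j k = det (\<chi> m r. p $ m $ (if r = 1 then i else if r = 2 then j else k))"

lemma minor_expand: "minor p i j k =
    p$1$i * p$2$j * p$3$k + p$1$j * p$2$k * p$3$i + p$1$k * p$2$i * p$3$j
  - p$1$i * p$2$k * p$3$j - p$1$j * p$2$i * p$3$k - p$1$k * p$2$j * p$3$i"
  by (simp add: minor_def det_3)

lemma minor_mult: "minor (M ** p) i j k = det M * minor p i j k"
proof -
  have "((\<chi> m r. (M ** p) $ m $ (if r = 1 then i else if r = 2 then j else k)) :: complex^3^3)
      = M ** (\<chi> m r. p $ m $ (if r = 1 then i else if r = 2 then j else k))"
    by (simp add: vec_eq_iff matrix_matrix_mult_def)
  then show ?thesis by (simp add: minor_def det_mul)
qed

lemma minor_scale:
  assumes "\<And>m k. c k * p' $ m $ k = q $ m $ k" shows "c i * c j * c k * minor p' i j k = minor q i j k"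
  unfolding minor_expand assms[symmetric] by (simp add: algebra_simps)

lemma vector_matrix_component: "(y v* p) $ k = (\<Sum>m\<in>UNIV. y $ m * p $ m $ k)" for y :: "complex^'m"
  by (simp add: vector_matrix_mult_def mult_ac)

lemma span_rows: "vec.span (rows p) = range (\<lambda>y. y v* p)" for p :: "complex^'n^'m"
proof
  show "vec.span (rows p) \<subseteq> range (\<lambda>y. y v* p)"
  proof (rule vec.span_minimal)
    show "rows p \<subseteq> range (\<lambda>y. y v* p)"
    proof
      fix w assume "w \<in> rows p"
      then obtain m where m: "w = row m p" by (auto simp: rows_def)
      have "(axis m 1 v* p) $ k = (\<Sum>i\<in>UNIV. if i = m then p $ m $ k else 0)" for k
        unfolding vector_matrix_component by (rule sum.cong) (auto simp: axis_def)
      then have "w = axis m 1 v* p" by (simp add: m row_def vec_eq_iff)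
      then show "w \<in> range (\<lambda>y. y v* p)" by blast
    qed
    have "(0 :: complex^'m) v* p = 0" by (simp add: vec_eq_iff vector_matrix_component)
    moreover have "y v* p + y' v* p = (y + y') v* p" for y y' :: "complex^'m"
      by (simp add: vector_matrix_left_distrib)
    moreover have "c *s (y v* p) = (c *s y) v* p" for y :: "complex^'m" and c
      by (simp add: vec_eq_iff vector_matrix_component sum_distrib_left mult_ac)
    ultimately show "vec.subspace (range (\<lambda>y. y v* p))"
      unfolding vec.subspace_def by (smt (verit, best) imageE rangeI)
  qed
  show "range (\<lambda>y. y v* p) \<subseteq> vec.span (rows p)"
  proof clarify
    fix y :: "complex^'m"
    have "y v* p = (\<Sum>m\<in>UNIV. y $ m *s row m p)"
      by (simp add: vec_eq_iff vector_matrix_component row_def)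
    also have "\<dots> \<in> vec.span (rows p)"
      by (intro vec.span_sum vec.span_scale vec.span_base) (auto simp: rows_def)
    finally show "y v* p \<in> vec.span (rows p)" .
  qed
qed

lemma dim_span_rows:
  fixes p :: "complex^'n^3"
  assumes "\<And>y. y v* p = 0 \<Longrightarrow> y = 0" shows "vec.dim (vec.span (rows p)) = 3"
proof -
  have "inj ((*v) (transpose p))"
  proof (rule injI)
    fix x y assume "transpose p *v x = transpose p *v y"
    then have "(x - y) v* p = 0" by (simp add: vector_matrix_mult_diff_distrib)
    then have "x - y = 0" by (rule assms)
    then show "x = y" by simp
  qed
  then have "vec.dim ((*v) (transpose p) ` UNIV) = vec.dim (UNIV :: (complex^3) set)"
    by (intro vec.dim_image_eq) (auto intro: inj_on_subset)
  then have "vec.dim (range (\<lambda>y. y v* p)) = CARD(3)" unfolding vec_dim_card by simp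
  then show ?thesis unfolding span_rows by simp
qed

lemma minor_nonzero_independent:
  assumes "minor p i j k \<noteq> 0" "y v* p = 0" shows "y = 0"
proof -
  let ?S = "(\<chi> m r. p $ m $ (if r = 1 then i else if r = 2 then j else k)) :: complex^3^3"
  have "invertible ?S" using assms(1) by (simp add: minor_def invertible_det_nz)
  then obtain S' where S': "?S ** S' = mat 1" by (auto simp: invertible_def)
  have "(y v* ?S) $ r = (y v* p) $ (if r = 1 then i else if r = 2 then j else k)" for r
    by (simp add: vector_matrix_component)
  then have "y v* ?S = 0" by (simp add: assms(2) vec_eq_iff)
  then have "(y v* ?S) v* S' = 0" by (simp add: vec_eq_iff vector_matrix_component)
  then show ?thesis by (simp add: vector_matrix_mul_assoc S')
qed

lemma mat_vec_rowcomb: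
  fixes T :: "complex^'n^'n" and p p' :: "complex^'n^3"
  assumes "\<And>m. T *v (p' $ m) = p $ m" shows "T *v (y v* p') = y v* p"
proof -
  have e: "y v* q = (\<Sum>m\<in>UNIV. y $ m *s q $ m)" for q :: "complex^'n^3"
    by (simp add: vec_eq_iff vector_matrix_component)
  have "T *v (y v* p') = (\<Sum>m\<in>UNIV. T *v (y $ m *s p' $ m))" unfolding e by (rule vec.sum)
  also have "\<dots> = y v* p" by (simp add: e vector_scalar_commute assms)
  finally show ?thesis .
qed

text \<open>Used to express that \<open>p'\<close> is the basis \<open>p\<close> in the coordinates given by \<open>T\<close>.\<close>

lemma transport_span_rows:
  fixes T :: "complex^'n^'n" and p p' :: "complex^'n^3"
  assumes T: "invertible T" and r: "\<And>m. T *v (p' $ m) = p $ m"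
  shows "{w. T *v w \<in> vec.span (rows p)} = vec.span (rows p')"
proof -
  obtain T' where T': "T' ** T = mat 1" using T by (auto simp: invertible_def)
  have inj: "w = w'" if "T *v w = T *v w'" for w w'
    using arg_cong[OF that, of "(*v) T'"] by (simp add: matrix_vector_mul_assoc T')
  have comb: "T *v (y v* p') = y v* p" for y by (rule mat_vec_rowcomb[OF r])
  show ?thesis unfolding span_rows
  proof (intro equalityI subsetI)
    fix w assume "w \<in> {w. T *v w \<in> range (\<lambda>y. y v* p)}"
    then obtain y where "T *v w = y v* p" by auto
    then have "w = y v* p'" using inj comb by metis
    then show "w \<in> range (\<lambda>y. y v* p')" by blast
  next
    fix w assume "w \<in> range (\<lambda>y. y v* p')"
    then show "w \<in> {w. T *v w \<in> range (\<lambda>y. y v* p)}" using comb by auto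
  qed
qed

text \<open>The scalar multiplication of the triples in \<open>refined_MPQ_holo\<close>.\<close>

abbreviation sc3 :: "complex \<Rightarrow> (complex^'n^'n) \<times> (complex^'n^'n) \<times> (complex^'n^3) \<Rightarrow> (complex^'n^'n) \<times> (complex^'n^'n) \<times> (complex^'n^3)" where
  "sc3 \<equiv> (\<lambda>c (A, B, p). (mscale c A, mscale c B, mscale c p))"

text \<open>Functions of a diagonal pencil with labelled coordinates and a basis of a three-dimensional subspace
  that are insensitive to rescaling the coordinates by \<open>c\<close>, to changing the basis of the pencil and to
  changing the basis of the subspace by \<open>M\<close>.\<close>

definition pair_invariant :: "(('n::finite \<Rightarrow> complex) \<Rightarrow> ('n \<Rightarrow> complex) \<Rightarrow> complex^'n^3 \<Rightarrow> complex) \<Rightarrow> bool" where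
  "pair_invariant G \<longleftrightarrow> (\<forall>a b p a' b' p' c \<alpha> \<beta> \<gamma> \<delta> M. separated a b \<longrightarrow> (\<forall>k. c k \<noteq> 0) \<longrightarrow> \<alpha> * \<delta> - \<beta> * \<gamma> \<noteq> 0 \<longrightarrow>
     (\<forall>k. a' k = (c k)\<^sup>2 * (\<alpha> * a k + \<beta> * b k)) \<longrightarrow> (\<forall>k. b' k = (c k)\<^sup>2 * (\<gamma> * a k + \<delta> * b k)) \<longrightarrow>
     det M \<noteq> 0 \<longrightarrow> (\<forall>m k. c k * p' $ m $ k = (M ** p) $ m $ k) \<longrightarrow> G a' b' p' = G a b p)"

text \<open>Holomorphy where one particular minor does not vanish; this minor is going to be a denominator.\<close>

definition pair_regular :: "'n::finite \<Rightarrow> 'n \<Rightarrow> 'n \<Rightarrow> (('n \<Rightarrow> complex) \<Rightarrow> ('n \<Rightarrow> complex) \<Rightarrow> complex^'n^3 \<Rightarrow> complex) \<Rightarrow> bool" where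
  "pair_regular i j k G \<longleftrightarrow> (\<forall>a b p (u :: (complex^'n^'n) \<times> (complex^'n^'n) \<times> (complex^'n^3)). (\<forall>k. cdiff sc3 UNIV (\<lambda>u. a u k) u) \<longrightarrow> (\<forall>k. cdiff sc3 UNIV (\<lambda>u. b u k) u) \<longrightarrow>
     (\<forall>m k. cdiff sc3 UNIV (\<lambda>u. p u $ m $ k) u) \<longrightarrow> separated (a u) (b u) \<longrightarrow> minor (p u) i j k \<noteq> 0 \<longrightarrow>
     cdiff sc3 UNIV (\<lambda>u. G (a u) (b u) (p u)) u)"

lemma cdiff_minor:
  assumes "\<And>m k. cdiff sc S (\<lambda>u. p u $ m $ k) u" shows "cdiff sc S (\<lambda>u. minor (p u) i j k) u"
  unfolding minor_expand by (intro cdiff_diff cdiff_add cdiff_mult assms)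

lemma cdiff_triple:
  fixes A0 B0 :: "complex^'n^'n" and p0 :: "complex^'n^3"
  shows "cdiff sc3 S (\<lambda>u. fst u $ i $ j) (A0, B0, p0)" "cdiff sc3 S (\<lambda>u. fst (snd u) $ i $ j) (A0, B0, p0)"
    "cdiff sc3 S (\<lambda>u. snd (snd u) $ m $ j) (A0, B0, p0)"
  by (rule cdiff_linear;
      (auto intro!: bounded_linear_compose[OF bounded_linear_vec_nth] bounded_linear_compose[OF bounded_linear_fst]
        bounded_linear_compose[OF bounded_linear_snd] bounded_linear_fst bounded_linear_snd)?)+

text \<open>As for cross ratios, close representatives of a class differ by a diagonal matrix, so an invariant of
  pairs descends to the classes having such a representative.  In addition to a frame, a local chart
  has to provide the coordinates of the subspace in that frame.\<close>

lemma pair_invariant_refined_holo: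
  fixes a0 b0 :: "'n::finite \<Rightarrow> complex" and G :: "('n \<Rightarrow> complex) \<Rightarrow> ('n \<Rightarrow> complex) \<Rightarrow> complex^'n^3 \<Rightarrow> complex" and l0 j0 k0 :: 'n
  assumes rig: "rigid_config a0 b0" and c: "CARD('n) > 1"
    and inv: "pair_invariant G" and reg: "pair_regular l0 j0 k0 G"
  obtains h U \<epsilon> where "\<epsilon> > 0" "refined_MPQ_holo h (U :: ((complex^'n^'n) set \<times> (complex^'n) set) set set)"
    "\<And>a b p. near_config \<epsilon> a0 b0 a b \<Longrightarrow> minor p l0 j0 k0 \<noteq> 0 \<Longrightarrow> pair_class (Pen a b) (vec.span (rows p)) \<in> U"
    "\<And>a b p. near_config \<epsilon> a0 b0 a b \<Longrightarrow> minor p l0 j0 k0 \<noteq> 0 \<Longrightarrow> h (pair_class (Pen a b) (vec.span (rows p))) = G a b p"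
proof -
  obtain \<epsilon> where e: "\<epsilon> > 0" "\<And>a b a' b' T. near_config \<epsilon> a0 b0 a b \<Longrightarrow> near_config \<epsilon> a0 b0 a' b' \<Longrightarrow> invertible T \<Longrightarrow>
    pull T ` Pen a b = Pen a' b' \<Longrightarrow> \<exists>c \<alpha> \<beta> \<gamma> \<delta>. T = diagm c \<and> (\<forall>k. c k \<noteq> 0) \<and> \<alpha> * \<delta> - \<beta> * \<gamma> \<noteq> 0 \<and>
      (\<forall>k. a' k = (c k)\<^sup>2 * (\<alpha> * a k + \<beta> * b k)) \<and> (\<forall>k. b' k = (c k)\<^sup>2 * (\<gamma> * a k + \<delta> * b k))"
    using near_config_equivalence_diagonal[OF rig c] by metis
  define cls where "cls a b p = pair_class (Pen a b) (vec.span (rows p))" for a b and p :: "complex^'n^3"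
  define ok where "ok a b p \<longleftrightarrow> near_config \<epsilon> a0 b0 a b \<and> minor p l0 j0 k0 \<noteq> 0" for a b and p :: "complex^'n^3"
  define U where "U = {cls a b p | a b p. ok a b p}"
  define R where "R C = (SOME q. ok (fst q) (fst (snd q)) (snd (snd q)) \<and> C = cls (fst q) (fst (snd q)) (snd (snd q)))" for C
  define h where "h C = G (fst (R C)) (fst (snd (R C))) (snd (snd (R C)))" for C
  have hU: "h (cls a b p) = G a b p" if ok: "ok a b p" for a b p
  proof -
    let ?C = "cls a b p"
    have "ok (fst (R ?C)) (fst (snd (R ?C))) (snd (snd (R ?C))) \<and> ?C = cls (fst (R ?C)) (fst (snd (R ?C))) (snd (snd (R ?C)))"
      unfolding R_def by (rule someI[of _ "(a, b, p)"]) (simp add: ok)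
    then obtain a' b' p' where ab: "R ?C = (a', b', p')" "ok a' b' p'" "?C = cls a' b' p'"
      by (metis prod.collapse)
    obtain T where T: "invertible T" "Pen a' b' = pull T ` Pen a b"
        "vec.span (rows p') = {w. T *v w \<in> vec.span (rows p)}"
      by (rule pair_class_eqD[OF ab(3)[unfolded cls_def]]) (rule that)
    have n: "near_config \<epsilon> a0 b0 a b" "near_config \<epsilon> a0 b0 a' b'" using ok ab(2) by (simp_all add: ok_def)
    obtain c \<alpha> \<beta> \<gamma> \<delta> where c: "T = diagm c" "\<forall>k. c k \<noteq> 0" and D: "\<alpha> * \<delta> - \<beta> * \<gamma> \<noteq> 0" and
      a': "\<forall>k. a' k = (c k)\<^sup>2 * (\<alpha> * a k + \<beta> * b k)" and b': "\<forall>k. b' k = (c k)\<^sup>2 * (\<gamma> * a k + \<delta> * b k)"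
      using e(2)[OF n T(1) T(2)[symmetric]] by metis
    have "\<exists>y. T *v (p' $ m) = y v* p" for m
    proof -
      have "p' $ m \<in> vec.span (rows p')" by (rule vec.span_base) (auto simp: rows_def row_def)
      then have "T *v (p' $ m) \<in> vec.span (rows p)" using T(3) by simp
      then show ?thesis by (auto simp: span_rows)
    qed
    then obtain y where y: "\<And>m. T *v (p' $ m) = y m v* p" by metis
    define M where "M = (\<chi> m. y m)"
    have cM: "\<forall>m k. c k * p' $ m $ k = (M ** p) $ m $ k"
    proof (intro allI)
      fix m k
      have "(T *v (p' $ m)) $ k = (y m v* p) $ k" using y by simp
      then show "c k * p' $ m $ k = (M ** p) $ m $ k"
        by (simp add: c(1) diagm_vec vector_matrix_component M_def matrix_matrix_mult_def)
    qed
    have "c l0 * c j0 * c k0 * minor p' l0 j0 k0 = minor (M ** p) l0 j0 k0"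
      by (rule minor_scale) (use cM in simp)
    then have "det M \<noteq> 0" using ab(2) c(2) by (auto simp: ok_def minor_mult)
    then have "G a' b' p' = G a b p"
      using inv[unfolded pair_invariant_def, rule_format, of a b c \<alpha> \<delta> \<beta> \<gamma> a' b' M p' p] n c(2) D a' b' cM
      by (simp add: near_config_def)
    then show ?thesis by (simp add: h_def ab(1))
  qed
  define S :: "((complex^'n^'n) \<times> (complex^'n^'n) \<times> (complex^'n^3)) set" where "S = forms \<times> forms \<times> UNIV"
  define F where "F = {(A, B, p). A \<in> forms \<and> B \<in> forms \<and> nonsingular_pencil (form_span A B) \<and> forms_independent A B \<and>
          vec.dim (vec.span (rows p)) = 3 \<and> pair_class (form_span A B) (vec.span (rows (p :: complex^'n^3))) \<in> U}"
  let ?h = "\<lambda>(A, B, p). h (pair_class (form_span A B) (vec.span (rows p)))"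
  have chart: "cdiff sc3 S ?h u0 \<and> eventually (\<lambda>u. u \<in> S \<longrightarrow> u \<in> F) (nhds u0)" if "u0 \<in> F" for u0
  proof -
    obtain A0 B0 p0 where u0: "u0 = (A0, B0, p0)" and AB: "A0 \<in> forms" "B0 \<in> forms"
      and cl: "pair_class (form_span A0 B0) (vec.span (rows p0)) \<in> U"
      using \<open>u0 \<in> F\<close> by (auto simp: F_def)
    obtain a b p where ab: "ok a b p" "pair_class (form_span A0 B0) (vec.span (rows p0)) = cls a b p"
      using cl by (auto simp: U_def)
    obtain T0 where T0: "invertible T0" "Pen a b = pull T0 ` form_span A0 B0"
        "vec.span (rows p) = {w. T0 *v w \<in> vec.span (rows p0)}"
      by (rule pair_class_eqD[OF ab(2)[unfolded cls_def]]) (rule that)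
    have n: "near_config \<epsilon> a0 b0 a b" using ab(1) by (simp add: ok_def)
    obtain T2 :: "(complex^'n^'n) \<times> (complex^'n^'n) \<Rightarrow> complex^'n^'n" and a2 b2 where T20: "T2 (A0, B0) = T0"
      and Td2: "\<And>i j. cdiff sc2 UNIV (\<lambda>u. T2 u $ i $ j) (A0, B0)"
      and ad2: "\<And>k. cdiff sc2 UNIV (\<lambda>u. a2 u k) (A0, B0)" and bd2: "\<And>k. cdiff sc2 UNIV (\<lambda>u. b2 u k) (A0, B0)"
      and sep: "separated (a2 (A0, B0)) (b2 (A0, B0))"
      and ev: "eventually (\<lambda>u. invertible (T2 u) \<and> near_config \<epsilon> a0 b0 (a2 u) (b2 u) \<and> (fst u \<in> forms \<longrightarrow> snd u \<in> forms \<longrightarrow>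
       pull (T2 u) (fst u) = diagm (a2 u) \<and> pull (T2 u) (snd u) = diagm (b2 u))) (nhds (A0, B0))"
      by (rule local_chart[OF T0(2)[symmetric] n c T0(1)]) (rule that)
    define L :: "(complex^'n^'n) \<times> (complex^'n^'n) \<times> (complex^'n^3) \<Rightarrow> (complex^'n^'n) \<times> (complex^'n^'n)"
      where "L u = (fst u, fst (snd u))" for u
    have Lbl: "bounded_linear L" unfolding L_def
      by (intro bounded_linear_Pair bounded_linear_compose[OF bounded_linear_fst] bounded_linear_fst bounded_linear_snd)
    have Lu0: "L u0 = (A0, B0)" by (simp add: L_def u0)
    have lift: "cdiff sc3 UNIV (\<lambda>u. f (L u)) u0" if "cdiff sc2 UNIV f (A0, B0)" for f
    proof (rule cdiff_compose_linear[where sc' = sc2 and S' = UNIV])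
      show "cdiff sc2 UNIV f (L u0)" unfolding Lu0 by (rule that)
      show "L (sc3 c h) = sc2 c (L h)" for c h by (cases h) (simp add: L_def)
    qed (simp_all add: Lbl)
    define a1 where "a1 u = a2 (L u)" for u
    define b1 where "b1 u = b2 (L u)" for u
    define T where "T u = T2 (L u)" for u
    have ad: "cdiff sc3 UNIV (\<lambda>u. a1 u k) u0" and bd: "cdiff sc3 UNIV (\<lambda>u. b1 u k) u0" for k
      unfolding a1_def b1_def by (rule lift[OF ad2], rule lift[OF bd2])
    have Td: "cdiff sc3 UNIV (\<lambda>u. T u $ i $ j) u0" for i j
      unfolding T_def by (rule lift[OF Td2])
    have sep1: "separated (a1 u0) (b1 u0)" using sep by (simp add: a1_def b1_def Lu0)
    obtain s where s: "\<And>k. s * a1 u0 k + b1 u0 k \<noteq> 0"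
      using exists_nonvanishing_comb[of "a1 u0" "b1 u0"] separated_nonzero[OF sep1 c] by blast
    \<comment> \<open>The rows of \<open>p1\<close> are the rows of the given basis multiplied by the inverse of \<open>T\<close>.  If \<open>C = s A + B\<close>
       is nondegenerate and \<open>D\<close> is the diagonal matrix \<open>T\<^sup>TCT\<close>, then this inverse is \<open>D\<^sup>-\<^sup>1 T\<^sup>T C\<close>,
       which is visibly holomorphic.\<close>
    define p1 where "p1 u = (\<chi> m k. (\<Sum>i\<in>UNIV. \<Sum>l\<in>UNIV. T u $ i $ k * (s * fst u $ i $ l + fst (snd u) $ i $ l) * snd (snd u) $ m $ l)
       / (s * a1 u k + b1 u k))" for u
    have pd: "cdiff sc3 UNIV (\<lambda>u. p1 u $ m $ k) u0" for m k
      unfolding p1_def vec_lambda_beta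
      by (intro cdiff_divide cdiff_sum cdiff_mult cdiff_add cdiff_const Td ad bd s) (simp_all add: u0 cdiff_triple)
    have "filterlim L (nhds (L u0)) (nhds u0)"
      using linear_continuous_at[OF Lbl] by (simp add: isCont_def tendsto_at_iff_tendsto_nhds)
    from this[unfolded filterlim_iff Lu0, rule_format, OF ev] have ev1: "eventually (\<lambda>u. invertible (T u) \<and> near_config \<epsilon> a0 b0 (a1 u) (b1 u) \<and> (fst u \<in> forms \<longrightarrow> fst (snd u) \<in> forms \<longrightarrow>
       pull (T u) (fst u) = diagm (a1 u) \<and> pull (T u) (fst (snd u)) = diagm (b1 u))) (nhds u0)"
      by (simp add: L_def T_def a1_def b1_def)
    have "eventually (\<lambda>u. s * a1 u k + b1 u k \<noteq> 0) (nhds u0)" for k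
    proof (rule tendsto_imp_eventually_ne)
      show "((\<lambda>u. s * a1 u k + b1 u k) \<longlongrightarrow> s * a1 u0 k + b1 u0 k) (nhds u0)"
        by (intro cdiff_tendsto_nhds[of sc3] cdiff_add cdiff_mult cdiff_const ad bd)
    qed (rule s)
    then have ev2: "eventually (\<lambda>u. \<forall>k. s * a1 u k + b1 u k \<noteq> 0) (nhds u0)"
      by (rule eventually_all_finite_type)
    have p1_row: "T u *v (p1 u $ m) = snd (snd u) $ m"
      if "invertible (T u)" "pull (T u) (fst u) = diagm (a1 u)" "pull (T u) (fst (snd u)) = diagm (b1 u)"
        "\<forall>k. s * a1 u k + b1 u k \<noteq> 0" for u m
    proof -
      define C where "C = mscale s (fst u) + mscale 1 (fst (snd u))"
      have pC: "pull (T u) C = diagm (\<lambda>k. s * a1 u k + b1 u k)"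
        by (simp add: C_def pull_comb that(2,3) diagm_comb)
      have "invertible (T u)" by (rule that(1))
      then obtain T' where T': "T u ** T' = mat 1" by (auto simp: invertible_def)
      define z where "z = T' *v (snd (snd u) $ m)"
      have Tz: "T u *v z = snd (snd u) $ m" by (simp add: z_def matrix_vector_mul_assoc T')
      have "pull (T u) C *v z = (C *v (T u *v z)) v* T u"
        by (simp add: pull_def matrix_vector_mul_assoc[symmetric] matrix_mul_assoc[symmetric])
      then have "(diagm (\<lambda>k. s * a1 u k + b1 u k) *v z) $ k = ((C *v (snd (snd u) $ m)) v* T u) $ k" for k
        by (simp add: pC Tz)
      moreover have "((C *v (snd (snd u) $ m)) v* T u) $ k = (s * a1 u k + b1 u k) * p1 u $ m $ k" for k
      proof -
        have "((C *v (snd (snd u) $ m)) v* T u) $ k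
            = (\<Sum>i\<in>UNIV. \<Sum>l\<in>UNIV. T u $ i $ k * (s * fst u $ i $ l + fst (snd u) $ i $ l) * snd (snd u) $ m $ l)"
          by (simp add: vector_matrix_component matrix_vector_mult_def C_def sum_distrib_left mult_ac)
        then show ?thesis using that(4) by (simp add: p1_def)
      qed
      ultimately have "(s * a1 u k + b1 u k) * z $ k = (s * a1 u k + b1 u k) * p1 u $ m $ k" for k
        by (simp add: diagm_vec)
      then have "z = p1 u $ m" using that(4) by (simp add: vec_eq_iff)
      then show ?thesis using Tz by simp
    qed
    note base = eventually_nhds_x_imp_x[OF ev1] eventually_nhds_x_imp_x[OF ev2]
    have T0u: "T u0 = T0" by (simp add: T_def Lu0 T20)
    have row0: "T0 *v (p1 u0 $ m) = p0 $ m" for m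
      using p1_row[of u0 m] base AB by (simp add: u0[symmetric] T0u) (simp add: u0)
    have "vec.span (rows p) = vec.span (rows (p1 u0))"
      using T0(3) transport_span_rows[OF T0(1) row0] by simp
    moreover have "p $ m \<in> vec.span (rows p)" for m by (rule vec.span_base) (auto simp: rows_def row_def)
    ultimately have "\<exists>y. p $ m = y v* p1 u0" for m by (auto simp: span_rows)
    then obtain y where y: "\<And>m. p $ m = y m v* p1 u0" by metis
    have "p = (\<chi> m. y m) ** p1 u0"
      by (simp add: vec_eq_iff y vector_matrix_component matrix_matrix_mult_def)
    then have "minor p l0 j0 k0 = det (\<chi> m. y m) * minor (p1 u0) l0 j0 k0" by (metis minor_mult)
    then have mn0: "minor (p1 u0) l0 j0 k0 \<noteq> 0" using ab(1) by (auto simp: ok_def)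
    have ev3: "eventually (\<lambda>u. minor (p1 u) l0 j0 k0 \<noteq> 0) (nhds u0)"
      by (rule tendsto_imp_eventually_ne[OF cdiff_tendsto_nhds[of sc3, OF cdiff_minor[OF pd]] mn0])
    have ev4: "eventually (\<lambda>u. u \<in> S \<longrightarrow> u \<in> F \<and> ?h u = G (a1 u) (b1 u) (p1 u)) (nhds u0)"
      using ev1 ev2 ev3
    proof eventually_elim
      case (elim u)
      show ?case
      proof
        assume "u \<in> S"
        then obtain A B q where u: "u = (A, B, q)" and f: "A \<in> forms" "B \<in> forms" by (auto simp: S_def)
        have inv: "invertible (T u)" and n: "near_config \<epsilon> a0 b0 (a1 u) (b1 u)"
          and p: "pull (T u) A = diagm (a1 u)" "pull (T u) B = diagm (b1 u)"
          using elim(1) f by (auto simp: u)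
        have r: "T u *v (p1 u $ m) = q $ m" for m
          using p1_row[of u m] inv p elim(2) by (simp add: u)
        have sp: "separated (a1 u) (b1 u)" using n by (simp add: near_config_def)
        have ns: "nonsingular_pencil (form_span A B)" "forms_independent A B"
          using diagonalizable_nonsingular[OF inv p sp c] by blast+
        have "y = 0" if "y v* q = 0" for y
        proof -
          have "T u *v (y v* p1 u) = 0" using mat_vec_rowcomb[OF r] that by simp
          moreover obtain T' where "T' ** T u = mat 1" using inv by (auto simp: invertible_def)
          ultimately have "y v* p1 u = 0" by (metis matrix_vector_mul_assoc matrix_vector_mul_lid matrix_vector_mult_0_right)
          then show "y = 0" using minor_nonzero_independent elim(3) by blast
        qed
        then have dim: "vec.dim (vec.span (rows q)) = 3" by (rule dim_span_rows)
        have "pair_class (form_span A B) (vec.span (rows q)) = pair_class (pull (T u) ` form_span A B) {w. T u *v w \<in> vec.span (rows q)}"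
          by (rule pair_class_pull[OF inv, symmetric])
        also have "\<dots> = cls (a1 u) (b1 u) (p1 u)"
          by (simp add: cls_def pull_form_span p transport_span_rows[OF inv r])
        finally have cl: "pair_class (form_span A B) (vec.span (rows q)) = cls (a1 u) (b1 u) (p1 u)" .
        have ok: "ok (a1 u) (b1 u) (p1 u)" using n elim(3) by (simp add: ok_def)
        have "cls (a1 u) (b1 u) (p1 u) \<in> U" using ok unfolding U_def by blast
        then have "(A, B, q) \<in> F" using f ns dim cl by (simp add: F_def)
        moreover have "?h (A, B, q) = G (a1 u) (b1 u) (p1 u)" using hU[OF ok] cl by simp
        ultimately show "u \<in> F \<and> ?h u = G (a1 u) (b1 u) (p1 u)" unfolding u by blast
      qed
    qed
    have u0S: "u0 \<in> S" by (simp add: S_def u0 AB)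
    have 1: "cdiff sc3 S (\<lambda>u. G (a1 u) (b1 u) (p1 u)) u0"
      by (rule cdiff_subset[of _ UNIV]) (rule reg[unfolded pair_regular_def, rule_format, OF ad bd pd sep1 mn0], simp)
    have "cdiff sc3 S ?h u0"
    proof (rule cdiff_transform_eventually[OF 1 _ _ u0S])
      show "eventually (\<lambda>u. G (a1 u) (b1 u) (p1 u) = ?h u) (at u0 within S)"
        using ev4 unfolding eventually_at_filter by eventually_elim auto
      show "G (a1 u0) (b1 u0) (p1 u0) = ?h u0"
        using eventually_nhds_x_imp_x[OF ev4] u0S by auto
    qed
    moreover have "eventually (\<lambda>u. u \<in> S \<longrightarrow> u \<in> F) (nhds u0)"
      using ev4 by eventually_elim auto
    ultimately show ?thesis by blast
  qed
  have "U \<subseteq> refined_MPQ"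
  proof
    fix C assume "C \<in> U"
    then obtain a b p where C: "C = cls a b p" "near_config \<epsilon> a0 b0 a b" "minor p l0 j0 k0 \<noteq> 0"
      by (auto simp: U_def ok_def)
    have "vec.dim (vec.span (rows p)) = 3"
      by (rule dim_span_rows) (rule minor_nonzero_independent[OF C(3)])
    moreover have "nonsingular_pencil (Pen a b)"
      using diagm_nonsingular[OF _ c] C(2) by (auto simp: near_config_def)
    ultimately show "C \<in> refined_MPQ" unfolding refined_MPQ_def C(1) cls_def
      using vec.subspace_span by blast
  qed
  moreover have "openin (top_of_set S) F"
    by (rule openin_if_eventually) (use chart in \<open>auto simp: F_def S_def\<close>)
  ultimately have "refined_MPQ_holo h U"
    unfolding refined_MPQ_holo_def holo_on_open_def F_def[symmetric] S_def[symmetric] using chart by (auto simp: cdiff_def)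
  then show thesis using that[of \<epsilon> h U] e(1) hU unfolding U_def ok_def cls_def by blast
qed

section \<open>Frames of the tangent space\<close>

lemma bil_add_left: "bil S (u + u') v = bil S u v + bil S u' v"
  by (simp add: bil_def sum.distrib algebra_simps)

lemma bil_add_right: "bil S u (v + v') = bil S u v + bil S u v'"
  by (simp add: bil_def sum.distrib matrix_vector_right_distrib algebra_simps)

lemma bil_scale_left: "bil S (c *s u) v = c * bil S u v"
  by (simp add: bil_def sum_distrib_left mult_ac)

lemma bil_scale_right: "bil S u (c *s v) = c * bil S u v"
  by (simp add: bil_def sum_distrib_left vector_scalar_commute mult_ac)

lemma bil_axis: "bil S (axis i 1) (axis j 1) = S $ i $ j"
proof -
  have "bil S (axis i 1) (axis j 1) = (\<Sum>l\<in>UNIV. if l = i then S $ i $ j else 0)"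
    unfolding bil_def mat_vec_axis by (rule sum.cong) (auto simp: axis_def column_def)
  then show ?thesis by simp
qed

lemma bil_eq_imp_eq: assumes "\<And>u v. bil S u v = bil S' u v" shows "S = S'"
  using assms[of "axis _ 1" "axis _ 1"] unfolding bil_axis by (simp add: vec_eq_iff)

lemma bil_commute: assumes "S \<in> forms" shows "bil S u v = bil S v u"
proof -
  have s: "S $ i $ j = S $ j $ i" for i j
    using assms by (metis (mono_tags) forms_def mem_Collect_eq transpose_def vec_lambda_beta)
  have "bil S u v = (\<Sum>i\<in>UNIV. \<Sum>j\<in>UNIV. u $ i * S $ i $ j * v $ j)"
    by (simp add: bil_def matrix_vector_mult_def sum_distrib_left mult_ac)
  also have "\<dots> = (\<Sum>j\<in>UNIV. \<Sum>i\<in>UNIV. u $ i * S $ i $ j * v $ j)" by (rule sum.swap)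
  also have "\<dots> = bil S v u"
    unfolding bil_def matrix_vector_mult_def sum_distrib_left vec_lambda_beta
    by (intro sum.cong refl) (subst s, simp)
  finally show ?thesis .
qed

lemma perp_add: "u \<in> perp A B x \<Longrightarrow> v \<in> perp A B x \<Longrightarrow> u + v \<in> perp A B x"
  by (simp add: perp_def bil_add_right)

lemma perp_scale: "u \<in> perp A B x \<Longrightarrow> c *s u \<in> perp A B x"
  by (simp add: perp_def bil_scale_right)

lemma tangent_frame_in_perp:
  assumes "tangent_frame A B x E" shows "E *v w \<in> perp A B x"
  using bij_betw_apply[OF assms[unfolded tangent_frame_def], of "(w, 0)"] by simp

lemma tangent_frame_decompose:
  assumes "tangent_frame A B x E" "v \<in> perp A B x" obtains y c where "v = E *v y + c *s x"
proof -
  have "v \<in> range (\<lambda>(w, c). E *v w + c *s x)"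
    using assms bij_betw_imp_surj_on unfolding tangent_frame_def by blast
  then show ?thesis using that by auto
qed

lemma tangent_frame_inj:
  assumes "tangent_frame A B x E" "E *v y + c *s x = E *v y' + c' *s x" shows "y = y' \<and> c = c'"
proof -
  have "inj (\<lambda>(w, c). E *v w + c *s x)" using assms(1) bij_betw_imp_inj_on unfolding tangent_frame_def by blast
  from injD[OF this, of "(y, c)" "(y', c')"] show ?thesis using assms(2) by simp
qed

text \<open>Two frames agree modulo \<open>x\<close> up to a linear automorphism of the model space.\<close>

lemma tangent_frame_change:
  fixes E E' :: "complex^'n^'v"
  assumes E: "tangent_frame A B x E" and E': "tangent_frame A B x E'"
  obtains T c where "invertible T" "\<And>w. E' *v w = E *v (T *v w) + (\<Sum>k\<in>UNIV. c k * w $ k) *s x"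
proof -
  have "\<exists>y c. E' *v axis k 1 = E *v y + c *s x" for k
    using tangent_frame_decompose[OF E tangent_frame_in_perp[OF E']] by metis
  then obtain y c where yc: "\<And>k. E' *v axis k 1 = E *v y k + c k *s x" by metis
  define T where "T = (\<chi> j k. y k $ j)"
  have ent: "E' $ i $ k = (\<Sum>j\<in>UNIV. E $ i $ j * y k $ j) + c k * x $ i" for i k
    using arg_cong[OF yc[of k, unfolded mat_vec_axis], of "\<lambda>v. v $ i"] by (simp add: column_def matrix_vector_mult_def)
  have eq: "E' *v w = E *v (T *v w) + (\<Sum>k\<in>UNIV. c k * w $ k) *s x" for w
  proof -
    have "(\<Sum>k\<in>UNIV. E' $ i $ k * w $ k) = (\<Sum>j\<in>UNIV. E $ i $ j * (\<Sum>k\<in>UNIV. y k $ j * w $ k)) + (\<Sum>k\<in>UNIV. c k * w $ k) * x $ i" for i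
    proof -
      have "(\<Sum>k\<in>UNIV. E' $ i $ k * w $ k) = (\<Sum>k\<in>UNIV. \<Sum>j\<in>UNIV. E $ i $ j * (y k $ j * w $ k)) + (\<Sum>k\<in>UNIV. c k * w $ k) * x $ i"
      proof -
        have "E' $ i $ k * w $ k = (\<Sum>j\<in>UNIV. E $ i $ j * (y k $ j * w $ k)) + c k * w $ k * x $ i" for k
          unfolding ent distrib_right sum_distrib_right by (simp add: mult.assoc mult.commute[of "x $ i"])
        then show ?thesis by (simp add: sum.distrib sum_distrib_right)
      qed
      also have "(\<Sum>k\<in>UNIV. \<Sum>j\<in>UNIV. E $ i $ j * (y k $ j * w $ k)) = (\<Sum>j\<in>UNIV. \<Sum>k\<in>UNIV. E $ i $ j * (y k $ j * w $ k))"
        by (rule sum.swap)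
      finally show ?thesis by (simp add: sum_distrib_left)
    qed
    then show ?thesis by (simp add: vec_eq_iff matrix_vector_mult_def T_def)
  qed
  have "w = 0" if "T *v w = 0" for w
  proof -
    have "E' *v w + 0 *s x = E' *v 0 + (\<Sum>k\<in>UNIV. c k * w $ k) *s x" using eq[of w] that by simp
    then show ?thesis using tangent_frame_inj[OF E'] by blast
  qed
  then have "\<exists>T'. T' ** T = mat 1" by (simp add: matrix_left_invertible_ker)
  then have "invertible T" by (simp add: invertible_left_inverse)
  then show ?thesis using eq that by blast
qed

lemma tangent_frame_compose:
  assumes E: "tangent_frame A B x E" and T: "invertible T" shows "tangent_frame A B x (E ** T)"
proof -
  obtain T' where T': "T ** T' = mat 1" "T' ** T = mat 1" using T by (auto simp: invertible_def)
  have "bij (\<lambda>(w, c). (T *v w, c :: complex))"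
    by (rule o_bij[of "\<lambda>(w, c). (T' *v w, c)"]) (auto simp: fun_eq_iff matrix_vector_mul_assoc T')
  from bij_betw_trans[OF this E[unfolded tangent_frame_def]]
  show ?thesis unfolding tangent_frame_def
    by (simp add: o_def case_prod_unfold matrix_vector_mul_assoc)
qed

text \<open>Multiples of \<open>x\<close> do not contribute, as \<open>x\<close> is isotropic and orthogonal to the tangent space.\<close>

lemma pull_tangent_frame_change:
  assumes S: "S \<in> forms" "bil S x x = 0" "\<And>w. bil S x (E *v (T *v w)) = 0"
    and e: "\<And>w. E' *v w = E *v (T *v w) + c w *s x"
  shows "pull E' S = pull T (pull E S)"
proof (rule bil_eq_imp_eq)
  fix u v
  have "bil S (E *v (T *v w)) x = 0" for w using S bil_commute by metis
  then show "bil (pull E' S) u v = bil (pull T (pull E S)) u v"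
    by (simp add: bil_pull e bil_add_left bil_add_right bil_scale_left bil_scale_right S)
qed

lemma moduli_map_eq:
  fixes E :: "complex^'n^'v"
  assumes f: "A \<in> forms" "B \<in> forms" and x: "quad A x = 0" "quad B x = 0" and E: "tangent_frame A B x E"
  shows "moduli_map A B x = pencil_class (II A B E)"
proof
  have p: "bil A x (E *v w) = 0" "bil B x (E *v w) = 0" for w
    using tangent_frame_in_perp[OF E] by (auto simp: perp_def)
  show "moduli_map A B x \<subseteq> pencil_class (II A B E)"
  proof
    fix \<Phi> :: "(complex^'n^'n) set" assume "\<Phi> \<in> moduli_map A B x"
    then obtain E' :: "complex^'n^'v" where E': "tangent_frame A B x E'" "\<Phi> = II A B E'" by (auto simp: moduli_map_def)
    obtain T c where T: "invertible T" and e: "\<And>w. E' *v w = E *v (T *v w) + (\<Sum>k\<in>UNIV. c k * w $ k) *s x"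
      using tangent_frame_change[OF E E'(1)] by metis
    have "pull E' A = pull T (pull E A)" "pull E' B = pull T (pull E B)"
      by (rule pull_tangent_frame_change[OF _ _ _ e]; use f x p in \<open>simp add: quad_def\<close>)+
    then have "\<Phi> = pull T ` II A B E" by (simp add: E'(2) II_def pull_form_span)
    then show "\<Phi> \<in> pencil_class (II A B E)" using T by (auto simp: pencil_class_def)
  qed
  show "pencil_class (II A B E) \<subseteq> moduli_map A B x"
  proof
    fix \<Phi> :: "(complex^'n^'n) set" assume "\<Phi> \<in> pencil_class (II A B E)"
    then obtain T where T: "invertible T" "\<Phi> = pull T ` II A B E" by (auto simp: pencil_class_def)
    then have "\<Phi> = II A B (E ** T)" by (simp add: II_def pull_form_span pull_pull)
    then show "\<Phi> \<in> moduli_map A B x" using tangent_frame_compose[OF E T(1)] by (auto simp: moduli_map_def)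
  qed
qed

lemma refined_moduli_map_eq:
  fixes E :: "complex^'n^'v"
  assumes f: "A \<in> forms" "B \<in> forms" and x: "quad A x = 0" "quad B x = 0" and E: "tangent_frame A B x E"
    and K: "\<And>v c. v \<in> ker_moduli_map TYPE('n) X A B x \<Longrightarrow> v + c *s x \<in> ker_moduli_map TYPE('n) X A B x"
  shows "refined_moduli_map X A B x = pair_class (II A B E) {w. E *v w \<in> ker_moduli_map TYPE('n) X A B x}"
proof
  let ?K = "ker_moduli_map TYPE('n) X A B x"
  have p: "bil A x (E *v w) = 0" "bil B x (E *v w) = 0" for w
    using tangent_frame_in_perp[OF E] by (auto simp: perp_def)
  have K': "v + c *s x \<in> ?K \<longleftrightarrow> v \<in> ?K" for v c
  proof
    assume "v + c *s x \<in> ?K"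
    from K[OF this, of "- c"] show "v \<in> ?K" by (simp add: vec_eq_iff[symmetric] vec.scale_minus_left)
  qed (rule K)
  show "refined_moduli_map X A B x \<subseteq> pair_class (II A B E) {w. E *v w \<in> ?K}"
  proof
    fix z :: "(complex^'n^'n) set \<times> (complex^'n) set" assume "z \<in> refined_moduli_map X A B x"
    then obtain E' :: "complex^'n^'v" where E': "tangent_frame A B x E'" "z = (II A B E', {w. E' *v w \<in> ?K})"
      unfolding refined_moduli_map_def by blast
    obtain T c where T: "invertible T" and e: "\<And>w. E' *v w = E *v (T *v w) + (\<Sum>k\<in>UNIV. c k * w $ k) *s x"
      using tangent_frame_change[OF E E'(1)] by metis
    have "pull E' A = pull T (pull E A)" "pull E' B = pull T (pull E B)"
      by (rule pull_tangent_frame_change[OF _ _ _ e]; use f x p in \<open>simp add: quad_def\<close>)+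
    then have "II A B E' = pull T ` II A B E" by (simp add: II_def pull_form_span)
    then have "z = (pull T ` II A B E, {w. T *v w \<in> {w. E *v w \<in> ?K}})" by (simp add: E'(2) e K')
    then show "z \<in> pair_class (II A B E) {w. E *v w \<in> ?K}" using T unfolding pair_class_def by blast
  qed
  show "pair_class (II A B E) {w. E *v w \<in> ?K} \<subseteq> refined_moduli_map X A B x"
  proof
    fix z assume "z \<in> pair_class (II A B E) {w. E *v w \<in> ?K}"
    then obtain T where T: "invertible T" "z = (pull T ` II A B E, {w. T *v w \<in> {w. E *v w \<in> ?K}})"
      unfolding pair_class_def by blast
    then have "z = (II A B (E ** T), {w. (E ** T) *v w \<in> ?K})"
      by (simp add: II_def pull_form_span pull_pull matrix_vector_mul_assoc)
    then show "z \<in> refined_moduli_map X A B x" using tangent_frame_compose[OF E T(1)]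
      unfolding refined_moduli_map_def by blast
  qed
qed

section \<open>Points described by the roots of their discriminant\<close>

lemma prod_linear_monic:
  fixes S :: "complex set"
  assumes "finite S" shows "degree (\<Prod>r\<in>S. [:- r, 1:]) = card S" "coeff (\<Prod>r\<in>S. [:- r, 1:]) (card S) = 1"
proof -
  show d: "degree (\<Prod>r\<in>S. [:- r, 1:]) = card S" by (subst degree_prod_eq_sum_degree) auto
  have "lead_coeff (\<Prod>r\<in>S. [:- r, 1:]) = 1" by (simp add: lead_coeff_prod)
  then show "coeff (\<Prod>r\<in>S. [:- r, 1:]) (card S) = 1" using d by simp
qed

text \<open>The left hand side is the leading coefficient of the Lagrange interpolation polynomial of \<open>g\<close>.\<close>

lemma lagrange_leading_coeff:
  fixes S :: "complex set"
  assumes S: "finite S" and d: "degree g < card S"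
  shows "(\<Sum>s\<in>S. poly g s / (\<Prod>r\<in>S - {s}. s - r)) = coeff g (card S - 1)"
proof -
  define P where "P s = (\<Prod>r\<in>S - {s}. [:- r, 1:])" for s
  define c where "c s = poly g s / (\<Prod>r\<in>S - {s}. s - r)" for s
  define H where "H = (\<Sum>s\<in>S. smult (c s) (P s))"
  have cd: "card (S - {s}) = card S - 1" if "s \<in> S" for s using that S by simp
  have dP: "degree (P s) = card S - 1" "coeff (P s) (card S - 1) = 1" if "s \<in> S" for s
    using prod_linear_monic[of "S - {s}"] S cd[OF that] by (auto simp: P_def)
  have "poly H s = poly g s" if s: "s \<in> S" for s
  proof -
    have "poly H s = (\<Sum>r\<in>S. if r = s then c s * poly (P s) s else 0)"
      unfolding H_def poly_sum poly_smult
    proof (rule sum.cong[OF refl])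
      fix r assume "r \<in> S"
      show "c r * poly (P r) s = (if r = s then c s * poly (P s) s else 0)"
        using s S by (auto simp: P_def poly_prod)
    qed
    also have "\<dots> = c s * (\<Prod>r\<in>S - {s}. s - r)" using s S by (simp add: P_def poly_prod)
    also have "\<dots> = poly g s" using S by (simp add: c_def)
    finally show ?thesis .
  qed
  moreover have "degree H \<le> card S - 1" unfolding H_def
    by (rule degree_sum_le[OF S]) (use dP degree_smult_le in \<open>metis order_trans order_refl\<close>)
  ultimately have "H = g" using d by (intro poly_eqI_degree[of S]) auto
  moreover have "coeff H (card S - 1) = (\<Sum>s\<in>S. c s)"
    unfolding H_def coeff_sum coeff_smult by (rule sum.cong) (simp_all only: dP mult_1_right)
  ultimately show ?thesis by (simp add: c_def)
qed

lemma lagrange_sum_zero: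
  fixes S :: "complex set"
  assumes "finite S" "degree g + 2 \<le> card S"
  shows "(\<Sum>s\<in>S. poly g s / (\<Prod>r\<in>S - {s}. s - r)) = 0"
  using lagrange_leading_coeff[of S g] assms by (simp add: coeff_eq_0)

text \<open>The coefficients of the first form in diagonal coordinates; the second form has coefficients \<open>1\<close>.  The
  parameter \<open>N\<close> only fixes the type of the indices of the roots.\<close>

locale quadric_pencil =
  fixes lam :: "'v::finite \<Rightarrow> complex" and N :: "'n::finite itself"
  assumes inj_lam: "inj lam" and card_v: "CARD('v) = CARD('n) + 3" and card_n: "CARD('n) > 4"
begin

text \<open>The derivative at \<open>lam\<^sub>i\<close> of the product of all \<open>s - lam\<^sub>j\<close>.\<close>

definition L :: "'v \<Rightarrow> complex" where "L i = (\<Prod>j\<in>UNIV - {i}. lam i - lam j)"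

lemma L_nonzero: "L i \<noteq> 0" using inj_lam by (auto simp: L_def inj_eq)

lemma lagrange_lam_leading:
  assumes "degree g < CARD('v)" shows "(\<Sum>i\<in>UNIV. poly g (lam i) / L i) = coeff g (CARD('v) - 1)"
proof -
  have e: "(\<Prod>r\<in>range lam - {lam i}. lam i - r) = L i" for i
  proof -
    have "range lam - {lam i} = lam ` (UNIV - {i})" using inj_lam by (auto simp: inj_eq)
    then show ?thesis using inj_lam by (simp add: L_def prod.reindex inj_on_subset)
  qed
  have "(\<Sum>s\<in>range lam. poly g s / (\<Prod>r\<in>range lam - {s}. s - r)) = coeff g (card (range lam) - 1)"
    by (rule lagrange_leading_coeff) (use assms inj_lam in \<open>simp_all add: card_image\<close>)
  then show ?thesis using inj_lam by (simp add: sum.reindex e card_image)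
qed

lemma lagrange_lam:
  assumes "degree g + 2 \<le> CARD('v)" shows "(\<Sum>i\<in>UNIV. poly g (lam i) / L i) = 0"
  using lagrange_lam_leading[of g] assms by (simp add: coeff_eq_0)

text \<open>Interpolation at the \<open>lam\<^sub>i\<close> and the additional node \<open>s\<close>.\<close>

lemma lagrange_lam_extra:
  assumes "degree g + 1 \<le> CARD('v)" and s: "\<And>i. s \<noteq> lam i"
  shows "(\<Sum>i\<in>UNIV. poly g (lam i) / (L i * (lam i - s))) = - poly g s / (\<Prod>i\<in>UNIV. s - lam i)"
proof -
  let ?S = "insert s (range lam)"
  have sn: "s \<notin> range lam" using s by auto
  have e: "(\<Prod>r\<in>?S - {lam i}. lam i - r) = L i * (lam i - s)" for i
  proof -
    have "?S - {lam i} = insert s (lam ` (UNIV - {i}))" using inj_lam s by (auto simp: inj_eq)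
    moreover have "s \<notin> lam ` (UNIV - {i})" using s by auto
    ultimately show ?thesis using inj_lam by (simp add: L_def prod.reindex inj_on_subset mult.commute)
  qed
  have "(\<Sum>r\<in>?S. poly g r / (\<Prod>q\<in>?S - {r}. r - q)) = 0"
    by (rule lagrange_sum_zero) (use assms inj_lam sn in \<open>simp_all add: card_image\<close>)
  moreover have "(\<Prod>q\<in>?S - {s}. s - q) = (\<Prod>i\<in>UNIV. s - lam i)"
    using sn inj_lam by (simp add: prod.reindex)
  ultimately have "poly g s / (\<Prod>i\<in>UNIV. s - lam i) + (\<Sum>i\<in>UNIV. poly g (lam i) / (L i * (lam i - s))) = 0"
    using sn inj_lam by (simp add: sum.reindex e)
  then show ?thesis by (simp add: add_eq_0_iff)
qed

abbreviation D1 :: "complex^'v^'v" where "D1 \<equiv> diagm lam"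
abbreviation D2 :: "complex^'v^'v" where "D2 \<equiv> diagm (\<lambda>_. 1)"

definition X :: "(complex^'v) set" where "X = {x. x \<noteq> 0 \<and> quad D1 x = 0 \<and> quad D2 x = 0}"

text \<open>The polynomial \<open>C \<Prod>\<^sub>k (s - t\<^sub>k)\<close> interpolates the values \<open>x\<^sub>i\<^sup>2 L\<^sub>i\<close> at \<open>lam\<^sub>i\<close>.\<close>

definition roots_at :: "complex^'v \<Rightarrow> ('n \<Rightarrow> complex) \<Rightarrow> complex \<Rightarrow> bool" where
  "roots_at x t C \<longleftrightarrow> inj t \<and> (\<forall>k i. t k \<noteq> lam i) \<and> C \<noteq> 0 \<and> (\<forall>i. (x $ i)\<^sup>2 * L i = C * (\<Prod>k\<in>UNIV. lam i - t k))"

text \<open>The frame diagonalizing both forms.  Its \<open>k\<close>-th column is the solution \<open>w\<close> of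
  \<open>(D\<^sub>1 - t\<^sub>k D\<^sub>2) w = x\<close>, so that it is orthogonal to everything in the tangent space for the
  \<open>k\<close>-th degenerate element of the pencil.\<close>

definition W :: "complex^'v \<Rightarrow> ('n \<Rightarrow> complex) \<Rightarrow> complex^'n^'v" where
  "W x t = (\<chi> i k. x $ i / (lam i - t k))"

text \<open>The value of the second form at the \<open>k\<close>-th vector of the frame.\<close>

definition frame_norm :: "complex^'v \<Rightarrow> ('n \<Rightarrow> complex) \<Rightarrow> 'n \<Rightarrow> complex" where
  "frame_norm x t k = (\<Sum>i\<in>UNIV. (x $ i)\<^sup>2 / (lam i - t k)\<^sup>2)"

lemma perp_D: "v \<in> perp D1 D2 y \<longleftrightarrow> (\<Sum>i\<in>UNIV. lam i * y $ i * v $ i) = 0 \<and> (\<Sum>i\<in>UNIV. y $ i * v $ i) = 0"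
  by (simp add: perp_def bil_diagm)

lemma roots_at_nonzero: assumes "roots_at x t C" shows "x $ i \<noteq> 0"
proof
  assume "x $ i = 0"
  moreover have "(x $ i)\<^sup>2 * L i = C * (\<Prod>k\<in>UNIV. lam i - t k)" using assms unfolding roots_at_def by blast
  ultimately have "C * (\<Prod>k\<in>UNIV. lam i - t k) = 0" by simp
  moreover have "lam i - t k \<noteq> 0" for k
  proof -
    have "t k \<noteq> lam i" using assms unfolding roots_at_def by blast
    then show ?thesis by auto
  qed
  moreover have "C \<noteq> 0" using assms unfolding roots_at_def by blast
  ultimately show False by simp
qed

context
  fixes x t C assumes rt: "roots_at x t C"
begin

lemma sq_eq: "(x $ i)\<^sup>2 = C * (\<Prod>k\<in>UNIV. lam i - t k) / L i"
  using rt L_nonzero[of i] by (simp add: roots_at_def field_simps)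

lemma lam_t: "lam i - t k \<noteq> 0" "t k - lam i \<noteq> 0"
proof -
  have "t k \<noteq> lam i" using rt unfolding roots_at_def by blast
  then show "lam i - t k \<noteq> 0" "t k - lam i \<noteq> 0" by auto
qed

lemma t_diff: "j \<noteq> k \<Longrightarrow> t j - t k \<noteq> 0"
  using rt by (auto simp: roots_at_def inj_eq)

text \<open>The degree of \<open>C \<Prod>\<^sub>k (s - t\<^sub>k)\<close> is small enough for the interpolation sums of this polynomial and of
  its product with \<open>s\<close> to vanish; these are the equations of the quadrics.\<close>

lemma sum_sq: "(\<Sum>i\<in>UNIV. (x $ i)\<^sup>2) = 0" "(\<Sum>i\<in>UNIV. lam i * (x $ i)\<^sup>2) = 0"
proof -
  let ?G = "(\<Prod>k\<in>UNIV. [:- t k, 1:])"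
  have dG: "degree ?G = CARD('n)" by (subst degree_prod_eq_sum_degree) auto
  have "(\<Sum>i\<in>UNIV. poly (smult C ?G) (lam i) / L i) = 0"
    by (rule lagrange_lam) (use dG degree_smult_le[of C ?G] card_v in simp)
  then show "(\<Sum>i\<in>UNIV. (x $ i)\<^sup>2) = 0" by (simp add: sq_eq poly_prod)
  have "degree ([:0, 1:] * smult C ?G) \<le> 1 + CARD('n)"
    using degree_mult_le[of "[:0, 1:]" "smult C ?G"] degree_smult_le[of C ?G] dG by simp
  then have "(\<Sum>i\<in>UNIV. poly ([:0, 1:] * smult C ?G) (lam i) / L i) = 0"
    by (intro lagrange_lam) (use card_v in simp)
  then show "(\<Sum>i\<in>UNIV. lam i * (x $ i)\<^sup>2) = 0" by (simp add: sq_eq poly_prod mult_ac)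
qed

lemma sq_div: "(x $ i)\<^sup>2 / (lam i - t k) = C * (\<Prod>j\<in>UNIV - {k}. lam i - t j) / L i"
proof -
  have "(\<Prod>j\<in>UNIV. lam i - t j) = (lam i - t k) * (\<Prod>j\<in>UNIV - {k}. lam i - t j)"
    by (rule prod.remove) auto
  then show ?thesis using lam_t by (simp add: sq_eq)
qed

lemma sum_sq_div: "(\<Sum>i\<in>UNIV. (x $ i)\<^sup>2 / (lam i - t k)) = 0"
proof -
  let ?G = "(\<Prod>j\<in>UNIV - {k}. [:- t j, 1:])"
  have dG: "degree ?G = CARD('n) - 1" by (subst degree_prod_eq_sum_degree) auto
  have "(\<Sum>i\<in>UNIV. poly (smult C ?G) (lam i) / L i) = 0"
    by (rule lagrange_lam) (use dG degree_smult_le[of C ?G] card_v in simp)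
  then show ?thesis by (simp add: sq_div poly_prod)
qed

lemma frame_norm_eq: "frame_norm x t k = - C * (\<Prod>j\<in>UNIV - {k}. t k - t j) / (\<Prod>i\<in>UNIV. t k - lam i)"
proof -
  let ?G = "(\<Prod>j\<in>UNIV - {k}. [:- t j, 1:])"
  have dG: "degree ?G = CARD('n) - 1" by (subst degree_prod_eq_sum_degree) auto
  have "(\<Sum>i\<in>UNIV. poly (smult C ?G) (lam i) / (L i * (lam i - t k))) = - poly (smult C ?G) (t k) / (\<Prod>i\<in>UNIV. t k - lam i)"
    by (rule lagrange_lam_extra) (use dG degree_smult_le[of C ?G] card_v lam_t(2)[of k] in auto)
  moreover have "(x $ i)\<^sup>2 / (lam i - t k)\<^sup>2 = poly (smult C ?G) (lam i) / (L i * (lam i - t k))" for i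
  proof -
    have "(x $ i)\<^sup>2 / (lam i - t k)\<^sup>2 = ((x $ i)\<^sup>2 / (lam i - t k)) / (lam i - t k)" by (simp add: power2_eq_square)
    then show ?thesis unfolding sq_div by (simp add: poly_prod)
  qed
  ultimately show ?thesis by (simp add: frame_norm_def poly_prod)
qed

lemma frame_norm_nonzero: "frame_norm x t k \<noteq> 0"
  unfolding frame_norm_eq using lam_t t_diff rt by (auto simp: roots_at_def)

text \<open>Orthogonality of the frame, by partial fractions.\<close>

lemma sum_sq_div2: "(\<Sum>i\<in>UNIV. (x $ i)\<^sup>2 / ((lam i - t j) * (lam i - t k))) = (if j = k then frame_norm x t k else 0)"
proof (cases "j = k")
  case False
  have "(t j - t k) * ((x $ i)\<^sup>2 / ((lam i - t j) * (lam i - t k))) = (x $ i)\<^sup>2 / (lam i - t j) - (x $ i)\<^sup>2 / (lam i - t k)" for i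
    using lam_t(1)[of i] by (simp add: field_simps)
  then have "(t j - t k) * (\<Sum>i\<in>UNIV. (x $ i)\<^sup>2 / ((lam i - t j) * (lam i - t k))) = 0"
    by (simp add: sum_distrib_left sum_subtractf sum_sq_div)
  then show ?thesis using t_diff False by simp
qed (simp add: frame_norm_def power2_eq_square)

lemma pull_W_D2: "pull (W x t) D2 = diagm (frame_norm x t)"
proof -
  have "pull (W x t) D2 $ j $ k = (\<Sum>i\<in>UNIV. (x $ i)\<^sup>2 / ((lam i - t j) * (lam i - t k)))" for j k
    by (simp add: pull_diagm_component W_def power2_eq_square)
  then show ?thesis by (simp add: vec_eq_iff sum_sq_div2 diagm_component)
qed

lemma pull_W_D1: "pull (W x t) D1 = diagm (\<lambda>k. t k * frame_norm x t k)"
proof -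
  have "pull (W x t) D1 $ j $ k = t k * (if j = k then frame_norm x t k else 0)" for j k
  proof -
    have e: "lam i * (x $ i / (lam i - t j)) * (x $ i / (lam i - t k)) =
       (x $ i)\<^sup>2 / (lam i - t j) + t k * ((x $ i)\<^sup>2 / ((lam i - t j) * (lam i - t k)))" for i
    proof -
      have h: "(q + s) * (y / p) * (y / q) = y\<^sup>2 / p + s * (y\<^sup>2 / (p * q))" if "p \<noteq> 0" "q \<noteq> 0" for p q s y :: complex
        using that by (simp add: field_simps power2_eq_square)
      show ?thesis using h[OF lam_t(1)[of i j] lam_t(1)[of i k], of "t k" "x $ i"] by simp
    qed
    have "pull (W x t) D1 $ j $ k = (\<Sum>i\<in>UNIV. lam i * (x $ i / (lam i - t j)) * (x $ i / (lam i - t k)))"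
      by (simp add: pull_diagm_component W_def)
    also have "\<dots> = (\<Sum>i\<in>UNIV. (x $ i)\<^sup>2 / (lam i - t j)) + t k * (\<Sum>i\<in>UNIV. (x $ i)\<^sup>2 / ((lam i - t j) * (lam i - t k)))"
      unfolding e sum.distrib sum_distrib_left ..
    finally show ?thesis by (simp add: sum_sq_div sum_sq_div2)
  qed
  then show ?thesis by (simp add: vec_eq_iff diagm_component)
qed

lemma in_X: "x \<in> X"
proof -
  have "x \<noteq> 0" using roots_at_nonzero[OF rt, of undefined] by auto
  then show ?thesis using sum_sq by (simp add: X_def quad_def bil_diagm power2_eq_square mult_ac)
qed

lemma W_vec: "(W x t *v y) $ i = (\<Sum>k\<in>UNIV. x $ i / (lam i - t k) * y $ k)"
  by (simp add: W_def matrix_vector_mult_def)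

lemma W_perp: "W x t *v y \<in> perp D1 D2 x"
proof -
  have col: "(\<Sum>i\<in>UNIV. lam i * x $ i * (x $ i / (lam i - t k))) = 0" "(\<Sum>i\<in>UNIV. x $ i * (x $ i / (lam i - t k))) = 0" for k
  proof -
    have e: "lam i * x $ i * (x $ i / (lam i - t k)) = (x $ i)\<^sup>2 + t k * ((x $ i)\<^sup>2 / (lam i - t k))" for i
      using lam_t(1)[of i] by (simp add: field_simps power2_eq_square)
    show "(\<Sum>i\<in>UNIV. lam i * x $ i * (x $ i / (lam i - t k))) = 0"
      unfolding e sum.distrib sum_distrib_left[symmetric] by (simp add: sum_sq sum_sq_div)
    show "(\<Sum>i\<in>UNIV. x $ i * (x $ i / (lam i - t k))) = 0"
      using sum_sq_div[of k] by (simp add: power2_eq_square)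
  qed
  have sw: "(\<Sum>i\<in>UNIV. f i * (W x t *v y) $ i) = (\<Sum>k\<in>UNIV. (\<Sum>i\<in>UNIV. f i * (x $ i / (lam i - t k))) * y $ k)" for f
  proof -
    have "(\<Sum>i\<in>UNIV. f i * (W x t *v y) $ i) = (\<Sum>i\<in>UNIV. \<Sum>k\<in>UNIV. f i * (x $ i / (lam i - t k)) * y $ k)"
      unfolding W_vec sum_distrib_left by (simp add: mult.assoc)
    also have "\<dots> = (\<Sum>k\<in>UNIV. \<Sum>i\<in>UNIV. f i * (x $ i / (lam i - t k)) * y $ k)" by (rule sum.swap)
    finally show ?thesis by (simp add: sum_distrib_right)
  qed
  show ?thesis unfolding perp_D by (simp only: sw col) simp
qed

lemma x_perp: "x \<in> perp D1 D2 x"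
  unfolding perp_D using sum_sq by (simp add: power2_eq_square mult_ac)

lemma W_inj: assumes "W x t *v y + c *s x = 0" shows "y = 0 \<and> c = 0"
proof -
  have "y $ k = 0" for k
  proof -
    have xk: "bil D2 (W x t *v axis k 1) x = 0"
      using W_perp[of "axis k 1"] by (simp add: perp_def bil_commute[of D2 x])
    have "bil D2 (W x t *v axis k 1) (W x t *v y + c *s x) = bil (pull (W x t) D2) (axis k 1) y"
      by (simp add: bil_add_right bil_scale_right xk bil_pull)
    also have "\<dots> = (\<Sum>i\<in>UNIV. if i = k then frame_norm x t k * y $ k else 0)"
      unfolding pull_W_D2 bil_diagm by (rule sum.cong) (auto simp: axis_def)
    finally have "frame_norm x t k * y $ k = 0" using assms by (simp add: bil_def)
    then show ?thesis using frame_norm_nonzero by simp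
  qed
  then have "y = 0" by (simp add: vec_eq_iff)
  moreover have "c = 0" using assms \<open>y = 0\<close> roots_at_nonzero[OF rt, of undefined]
    by (auto simp: vec_eq_iff)
  ultimately show ?thesis by blast
qed

text \<open>The frame and \<open>x\<close> span a space of dimension \<open>n + 1\<close>.  If a vector \<open>v\<close> of the orthogonal space were
  outside it, then adding \<open>v\<close>, a vector orthogonal to \<open>x\<close> for the second form only, and a vector not
  orthogonal to \<open>x\<close> for the second form would produce \<open>n + 4\<close> independent vectors in a space of
  dimension \<open>n + 3\<close>.\<close>

lemma W_surj: assumes v: "v \<in> perp D1 D2 x" shows "\<exists>y c. v = W x t *v y + c *s x"
proof (rule ccontr)
  assume no: "\<nexists>y c. v = W x t *v y + c *s x"
  define E :: "complex^('n option)^'v" where "E = (\<chi> i j. case j of None \<Rightarrow> x $ i | Some k \<Rightarrow> W x t $ i $ k)"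
  have E: "E *v y = W x t *v (\<chi> k. y $ Some k) + y $ None *s x" for y
  proof -
    have "(\<Sum>j\<in>UNIV. E $ i $ j * y $ j) = x $ i * y $ None + (\<Sum>k\<in>UNIV. W x t $ i $ k * y $ Some k)" for i
      unfolding UNIV_option_conv by (subst sum.insert) (auto simp: E_def sum.reindex)
    then show ?thesis by (simp add: vec_eq_iff matrix_vector_mult_def mult_ac)
  qed
  have "inj ((*v) E)"
  proof (rule injI)
    fix y y' assume "E *v y = E *v y'"
    then have "E *v (y - y') = 0" by (simp add: matrix_vector_mult_diff_distrib)
    from W_inj[OF this[unfolded E]] have e: "(\<chi> k. (y - y') $ Some k) = 0" "(y - y') $ None = 0" by auto
    have "(y - y') $ j = 0" for j
      using e by (cases j) (auto simp: vec_eq_iff)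
    then show "y = y'" by (simp add: vec_eq_iff)
  qed
  then have dim: "vec.dim (range ((*v) E)) = vec.dim (UNIV :: (complex^'n option) set)"
    by (intro vec.dim_image_eq) (auto intro: inj_on_subset)
  obtain B where B: "B \<subseteq> range ((*v) E)" "vec.independent B" "range ((*v) E) \<subseteq> vec.span B" "card B = vec.dim (range ((*v) E))"
    using vec.basis_exists by blast
  have fB: "finite B" using vec.finiteI_independent[OF B(2)] .
  have cB: "card B = CARD('n) + 1" using B(4) unfolding dim vec_dim_card by (simp add: card_option)
  have sub: "vec.subspace (range ((*v) E))"
    using vec.subspace_UNIV by (rule vec.subspace_image)
  have sB: "vec.span B = range ((*v) E)" using B(1,3) sub vec.span_minimal by blast
  have "CARD('v) > 1" using card_v by simp
  then obtain i j :: 'v where ij: "i \<noteq> j" using exists_other_index by metis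
  have "v \<notin> vec.span B" using no unfolding sB by (auto simp: E)
  then have i1: "vec.independent (insert v B)" using B(2) by (simp add: vec.independent_insert)
  have sp1: "vec.span (insert v B) \<subseteq> perp D1 D2 x"
  proof (rule vec.span_minimal)
    show "insert v B \<subseteq> perp D1 D2 x" using v B(1) by (auto simp: E intro!: perp_add W_perp perp_scale x_perp)
    show "vec.subspace (perp D1 D2 x)"
    proof -
      have "0 \<in> perp D1 D2 x" by (simp add: perp_D)
      then show ?thesis unfolding vec.subspace_def using perp_add perp_scale by blast
    qed
  qed
  \<comment> \<open>Orthogonal to \<open>x\<close> for the second form, but not for the first, as \<open>lam\<^sub>i \<noteq> lam\<^sub>j\<close>.\<close>
  define u where "u = (inverse (x $ i) *s axis i 1 - inverse (x $ j) *s axis j 1 :: complex^'v)"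
  have xi: "x $ i \<noteq> 0" "x $ j \<noteq> 0" using roots_at_nonzero[OF rt] by auto
  have us: "(\<Sum>l\<in>UNIV. f l * x $ l * u $ l) = f i - f j" for f
  proof -
    have "(\<Sum>l\<in>UNIV. f l * x $ l * u $ l) = (\<Sum>l\<in>UNIV. (if l = i then f i else 0) - (if l = j then f j else 0))"
      by (rule sum.cong) (use xi in \<open>auto simp: u_def axis_def\<close>)
    then show ?thesis by (simp add: sum_subtractf)
  qed
  have u1: "(\<Sum>l\<in>UNIV. x $ l * u $ l) = 0" using us[of "\<lambda>_. 1"] by simp
  have "u \<notin> perp D1 D2 x" unfolding perp_D us using ij inj_lam by (auto simp: inj_eq)
  then have i2: "vec.independent (insert u (insert v B))" using sp1 i1 by (subst vec.independent_insert) (simp, blast)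
  let ?H = "{w. (\<Sum>l\<in>UNIV. x $ l * w $ l) = 0}"
  have sp2: "vec.span (insert u (insert v B)) \<subseteq> ?H"
  proof (rule vec.span_minimal)
    have "insert v B \<subseteq> perp D1 D2 x" using sp1 vec.span_superset[of "insert v B"] by blast
    then have "insert v B \<subseteq> ?H" by (auto simp only: perp_D)
    then show "insert u (insert v B) \<subseteq> ?H" using u1 by auto
    show "vec.subspace ?H"
    proof -
      have "(\<Sum>l\<in>UNIV. x $ l * (c * w $ l)) = c * (\<Sum>l\<in>UNIV. x $ l * w $ l)" for c and w :: "complex^'v"
        by (simp add: sum_distrib_left mult_ac)
      then show ?thesis unfolding vec.subspace_def by (simp add: distrib_left sum.distrib)
    qed
  qed
  have "(\<Sum>l\<in>UNIV. x $ l * (axis i 1 :: complex^'v) $ l) = (\<Sum>l\<in>UNIV. if l = i then x $ i else 0)"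
    by (rule sum.cong) (auto simp: axis_def)
  then have "axis i 1 \<notin> ?H" using xi by simp
  then have i3: "vec.independent (insert (axis i 1) (insert u (insert v B)))" (is "vec.independent ?B")
    using sp2 i2 by (subst vec.independent_insert) (simp, blast)
  have "v \<notin> B" using \<open>v \<notin> vec.span B\<close> vec.span_base[of v B] by blast
  moreover have "u \<notin> insert v B" using \<open>u \<notin> perp D1 D2 x\<close> sp1 vec.span_base[of u "insert v B"] by blast
  moreover have "axis i 1 \<notin> insert u (insert v B)"
    using \<open>axis i 1 \<notin> ?H\<close> sp2 vec.span_base[of "axis i 1" "insert u (insert v B)"] by blast
  ultimately have "card ?B = CARD('n) + 4" using fB cB by simp
  moreover have "card ?B \<le> vec.dim (UNIV :: (complex^'v) set)"
    using i3 by (intro vec.independent_card_le_dim) auto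
  ultimately show False unfolding vec_dim_card using card_v by simp
qed

lemma W_frame: "tangent_frame D1 D2 x (W x t)"
  unfolding tangent_frame_def
proof (rule bij_betw_imageI)
  show "inj (\<lambda>(w, c). W x t *v w + c *s x)"
  proof (rule injI, clarify)
    fix w c w' c' assume "W x t *v w + c *s x = W x t *v w' + c' *s x"
    then have "W x t *v (w - w') + (c - c') *s x = 0"
      by (simp add: matrix_vector_mult_diff_distrib vector_sub_rdistrib algebra_simps)
    from W_inj[OF this] show "w = w' \<and> c = c'" by simp
  qed
  show "range (\<lambda>(w, c). W x t *v w + c *s x) = perp D1 D2 x"
  proof
    show "perp D1 D2 x \<subseteq> range (\<lambda>(w, c). W x t *v w + c *s x)"
    proof
      fix v assume "v \<in> perp D1 D2 x"
      then obtain y c where "v = W x t *v y + c *s x" using W_surj by blast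
      then show "v \<in> range (\<lambda>(w, c). W x t *v w + c *s x)" by (intro image_eqI[of _ _ "(y, c)"]) auto
    qed
  qed (auto intro!: perp_add W_perp perp_scale x_perp)
qed

lemma II_W: "II D1 D2 (W x t) = Pen (\<lambda>k. t k * frame_norm x t k) (frame_norm x t)"
  by (simp add: II_def pull_W_D1 pull_W_D2)

lemma W_separated: "separated (\<lambda>k. t k * frame_norm x t k) (frame_norm x t)"
  unfolding separated_def
proof (intro allI impI)
  fix i j :: 'n assume "i \<noteq> j"
  moreover have "det2 (\<lambda>k. t k * frame_norm x t k) (frame_norm x t) i j = frame_norm x t i * frame_norm x t j * (t i - t j)"
    by (simp add: det2_def algebra_simps)
  ultimately show "det2 (\<lambda>k. t k * frame_norm x t k) (frame_norm x t) i j \<noteq> 0" using frame_norm_nonzero t_diff by simp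
qed

lemma in_X_o: "x \<in> X_o TYPE('n) X D1 D2"
  unfolding X_o_def using in_X W_frame diagm_nonsingular[OF W_separated] card_n II_W by auto

lemma moduli_map_W: "moduli_map D1 D2 x = pencil_class (Pen (\<lambda>k. t k * frame_norm x t k) (frame_norm x t))"
  unfolding II_W[symmetric] by (rule moduli_map_eq) (use in_X W_frame in \<open>auto simp: X_def\<close>)

end

end

section \<open>Logarithmic derivatives\<close>

text \<open>The number \<open>c\<close> is the logarithmic derivative of \<open>f\<close> at \<open>0\<close>, which is additive under products.\<close>

definition log_deriv :: "(complex \<Rightarrow> complex) \<Rightarrow> complex \<Rightarrow> bool" where
  "log_deriv f c \<longleftrightarrow> f 0 \<noteq> 0 \<and> (f has_field_derivative f 0 * c) (at 0)"

lemma log_derivI: "(f has_field_derivative d) (at 0) \<Longrightarrow> f 0 \<noteq> 0 \<Longrightarrow> log_deriv f (d / f 0)"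
  by (simp add: log_deriv_def)

lemma log_deriv_mult: "log_deriv f c \<Longrightarrow> log_deriv g d \<Longrightarrow> log_deriv (\<lambda>z. f z * g z) (c + d)"
  unfolding log_deriv_def by (auto intro!: derivative_eq_intros simp: algebra_simps)

lemma log_deriv_divide: "log_deriv f c \<Longrightarrow> log_deriv g d \<Longrightarrow> log_deriv (\<lambda>z. f z / g z) (c - d)"
  unfolding log_deriv_def by (auto intro!: derivative_eq_intros simp: field_simps)

lemma log_deriv_const: "k \<noteq> 0 \<Longrightarrow> log_deriv (\<lambda>z. k) 0"
  unfolding log_deriv_def by (auto intro!: derivative_eq_intros)

lemma log_deriv_power: "log_deriv f c \<Longrightarrow> log_deriv (\<lambda>z. f z ^ m) (of_nat m * c)"
proof (induction m)
  case (Suc m)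
  from log_deriv_mult[OF Suc.prems Suc.IH[OF Suc.prems]] show ?case by (simp add: algebra_simps)
qed (simp add: log_deriv_const)

lemma log_deriv_prod: "finite I \<Longrightarrow> (\<And>i. i \<in> I \<Longrightarrow> log_deriv (f i) (c i)) \<Longrightarrow> log_deriv (\<lambda>z. \<Prod>i\<in>I. f i z) (\<Sum>i\<in>I. c i)"
  by (induction I rule: finite_induct) (auto intro: log_deriv_mult log_deriv_const)

lemma log_deriv_zero_if_stationary:
  assumes "log_deriv f c" "(g has_field_derivative 0) (at 0)" "eventually (\<lambda>z. g z = f z) (nhds 0)" shows "c = 0"
proof -
  have "(f has_field_derivative 0) (at 0)"
    using assms(2,3) DERIV_cong_ev[of 0 0 g f 0 0] by simp
  then have "f 0 * c = 0" using assms(1) DERIV_unique unfolding log_deriv_def by blast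
  then show ?thesis using assms(1) by (simp add: log_deriv_def)
qed

text \<open>A quadratic polynomial \<open>q\<close> interpolates the velocities at three of the points.  Its values are
  velocities of a projective motion and thus satisfy the equations.  For any further index \<open>l\<close> the
  difference between \<open>\<sigma>\<^sub>l\<close> and the value of \<open>q\<close> then satisfies a homogeneous equation with nonzero
  coefficient.\<close>

lemma cross_ratio_preserving_quadratic:
  fixes t \<sigma> :: "'n::finite \<Rightarrow> complex" and i j k :: 'n
  assumes inj: "inj t" and d: "distinct [i, j, k]"
    and eq: "\<And>i j k l. distinct [i, j, k, l] \<Longrightarrow> (\<sigma> i - \<sigma> j) / (t i - t j) + (\<sigma> k - \<sigma> l) / (t k - t l)
      - ((\<sigma> i - \<sigma> k) / (t i - t k) + (\<sigma> j - \<sigma> l) / (t j - t l)) = 0"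
  shows "\<exists>a b c. \<forall>l. \<sigma> l = a + b * t l + c * (t l)\<^sup>2"
proof -
  have td: "t i - t j \<noteq> 0" if "i \<noteq> j" for i j using inj that by (auto simp: inj_eq)
  define f1 where "f1 = (\<sigma> j - \<sigma> i) / (t j - t i)"
  define f2 where "f2 = ((\<sigma> k - \<sigma> i - f1 * (t k - t i)) / (t k - t i)) / (t k - t j)"
  define q where "q s = \<sigma> i + f1 * (s - t i) + f2 * ((s - t i) * (s - t j))" for s
  have qi: "q (t i) = \<sigma> i" by (simp add: q_def)
  have "t j - t i \<noteq> 0" using d by (intro td) auto
  then have qj: "q (t j) = \<sigma> j" by (simp add: q_def f1_def)
  have qk: "q (t k) = \<sigma> k"
  proof -
    have "t k - t i \<noteq> 0" "t k - t j \<noteq> 0" using td d by auto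
    then have "f2 * ((t k - t i) * (t k - t j)) = \<sigma> k - \<sigma> i - f1 * (t k - t i)" by (simp add: f2_def)
    then show ?thesis by (simp add: q_def)
  qed
  define c where "c = f2"
  define b where "b = f1 - f2 * (t i + t j)"
  define a where "a = \<sigma> i - f1 * t i + f2 * t i * t j"
  have qabc: "q s = a + b * s + c * s\<^sup>2" for s
    by (simp add: q_def a_def b_def c_def power2_eq_square algebra_simps)
  have qd: "q x - q y = (b + c * (x + y)) * (x - y)" for x y
    unfolding qabc by (simp add: power2_eq_square algebra_simps)
  have "\<sigma> l = q (t l)" for l
  proof (cases "l \<in> {i, j, k}")
    case True
    then show ?thesis using qi qj qk by auto
  next
    case False
    then have l: "distinct [i, j, k, l]" using d by auto
    define \<rho> where "\<rho> = \<sigma> l - q (t l)"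
    have nz: "t i - t j \<noteq> 0" "t k - t l \<noteq> 0" "t i - t k \<noteq> 0" "t j - t l \<noteq> 0" "t j - t k \<noteq> 0" using l td by auto
    have e1: "(\<sigma> i - \<sigma> j) / (t i - t j) = b + c * (t i + t j)" "(\<sigma> i - \<sigma> k) / (t i - t k) = b + c * (t i + t k)"
      unfolding qi[symmetric] qj[symmetric] qk[symmetric] qd using nz by auto
    have "\<sigma> k - \<sigma> l = (b + c * (t k + t l)) * (t k - t l) - \<rho>" "\<sigma> j - \<sigma> l = (b + c * (t j + t l)) * (t j - t l) - \<rho>"
      unfolding \<rho>_def qj[symmetric] qk[symmetric] qd[symmetric] by simp_all
    then have e2: "(\<sigma> k - \<sigma> l) / (t k - t l) = b + c * (t k + t l) - \<rho> / (t k - t l)"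
      "(\<sigma> j - \<sigma> l) / (t j - t l) = b + c * (t j + t l) - \<rho> / (t j - t l)"
      using nz by (simp_all add: diff_divide_distrib)
    have "\<rho> / (t j - t l) = \<rho> / (t k - t l)" using eq[OF l] unfolding e1 e2 by (simp add: algebra_simps)
    then have "\<rho> * (t j - t k) = 0" using nz by (simp add: field_simps)
    then have "\<rho> = 0" using nz by simp
    then show ?thesis by (simp add: \<rho>_def)
  qed
  then show ?thesis unfolding qabc by blast
qed

lemma three_distinct_indices:
  assumes "CARD('m::finite) \<ge> 3" obtains i j k :: "'m::finite" where "distinct [i, j, k]"
proof -
  obtain S :: "'m set" where "card S = 3" using obtain_subset_with_card_n[OF assms] by metis
  then obtain i j k where "S = {i, j, k}" "i \<noteq> j" "j \<noteq> k" "i \<noteq> k" unfolding card_3_iff by metis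
  then show ?thesis using that[of i j k] by auto
qed

lemma has_derivative_matrix_entries:
  fixes f :: "'a::real_normed_vector \<Rightarrow> complex^'m^'k"
  assumes "\<And>i j. cdiff sc UNIV (\<lambda>x. f x $ i $ j) u" shows "\<exists>D. (f has_derivative D) (at u)"
proof -
  have "\<exists>D. ((\<lambda>x. f x $ i $ j) has_derivative D) (at u)" for i j using assms[of i j] by (auto simp: cdiff_def)
  then obtain D where D: "\<And>i j. ((\<lambda>x. f x $ i $ j) has_derivative D i j) (at u)" by metis
  have "((\<lambda>x. \<chi> i j. f x $ i $ j) has_derivative (\<lambda>h. \<chi> i j. D i j h)) (at u)"
    by (intro has_derivative_vec_lambda D)
  then show ?thesis by auto
qed

lemma arc_has_derivative:
  assumes "arc_in Y x v \<gamma>" shows "(\<gamma> has_derivative (\<lambda>z. z *s v)) (at 0)" "\<gamma> 0 = x"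
    "eventually (\<lambda>z. \<gamma> z \<in> Y) (nhds 0)"
proof -
  have e: "(\<lambda>z. z * v $ i) = (*) (v $ i)" for i by (simp add: fun_eq_iff mult.commute)
  have "((\<lambda>z. \<gamma> z $ i) has_derivative (\<lambda>z. z * v $ i)) (at 0)" for i
    using assms unfolding e by (simp add: arc_in_def has_field_derivative_def)
  then have "((\<lambda>z. \<chi> i. \<gamma> z $ i) has_derivative (\<lambda>z. \<chi> i. z * v $ i)) (at 0)"
    by (rule has_derivative_vec_lambda)
  then show "(\<gamma> has_derivative (\<lambda>z. z *s v)) (at 0)" by (simp add: vector_scalar_mult_def)
  show "\<gamma> 0 = x" using assms by (simp add: arc_in_def)
  show "eventually (\<lambda>z. \<gamma> z \<in> Y) (nhds 0)"
    using assms unfolding arc_in_def by (auto simp: eventually_nhds_metric dist_commute)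
qed

context quadric_pencil
begin

lemma distinct_indices_n: obtains i j k :: 'n where "distinct [i, j, k]"
proof -
  have "CARD('n) \<ge> 3" using card_n by simp
  then show ?thesis using three_distinct_indices that by metis
qed

lemma X_iff: "y \<in> X \<longleftrightarrow> y \<noteq> 0 \<and> (\<Sum>i\<in>UNIV. lam i * (y $ i)\<^sup>2) = 0 \<and> (\<Sum>i\<in>UNIV. (y $ i)\<^sup>2) = 0"
  by (simp add: X_def quad_def bil_diagm power2_eq_square mult.assoc)

lemma pencil_class_roots:
  assumes "\<And>k. s k \<noteq> 0" shows "pencil_class (Pen (\<lambda>k. t k * s k) s) = pencil_class (Pen t (\<lambda>_. 1))"
proof -
  have e: "Pen (\<lambda>k. t k * s k) s = pull (diagm (\<lambda>k. csqrt (s k))) ` Pen t (\<lambda>_. 1)"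
    by (rule Pen_pull_diagm[where \<alpha> = 1 and \<beta> = 0 and \<gamma> = 0 and \<delta> = 1]) auto
  show ?thesis unfolding e by (rule pencil_class_pull) (use assms in \<open>auto intro!: invertible_diagm\<close>)
qed

lemma moduli_map_roots:
  assumes "roots_at x t C" shows "moduli_map D1 D2 x = pencil_class (Pen t (\<lambda>_. 1))"
  using moduli_map_W[OF assms] pencil_class_roots[OF frame_norm_nonzero[OF assms]] by simp

text \<open>A projective transformation of the roots changes the basis of the pencil and rescales the
  coordinates.\<close>

lemma pencil_class_moebius:
  assumes "\<And>k. 1 - z * c * t k \<noteq> 0" and D: "1 + z * b + z * a * (z * c) \<noteq> 0"
  shows "pencil_class (Pen (\<lambda>k. (t k + z * (a + b * t k)) / (1 - z * c * t k)) (\<lambda>_. 1)) = pencil_class (Pen t (\<lambda>_. 1))"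
proof -
  have e: "Pen (\<lambda>k. (t k + z * (a + b * t k)) / (1 - z * c * t k)) (\<lambda>_. 1)
     = pull (diagm (\<lambda>k. csqrt (1 / (1 - z * c * t k)))) ` Pen t (\<lambda>_. 1)"
    by (rule Pen_pull_diagm[where \<alpha> = "1 + z * b" and \<beta> = "z * a" and \<gamma> = "- (z * c)" and \<delta> = 1])
      (use assms in \<open>auto simp: field_simps\<close>)
  show ?thesis unfolding e by (rule pencil_class_pull) (use assms in \<open>auto intro!: invertible_diagm\<close>)
qed

text \<open>The squares of the coordinates are prescribed by the motion of the roots.  Their quotients \<open>R\<^sub>i\<close> by the
  initial values are close to \<open>1\<close>, so the principal branch of the square root applies to them.\<close>

lemma root_arc:
  assumes rt: "roots_at x t C" and r0: "r0 > 0"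
    and hol: "\<And>k. \<tau> k holomorphic_on ball 0 r0" and t0: "\<And>k. \<tau> k 0 = t k"
    and der: "\<And>k. (\<tau> k has_field_derivative \<sigma> k) (at 0)"
  obtains \<gamma> r C' where "r > 0" "r \<le> r0" "\<gamma> 0 = x" "\<And>i. (\<lambda>z. \<gamma> z $ i) holomorphic_on ball 0 r"
    "\<And>i. ((\<lambda>z. \<gamma> z $ i) has_field_derivative (\<kappa> *s x + W x t *v (\<chi> k. - \<sigma> k / 2)) $ i) (at 0)"
    "\<And>z. z \<in> ball 0 r \<Longrightarrow> roots_at (\<gamma> z) (\<lambda>k. \<tau> k z) (C' z)"
proof -
  define R where "R i z = (\<Prod>k\<in>UNIV. (lam i - \<tau> k z) / (lam i - t k))" for i z
  have R0: "R i 0 = 1" for i using lam_t(1)[OF rt] by (simp add: R_def t0)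
  have ld: "log_deriv (R i) (\<Sum>k\<in>UNIV. - \<sigma> k / (lam i - t k))" for i
  proof -
    have "log_deriv (\<lambda>z. (lam i - \<tau> k z) / (lam i - t k)) (- \<sigma> k / (lam i - t k))" for k
    proof -
      have ne: "lam i \<noteq> t k" using lam_t(1)[OF rt, of i k] by auto
      have "((\<lambda>z. (lam i - \<tau> k z) / (lam i - t k)) has_field_derivative - \<sigma> k / (lam i - t k)) (at 0)"
        using ne by (auto intro!: derivative_eq_intros der)
      moreover have one: "(lam i - \<tau> k 0) / (lam i - t k) = 1"
        unfolding t0 using lam_t(1)[OF rt, of i k] by (rule divide_self)
      ultimately show ?thesis using log_derivI[of "\<lambda>z. (lam i - \<tau> k z) / (lam i - t k)" "- \<sigma> k / (lam i - t k)"]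
        by (simp only: one div_by_1 one_neq_zero not_False_eq_True simp_thms)
    qed
    then show ?thesis unfolding R_def[abs_def] by (intro log_deriv_prod) auto
  qed
  have Rd: "(R i has_field_derivative (\<Sum>k\<in>UNIV. - \<sigma> k / (lam i - t k))) (at 0)" for i
    using ld[of i] by (simp add: log_deriv_def R0)
  have Rhol: "R i holomorphic_on ball 0 r0" for i
    unfolding R_def[abs_def] by (intro holomorphic_intros hol lam_t(1)[OF rt])
  have ct: "(f \<longlongrightarrow> f 0) (nhds 0)" if "(f has_field_derivative d) (at 0)" for f :: "complex \<Rightarrow> complex" and d
    using DERIV_isCont[OF that] by (simp add: isCont_def tendsto_at_iff_tendsto_nhds)
  have e1: "eventually (\<lambda>z. 0 < Re (R i z)) (nhds 0)" for i
    using tendsto_Re[OF ct[OF Rd[of i]]] by (rule order_tendstoD(1)) (simp add: R0)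
  have e2: "eventually (\<lambda>z. j \<noteq> k \<longrightarrow> \<tau> j z \<noteq> \<tau> k z) (nhds 0)" for j k
  proof (cases "j = k")
    case False
    have "((\<lambda>z. \<tau> j z - \<tau> k z) \<longlongrightarrow> t j - t k) (nhds 0)"
      using tendsto_diff[OF ct[OF der[of j]] ct[OF der[of k]]] by (simp add: t0)
    then have "eventually (\<lambda>z. \<tau> j z - \<tau> k z \<noteq> 0) (nhds 0)"
      using t_diff[OF rt False] by (rule tendsto_imp_eventually_ne)
    then show ?thesis by eventually_elim simp
  qed simp
  have e3: "eventually (\<lambda>z. \<tau> k z \<noteq> lam i) (nhds 0)" for k i
  proof -
    have "((\<lambda>z. \<tau> k z - lam i) \<longlongrightarrow> t k - lam i) (nhds 0)"
      using tendsto_diff[OF ct[OF der[of k]] tendsto_const] by (simp add: t0)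
    then have "eventually (\<lambda>z. \<tau> k z - lam i \<noteq> 0) (nhds 0)"
      using lam_t(2)[OF rt] by (rule tendsto_imp_eventually_ne)
    then show ?thesis by eventually_elim simp
  qed
  have e4: "eventually (\<lambda>z. 1 + \<kappa> * z \<noteq> 0) (nhds 0)"
  proof (rule tendsto_imp_eventually_ne)
    show "((\<lambda>z. 1 + \<kappa> * z) \<longlongrightarrow> 1 + \<kappa> * 0) (nhds 0)" by (intro tendsto_intros filterlim_ident)
  qed simp
  have "eventually (\<lambda>z. (\<forall>i. 0 < Re (R i z)) \<and> (\<forall>j k. j \<noteq> k \<longrightarrow> \<tau> j z \<noteq> \<tau> k z) \<and> (\<forall>k i. \<tau> k z \<noteq> lam i) \<and> 1 + \<kappa> * z \<noteq> 0) (nhds 0)"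
    by (intro eventually_conj eventually_all_finite_type e1 e2 e3 e4)
  then obtain r1 where r1: "r1 > 0" "\<And>z. z \<in> ball 0 r1 \<Longrightarrow> (\<forall>i. 0 < Re (R i z)) \<and> (\<forall>j k. j \<noteq> k \<longrightarrow> \<tau> j z \<noteq> \<tau> k z) \<and> (\<forall>k i. \<tau> k z \<noteq> lam i) \<and> 1 + \<kappa> * z \<noteq> 0"
    unfolding eventually_nhds_metric by (auto simp: dist_commute)
  define r where "r = min r0 r1"
  define \<gamma> where "\<gamma> z = (\<chi> i. (1 + \<kappa> * z) * x $ i * csqrt (R i z))" for z
  define C' where "C' z = C * (1 + \<kappa> * z)\<^sup>2" for z
  show thesis
  proof (rule that[of r \<gamma> C'])
    show "r > 0" "r \<le> r0" using r0 r1(1) by (auto simp: r_def)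
    show "\<gamma> 0 = x" by (simp add: \<gamma>_def R0)
    show "(\<lambda>z. \<gamma> z $ i) holomorphic_on ball 0 r" for i
    proof -
      have "(csqrt \<circ> R i) holomorphic_on ball 0 r"
      proof (rule holomorphic_on_compose)
        show "R i holomorphic_on ball 0 r" by (rule holomorphic_on_subset[OF Rhol]) (auto simp: r_def)
        show "csqrt holomorphic_on R i ` ball 0 r"
        proof (rule holomorphic_on_csqrt[THEN holomorphic_on_subset], rule image_subsetI)
          fix z :: complex assume "z \<in> ball 0 r"
          then have "0 < Re (R i z)" using r1(2)[of z] by (simp add: r_def)
          then show "R i z \<in> - \<real>\<^sub>\<le>\<^sub>0" by (simp add: complex_nonpos_Reals_iff)
        qed
      qed
      then show ?thesis unfolding \<gamma>_def vec_lambda_beta o_def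
        by (intro holomorphic_on_mult holomorphic_on_add holomorphic_on_const holomorphic_on_ident)
    qed
    show "((\<lambda>z. \<gamma> z $ i) has_field_derivative (\<kappa> *s x + W x t *v (\<chi> k. - \<sigma> k / 2)) $ i) (at 0)" for i
    proof -
      have c: "((\<lambda>z. csqrt (R i z)) has_field_derivative inverse (2 * csqrt (R i 0)) * (\<Sum>k\<in>UNIV. - \<sigma> k / (lam i - t k))) (at 0)"
        by (rule DERIV_chain2[OF has_field_derivative_csqrt Rd]) (simp add: R0)
      have "((\<lambda>z. \<gamma> z $ i) has_field_derivative \<kappa> * x $ i + x $ i * ((\<Sum>k\<in>UNIV. - \<sigma> k / (lam i - t k)) / 2)) (at 0)"
        unfolding \<gamma>_def vec_lambda_beta by (rule derivative_eq_intros c refl | simp add: R0)+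
      also have "\<kappa> * x $ i + x $ i * ((\<Sum>k\<in>UNIV. - \<sigma> k / (lam i - t k)) / 2) = (\<kappa> *s x + W x t *v (\<chi> k. - \<sigma> k / 2)) $ i"
        by (simp add: W_vec[OF rt] sum_distrib_left sum_divide_distrib sum_negf[symmetric])
      finally show ?thesis .
    qed
    show "roots_at (\<gamma> z) (\<lambda>k. \<tau> k z) (C' z)" if "z \<in> ball 0 r" for z
    proof -
      have z: "\<And>j k. j \<noteq> k \<Longrightarrow> \<tau> j z \<noteq> \<tau> k z" "\<And>k i. \<tau> k z \<noteq> lam i" "1 + \<kappa> * z \<noteq> 0"
        using r1(2)[of z] that by (auto simp: r_def)
      have "(\<gamma> z $ i)\<^sup>2 * L i = C' z * (\<Prod>k\<in>UNIV. lam i - \<tau> k z)" for i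
      proof -
        have "(\<gamma> z $ i)\<^sup>2 * L i = (1 + \<kappa> * z)\<^sup>2 * ((x $ i)\<^sup>2 * L i) * R i z"
          by (simp add: \<gamma>_def power_mult_distrib)
        also have "\<dots> = (1 + \<kappa> * z)\<^sup>2 * C * ((\<Prod>k\<in>UNIV. lam i - t k) * R i z)"
          using rt by (simp add: roots_at_def)
        also have "(\<Prod>k\<in>UNIV. lam i - t k) * R i z = (\<Prod>k\<in>UNIV. lam i - \<tau> k z)"
          unfolding R_def prod.distrib[symmetric] using lam_t(1)[OF rt] by simp
        finally show ?thesis by (simp add: C'_def)
      qed
      moreover have "inj (\<lambda>k. \<tau> k z)" using z(1) by (meson injI)
      ultimately show ?thesis using z rt by (auto simp: roots_at_def C'_def)
    qed
  qed
qed

section \<open>Transporting a frame to nearby points\<close>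

text \<open>The diagonal matrix with entries \<open>x\<^sub>i / y\<^sub>i\<close> maps the vectors orthogonal to \<open>x\<close> to those orthogonal to
  \<open>y\<close>, for both forms at once.  It carries the frame at \<open>x\<close> to nearby points in a way that depends
  on \<open>y\<close> only, and not on a choice of the roots at \<open>y\<close>.\<close>

definition moved_frame :: "complex^'v \<Rightarrow> ('n \<Rightarrow> complex) \<Rightarrow> complex^'v \<Rightarrow> complex^'n^'v" where
  "moved_frame x t y = (\<chi> i k. x $ i / y $ i * W x t $ i $ k)"

text \<open>The coefficient of the orthogonal projection to the \<open>k\<close>-th vector of the frame, with respect to the
  second form.\<close>

definition coord :: "complex^'v \<Rightarrow> ('n \<Rightarrow> complex) \<Rightarrow> complex^'v \<Rightarrow> 'n \<Rightarrow> complex" where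
  "coord x t u k = (\<Sum>i\<in>UNIV. u $ i * W x t $ i $ k) / frame_norm x t k"

text \<open>The coefficient of \<open>x\<close> once the frame coordinates are known.  It may be read off from any component, as no
  component of \<open>x\<close> vanishes.\<close>

definition line_coord :: "complex^'v \<Rightarrow> ('n \<Rightarrow> complex) \<Rightarrow> complex^'v \<Rightarrow> complex" where
  "line_coord x t u = (u $ undefined - (\<Sum>k\<in>UNIV. W x t $ undefined $ k * coord x t u k)) / x $ undefined"

text \<open>The image of \<open>y\<close> under the diagonal matrix with entries \<open>y\<^sub>i / x\<^sub>i\<close>.\<close>

definition moved_point :: "complex^'v \<Rightarrow> complex^'v \<Rightarrow> complex^'v" where
  "moved_point x y = (\<chi> i. (y $ i)\<^sup>2 / x $ i)"

lemma moved_frame_self: "roots_at x t C \<Longrightarrow> moved_frame x t x = W x t"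
  using roots_at_nonzero by (simp add: moved_frame_def vec_eq_iff)

lemma moved_frame_vec: "(moved_frame x t y *v w) $ i = x $ i / y $ i * (W x t *v w) $ i"
  by (simp add: moved_frame_def matrix_vector_mult_def sum_distrib_left mult.assoc)

lemma coord_eq:
  assumes rt: "roots_at x t C" shows "coord x t (W x t *v y + c *s x) k = y $ k" "line_coord x t (W x t *v y + c *s x) = c"
proof -
  have ck: "coord x t (W x t *v y + c *s x) k = y $ k" for k
  proof -
    have "coord x t u k = bil D2 (W x t *v axis k 1) u / frame_norm x t k" for u
      by (simp add: coord_def, simp add: bil_diagm mat_vec_axis column_def mult.commute del: matrix_vector_mul_component)
    moreover have "bil D2 (W x t *v axis k 1) x = 0"
      using W_perp[OF rt, of "axis k 1"] by (simp add: perp_def bil_commute[of D2 x])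
    moreover have "bil D2 (W x t *v axis k 1) (W x t *v y) = frame_norm x t k * y $ k"
    proof -
      have "bil D2 (W x t *v axis k 1) (W x t *v y) = (\<Sum>i\<in>UNIV. if i = k then frame_norm x t k * y $ k else 0)"
        unfolding bil_pull[symmetric] pull_W_D2[OF rt] bil_diagm by (rule sum.cong) (auto simp: axis_def)
      then show ?thesis by simp
    qed
    ultimately show ?thesis using frame_norm_nonzero[OF rt] by (simp add: bil_add_right bil_scale_right)
  qed
  then show "coord x t (W x t *v y + c *s x) k = y $ k" .
  have "(\<Sum>k\<in>UNIV. W x t $ undefined $ k * coord x t (W x t *v y + c *s x) k) = (W x t *v y) $ undefined"
    unfolding ck by (simp add: matrix_vector_mult_def)
  then show "line_coord x t (W x t *v y + c *s x) = c"
    using roots_at_nonzero[OF rt] by (simp add: line_coord_def)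
qed

lemma perp_coord:
  assumes rt: "roots_at x t C" and u: "u \<in> perp D1 D2 x"
  shows "u = W x t *v (\<chi> k. coord x t u k) + line_coord x t u *s x"
proof -
  obtain y c where yc: "u = W x t *v y + c *s x" using W_surj[OF rt u] by blast
  have "(\<chi> k. coord x t u k) = y" unfolding yc by (simp add: coord_eq[OF rt] vec_eq_iff)
  moreover have "line_coord x t u = c" unfolding yc by (rule coord_eq[OF rt])
  ultimately show ?thesis using yc by simp
qed

lemma perp_moved:
  assumes "\<And>i. x $ i \<noteq> 0" "\<And>i. y $ i \<noteq> 0"
  shows "(\<chi> i. y $ i / x $ i * u $ i) \<in> perp D1 D2 x \<longleftrightarrow> u \<in> perp D1 D2 y"
  unfolding perp_D using assms by (simp add: mult.assoc)

text \<open>The diagonal matrix with entries \<open>y\<^sub>i / x\<^sub>i\<close> maps the moved frame back to the frame at \<open>x\<close>, and \<open>y\<close> to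
  \<open>moved_point x y\<close>.  So it suffices that the latter is not in the span of the frame at \<open>x\<close>.\<close>

lemma moved_frame_tangent:
  assumes rt: "roots_at x t C" and y: "y \<in> X" "\<And>i. y $ i \<noteq> 0" and eta: "line_coord x t (moved_point x y) \<noteq> 0"
  shows "tangent_frame D1 D2 y (moved_frame x t y)"
proof -
  note xn = roots_at_nonzero[OF rt]
  define \<omega> where "\<omega> = (\<chi> k. coord x t (moved_point x y) k)"
  define \<eta> where "\<eta> = line_coord x t (moved_point x y)"
  have "moved_point x y \<in> perp D1 D2 x" unfolding perp_D using y(1) xn by (simp add: moved_point_def X_iff mult.assoc)
  from perp_coord[OF rt this] have sq: "moved_point x y = W x t *v \<omega> + \<eta> *s x" by (simp add: \<omega>_def \<eta>_def)
  have mv: "(\<chi> i. y $ i / x $ i * (moved_frame x t y *v w + c *s y) $ i) = W x t *v (w + c *s \<omega>) + (c * \<eta>) *s x" for w c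
  proof -
    have "(\<chi> i. y $ i / x $ i * (moved_frame x t y *v w + c *s y) $ i) = W x t *v w + c *s moved_point x y"
      using xn y(2) by (simp add: vec_eq_iff moved_frame_vec moved_point_def field_simps power2_eq_square)
    also have "\<dots> = W x t *v (w + c *s \<omega>) + (c * \<eta>) *s x"
      by (simp add: sq matrix_vector_right_distrib vector_scalar_commute vec.scale_right_distrib)
    finally show ?thesis .
  qed
  have inj0: "u = u'" if "(\<chi> i. y $ i / x $ i * u $ i) = (\<chi> i. y $ i / x $ i * u' $ i)" for u u'
    using that xn y(2) by (simp add: vec_eq_iff)
  show ?thesis unfolding tangent_frame_def
  proof (rule bij_betw_imageI)
    show "inj (\<lambda>(w, c). moved_frame x t y *v w + c *s y)"
    proof (rule injI, clarify)
      fix w c w' c' assume "moved_frame x t y *v w + c *s y = moved_frame x t y *v w' + c' *s y"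
      then have "W x t *v (w + c *s \<omega>) + (c * \<eta>) *s x = W x t *v (w' + c' *s \<omega>) + (c' * \<eta>) *s x"
        unfolding mv[symmetric] by simp
      from tangent_frame_inj[OF W_frame[OF rt] this] show "w = w' \<and> c = c'" using eta by (auto simp: \<eta>_def)
    qed
    show "range (\<lambda>(w, c). moved_frame x t y *v w + c *s y) = perp D1 D2 y"
    proof
      show "range (\<lambda>(w, c). moved_frame x t y *v w + c *s y) \<subseteq> perp D1 D2 y"
      proof clarify
        fix w c
        show "moved_frame x t y *v w + c *s y \<in> perp D1 D2 y"
          unfolding perp_moved[OF xn y(2), symmetric] mv
          by (intro perp_add W_perp[OF rt] perp_scale x_perp[OF rt])
      qed
      show "perp D1 D2 y \<subseteq> range (\<lambda>(w, c). moved_frame x t y *v w + c *s y)"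
      proof
        fix u assume "u \<in> perp D1 D2 y"
        then have "(\<chi> i. y $ i / x $ i * u $ i) \<in> perp D1 D2 x" by (simp only: perp_moved[OF xn y(2)])
        then obtain w d where wd: "(\<chi> i. y $ i / x $ i * u $ i) = W x t *v w + d *s x"
          using W_surj[OF rt] by metis
        have "(\<chi> i. y $ i / x $ i * (moved_frame x t y *v (w - (d / \<eta>) *s \<omega>) + (d / \<eta>) *s y) $ i) = W x t *v w + d *s x"
          unfolding mv using eta by (simp add: \<eta>_def)
        then have "u = moved_frame x t y *v (w - (d / \<eta>) *s \<omega>) + (d / \<eta>) *s y" using inj0 wd by metis
        then show "u \<in> range (\<lambda>(w, c). moved_frame x t y *v w + c *s y)"
          by (intro image_eqI[of _ _ "(w - (d / \<eta>) *s \<omega>, d / \<eta>)"]) auto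
      qed
    qed
  qed
qed

lemma cdiff_nth: "cdiff (*s) S (\<lambda>y :: complex^'v. y $ i) u"
  by (rule cdiff_linear[OF bounded_linear_vec_nth]) simp

lemma cdiff_coord:
  assumes "roots_at x t C" "\<And>i. cdiff sc S (\<lambda>y. f y $ i) u"
  shows "cdiff sc S (\<lambda>y. coord x t (f y) k) u" "cdiff sc S (\<lambda>y. line_coord x t (f y)) u"
  unfolding coord_def line_coord_def
  by (intro cdiff_divide cdiff_sum cdiff_mult cdiff_diff cdiff_const assms frame_norm_nonzero[OF assms(1)] roots_at_nonzero[OF assms(1)])+

lemma cdiff_moved_point: assumes "roots_at x t C" shows "cdiff (*s) S (\<lambda>y. moved_point x y $ i) u"
  unfolding moved_point_def vec_lambda_beta
  by (intro cdiff_divide cdiff_power cdiff_nth cdiff_const roots_at_nonzero[OF assms])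

lemma moved_point_self: assumes "roots_at x t C" shows "line_coord x t (moved_point x x) = 1" "coord x t (moved_point x x) k = 0"
proof -
  have "moved_point x x = W x t *v 0 + 1 *s x"
    using roots_at_nonzero[OF assms] by (simp add: moved_point_def vec_eq_iff power2_eq_square)
  then show "line_coord x t (moved_point x x) = 1" "coord x t (moved_point x x) k = 0"
    by (simp_all only: coord_eq[OF assms] zero_index)
qed

lemma eventually_moved_frame:
  assumes rt: "roots_at x t C"
  shows "eventually (\<lambda>y. (\<forall>i. y $ i \<noteq> 0) \<and> line_coord x t (moved_point x y) \<noteq> 0) (nhds x)"
proof (intro eventually_conj eventually_all_finite_type)
  show "eventually (\<lambda>y. y $ i \<noteq> 0) (nhds x)" for i
    by (rule tendsto_imp_eventually_ne[OF cdiff_tendsto_nhds[OF cdiff_nth] roots_at_nonzero[OF rt]])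
  show "eventually (\<lambda>y. line_coord x t (moved_point x y) \<noteq> 0) (nhds x)"
    by (rule tendsto_imp_eventually_ne[OF cdiff_tendsto_nhds[OF cdiff_coord(2)[OF rt cdiff_moved_point[OF rt]]]])
      (simp add: moved_point_self[OF rt])
qed

definition second_form :: "complex^'v \<Rightarrow> ('n \<Rightarrow> complex) \<Rightarrow> complex^'v \<Rightarrow> (complex^'n^'n) \<times> (complex^'n^'n)" where
  "second_form x t y = (pull (moved_frame x t y) D1, pull (moved_frame x t y) D2)"

lemma cdiff_moved_frame: assumes "roots_at x t C" shows "cdiff (*s) S (\<lambda>y. moved_frame x t y $ i $ k) x"
  unfolding moved_frame_def vec_lambda_beta
  by (intro cdiff_mult cdiff_divide cdiff_nth cdiff_const roots_at_nonzero[OF assms])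

lemma second_form_derivative: assumes "roots_at x t C" shows "\<exists>D. (second_form x t has_derivative D) (at x)"
proof -
  have "\<exists>D. ((\<lambda>y. pull (moved_frame x t y) (diagm a)) has_derivative D) (at x)" for a
    by (rule has_derivative_matrix_entries[where sc = "(*s)"], unfold pull_diagm_component)
      (intro cdiff_sum cdiff_mult cdiff_const cdiff_moved_frame[OF assms])
  then obtain E1 E2 where "((\<lambda>y. pull (moved_frame x t y) D1) has_derivative E1) (at x)"
      "((\<lambda>y. pull (moved_frame x t y) D2) has_derivative E2) (at x)" by metis
  from has_derivative_Pair[OF this] show ?thesis unfolding second_form_def[abs_def] by blast
qed

text \<open>In the moved frame the second fundamental form depends differentiably on the point, so along arcs the
  moduli map factors through a differentiable map.  As a consequence, membership of a tangent vector in
  the kernel can be tested on a single arc.\<close>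

lemma moduli_map_chain_rule:
  assumes rt: "roots_at x t C" and h: "MPQ_holo h U" and U: "moduli_map D1 D2 x \<in> (U :: (complex^'n^'n) set set set)"
  obtains D where "\<And>v \<gamma>. arc_in (X_o TYPE('n) X D1 D2) x v \<gamma> \<Longrightarrow>
    ((\<lambda>z. h (moduli_map D1 D2 (\<gamma> z))) has_derivative (\<lambda>z. D (z *s v))) (at 0)"
proof -
  define Hf where "Hf = (\<lambda>(A, B). h (pencil_class (form_span A B)))"
  have K0: "second_form x t x = (diagm (\<lambda>k. t k * frame_norm x t k), diagm (frame_norm x t))"
    by (simp add: second_form_def moved_frame_self[OF rt] pull_W_D1[OF rt] pull_W_D2[OF rt])
  have c1: "CARD('n) > 1" using card_n by simp
  define F where "F = {(A, B). A \<in> forms \<and> B \<in> forms \<and> nonsingular_pencil (form_span A B) \<and> forms_independent A B \<and>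
          pencil_class (form_span A B) \<in> U}"
  have "second_form x t x \<in> F"
    using U moduli_map_W[OF rt] diagm_nonsingular[OF W_separated[OF rt] c1] diagm_independent[OF W_separated[OF rt] c1]
    by (simp add: K0 F_def)
  moreover have "holo_on_open sc2 (forms \<times> forms) Hf F"
    using h unfolding MPQ_holo_def Hf_def F_def by (rule conjunct2)
  ultimately obtain DH where DH: "(Hf has_derivative DH) (at (second_form x t x) within forms \<times> forms)"
    unfolding holo_on_open_def by metis
  obtain DK where DK: "(second_form x t has_derivative DK) (at x)" using second_form_derivative[OF rt] by blast
  have Kf: "second_form x t y \<in> forms \<times> forms" for y by (simp add: second_form_def pull_forms)
  show thesis
  proof (rule that[of "\<lambda>v. DH (DK v)"])
    fix v \<gamma> assume arc: "arc_in (X_o TYPE('n) X D1 D2) x v \<gamma>"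
    note a = arc_has_derivative[OF arc]
    have "((\<lambda>z. second_form x t (\<gamma> z)) has_derivative (\<lambda>z. DK (z *s v))) (at 0)"
      using has_derivative_compose[OF a(1)] DK a(2) by blast
    from has_derivative_in_compose[OF this, of Hf DH]
    have 1: "((\<lambda>z. Hf (second_form x t (\<gamma> z))) has_derivative (\<lambda>z. DH (DK (z *s v)))) (at 0)"
      using has_derivative_subset[OF DH, of "range (\<lambda>z. second_form x t (\<gamma> z))"] Kf a(2) by blast
    have ev: "eventually (\<lambda>z. Hf (second_form x t (\<gamma> z)) = h (moduli_map D1 D2 (\<gamma> z))) (nhds 0)"
    proof -
      have "(\<gamma> \<longlongrightarrow> \<gamma> 0) (nhds 0)"
        using has_derivative_continuous[OF a(1)] by (simp add: isCont_def tendsto_at_iff_tendsto_nhds)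
      then have "(\<gamma> \<longlongrightarrow> x) (nhds 0)" using a(2) by simp
      then have "eventually (\<lambda>z. (\<forall>i. \<gamma> z $ i \<noteq> 0) \<and> line_coord x t (moved_point x (\<gamma> z)) \<noteq> 0) (nhds 0)"
        using eventually_moved_frame[OF rt] unfolding filterlim_iff by blast
      with a(3) show ?thesis
      proof eventually_elim
        case (elim z)
        then have X: "\<gamma> z \<in> X" by (simp add: X_o_def)
        have "tangent_frame D1 D2 (\<gamma> z) (moved_frame x t (\<gamma> z))"
          by (rule moved_frame_tangent[OF rt X]) (use elim in auto)
        from moduli_map_eq[OF _ _ _ _ this] X show ?case
          by (simp add: X_def II_def Hf_def second_form_def)
      qed
    qed
    show "((\<lambda>z. h (moduli_map D1 D2 (\<gamma> z))) has_derivative (\<lambda>z. DH (DK (z *s v)))) (at 0)"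
      by (rule has_derivative_transform_eventually[OF 1 eventually_at_within_if_nhds[OF ev]
        eventually_nhds_x_imp_x[OF ev] UNIV_I])
  qed
qed

end

section \<open>The kernel of the differential of the moduli map\<close>

text \<open>A curve of projective transformations through the identity, with velocity \<open>a + b s + c s\<^sup>2\<close> at \<open>z = 0\<close>.\<close>

definition moebius_move :: "complex \<Rightarrow> complex \<Rightarrow> complex \<Rightarrow> complex \<Rightarrow> complex \<Rightarrow> complex" where
  "moebius_move a b c z s = (s + z * (a + b * s)) / (1 - z * c * s)"

lemma log_deriv_diff:
  assumes "(f has_field_derivative f') (at 0)" "(g has_field_derivative g') (at 0)" "f 0 - g 0 \<noteq> 0"
  shows "log_deriv (\<lambda>z. f z - g z) ((f' - g') / (f 0 - g 0))"
  unfolding log_deriv_def using assms by (auto intro!: derivative_eq_intros)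

lemma tendsto_cross_ratio:
  assumes "\<And>k. ((\<lambda>z. \<tau> k z) \<longlongrightarrow> t k) F" "inj t" "distinct [i, j, k, l]"
  shows "((\<lambda>z. cross_ratio (\<lambda>k. \<tau> k z) (\<lambda>_. 1) i j k l) \<longlongrightarrow> cross_ratio t (\<lambda>_. 1) i j k l) F"
  unfolding cross_ratio_def det2_def using assms(2,3) by (intro tendsto_intros assms(1)) (auto simp: inj_eq)

lemma eventually_near_config:
  fixes t :: "'n::finite \<Rightarrow> complex"
  assumes "\<And>k. ((\<lambda>z. \<tau> k z) \<longlongrightarrow> t k) F" "inj t" "\<epsilon> > 0"
  shows "eventually (\<lambda>z. near_config \<epsilon> t (\<lambda>_. 1) (\<lambda>k. \<tau> k z) (\<lambda>_. 1)) F"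
  unfolding near_config_def separated_def
proof (intro eventually_conj eventually_all_finite_type)
  fix i j :: 'n
  show "eventually (\<lambda>z. i \<noteq> j \<longrightarrow> det2 (\<lambda>k. \<tau> k z) (\<lambda>_. 1) i j \<noteq> 0) F"
  proof (cases "i = j")
    case False
    have "((\<lambda>z. det2 (\<lambda>k. \<tau> k z) (\<lambda>_. 1) i j) \<longlongrightarrow> det2 t (\<lambda>_. 1) i j) F"
      unfolding det2_def by (intro tendsto_intros assms(1))
    moreover have "det2 t (\<lambda>_. 1) i j \<noteq> 0" using False assms(2) by (auto simp: det2_def inj_eq)
    ultimately have "eventually (\<lambda>z. det2 (\<lambda>k. \<tau> k z) (\<lambda>_. 1) i j \<noteq> 0) F" by (rule tendsto_imp_eventually_ne)
    then show ?thesis by eventually_elim simp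
  qed simp
  fix k l
  show "eventually (\<lambda>z. distinct [i, j, k, l] \<longrightarrow> cmod (cross_ratio (\<lambda>k. \<tau> k z) (\<lambda>_. 1) i j k l - cross_ratio t (\<lambda>_. 1) i j k l) < \<epsilon>) F"
  proof (cases "distinct [i, j, k, l]")
    case True
    have "((\<lambda>z. cross_ratio (\<lambda>k. \<tau> k z) (\<lambda>_. 1) i j k l - cross_ratio t (\<lambda>_. 1) i j k l) \<longlongrightarrow> 0) F"
      using tendsto_diff[OF tendsto_cross_ratio[OF assms(1,2) True] tendsto_const[of "cross_ratio t (\<lambda>_. 1) i j k l"]] by simp
    then have "eventually (\<lambda>z. cmod (cross_ratio (\<lambda>k. \<tau> k z) (\<lambda>_. 1) i j k l - cross_ratio t (\<lambda>_. 1) i j k l) < \<epsilon>) F"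
      using assms(3) by (auto dest!: tendstoD simp: dist_norm)
    then show ?thesis by eventually_elim simp
  qed (rule always_eventually, auto)
qed

text \<open>Rigidity is an open condition: it is witnessed by finitely many inequations between cross ratios.\<close>

lemma eventually_rigid_config:
  fixes t :: "'n::finite \<Rightarrow> complex"
  assumes "\<And>k. ((\<lambda>z. \<tau> k z) \<longlongrightarrow> t k) F" "inj t" "rigid_config t (\<lambda>_. 1)"
  shows "eventually (\<lambda>z. rigid_config (\<lambda>k. \<tau> k z) (\<lambda>_. 1)) F"
proof -
  have "eventually (\<lambda>z. \<sigma> \<noteq> id \<longrightarrow> bij \<sigma> \<longrightarrow> (\<exists>i j k l. distinct [i, j, k, l] \<and>
     cross_ratio (\<lambda>k. \<tau> k z) (\<lambda>_. 1) (\<sigma> i) (\<sigma> j) (\<sigma> k) (\<sigma> l) \<noteq> cross_ratio (\<lambda>k. \<tau> k z) (\<lambda>_. 1) i j k l)) F" for \<sigma> :: "'n \<Rightarrow> 'n"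
  proof (cases "\<sigma> \<noteq> id \<and> bij \<sigma>")
    case True
    then obtain i j k l where d: "distinct [i, j, k, l]" and ne: "cross_ratio t (\<lambda>_. 1) (\<sigma> i) (\<sigma> j) (\<sigma> k) (\<sigma> l) \<noteq> cross_ratio t (\<lambda>_. 1) i j k l"
      using assms(3) unfolding rigid_config_def by blast
    have d': "distinct [\<sigma> i, \<sigma> j, \<sigma> k, \<sigma> l]" using d True by (auto simp: bij_def inj_eq)
    have "((\<lambda>z. cross_ratio (\<lambda>k. \<tau> k z) (\<lambda>_. 1) (\<sigma> i) (\<sigma> j) (\<sigma> k) (\<sigma> l) - cross_ratio (\<lambda>k. \<tau> k z) (\<lambda>_. 1) i j k l)
      \<longlongrightarrow> cross_ratio t (\<lambda>_. 1) (\<sigma> i) (\<sigma> j) (\<sigma> k) (\<sigma> l) - cross_ratio t (\<lambda>_. 1) i j k l) F"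
      by (intro tendsto_diff tendsto_cross_ratio assms(1,2) d d')
    then have "eventually (\<lambda>z. cross_ratio (\<lambda>k. \<tau> k z) (\<lambda>_. 1) (\<sigma> i) (\<sigma> j) (\<sigma> k) (\<sigma> l) - cross_ratio (\<lambda>k. \<tau> k z) (\<lambda>_. 1) i j k l \<noteq> 0) F"
      by (rule tendsto_imp_eventually_ne) (use ne in simp)
    then show ?thesis by eventually_elim (use d in auto)
  qed (rule always_eventually, auto)
  then have "eventually (\<lambda>z. \<forall>\<sigma>. \<sigma> \<noteq> id \<longrightarrow> bij \<sigma> \<longrightarrow> (\<exists>i j k l. distinct [i, j, k, l] \<and>
     cross_ratio (\<lambda>k. \<tau> k z) (\<lambda>_. 1) (\<sigma> i) (\<sigma> j) (\<sigma> k) (\<sigma> l) \<noteq> cross_ratio (\<lambda>k. \<tau> k z) (\<lambda>_. 1) i j k l)) F"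
    by (rule eventually_all_finite_type)
  then show ?thesis by eventually_elim (unfold rigid_config_def, blast)
qed

lemma cross_ratio_log_deriv:
  fixes \<tau> :: "'n \<Rightarrow> complex \<Rightarrow> complex"
  assumes "\<And>k. (\<tau> k has_field_derivative \<sigma> k) (at 0)" "\<And>k. \<tau> k 0 = t k" "inj t" "distinct [i, j, k, l]"
  shows "log_deriv (\<lambda>z. cross_ratio (\<lambda>k. \<tau> k z) (\<lambda>_. 1) i j k l)
     ((\<sigma> i - \<sigma> j) / (t i - t j) + (\<sigma> k - \<sigma> l) / (t k - t l) - ((\<sigma> i - \<sigma> k) / (t i - t k) + (\<sigma> j - \<sigma> l) / (t j - t l)))"
proof -
  have *: "log_deriv (\<lambda>z. \<tau> i z - \<tau> j z) ((\<sigma> i - \<sigma> j) / (t i - t j))" if "i \<noteq> j" for i j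
    unfolding assms(2)[symmetric]
    by (rule log_deriv_diff[OF assms(1,1)]) (use that assms(3) in \<open>auto simp: assms(2) inj_eq\<close>)
  show ?thesis unfolding cross_ratio_def det2_def mult_1_right
    using assms(4) by (intro log_deriv_divide log_deriv_mult *) auto
qed

context quadric_pencil
begin

lemma moebius_arc:
  assumes rt: "roots_at x t C"
  obtains \<gamma> r C' where "r > 0" "\<gamma> 0 = x" "\<And>i. (\<lambda>z. \<gamma> z $ i) holomorphic_on ball 0 r"
    "\<And>i. ((\<lambda>z. \<gamma> z $ i) has_field_derivative (\<kappa> *s x + W x t *v (\<chi> k. - (a + b * t k + c * (t k)\<^sup>2) / 2)) $ i) (at 0)"
    "\<And>z. z \<in> ball 0 r \<Longrightarrow> roots_at (\<gamma> z) (\<lambda>k. moebius_move a b c z (t k)) (C' z)"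
    "\<And>z k. z \<in> ball 0 r \<Longrightarrow> 1 - z * c * t k \<noteq> 0" "\<And>z. z \<in> ball 0 r \<Longrightarrow> 1 + z * b + z * a * (z * c) \<noteq> 0"
    "\<And>k. ((\<lambda>z. moebius_move a b c z (t k)) has_field_derivative a + b * t k + c * (t k)\<^sup>2) (at 0)"
proof -
  have e1: "eventually (\<lambda>z. 1 - z * c * t k \<noteq> 0) (nhds 0)" for k
  proof (rule tendsto_imp_eventually_ne)
    show "((\<lambda>z. 1 - z * c * t k) \<longlongrightarrow> 1 - 0 * c * t k) (nhds 0)" by (intro tendsto_intros filterlim_ident)
  qed simp
  have e2: "eventually (\<lambda>z. 1 + z * b + z * a * (z * c) \<noteq> 0) (nhds 0)"
  proof (rule tendsto_imp_eventually_ne)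
    show "((\<lambda>z. 1 + z * b + z * a * (z * c)) \<longlongrightarrow> 1 + 0 * b + 0 * a * (0 * c)) (nhds 0)" by (intro tendsto_intros filterlim_ident)
  qed simp
  have "eventually (\<lambda>z. (\<forall>k. 1 - z * c * t k \<noteq> 0) \<and> 1 + z * b + z * a * (z * c) \<noteq> 0) (nhds 0)"
    by (intro eventually_conj eventually_all_finite_type e1 e2)
  then obtain r0 where r0: "r0 > 0" "\<And>z. z \<in> ball 0 r0 \<Longrightarrow> (\<forall>k. 1 - z * c * t k \<noteq> 0) \<and> 1 + z * b + z * a * (z * c) \<noteq> 0"
    unfolding eventually_nhds_metric by (auto simp: dist_commute)
  have hol: "(\<lambda>z. moebius_move a b c z (t k)) holomorphic_on ball 0 r0" for k
    unfolding moebius_move_def using r0(2) by (intro holomorphic_intros) auto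
  have z0: "moebius_move a b c 0 (t k) = t k" for k by (simp add: moebius_move_def)
  have der: "((\<lambda>z. moebius_move a b c z (t k)) has_field_derivative a + b * t k + c * (t k)\<^sup>2) (at 0)" for k
    unfolding moebius_move_def by (auto intro!: derivative_eq_intros simp: power2_eq_square algebra_simps)
  obtain \<gamma> r C' where g: "r > 0" "r \<le> r0" "\<gamma> 0 = x" "\<And>i. (\<lambda>z. \<gamma> z $ i) holomorphic_on ball 0 r"
    "\<And>i. ((\<lambda>z. \<gamma> z $ i) has_field_derivative (\<kappa> *s x + W x t *v (\<chi> k. - (a + b * t k + c * (t k)\<^sup>2) / 2)) $ i) (at 0)"
    "\<And>z. z \<in> ball 0 r \<Longrightarrow> roots_at (\<gamma> z) (\<lambda>k. moebius_move a b c z (t k)) (C' z)"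
    by (rule root_arc[where \<tau> = "\<lambda>k z. moebius_move a b c z (t k)" and \<kappa> = \<kappa>, OF rt r0(1) hol z0 der]) (rule that)
  have "z \<in> ball 0 r0" if "z \<in> ball 0 r" for z using that g(2) by auto
  then show thesis using that[OF g(1,3-6) _ _ der] r0(2) by blast
qed

text \<open>Kernels are represented by their preimages in the orthogonal space of \<open>x\<close>, so the line of \<open>x\<close> is
  included.\<close>

definition quadratic_kernel :: "complex^'v \<Rightarrow> ('n \<Rightarrow> complex) \<Rightarrow> (complex^'v) set" where
  "quadratic_kernel x t = {\<kappa> *s x + W x t *v (\<chi> k. a + b * t k + c * (t k)\<^sup>2) | \<kappa> a b c. True}"

lemma roots_at_inj: "roots_at x t C \<Longrightarrow> inj t" by (simp add: roots_at_def)

text \<open>A quadratic velocity is that of a projective motion of the roots, along which the class of the pencil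
  is constant.\<close>

lemma quadratic_kernel_subset_ker:
  assumes rt: "roots_at x t C" shows "quadratic_kernel x t \<subseteq> ker_moduli_map TYPE('n) X D1 D2 x"
proof
  fix v assume "v \<in> quadratic_kernel x t"
  then obtain \<kappa> a b c where v: "v = \<kappa> *s x + W x t *v (\<chi> k. a + b * t k + c * (t k)\<^sup>2)"
    by (auto simp: quadratic_kernel_def)
  have vp: "v \<in> perp D1 D2 x" unfolding v by (intro perp_add W_perp[OF rt] perp_scale x_perp[OF rt])
  \<comment> \<open>The factor \<open>-2\<close> compensates the \<open>-1/2\<close> in the tangent vector of a root arc.\<close>
  define a' b' c' where "a' = - 2 * a" and "b' = - 2 * b" and "c' = - 2 * c"
  obtain \<gamma>' r C' where g: "r > 0" "\<gamma>' 0 = x" "\<And>i. (\<lambda>z. \<gamma>' z $ i) holomorphic_on ball 0 r"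
    "\<And>i. ((\<lambda>z. \<gamma>' z $ i) has_field_derivative (\<kappa> *s x + W x t *v (\<chi> k. - (a' + b' * t k + c' * (t k)\<^sup>2) / 2)) $ i) (at 0)"
    "\<And>z. z \<in> ball 0 r \<Longrightarrow> roots_at (\<gamma>' z) (\<lambda>k. moebius_move a' b' c' z (t k)) (C' z)"
    "\<And>z k. z \<in> ball 0 r \<Longrightarrow> 1 - z * c' * t k \<noteq> 0" "\<And>z. z \<in> ball 0 r \<Longrightarrow> 1 + z * b' + z * a' * (z * c') \<noteq> 0"
    by (rule moebius_arc[OF rt, of \<kappa> a' b' c']) (rule that)
  have v': "v = \<kappa> *s x + W x t *v (\<chi> k. - (a' + b' * t k + c' * (t k)\<^sup>2) / 2)"
  proof -
    have "(\<chi> k. - (a' + b' * t k + c' * (t k)\<^sup>2) / 2) = (\<chi> k. a + b * t k + c * (t k)\<^sup>2)"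
      by (simp add: a'_def b'_def c'_def vec_eq_iff field_simps)
    then show ?thesis by (simp only: v)
  qed
  have arc: "arc_in (X_o TYPE('n) X D1 D2) x v \<gamma>'"
    unfolding arc_in_def v' using g(1-5) in_X_o by blast
  have const: "moduli_map D1 D2 (\<gamma>' z) = pencil_class (Pen t (\<lambda>_. 1))" if "z \<in> ball 0 r" for z
    using moduli_map_roots[OF g(5)[OF that]] pencil_class_moebius[OF g(6,7)[OF that]]
    by (simp add: moebius_move_def)
  show "v \<in> ker_moduli_map TYPE('n) X D1 D2 x"
    unfolding ker_moduli_map_def
  proof (intro CollectI conjI vp allI impI, elim conjE)
    fix h :: "(complex^'n^'n) set set \<Rightarrow> complex" and U \<gamma>
    assume h: "MPQ_holo h U" "moduli_map D1 D2 x \<in> U" and \<gamma>: "arc_in (X_o TYPE('n) X D1 D2) x v \<gamma>"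
    obtain D where D: "\<And>v \<gamma>. arc_in (X_o TYPE('n) X D1 D2) x v \<gamma> \<Longrightarrow>
      ((\<lambda>z. h (moduli_map D1 D2 (\<gamma> z))) has_derivative (\<lambda>z. D (z *s v))) (at 0)"
      by (rule moduli_map_chain_rule[OF rt h]) (rule that)
    have "((\<lambda>z. h (moduli_map D1 D2 (\<gamma>' z))) has_derivative (\<lambda>z. 0)) (at 0)"
    proof (rule has_derivative_transform_within_open[where s = "ball 0 r" and f = "\<lambda>z. h (pencil_class (Pen t (\<lambda>_. 1)))"])
      show "0 \<in> ball (0 :: complex) r" using g(1) by simp
    qed (auto simp: const)
    from has_derivative_unique[OF D[OF arc] this] have "(\<lambda>z. D (z *s v)) = (\<lambda>z. 0)" .
    with D[OF \<gamma>] show "((\<lambda>z. h (moduli_map D1 D2 (\<gamma> z))) has_field_derivative 0) (at 0)"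
      by (simp add: has_field_derivative_def mult_zero_left[abs_def])
  qed
qed

text \<open>Along a linear motion of the roots that is tangent to the kernel, the local functions given by the
  cross ratios are stationary.\<close>

lemma ker_subset_quadratic_kernel:
  assumes rt: "roots_at x t C" and rig: "rigid_config t (\<lambda>_. 1)"
  shows "ker_moduli_map TYPE('n) X D1 D2 x \<subseteq> quadratic_kernel x t"
proof
  fix v assume v: "v \<in> ker_moduli_map TYPE('n) X D1 D2 x"
  then have "v \<in> perp D1 D2 x" by (simp add: ker_moduli_map_def)
  then obtain y \<kappa> where yk: "v = W x t *v y + \<kappa> *s x" using W_surj[OF rt] by blast
  define \<sigma> where "\<sigma> k = - 2 * y $ k" for k
  define \<tau> where "\<tau> k z = t k + z * \<sigma> k" for k z
  have der: "(\<tau> k has_field_derivative \<sigma> k) (at 0)" for k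
    unfolding \<tau>_def by (auto intro!: derivative_eq_intros)
  have t0: "\<tau> k 0 = t k" for k by (simp add: \<tau>_def)
  have hol: "\<tau> k holomorphic_on ball 0 1" for k unfolding \<tau>_def by (intro holomorphic_intros)
  obtain \<gamma> r C' where g: "r > 0" "r \<le> 1" "\<gamma> 0 = x" "\<And>i. (\<lambda>z. \<gamma> z $ i) holomorphic_on ball 0 r"
    "\<And>i. ((\<lambda>z. \<gamma> z $ i) has_field_derivative (\<kappa> *s x + W x t *v (\<chi> k. - \<sigma> k / 2)) $ i) (at 0)"
    "\<And>z. z \<in> ball 0 r \<Longrightarrow> roots_at (\<gamma> z) (\<lambda>k. \<tau> k z) (C' z)"
    by (rule root_arc[where \<tau> = \<tau> and \<kappa> = \<kappa>, OF rt zero_less_one hol t0 der]) (rule that)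
  have v': "v = \<kappa> *s x + W x t *v (\<chi> k. - \<sigma> k / 2)"
    by (simp add: yk \<sigma>_def add.commute)
  have arc: "arc_in (X_o TYPE('n) X D1 D2) x v \<gamma>"
    unfolding arc_in_def v' using g(1,3-6) in_X_o by blast
  have tend: "((\<lambda>z. \<tau> k z) \<longlongrightarrow> t k) (nhds 0)" for k
  proof -
    have "((\<lambda>z. \<tau> k z) \<longlongrightarrow> \<tau> k 0) (nhds 0)"
      using DERIV_isCont[OF der[of k]] by (simp add: isCont_def tendsto_at_iff_tendsto_nhds)
    then show ?thesis by (simp only: t0)
  qed
  have "(\<sigma> i - \<sigma> j) / (t i - t j) + (\<sigma> k - \<sigma> l) / (t k - t l)
      - ((\<sigma> i - \<sigma> k) / (t i - t k) + (\<sigma> j - \<sigma> l) / (t j - t l)) = 0" if d: "distinct [i, j, k, l]" for i j k l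
  proof -
    have c1: "CARD('n) > 1" using card_n by simp
    obtain h U \<epsilon> where e: "\<epsilon> > 0" and h: "MPQ_holo h (U :: (complex^'n^'n) set set set)"
      and hU: "\<And>a b. near_config \<epsilon> t (\<lambda>_. 1) a b \<Longrightarrow> pencil_class (Pen a b) \<in> U"
      and hv: "\<And>a b. near_config \<epsilon> t (\<lambda>_. 1) a b \<Longrightarrow> h (pencil_class (Pen a b)) = cross_ratio a b i j k l"
      by (rule cross_ratio_MPQ_holo[OF rig c1 d]) (rule that)
    have ev: "eventually (\<lambda>z. near_config \<epsilon> t (\<lambda>_. 1) (\<lambda>k. \<tau> k z) (\<lambda>_. 1)) (nhds 0)"
      by (rule eventually_near_config[OF tend roots_at_inj[OF rt] e])
    from eventually_nhds_x_imp_x[OF this] have "moduli_map D1 D2 x \<in> U"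
      using hU moduli_map_roots[OF rt] by (simp add: t0)
    then have "((\<lambda>z. h (moduli_map D1 D2 (\<gamma> z))) has_field_derivative 0) (at 0)"
      using v h arc unfolding ker_moduli_map_def by blast
    moreover have "eventually (\<lambda>z. h (moduli_map D1 D2 (\<gamma> z)) = cross_ratio (\<lambda>k. \<tau> k z) (\<lambda>_. 1) i j k l) (nhds 0)"
    proof -
      have "eventually (\<lambda>z. z \<in> ball 0 r) (nhds (0 :: complex))"
        by (rule eventually_nhds_in_open) (use g(1) in auto)
      with ev show ?thesis
        by eventually_elim (use hv moduli_map_roots[OF g(6)] in simp)
    qed
    ultimately show ?thesis
      by (rule log_deriv_zero_if_stationary[OF cross_ratio_log_deriv[OF der t0 roots_at_inj[OF rt] d]])
  qed
  moreover obtain i j k :: 'n where "distinct [i, j, k]" using distinct_indices_n by metis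
  ultimately obtain a b c where abc: "\<And>k. \<sigma> k = a + b * t k + c * (t k)\<^sup>2"
    using cross_ratio_preserving_quadratic[OF roots_at_inj[OF rt], of i j k \<sigma>] by blast
  have "(\<chi> k. - \<sigma> k / 2) = (\<chi> k. (- a / 2) + (- b / 2) * t k + (- c / 2) * (t k)\<^sup>2)"
    by (simp add: vec_eq_iff abc field_simps)
  then have "v = \<kappa> *s x + W x t *v (\<chi> k. (- a / 2) + (- b / 2) * t k + (- c / 2) * (t k)\<^sup>2)"
    unfolding v' by (simp only:)
  then show "v \<in> quadratic_kernel x t" unfolding quadratic_kernel_def by blast
qed

lemma ker_moduli_map_eq:
  assumes "roots_at x t C" "rigid_config t (\<lambda>_. 1)"
  shows "ker_moduli_map TYPE('n) X D1 D2 x = quadratic_kernel x t"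
  using quadratic_kernel_subset_ker[OF assms(1)] ker_subset_quadratic_kernel[OF assms] by blast

text \<open>The rows span the coordinates of \<open>quadratic_kernel\<close> in the frame.\<close>

definition vander :: "('n \<Rightarrow> complex) \<Rightarrow> complex^'n^3" where
  "vander t = (\<chi> m k. if m = 1 then 1 else if m = 2 then t k else (t k)\<^sup>2)"

lemma minor_vander: "minor (vander t) i j k = (t j - t i) * (t k - t i) * (t k - t j)"
  by (simp add: minor_expand vander_def power2_eq_square algebra_simps)

lemma span_vander: "vec.span (rows (vander t)) = {\<chi> k. a + b * t k + c * (t k)\<^sup>2 | a b c. True}"
proof -
  have e: "y v* vander t = (\<chi> k. y$1 + y$2 * t k + y$3 * (t k)\<^sup>2)" for y
    by (simp add: vec_eq_iff vector_matrix_component sum_3 vander_def)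
  show ?thesis unfolding span_rows
  proof (intro equalityI subsetI)
    fix w assume "w \<in> range (\<lambda>y. y v* vander t)"
    then show "w \<in> {\<chi> k. a + b * t k + c * (t k)\<^sup>2 | a b c. True}" unfolding e by blast
  next
    fix w assume "w \<in> {\<chi> k. a + b * t k + c * (t k)\<^sup>2 | a b c. True}"
    then obtain a b c where w: "w = (\<chi> k. a + b * t k + c * (t k)\<^sup>2)" by blast
    have "w = (vector [a, b, c] :: complex^3) v* vander t" unfolding e w by (simp add: vector_3)
    then show "w \<in> range (\<lambda>y. y v* vander t)" by blast
  qed
qed

lemma quadratic_kernel_add: "v \<in> quadratic_kernel x t \<Longrightarrow> v + c *s x \<in> quadratic_kernel x t"
  unfolding quadratic_kernel_def
proof clarify
  fix \<kappa> a b c'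
  have "\<kappa> *s x + W x t *v (\<chi> k. a + b * t k + c' * (t k)\<^sup>2) + c *s x
     = (\<kappa> + c) *s x + W x t *v (\<chi> k. a + b * t k + c' * (t k)\<^sup>2)" by (simp add: vector_sadd_rdistrib)
  then show "\<exists>\<kappa>' a' b' c''. \<kappa> *s x + W x t *v (\<chi> k. a + b * t k + c' * (t k)\<^sup>2) + c *s x
     = \<kappa>' *s x + W x t *v (\<chi> k. a' + b' * t k + c'' * (t k)\<^sup>2) \<and> True" by blast
qed

lemma refined_moduli_map_roots:
  assumes rt: "roots_at x t C" and rig: "rigid_config t (\<lambda>_. 1)"
  shows "refined_moduli_map X D1 D2 x = pair_class (Pen (\<lambda>k. t k * frame_norm x t k) (frame_norm x t)) (vec.span (rows (vander t)))"
proof -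
  have X: "quad D1 x = 0" "quad D2 x = 0" using in_X[OF rt] by (auto simp: X_def)
  have K: "ker_moduli_map TYPE('n) X D1 D2 x = quadratic_kernel x t" by (rule ker_moduli_map_eq[OF rt rig])
  have "refined_moduli_map X D1 D2 x = pair_class (II D1 D2 (W x t)) {w. W x t *v w \<in> ker_moduli_map TYPE('n) X D1 D2 x}"
    by (rule refined_moduli_map_eq[OF _ _ X W_frame[OF rt]]) (auto simp: K quadratic_kernel_add)
  moreover have "{w. W x t *v w \<in> quadratic_kernel x t} = vec.span (rows (vander t))"
  proof (intro equalityI subsetI)
    fix w assume "w \<in> {w. W x t *v w \<in> quadratic_kernel x t}"
    then obtain \<kappa> a b c where "W x t *v w = \<kappa> *s x + W x t *v (\<chi> k. a + b * t k + c * (t k)\<^sup>2)"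
      by (auto simp: quadratic_kernel_def)
    then have "W x t *v w + 0 *s x = W x t *v (\<chi> k. a + b * t k + c * (t k)\<^sup>2) + \<kappa> *s x" by (simp add: add.commute)
    from tangent_frame_inj[OF W_frame[OF rt] this] show "w \<in> vec.span (rows (vander t))" unfolding span_vander by blast
  next
    fix w assume "w \<in> vec.span (rows (vander t))"
    then obtain a b c where w: "w = (\<chi> k. a + b * t k + c * (t k)\<^sup>2)" unfolding span_vander by blast
    have "W x t *v w = 0 *s x + W x t *v (\<chi> k. a + b * t k + c * (t k)\<^sup>2)" by (simp add: w)
    then show "w \<in> {w. W x t *v w \<in> quadratic_kernel x t}" unfolding quadratic_kernel_def by blast
  qed
  ultimately show ?thesis by (simp add: K II_W[OF rt])
qed

end

section \<open>Two invariants of pairs\<close>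

lemma cross_ratio_pair_invariant: "pair_invariant (\<lambda>a b p. cross_ratio a b i j k l)"
  unfolding pair_invariant_def
proof (intro allI impI)
  fix a b :: "'a \<Rightarrow> complex" and p :: "complex^'a^3" and a' b' p' c \<alpha> \<beta> \<gamma> \<delta> and M :: "complex^3^3"
  assume "\<forall>k. c k \<noteq> 0" "\<alpha> * \<delta> - \<beta> * \<gamma> \<noteq> 0" "\<forall>k. a' k = (c k)\<^sup>2 * (\<alpha> * a k + \<beta> * b k)" "\<forall>k. b' k = (c k)\<^sup>2 * (\<gamma> * a k + \<delta> * b k)"
  then show "cross_ratio a' b' i j k l = cross_ratio a b i j k l"
    using cross_ratio_transform[where a = a and b = b and \<sigma> = "\<lambda>x. x" and c = c and a' = a' and b' = b'] by blast
qed

lemma cross_ratio_pair_regular: "distinct [i, j, k, l] \<Longrightarrow> pair_regular i0 j0 k0 (\<lambda>a b p. cross_ratio a b i j k l)"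
  unfolding pair_regular_def by (intro allI impI cdiff_cross_ratio) auto

text \<open>Rescaling the coordinates by \<open>c\<close> divides the square of a minor by \<open>(c\<^sub>i c\<^sub>j c\<^sub>k)\<^sup>2\<close> and multiplies \<open>det2 i j\<close> by
  \<open>(c\<^sub>i c\<^sub>j)\<^sup>2\<close>, leaving a factor that depends on \<open>k\<close> only and cancels in the quotient.\<close>

definition minor_ratio :: "'n \<Rightarrow> 'n \<Rightarrow> 'n \<Rightarrow> 'n \<Rightarrow> ('n::finite \<Rightarrow> complex) \<Rightarrow> ('n \<Rightarrow> complex) \<Rightarrow> complex^'n^3 \<Rightarrow> complex" where
  "minor_ratio i l j k a b p = ((minor p i j k)\<^sup>2 * det2 a b i j) / ((minor p l j k)\<^sup>2 * det2 a b l j)"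

lemma minor_ratio_pair_invariant: "pair_invariant (minor_ratio i l j k)"
  unfolding pair_invariant_def
proof (intro allI impI)
  fix a b :: "'a \<Rightarrow> complex" and p :: "complex^'a^3" and a' b' p' c \<alpha> \<beta> \<gamma> \<delta> and M :: "complex^3^3"
  assume c: "\<forall>k. c k \<noteq> 0" and D: "\<alpha> * \<delta> - \<beta> * \<gamma> \<noteq> 0" and a': "\<forall>k. a' k = (c k)\<^sup>2 * (\<alpha> * a k + \<beta> * b k)"
    and b': "\<forall>k. b' k = (c k)\<^sup>2 * (\<gamma> * a k + \<delta> * b k)"
    and M: "det M \<noteq> 0" and p': "\<forall>m k. c k * p' $ m $ k = (M ** p) $ m $ k"
  define \<Delta> where "\<Delta> = \<alpha> * \<delta> - \<beta> * \<gamma>"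
  have d: "det2 a' b' i j = (c i)\<^sup>2 * (c j)\<^sup>2 * \<Delta> * det2 a b i j" for i j
    unfolding \<Delta>_def by (rule det2_transform[where \<sigma> = "\<lambda>x. x"]) (use a' b' in auto)
  have m: "c i * c j * c k * minor p' i j k = det M * minor p i j k" for i j k
    unfolding minor_mult[symmetric] by (rule minor_scale) (use p' in auto)
  have s: "(c k)\<^sup>2 * ((minor p' i j k)\<^sup>2 * det2 a' b' i j) = (det M)\<^sup>2 * \<Delta> * ((minor p i j k)\<^sup>2 * det2 a b i j)" for i j k
  proof -
    have "(c k)\<^sup>2 * ((minor p' i j k)\<^sup>2 * det2 a' b' i j) = (c i * c j * c k * minor p' i j k)\<^sup>2 * \<Delta> * det2 a b i j"
      unfolding d by (simp add: power_mult_distrib mult_ac)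
    then show ?thesis unfolding m by (simp add: power_mult_distrib mult_ac)
  qed
  have "minor_ratio i l j k a' b' p' = ((c k)\<^sup>2 * ((minor p' i j k)\<^sup>2 * det2 a' b' i j)) / ((c k)\<^sup>2 * ((minor p' l j k)\<^sup>2 * det2 a' b' l j))"
    using c by (simp add: minor_ratio_def)
  also have "\<dots> = minor_ratio i l j k a b p" unfolding s using M D by (simp add: minor_ratio_def \<Delta>_def)
  finally show "minor_ratio i l j k a' b' p' = minor_ratio i l j k a b p" .
qed

lemma minor_ratio_pair_regular: "l \<noteq> j \<Longrightarrow> pair_regular l j k (minor_ratio i l j k)"
  unfolding pair_regular_def minor_ratio_def
  by (intro allI impI cdiff_divide cdiff_mult cdiff_power cdiff_minor cdiff_det2) (auto simp: separated_def)

section \<open>Rigid pencils and rigid configurations of roots\<close>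

lemma cross_ratio_permuted: "cross_ratio (\<lambda>k. t (\<sigma> k)) (\<lambda>_. 1) i j k l = cross_ratio t (\<lambda>_. 1) (\<sigma> i) (\<sigma> j) (\<sigma> k) (\<sigma> l)"
  by (simp add: cross_ratio_def det2_def)

lemma quadratic_three_zeros:
  fixes t :: "'n \<Rightarrow> complex" and p q r :: complex and i j k :: 'n
  assumes "inj t" "distinct [i, j, k]" "\<And>l. p * (t l)\<^sup>2 + q * t l + r = 0" shows "p = 0 \<and> q = 0 \<and> r = 0"
proof -
  have ne: "t i - t j \<noteq> 0" "t i - t k \<noteq> 0" "t j - t k \<noteq> 0" using assms(1,2) by (auto simp: inj_eq)
  have "(t i - t j) * (p * (t i + t j) + q) = 0" "(t i - t k) * (p * (t i + t k) + q) = 0"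
    using assms(3)[of i] assms(3)[of j] assms(3)[of k] by algebra+
  then have e: "p * (t i + t j) + q = 0" "p * (t i + t k) + q = 0" using ne by auto
  then have "p * (t j - t k) = 0" by algebra
  then have "p = 0" using ne by simp
  then show ?thesis using e assms(3)[of i] by simp
qed

text \<open>In the basis \<open>A\<close>, \<open>B\<close> an automorphism of the pencil is an invertible matrix.  If it preserves the
  degenerate elements, it induces a permutation \<open>\<sigma>\<close> of the roots by a projective transformation.  Then
  \<open>\<sigma>\<close> preserves cross ratios, so it is trivial, and a projective transformation fixing three points is
  the identity.\<close>

lemma rigid_pencil_if_rigid_config:
  fixes t :: "'n::finite \<Rightarrow> complex" and A B :: "complex^'m^'m"
  assumes inj: "inj t" and d: "distinct [i0, j0, k0 :: 'n]" and rig: "rigid_config t (\<lambda>_. 1)"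
    and deg: "\<And>u v. degenerate (mscale u A + mscale v B) \<longleftrightarrow> (\<exists>l. u * t l + v = 0)"
    and ind: "forms_independent A B"
  shows "rigid_pencil (form_span A B)"
  unfolding rigid_pencil_def
proof (intro allI impI, elim conjE)
  fix T assume bij: "bij_betw T (form_span A B) (form_span A B)"
    and lin: "\<forall>R\<in>form_span A B. \<forall>S\<in>form_span A B. \<forall>a b. T (mscale a R + mscale b S) = mscale a (T R) + mscale b (T S)"
    and dg: "\<forall>R\<in>form_span A B. degenerate (T R) \<longleftrightarrow> degenerate R"
  have mem: "mscale u A + mscale v B \<in> form_span A B" for u v unfolding form_span_def by blast
  have "mscale 1 A + mscale 0 B = A" "mscale 0 A + mscale 1 B = B" by (simp_all add: vec_eq_iff)
  then have AB: "A \<in> form_span A B" "B \<in> form_span A B" using mem by metis+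
  then have "T A \<in> form_span A B" "T B \<in> form_span A B" using bij bij_betwE by blast+
  then obtain \<alpha> \<beta> \<gamma> \<delta> where TA: "T A = mscale \<alpha> A + mscale \<beta> B" and TB: "T B = mscale \<gamma> A + mscale \<delta> B"
    unfolding form_span_def by blast
  have T: "T (mscale u A + mscale v B) = mscale (u * \<alpha> + v * \<gamma>) A + mscale (u * \<beta> + v * \<delta>) B" for u v
  proof -
    have "T (mscale u A + mscale v B) = mscale u (T A) + mscale v (T B)" using lin AB by blast
    then show ?thesis by (simp add: TA TB vec_eq_iff algebra_simps)
  qed
  have inj0: "u = 0 \<and> v = 0" if "u * \<alpha> + v * \<gamma> = 0" "u * \<beta> + v * \<delta> = 0" for u v
  proof -
    have "T (mscale u A + mscale v B) = T (mscale 0 A + mscale 0 B)" unfolding T using that by simp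
    then have "mscale u A + mscale v B = mscale 0 A + mscale 0 B"
      using bij mem unfolding bij_betw_def inj_on_def by blast
    moreover have "mscale 0 A + mscale 0 B = 0" by (simp add: vec_eq_iff)
    ultimately show ?thesis using ind unfolding forms_independent_def by metis
  qed
  have D: "\<alpha> * \<delta> - \<beta> * \<gamma> \<noteq> 0"
  proof
    assume D0: "\<alpha> * \<delta> - \<beta> * \<gamma> = 0"
    have "\<delta> = 0 \<and> - \<beta> = 0" by (rule inj0) (use D0 in \<open>simp_all add: algebra_simps\<close>)
    moreover have "\<gamma> = 0 \<and> - \<alpha> = 0" by (rule inj0) (use D0 in \<open>simp_all add: algebra_simps\<close>)
    ultimately show False using inj0[of 1 0] by simp
  qed
  have ex: "\<exists>j. t j * (\<alpha> - \<gamma> * t k) = \<delta> * t k - \<beta> \<and> \<alpha> - \<gamma> * t k \<noteq> 0" for k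
  proof -
    have "degenerate (mscale 1 A + mscale (- t k) B)" unfolding deg by auto
    then have "degenerate (T (mscale 1 A + mscale (- t k) B))" using dg mem by blast
    then obtain j where j: "(\<alpha> - t k * \<gamma>) * t j + (\<beta> - t k * \<delta>) = 0" unfolding T deg by auto
    have "\<alpha> - \<gamma> * t k \<noteq> 0"
    proof
      assume z: "\<alpha> - \<gamma> * t k = 0"
      then have "\<beta> - t k * \<delta> = 0" using j by (simp add: mult.commute)
      then show False using inj0[of 1 "- t k"] z by (simp add: mult.commute)
    qed
    moreover have "t j * (\<alpha> - \<gamma> * t k) = \<delta> * t k - \<beta>" using j by algebra
    ultimately show ?thesis by blast
  qed
  then obtain \<sigma> where s: "\<And>k. t (\<sigma> k) * (\<alpha> - \<gamma> * t k) = \<delta> * t k - \<beta>" and nz: "\<And>k. \<alpha> - \<gamma> * t k \<noteq> 0" by metis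
  define c where "c k = csqrt (1 / (\<alpha> - \<gamma> * t k))" for k
  have c2: "(c k)\<^sup>2 = 1 / (\<alpha> - \<gamma> * t k)" for k by (simp add: c_def)
  have cnz: "c k \<noteq> 0" for k using nz[of k] by (simp add: c_def)
  have a': "t (\<sigma> k) = (c k)\<^sup>2 * (\<delta> * t k + (- \<beta>) * 1)" for k
    using s[of k] nz[of k] by (simp add: c2 field_simps)
  have b': "1 = (c k)\<^sup>2 * ((- \<gamma>) * t k + \<alpha> * 1)" for k
    using nz[of k] by (simp add: c2 field_simps)
  have D': "\<delta> * \<alpha> - (- \<beta>) * (- \<gamma>) \<noteq> 0" using D by (simp add: mult.commute)
  have cross_ratio: "cross_ratio t (\<lambda>_. 1) (\<sigma> i) (\<sigma> j) (\<sigma> k) (\<sigma> l) = cross_ratio t (\<lambda>_. 1) i j k l" for i j k l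
    unfolding cross_ratio_permuted[symmetric]
    by (rule cross_ratio_transform[where \<sigma> = "\<lambda>x. x" and c = c]) (rule a' b' cnz D')+
  have "inj \<sigma>"
  proof (rule injI, rule ccontr)
    fix x y assume xy: "\<sigma> x = \<sigma> y" "x \<noteq> y"
    have "det2 (\<lambda>k. t (\<sigma> k)) (\<lambda>_. 1) x y = (c x)\<^sup>2 * (c y)\<^sup>2 * (\<delta> * \<alpha> - (- \<beta>) * (- \<gamma>)) * det2 t (\<lambda>_. 1) x y"
      by (rule det2_transform[where \<sigma> = "\<lambda>x. x" and c = c]) (rule a' b')+
    moreover have "det2 (\<lambda>k. t (\<sigma> k)) (\<lambda>_. 1) x y = 0" using xy by (simp add: det2_def)
    ultimately have "det2 t (\<lambda>_. 1) x y = 0" using cnz D' by auto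
    then show False using xy inj by (simp add: det2_def inj_eq)
  qed
  then have "bij \<sigma>" by (simp add: bij_def finite_UNIV_inj_surj)
  then have id: "\<sigma> = id" using rig cross_ratio unfolding rigid_config_def by blast
  have "\<gamma> * (t k)\<^sup>2 + (\<delta> - \<alpha>) * t k + (- \<beta>) = 0" for k
  proof -
    have "t k * (\<alpha> - \<gamma> * t k) = \<delta> * t k - \<beta>" using s[of k] by (simp add: id)
    then show ?thesis by algebra
  qed
  from quadratic_three_zeros[OF inj d this] have e: "\<gamma> = 0" "\<delta> = \<alpha>" "\<beta> = 0" by auto
  have "T R = mscale \<alpha> R" if R0: "R \<in> form_span A B" for R
  proof -
    obtain u v where R: "R = mscale u A + mscale v B" using R0 unfolding form_span_def by blast
    show ?thesis unfolding R T by (simp add: e vec_eq_iff algebra_simps)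
  qed
  then show "\<exists>c. \<forall>R\<in>form_span A B. T R = mscale c R" by blast
qed

text \<open>With three points fixed, a further point is determined by its cross ratio with them through a
  projective transformation.\<close>

lemma moebius_from_cross_ratios:
  fixes t s :: "'n::finite \<Rightarrow> complex"
  assumes inj: "inj t" "inj s" and d: "distinct [i, j, k]"
    and cross_ratio: "\<And>l. distinct [i, j, k, l] \<Longrightarrow> cross_ratio s (\<lambda>_. 1) i j k l = cross_ratio t (\<lambda>_. 1) i j k l"
  obtains \<alpha> \<beta> \<gamma> \<delta> where "\<alpha> * \<delta> - \<beta> * \<gamma> \<noteq> 0" "\<And>l. \<alpha> * t l + \<beta> = s l * (\<gamma> * t l + \<delta>)"
proof -
  have ne: "t x - t y \<noteq> 0" "s x - s y \<noteq> 0" if "x \<noteq> y" for x y using inj that by (auto simp: inj_eq)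
  define p where "p = (t i - t j) * (s i - s k)"
  define q where "q = (t i - t k) * (s i - s j)"
  \<comment> \<open>Equality of the cross ratios reads \<open>p (t\<^sub>k - t\<^sub>l)(s\<^sub>j - s\<^sub>l) = q (t\<^sub>j - t\<^sub>l)(s\<^sub>k - s\<^sub>l)\<close>,
     which is affine in each of \<open>t\<^sub>l\<close> and \<open>s\<^sub>l\<close>.\<close>
  have main: "p * (t k - t l) * (s j - s l) = q * (t j - t l) * (s k - s l)" for l
  proof (cases "l \<in> {i, j, k}")
    case True
    then show ?thesis by (auto simp: p_def q_def algebra_simps)
  next
    case False
    then have l: "distinct [i, j, k, l]" using d by auto
    have n: "t i - t k \<noteq> 0" "t j - t l \<noteq> 0" "s i - s k \<noteq> 0" "s j - s l \<noteq> 0" by (rule ne, use l in simp)+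
    from cross_ratio[OF l] have "(s i - s j) * (s k - s l) / ((s i - s k) * (s j - s l)) = (t i - t j) * (t k - t l) / ((t i - t k) * (t j - t l))"
      by (simp add: cross_ratio_def det2_def)
    then have "(s i - s j) * (s k - s l) * ((t i - t k) * (t j - t l)) = (t i - t j) * (t k - t l) * ((s i - s k) * (s j - s l))"
      by (subst (asm) frac_eq_eq) (use n in auto)
    then show ?thesis unfolding p_def q_def by algebra
  qed
  define \<alpha> where "\<alpha> = q * s k - p * s j"
  define \<beta> where "\<beta> = p * t k * s j - q * t j * s k"
  define \<gamma> where "\<gamma> = q - p"
  define \<delta> where "\<delta> = p * t k - q * t j"
  have "\<alpha> * \<delta> - \<beta> * \<gamma> = p * q * (t k - t j) * (s k - s j)"
    unfolding \<alpha>_def \<beta>_def \<gamma>_def \<delta>_def by (simp add: algebra_simps)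
  moreover have "t i - t j \<noteq> 0" "s i - s k \<noteq> 0" "t i - t k \<noteq> 0" "s i - s j \<noteq> 0" "t k - t j \<noteq> 0" "s k - s j \<noteq> 0"
    by (rule ne, use d in fastforce)+
  moreover from this have "p \<noteq> 0" "q \<noteq> 0" unfolding p_def q_def by auto
  ultimately have D: "\<alpha> * \<delta> - \<beta> * \<gamma> \<noteq> 0" by simp
  have "\<alpha> * t l + \<beta> = s l * (\<gamma> * t l + \<delta>)" for l
    using main[of l] unfolding \<alpha>_def \<beta>_def \<gamma>_def \<delta>_def by algebra
  then show ?thesis using that D by blast
qed

text \<open>A permutation that preserves cross ratios comes from a projective transformation of the line, and its
  matrix acts on the pencil in the basis \<open>A\<close>, \<open>B\<close>.\<close>

lemma rigid_config_if_rigid_pencil: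
  fixes t :: "'n::finite \<Rightarrow> complex" and A B :: "complex^'m^'m"
  assumes inj: "inj t" and d: "distinct [i0, j0, k0 :: 'n]" and rig: "rigid_pencil (form_span A B)"
    and deg: "\<And>u v. degenerate (mscale u A + mscale v B) \<longleftrightarrow> (\<exists>l. u * t l + v = 0)"
    and ind: "forms_independent A B"
  shows "rigid_config t (\<lambda>_. 1)"
  unfolding rigid_config_def
proof (intro allI impI, elim conjE)
  fix \<sigma> :: "'n \<Rightarrow> 'n" assume bs: "bij \<sigma>"
    and cross_ratio: "\<forall>i j k l. distinct [i, j, k, l] \<longrightarrow> cross_ratio t (\<lambda>_. 1) (\<sigma> i) (\<sigma> j) (\<sigma> k) (\<sigma> l) = cross_ratio t (\<lambda>_. 1) i j k l"
  have injs: "inj (\<lambda>k. t (\<sigma> k))" using inj bs by (auto simp: inj_def bij_def)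
  obtain \<alpha> \<beta> \<gamma> \<delta> where D: "\<alpha> * \<delta> - \<beta> * \<gamma> \<noteq> 0" and m: "\<And>l. \<alpha> * t l + \<beta> = t (\<sigma> l) * (\<gamma> * t l + \<delta>)"
    by (rule moebius_from_cross_ratios[OF inj injs d]) (use cross_ratio in \<open>auto simp: cross_ratio_permuted\<close>)
  have mem: "mscale u A + mscale v B \<in> form_span A B" for u v unfolding form_span_def by blast
  have uniq: "u = u' \<and> v = v'" if "mscale u A + mscale v B = mscale u' A + mscale v' B" for u v u' v'
  proof -
    have "mscale (u - u') A + mscale (v - v') B = (mscale u A + mscale v B) - (mscale u' A + mscale v' B)"
      by (simp add: vec_eq_iff algebra_simps)
    then have "mscale (u - u') A + mscale (v - v') B = 0" using that by simp
    then show ?thesis using ind unfolding forms_independent_def by fastforce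
  qed
  \<comment> \<open>The coordinates of an element of the pencil.\<close>
  define crd where "crd S = (SOME p. S = mscale (fst p) A + mscale (snd p) B)" for S
  define T where "T S = (case crd S of (u, v) \<Rightarrow> mscale (\<delta> * u - \<gamma> * v) A + mscale (\<alpha> * v - \<beta> * u) B)" for S
  have T: "T (mscale u A + mscale v B) = mscale (\<delta> * u - \<gamma> * v) A + mscale (\<alpha> * v - \<beta> * u) B" for u v
  proof -
    have "mscale u A + mscale v B = mscale (fst (crd (mscale u A + mscale v B))) A + mscale (snd (crd (mscale u A + mscale v B))) B"
      unfolding crd_def by (rule someI[of _ "(u, v)"]) simp
    from uniq[OF this] have "crd (mscale u A + mscale v B) = (u, v)" by (simp add: prod_eq_iff)
    then show ?thesis by (simp add: T_def)
  qed
  have lin: "T (mscale a R + mscale b S) = mscale a (T R) + mscale b (T S)" if "R \<in> form_span A B" "S \<in> form_span A B" for R S a b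
  proof -
    obtain u v u' v' where RS: "R = mscale u A + mscale v B" "S = mscale u' A + mscale v' B"
      using \<open>R \<in> form_span A B\<close> \<open>S \<in> form_span A B\<close> unfolding form_span_def by blast
    have "mscale a R + mscale b S = mscale (a * u + b * u') A + mscale (a * v + b * v') B"
      unfolding RS by (simp add: vec_eq_iff algebra_simps)
    then show ?thesis unfolding RS by (simp add: T) (simp add: vec_eq_iff algebra_simps)
  qed
  define D where "D = \<alpha> * \<delta> - \<beta> * \<gamma>"
  have Dnz: "D \<noteq> 0" using D by (simp add: D_def)
  have bij: "bij_betw T (form_span A B) (form_span A B)"
  proof (rule bij_betw_byWitness[where f' = "\<lambda>S. case crd S of (u, v) \<Rightarrow> mscale ((\<alpha> * u + \<gamma> * v) / D) A + mscale ((\<beta> * u + \<delta> * v) / D) B"])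
    let ?T' = "\<lambda>S. case crd S of (u, v) \<Rightarrow> mscale ((\<alpha> * u + \<gamma> * v) / D) A + mscale ((\<beta> * u + \<delta> * v) / D) B"
    have T': "?T' (mscale u A + mscale v B) = mscale ((\<alpha> * u + \<gamma> * v) / D) A + mscale ((\<beta> * u + \<delta> * v) / D) B" for u v
    proof -
      have "mscale u A + mscale v B = mscale (fst (crd (mscale u A + mscale v B))) A + mscale (snd (crd (mscale u A + mscale v B))) B"
        unfolding crd_def by (rule someI[of _ "(u, v)"]) simp
      from uniq[OF this] have "crd (mscale u A + mscale v B) = (u, v)" by (simp add: prod_eq_iff)
      then show ?thesis by simp
    qed
    show "\<forall>S\<in>form_span A B. ?T' (T S) = S"
    proof
      fix S assume "S \<in> form_span A B"
      then obtain u v where S: "S = mscale u A + mscale v B" unfolding form_span_def by blast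
      have "(\<alpha> * (\<delta> * u - \<gamma> * v) + \<gamma> * (\<alpha> * v - \<beta> * u)) = D * u" "(\<beta> * (\<delta> * u - \<gamma> * v) + \<delta> * (\<alpha> * v - \<beta> * u)) = D * v"
        unfolding D_def by (simp_all add: algebra_simps)
      then show "?T' (T S) = S" unfolding S T T' using Dnz by simp
    qed
    show "\<forall>S\<in>form_span A B. T (?T' S) = S"
    proof
      fix S assume "S \<in> form_span A B"
      then obtain u v where S: "S = mscale u A + mscale v B" unfolding form_span_def by blast
      have "\<delta> * ((\<alpha> * u + \<gamma> * v) / D) - \<gamma> * ((\<beta> * u + \<delta> * v) / D) = (D * u) / D"
        "\<alpha> * ((\<beta> * u + \<delta> * v) / D) - \<beta> * ((\<alpha> * u + \<gamma> * v) / D) = (D * v) / D"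
        unfolding times_divide_eq_right diff_divide_distrib[symmetric] by (simp_all add: D_def algebra_simps)
      then show "T (?T' S) = S" unfolding S T T' using Dnz by simp
    qed
    show "T ` form_span A B \<subseteq> form_span A B"
      unfolding T_def using mem by (auto split: prod.splits)
    show "?T' ` form_span A B \<subseteq> form_span A B"
      using mem by (auto split: prod.splits)
  qed
  have dg: "degenerate (T S) \<longleftrightarrow> degenerate S" if S0: "S \<in> form_span A B" for S
  proof -
    obtain u v where S: "S = mscale u A + mscale v B" using S0 unfolding form_span_def by blast
    have nz: "\<gamma> * t l + \<delta> \<noteq> 0" for l
    proof
      assume z: "\<gamma> * t l + \<delta> = 0"
      then have z2: "\<alpha> * t l + \<beta> = 0" using m[of l] by simp
      have "\<alpha> * \<delta> - \<beta> * \<gamma> = 0" using z z2 by algebra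
      then show False using D by simp
    qed
    have e: "(\<gamma> * t l + \<delta>) * ((\<delta> * u - \<gamma> * v) * t (\<sigma> l) + (\<alpha> * v - \<beta> * u)) = D * (u * t l + v)" for l
      using m[of l] unfolding D_def by algebra
    have "(\<delta> * u - \<gamma> * v) * t (\<sigma> l) + (\<alpha> * v - \<beta> * u) = 0 \<longleftrightarrow> u * t l + v = 0" for l
      using e[of l] nz[of l] Dnz by (metis mult_eq_0_iff)
    then have "(\<exists>l. (\<delta> * u - \<gamma> * v) * t (\<sigma> l) + (\<alpha> * v - \<beta> * u) = 0) \<longleftrightarrow> (\<exists>l. u * t l + v = 0)" by simp
    moreover have "(\<exists>l. (\<delta> * u - \<gamma> * v) * t (\<sigma> l) + (\<alpha> * v - \<beta> * u) = 0) \<longleftrightarrow> (\<exists>l. (\<delta> * u - \<gamma> * v) * t l + (\<alpha> * v - \<beta> * u) = 0)"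
      using bs by (metis bij_pointE)
    ultimately show ?thesis unfolding S T deg by simp
  qed
  obtain c where c: "\<And>S. S \<in> form_span A B \<Longrightarrow> T S = mscale c S"
    using rig[unfolded rigid_pencil_def, rule_format, of T] bij lin dg by blast
  have "mscale (\<delta> * 1 - \<gamma> * 0) A + mscale (\<alpha> * 0 - \<beta> * 1) B = mscale c A + mscale 0 B"
    using c[OF mem[of 1 0]] unfolding T by (simp add: vec_eq_iff)
  from uniq[OF this] have 1: "\<delta> = c" "\<beta> = 0" by auto
  have "mscale (\<delta> * 0 - \<gamma> * 1) A + mscale (\<alpha> * 1 - \<beta> * 0) B = mscale 0 A + mscale c B"
    using c[OF mem[of 0 1]] unfolding T by (simp add: vec_eq_iff)
  from uniq[OF this] have 2: "\<alpha> = c" "\<gamma> = 0" by auto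
  have "c \<noteq> 0" using D 1 2 by auto
  then have "t l = t (\<sigma> l)" for l using m[of l] 1 2 by simp
  then show "\<sigma> = id" using inj by (metis eq_id_iff injD)
qed

section \<open>Regular points\<close>

context quadric_pencil
begin

lemma lam_diff: "i \<noteq> j \<Longrightarrow> lam i - lam j \<noteq> 0" using inj_lam by (auto simp: inj_eq)

text \<open>For three indices there is a vector orthogonal to \<open>x\<close> for both forms on which the functional is the
  second divided difference of \<open>f\<close> as a function of \<open>lam\<close>.\<close>

lemma functional_on_perp:
  assumes xn: "\<And>i. x $ i \<noteq> 0" and v: "\<And>v. v \<in> perp D1 D2 x \<Longrightarrow> (\<Sum>i\<in>UNIV. f i * x $ i * v $ i) = 0"
  shows "\<exists>a b. \<forall>i. f i = a + b * lam i"
proof -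
  have "CARD('v) \<ge> 3" using card_v by simp
  then obtain i j k0 :: 'v where d: "distinct [i, j, k0]" using three_distinct_indices by metis
  then have ij: "i \<noteq> j" by auto
  define b where "b = (f j - f i) / (lam j - lam i)"
  define a where "a = f i - b * lam i"
  have "b * (lam j - lam i) = f j - f i" using lam_diff[of j i] ij by (simp add: b_def)
  then have fj: "f j = a + b * lam j" by (simp add: a_def algebra_simps)
  have "f k = a + b * lam k" for k
  proof (cases "k = i \<or> k = j")
    case True
    then show ?thesis using fj by (auto simp: a_def)
  next
    case False
    then have kk: "k \<noteq> i" "k \<noteq> j" by auto
    define p q r where "p = lam j - lam k" and "q = lam k - lam i" and "r = lam i - lam j"
    define v :: "complex^'v" where "v = p / x $ i *s axis i 1 + q / x $ j *s axis j 1 + r / x $ k *s axis k 1"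
    have s: "(\<Sum>l\<in>UNIV. g l * x $ l * v $ l) = g i * p + g j * q + g k * r" for g
    proof -
      have "(\<Sum>l\<in>UNIV. g l * x $ l * v $ l) = (\<Sum>l\<in>UNIV. (if l = i then g i * p else 0) + (if l = j then g j * q else 0) + (if l = k then g k * r else 0))"
        by (rule sum.cong) (use xn kk ij in \<open>auto simp: v_def axis_def\<close>)
      then show ?thesis by (simp add: sum.distrib)
    qed
    have "v \<in> perp D1 D2 x"
      unfolding perp_D using s[of "\<lambda>_. 1"] s[of lam] by (simp add: p_def q_def r_def algebra_simps)
    from v[OF this] have "f i * p + f j * q + f k * r = 0" by (simp add: s)
    then have "(f k - (a + b * lam k)) * r = 0" unfolding fj p_def q_def r_def a_def by algebra
    then show ?thesis using lam_diff[OF ij] by (simp add: r_def)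
  qed
  then show ?thesis by blast
qed

text \<open>Let \<open>u\<close> represent a vector in the kernel of the degenerate element.  The functional given by
  \<open>(lam\<^sub>i - s) u\<^sub>i / x\<^sub>i\<close> vanishes on the orthogonal space, so it is affine in \<open>lam\<^sub>i\<close>; solving for \<open>u\<^sub>i\<close> shows that
  \<open>u\<close> is a combination of \<open>x\<close> and of the vector with components \<open>x\<^sub>i / (lam\<^sub>i - s)\<close>, which must be
  orthogonal to \<open>x\<close>.\<close>

lemma degenerate_member_root:
  fixes E :: "complex^'n^'v"
  assumes x: "x \<in> X" "\<And>i. x $ i \<noteq> 0" and E: "tangent_frame D1 D2 x E"
    and dg: "degenerate (mscale 1 (pull E D1) + mscale (- s) (pull E D2))"
  shows "(\<forall>i. s \<noteq> lam i) \<and> (\<Sum>i\<in>UNIV. (x $ i)\<^sup>2 / (lam i - s)) = 0"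
proof -
  define u0 where "u0 = mscale 1 D1 + mscale (- s) D2"
  have u0: "u0 = diagm (\<lambda>i. lam i - s)" by (simp add: u0_def diagm_comb)
  have "mscale 1 (pull E D1) + mscale (- s) (pull E D2) = pull E u0" unfolding u0_def pull_comb ..
  then obtain w where w: "w \<noteq> 0" "\<And>w'. bil (pull E u0) w' w = 0" using dg by (auto simp: degenerate_def)
  define u where "u = E *v w"
  have up: "u \<in> perp D1 D2 x" unfolding u_def by (rule tangent_frame_in_perp[OF E])
  have not: "u \<noteq> c *s x" for c
  proof
    assume "u = c *s x"
    then have "E *v w + 0 *s x = E *v 0 + c *s x" by (simp add: u_def)
    from tangent_frame_inj[OF E this] show False using w(1) by simp
  qed
  have X0: "(\<Sum>i\<in>UNIV. lam i * (x $ i)\<^sup>2) = 0" "(\<Sum>i\<in>UNIV. (x $ i)\<^sup>2) = 0" using x(1) by (auto simp: X_iff)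
  have "(\<Sum>i\<in>UNIV. ((lam i - s) * u $ i / x $ i) * x $ i * v $ i) = 0" if v: "v \<in> perp D1 D2 x" for v
  proof -
    obtain y c where vy: "v = E *v y + c *s x" using tangent_frame_decompose[OF E v] by metis
    have "bil u0 x u = 0"
    proof -
      have "bil u0 x u = (\<Sum>i\<in>UNIV. lam i * x $ i * u $ i) - s * (\<Sum>i\<in>UNIV. x $ i * u $ i)"
        unfolding u0 bil_diagm by (simp add: algebra_simps sum_subtractf sum_distrib_left)
      then show ?thesis using up by (simp add: perp_D)
    qed
    moreover have "bil u0 (E *v y) u = 0" using w(2)[of y] by (simp add: bil_pull u_def)
    ultimately have "bil u0 v u = 0" by (simp add: vy bil_add_left bil_scale_left)
    then show ?thesis unfolding u0 bil_diagm using x(2) by (simp add: mult_ac)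
  qed
  from functional_on_perp[OF x(2) this] obtain a b where ab0: "\<And>i. (lam i - s) * u $ i / x $ i = a + b * lam i" by blast
  have ab: "(lam i - s) * u $ i = (a + b * lam i) * x $ i" for i using ab0[of i] x(2)[of i] by (simp add: field_simps)
  define e where "e = a + b * s"
  have ue: "(lam i - s) * (u $ i - b * x $ i) = e * x $ i" for i
    using ab[of i] by (simp add: e_def algebra_simps)
  have us: "(\<Sum>i\<in>UNIV. x $ i * (u $ i - b * x $ i)) = 0"
  proof -
    have "(\<Sum>i\<in>UNIV. x $ i * (u $ i - b * x $ i)) = (\<Sum>i\<in>UNIV. x $ i * u $ i) - b * (\<Sum>i\<in>UNIV. (x $ i)\<^sup>2)"
      by (simp add: algebra_simps sum_subtractf sum_distrib_left power2_eq_square)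
    then show ?thesis using up X0 by (simp add: perp_D)
  qed
  have ns: "s \<noteq> lam j" for j
  proof
    assume s: "s = lam j"
    then have "e = 0" using ue[of j] x(2)[of j] by simp
    then have "u $ i - b * x $ i = 0" if "i \<noteq> j" for i using ue[of i] lam_diff[OF that] s by simp
    then have "(\<Sum>i\<in>UNIV. x $ i * (u $ i - b * x $ i)) = (\<Sum>i\<in>UNIV. if i = j then x $ j * (u $ j - b * x $ j) else 0)"
      by (intro sum.cong) auto
    then have "x $ j * (u $ j - b * x $ j) = 0" using us by simp
    then have "u $ i - b * x $ i = 0" for i
      using x(2)[of j] \<open>\<And>i. i \<noteq> j \<Longrightarrow> u $ i - b * x $ i = 0\<close> by (cases "i = j") auto
    then have "u = b *s x" by (simp add: vec_eq_iff)
    then show False using not by blast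
  qed
  then have ls: "lam i - s \<noteq> 0" for i by (metis eq_iff_diff_eq_0)
  have ui: "u $ i - b * x $ i = e * (x $ i / (lam i - s))" for i using ue[of i] ls[of i] by (simp add: field_simps)
  have "e \<noteq> 0"
  proof
    assume "e = 0"
    then have "u = b *s x" using ui by (simp add: vec_eq_iff)
    then show False using not by blast
  qed
  moreover have "e * (\<Sum>i\<in>UNIV. (x $ i)\<^sup>2 / (lam i - s)) = 0"
    using us unfolding ui sum_distrib_left by (simp add: power2_eq_square mult_ac)
  ultimately show ?thesis using ns by simp
qed

text \<open>The polynomial is the numerator of the sum of the \<open>x\<^sub>i\<^sup>2 / (s - lam\<^sub>i)\<close>; the equations of the two quadrics
  say that its two leading coefficients vanish.\<close>

lemma discriminant_polynomial:
  assumes x: "x \<in> X"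
  obtains p where "degree p \<le> CARD('n)" "\<And>i. poly p (lam i) = (x $ i)\<^sup>2 * L i"
    "\<And>s. (\<forall>i. s \<noteq> lam i) \<Longrightarrow> (\<Sum>i\<in>UNIV. (x $ i)\<^sup>2 / (lam i - s)) = 0 \<Longrightarrow> poly p s = 0"
proof -
  define p where "p = (\<Sum>i\<in>UNIV. smult ((x $ i)\<^sup>2) (\<Prod>j\<in>UNIV - {i}. [:- lam j, 1:]))"
  have pl: "poly p (lam i) = (x $ i)\<^sup>2 * L i" for i
  proof -
    have "poly p (lam i) = (\<Sum>j\<in>UNIV. if j = i then (x $ i)\<^sup>2 * L i else 0)"
      unfolding p_def poly_sum
    proof (rule sum.cong[OF refl])
      fix j
      show "poly (smult ((x $ j)\<^sup>2) (\<Prod>l\<in>UNIV - {j}. [:- lam l, 1:])) (lam i) = (if j = i then (x $ i)\<^sup>2 * L i else 0)"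
        by (auto simp: poly_prod L_def)
    qed
    then show ?thesis by simp
  qed
  have x2: "(x $ i)\<^sup>2 = poly p (lam i) / L i" for i using pl[of i] L_nonzero[of i] by simp
  have X0: "(\<Sum>i\<in>UNIV. lam i * (x $ i)\<^sup>2) = 0" "(\<Sum>i\<in>UNIV. (x $ i)\<^sup>2) = 0" using x by (auto simp: X_iff)
  have dp: "degree p \<le> CARD('v) - 1"
    unfolding p_def
  proof (rule degree_sum_le, simp)
    fix i
    have "degree (\<Prod>j\<in>UNIV - {i}. [:- lam j, 1:]) = CARD('v) - 1" by (subst degree_prod_eq_sum_degree) auto
    then show "degree (smult ((x $ i)\<^sup>2) (\<Prod>j\<in>UNIV - {i}. [:- lam j, 1:])) \<le> CARD('v) - 1"
      using degree_smult_le by metis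
  qed
  have c2: "coeff p (CARD('v) - 1) = 0"
    using lagrange_lam_leading[of p] dp card_v X0(2) by (simp add: x2)
  have dp1: "degree p \<le> CARD('v) - 2"
  proof (rule degree_le, intro allI impI)
    fix m assume "CARD('v) - 2 < m"
    then have "m = CARD('v) - 1 \<or> degree p < m" using dp by linarith
    then show "coeff p m = 0" using c2 coeff_eq_0 by blast
  qed
  have "degree (pCons 0 p) < CARD('v)" using dp1 card_v degree_pCons_le[of 0 p] by linarith
  from lagrange_lam_leading[OF this] have "coeff (pCons 0 p) (CARD('v) - 1) = 0"
    using X0(1) by (simp add: x2)
  then have c1: "coeff p (CARD('v) - 2) = 0" using card_v by (simp add: coeff_pCons split: nat.splits)
  have "degree p \<le> CARD('n)"
  proof (rule degree_le, intro allI impI)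
    fix m assume "CARD('n) < m"
    then have "m = CARD('v) - 2 \<or> degree p < m" using dp1 card_v by linarith
    then show "coeff p m = 0" using c1 coeff_eq_0 by blast
  qed
  moreover have "poly p s = 0" if s: "\<forall>i. s \<noteq> lam i" and z: "(\<Sum>i\<in>UNIV. (x $ i)\<^sup>2 / (lam i - s)) = 0" for s
  proof -
    have sl: "s - lam i \<noteq> 0" "lam i - s \<noteq> 0" for i using s by (metis eq_iff_diff_eq_0)+
    have "poly p s = (\<Sum>i\<in>UNIV. - (\<Prod>j\<in>UNIV. s - lam j) * ((x $ i)\<^sup>2 / (lam i - s)))"
      unfolding p_def poly_sum
    proof (rule sum.cong[OF refl])
      fix i
      have "(\<Prod>j\<in>UNIV. s - lam j) = (s - lam i) * (\<Prod>j\<in>UNIV - {i}. s - lam j)" by (rule prod.remove) auto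
      then have "- (\<Prod>j\<in>UNIV. s - lam j) = (lam i - s) * (\<Prod>j\<in>UNIV - {i}. s - lam j)" by (simp add: algebra_simps)
      then show "poly (smult ((x $ i)\<^sup>2) (\<Prod>j\<in>UNIV - {i}. [:- lam j, 1:])) s = - (\<Prod>j\<in>UNIV. s - lam j) * ((x $ i)\<^sup>2 / (lam i - s))"
        using sl(2)[of i] by (simp only:) (simp add: poly_prod)
    qed
    then have "poly p s = - (\<Prod>j\<in>UNIV. s - lam j) * (\<Sum>i\<in>UNIV. (x $ i)\<^sup>2 / (lam i - s))"
      by (simp only: sum_distrib_left)
    then show ?thesis by (simp only: z) simp
  qed
  ultimately show ?thesis using that pl by blast
qed

abbreviation e0 :: "'v \<Rightarrow> complex^'v" where "e0 \<equiv> (\<lambda>i. axis i 1)"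

lemma sum_axis: "(\<Sum>i\<in>UNIV. z i *s axis i 1) = (\<chi> i. z i)" for z :: "'v \<Rightarrow> complex"
proof -
  have "(\<Sum>i\<in>UNIV. z i *s axis i 1) $ j = (\<Sum>i\<in>UNIV. if i = j then z j else 0)" for j
    unfolding sum_component by (rule sum.cong) (auto simp: axis_def)
  then show ?thesis by (simp add: vec_eq_iff)
qed

lemma in_X_reg:
  assumes rt: "roots_at x t C" and rig: "rigid_config t (\<lambda>_. 1)" and t0: "\<And>k. t k \<noteq> 0"
  shows "x \<in> X_reg TYPE('n) X D1 D2 e0"
proof -
  have c1: "CARD('n) > 1" using card_n by simp
  note sep = W_separated[OF rt]
  obtain i j k :: 'n where d: "distinct [i, j, k]" using distinct_indices_n by metis
  have "rigid_pencil (Pen (\<lambda>k. t k * frame_norm x t k) (frame_norm x t))"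
  proof (rule rigid_pencil_if_rigid_config[OF roots_at_inj[OF rt] d rig _ diagm_independent[OF sep c1]])
    fix u v
    have "u * (t k * frame_norm x t k) + v * frame_norm x t k = frame_norm x t k * (u * t k + v)" for k by (simp add: algebra_simps)
    then show "degenerate (mscale u (diagm (\<lambda>k. t k * frame_norm x t k)) + mscale v (diagm (frame_norm x t))) \<longleftrightarrow> (\<exists>l. u * t l + v = 0)"
      unfolding diagm_comb degenerate_diagm using frame_norm_nonzero[OF rt] by simp
  qed
  moreover have "nonsingular_pencil (Pen (\<lambda>k. t k * frame_norm x t k) (frame_norm x t))" by (rule diagm_nonsingular[OF sep c1])
  moreover have "\<not> degenerate (pull (W x t) D1)" "\<not> degenerate (pull (W x t) D2)"
    unfolding pull_W_D1[OF rt] pull_W_D2[OF rt] degenerate_diagm using frame_norm_nonzero[OF rt] t0 by auto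
  moreover have "\<exists>z. x = (\<Sum>i\<in>UNIV. z i *s e0 i) \<and> (\<forall>i. z i \<noteq> 0)"
    by (rule exI[of _ "\<lambda>i. x $ i"]) (use roots_at_nonzero[OF rt] in \<open>simp add: sum_axis vec_eq_iff\<close>)
  ultimately show ?thesis unfolding X_reg_def using in_X[OF rt] W_frame[OF rt] II_W[OF rt] by auto
qed

text \<open>The \<open>n\<close> degenerate elements give distinct roots of the discriminant polynomial, which has degree at most
  \<open>n\<close> and thus is the product of the corresponding linear factors.  No degenerate element is at
  infinity because the second form is nondegenerate on the tangent space.\<close>

lemma X_regD:
  assumes "x \<in> X_reg TYPE('n) X D1 D2 e0" shows "\<exists>t C. roots_at x t C \<and> rigid_config t (\<lambda>_. 1)"
proof -
  obtain z and E :: "complex^'n^'v" where x: "x \<in> X" and z: "x = (\<Sum>i\<in>UNIV. z i *s e0 i)" "\<And>i. z i \<noteq> 0"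
    and E: "tangent_frame D1 D2 x E" and ns: "nonsingular_pencil (II D1 D2 E)" and rig: "rigid_pencil (II D1 D2 E)"
    and nd: "\<not> degenerate (pull E D1)" "\<not> degenerate (pull E D2)"
    using assms unfolding X_reg_def by blast
  have xn: "x $ i \<noteq> 0" for i using z(2)[of i] unfolding z(1) sum_axis by simp
  define A B where "A = pull E D1" and "B = pull E D2"
  have nB: "\<not> degenerate B" using nd by (simp add: B_def)
  have scale: "degenerate (mscale c S) \<longleftrightarrow> degenerate S" if "c \<noteq> 0" for c and S :: "complex^'n^'n"
    using that by (auto simp: degenerate_iff mscale_mult_vec)
  have zero: "degenerate (0 :: complex^'n^'n)" unfolding degenerate_iff
    by (intro exI[of _ "axis undefined 1"]) (simp add: axis_eq_0_iff)
  define R where "R = {s. degenerate (mscale 1 A + mscale (- s) B)}"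
  have comb: "degenerate (mscale u A + mscale v B) \<longleftrightarrow> - v / u \<in> R" if "u \<noteq> 0" for u v
  proof -
    have "mscale u A + mscale v B = mscale u (mscale 1 A + mscale (- (- v / u)) B)"
      using that by (simp add: vec_eq_iff algebra_simps)
    then show ?thesis using scale[OF that] by (simp add: R_def)
  qed
  have comb0: "degenerate (mscale v B) \<longleftrightarrow> v = 0" for v
  proof (cases "v = 0")
    case True
    then have "mscale v B = 0" by (simp add: vec_eq_iff)
    then show ?thesis using zero True by simp
  qed (use scale nB in auto)
  obtain p where p: "degree p \<le> CARD('n)" "\<And>i. poly p (lam i) = (x $ i)\<^sup>2 * L i"
    "\<And>s. (\<forall>i. s \<noteq> lam i) \<Longrightarrow> (\<Sum>i\<in>UNIV. (x $ i)\<^sup>2 / (lam i - s)) = 0 \<Longrightarrow> poly p s = 0"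
    by (rule discriminant_polynomial[OF x]) (rule that)
  have Rs: "(\<forall>i. s \<noteq> lam i) \<and> (\<Sum>i\<in>UNIV. (x $ i)\<^sup>2 / (lam i - s)) = 0" if "s \<in> R" for s
    using degenerate_member_root[OF x xn E] that unfolding R_def A_def B_def by blast
  have pn: "p \<noteq> 0" using p(2)[of undefined] xn[of undefined] L_nonzero by auto
  have Rp: "R \<subseteq> {s. poly p s = 0}" using Rs p(3) by blast
  have finR: "finite R" by (rule finite_subset[OF Rp poly_roots_finite[OF pn]])
  have "card R \<le> card {s. poly p s = 0}" by (rule card_mono[OF poly_roots_finite[OF pn] Rp])
  also have "\<dots> \<le> degree p" by (rule card_poly_roots_bound[OF pn])
  finally have cR1: "card R \<le> CARD('n)" using p(1) by simp
  have de: "degenerate_elements (II D1 D2 E) \<subseteq> (\<lambda>s. range (\<lambda>c. mscale c (mscale 1 A + mscale (- s) B))) ` R"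
  proof
    fix l assume "l \<in> degenerate_elements (II D1 D2 E)"
    then obtain u v where l: "l = range (\<lambda>c. mscale c (mscale u A + mscale v B))" and nz: "mscale u A + mscale v B \<noteq> 0"
      and dg: "degenerate (mscale u A + mscale v B)"
      unfolding degenerate_elements_def II_def form_span_def A_def B_def by blast
    have u: "u \<noteq> 0"
    proof
      assume "u = 0"
      then have "mscale u A + mscale v B = mscale v B" by (simp add: vec_eq_iff)
      then have "v = 0" using dg comb0 by simp
      then show False using nz \<open>u = 0\<close> by (simp add: vec_eq_iff)
    qed
    have "mscale u A + mscale v B = mscale u (mscale 1 A + mscale (- (- v / u)) B)"
      using u by (simp add: vec_eq_iff algebra_simps)
    then have "l = range (\<lambda>c. mscale c (mscale 1 A + mscale (- (- v / u)) B))"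
      unfolding l using range_mscale[OF u] by metis
    moreover have "- v / u \<in> R" using comb[OF u] dg by blast
    ultimately show "l \<in> (\<lambda>s. range (\<lambda>c. mscale c (mscale 1 A + mscale (- s) B))) ` R" by blast
  qed
  have "CARD('n) = card (degenerate_elements (II D1 D2 E))" using ns by (simp add: nonsingular_pencil_def)
  also have "\<dots> \<le> card ((\<lambda>s. range (\<lambda>c. mscale c (mscale 1 A + mscale (- s) B))) ` R)"
    by (rule card_mono[OF finite_imageI[OF finR] de])
  also have "\<dots> \<le> card R" by (rule card_image_le[OF finR])
  finally have cR: "card R = CARD('n)" using cR1 by simp
  then obtain t where t: "bij_betw t (UNIV :: 'n set) R"
    using finite_same_card_bij[of "UNIV :: 'n set" R] finR by auto
  then have tinj: "inj t" and tR: "range t = R" by (auto simp: bij_betw_def)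
  define C where "C = coeff p CARD('n)"
  have dG: "degree (\<Prod>s\<in>R. [:- s, 1:]) = CARD('n)" "coeff (\<Prod>s\<in>R. [:- s, 1:]) CARD('n) = 1"
    using prod_linear_monic[OF finR] cR by auto
  have pG: "p = smult C (\<Prod>s\<in>R. [:- s, 1:])"
  proof (rule poly_eqI_degree_lead_coeff[of _ "CARD('n)" _ R])
    show "degree (smult C (\<Prod>s\<in>R. [:- s, 1:])) \<le> CARD('n)" using dG(1) degree_smult_le by metis
    fix s assume s: "s \<in> R"
    then have "poly (\<Prod>s\<in>R. [:- s, 1:]) s = 0" using finR by (auto simp: poly_prod)
    then show "poly p s = poly (smult C (\<Prod>s\<in>R. [:- s, 1:])) s" using Rp s by auto
  qed (use p(1) cR dG C_def in auto)
  have "C \<noteq> 0" using pn pG by auto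
  moreover have "(x $ i)\<^sup>2 * L i = C * (\<Prod>k\<in>UNIV. lam i - t k)" for i
  proof -
    have "(x $ i)\<^sup>2 * L i = poly (smult C (\<Prod>s\<in>R. [:- s, 1:])) (lam i)" using p(2) pG by metis
    also have "\<dots> = C * (\<Prod>s\<in>R. lam i - s)" by (simp add: poly_prod)
    also have "(\<Prod>s\<in>R. lam i - s) = (\<Prod>k\<in>UNIV. lam i - t k)"
      unfolding tR[symmetric] using tinj by (simp add: prod.reindex)
    finally show ?thesis .
  qed
  moreover have "t k \<noteq> lam i" for k i using Rs tR by auto
  ultimately have rt: "roots_at x t C" using tinj by (simp add: roots_at_def)
  have deg: "degenerate (mscale u A + mscale v B) \<longleftrightarrow> (\<exists>l. u * t l + v = 0)" for u v
  proof (cases "u = 0")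
    case True
    then have "mscale u A + mscale v B = mscale v B" by (simp add: vec_eq_iff)
    then show ?thesis using comb0 True by simp
  next
    case False
    have "u * t l + v = 0 \<longleftrightarrow> t l = - v / u" for l using False by (auto simp: field_simps eq_neg_iff_add_eq_0)
    then show ?thesis unfolding comb[OF False] tR[symmetric] by (metis rangeE rangeI)
  qed
  obtain i j k :: 'n where d: "distinct [i, j, k]" using distinct_indices_n by metis
  have "forms_independent A B" unfolding forms_independent_def
  proof (intro allI impI)
    fix u v assume uv: "mscale u A + mscale v B = 0"
    have un: "u = 0"
    proof (rule ccontr)
      assume u: "u \<noteq> 0"
      \<comment> \<open>\<open>A\<close> would be a multiple of \<open>B\<close>, leaving room for only one root.\<close>
      have "mscale u A + mscale v' B = mscale (v' - v) B" for v'
      proof -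
        have "mscale u A + mscale v' B = (mscale u A + mscale v B) + mscale (v' - v) B" by (simp add: vec_eq_iff algebra_simps)
        then show ?thesis using uv by simp
      qed
      then have "(\<exists>l. u * t l + v' = 0) \<longleftrightarrow> v' = v" for v' using deg[of u v'] comb0[of "v' - v"] by simp
      from this[of "- u * t i"] this[of "- u * t j"] have "- u * t i = v" "- u * t j = v" by auto
      then have "t i = t j" using u by (metis mult_cancel_left neg_equal_0_iff_equal)
      then show False using tinj d by (auto dest: injD)
    qed
    then have "mscale v B = 0" using uv by (simp add: vec_eq_iff)
    then show "u = 0 \<and> v = 0" using un comb0[of v] zero by simp
  qed
  then have "rigid_config t (\<lambda>_. 1)"
    using rigid_config_if_rigid_pencil[OF tinj d _ deg] rig unfolding II_def A_def[symmetric] B_def[symmetric] by blast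
  then show ?thesis using rt by blast
qed

end

section \<open>A root-free basis of the kernel\<close>

context quadric_pencil
begin

text \<open>The sum of the \<open>1 / (lam\<^sub>i - t\<^sub>k)\<close> over all roots, expressed by the coordinates of the point.\<close>

definition root_sum :: "complex^'v \<Rightarrow> 'v \<Rightarrow> complex" where
  "root_sum y i = (\<Sum>j\<in>UNIV - {i}. (1 + (y $ j)\<^sup>2 / (y $ i)\<^sup>2) / (lam i - lam j))"

lemma log_deriv_linear_factor: "s - c \<noteq> 0 \<Longrightarrow> log_deriv (\<lambda>z. s + z - c) (1 / (s - c))"
  unfolding log_deriv_def by (auto intro!: derivative_eq_intros)

text \<open>Both sides are the logarithmic derivative at \<open>lam\<^sub>i\<close> of the discriminant polynomial, computed from
  its factorization by the roots and from its expansion by the squares of the coordinates.\<close>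

lemma sum_inverse_roots:
  assumes rt: "roots_at y t C" shows "(\<Sum>k\<in>UNIV. 1 / (lam i - t k)) = root_sum y i"
proof -
  define p where "p = (\<Sum>j\<in>UNIV. smult ((y $ j)\<^sup>2) (\<Prod>l\<in>UNIV - {j}. [:- lam l, 1:]))"
  define g where "g = smult C (\<Prod>k\<in>UNIV. [:- t k, 1:])"
  have pe: "poly p s = (\<Sum>j\<in>UNIV. (y $ j)\<^sup>2 * (\<Prod>l\<in>UNIV - {j}. s - lam l))" for s
    by (simp add: p_def poly_sum poly_prod)
  have ge: "poly g s = C * (\<Prod>k\<in>UNIV. s - t k)" for s by (simp add: g_def poly_prod)
  have pl: "poly p (lam j) = (y $ j)\<^sup>2 * L j" for j
  proof -
    have "poly p (lam j) = (\<Sum>l\<in>UNIV. if l = j then (y $ j)\<^sup>2 * L j else 0)"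
      unfolding pe by (rule sum.cong) (auto simp: L_def)
    then show ?thesis by simp
  qed
  have "p = g"
  proof (rule poly_eqI_degree[of "range lam"])
    show "poly p s = poly g s" if s0: "s \<in> range lam" for s
    proof -
      obtain j where j: "s = lam j" using s0 by auto
      show ?thesis unfolding j pl ge using rt by (simp add: roots_at_def)
    qed
    have c: "card (range lam) = CARD('v)" using inj_lam by (simp add: card_image)
    have "degree p \<le> CARD('v) - 1" unfolding p_def
    proof (rule degree_sum_le, simp)
      fix j
      have "degree (\<Prod>l\<in>UNIV - {j}. [:- lam l, 1:]) = CARD('v) - 1" by (subst degree_prod_eq_sum_degree) auto
      then show "degree (smult ((y $ j)\<^sup>2) (\<Prod>l\<in>UNIV - {j}. [:- lam l, 1:])) \<le> CARD('v) - 1"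
        using degree_smult_le by metis
    qed
    then show "degree p < card (range lam)" using c card_v by linarith
    have "degree (\<Prod>k\<in>UNIV. [:- t k, 1:]) = CARD('n)" by (subst degree_prod_eq_sum_degree) auto
    then have "degree g \<le> CARD('n)" unfolding g_def using degree_smult_le by metis
    then show "degree g < card (range lam)" using c card_v by linarith
  qed
  define f where "f j z = (\<Prod>l\<in>UNIV - {j}. lam i + z - lam l)" for j z
  have yi: "y $ i \<noteq> 0" by (rule roots_at_nonzero[OF rt])
  have d1: "(f i has_field_derivative L i * (\<Sum>j\<in>UNIV - {i}. 1 / (lam i - lam j))) (at 0)"
  proof -
    have "log_deriv (f i) (\<Sum>j\<in>UNIV - {i}. 1 / (lam i - lam j))"
      unfolding f_def[abs_def] by (intro log_deriv_prod log_deriv_linear_factor lam_diff) auto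
    then show ?thesis by (simp add: log_deriv_def f_def L_def)
  qed
  have d2: "(f j has_field_derivative L i / (lam i - lam j)) (at 0)" if ji: "j \<noteq> i" for j
  proof -
    define Q where "Q z = (\<Prod>l\<in>UNIV - {j} - {i}. lam i + z - lam l)" for z
    have fe: "f j = (\<lambda>z. z * Q z)"
    proof
      fix z show "f j z = z * Q z" unfolding f_def Q_def
        by (subst prod.remove[of _ i]) (use ji in auto)
    qed
    have Lq: "L i = (lam i - lam j) * Q 0"
    proof -
      have "L i = (lam i - lam j) * (\<Prod>l\<in>UNIV - {i} - {j}. lam i - lam l)" unfolding L_def
        by (rule prod.remove) (use ji in auto)
      moreover have "UNIV - {i} - {j} = UNIV - {j} - {i}" by auto
      ultimately show ?thesis by (simp add: Q_def)
    qed
    have "log_deriv Q (\<Sum>l\<in>UNIV - {j} - {i}. 1 / (lam i - lam l))"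
      unfolding Q_def[abs_def] by (intro log_deriv_prod log_deriv_linear_factor lam_diff) auto
    then obtain q where "(Q has_field_derivative q) (at 0)" by (auto simp: log_deriv_def)
    then have "(f j has_field_derivative Q 0) (at 0)" unfolding fe
      by (auto intro!: derivative_eq_intros)
    then show ?thesis using Lq lam_diff[of i j] ji by simp
  qed
  define F where "F z = (\<Sum>j\<in>UNIV. (y $ j)\<^sup>2 * f j z)" for z
  have Fd: "(F has_field_derivative (\<Sum>j\<in>UNIV. (y $ j)\<^sup>2 * (if j = i then L i * (\<Sum>j\<in>UNIV - {i}. 1 / (lam i - lam j)) else L i / (lam i - lam j)))) (at 0)"
    unfolding F_def[abs_def]
  proof (rule DERIV_sum)
    fix j
    show "((\<lambda>z. (y $ j)\<^sup>2 * f j z) has_field_derivative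
       (y $ j)\<^sup>2 * (if j = i then L i * (\<Sum>j\<in>UNIV - {i}. 1 / (lam i - lam j)) else L i / (lam i - lam j))) (at 0)"
      by (rule DERIV_cmult) (use d1 d2 in auto)
  qed
  have Fg: "F = (\<lambda>z. C * (\<Prod>k\<in>UNIV. lam i + z - t k))"
  proof
    fix z
    have "F z = poly p (lam i + z)" by (simp add: F_def f_def pe)
    then show "F z = C * (\<Prod>k\<in>UNIV. lam i + z - t k)" unfolding \<open>p = g\<close> ge .
  qed
  have "log_deriv F (0 + (\<Sum>k\<in>UNIV. 1 / (lam i - t k)))"
    unfolding Fg using rt
    by (intro log_deriv_mult log_deriv_const log_deriv_prod log_deriv_linear_factor lam_t(1)[OF rt]) (auto simp: roots_at_def)
  moreover have "F 0 = (y $ i)\<^sup>2 * L i" using rt by (simp add: Fg roots_at_def)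
  ultimately have "(F has_field_derivative ((y $ i)\<^sup>2 * L i) * (\<Sum>k\<in>UNIV. 1 / (lam i - t k))) (at 0)"
    by (simp add: log_deriv_def)
  from DERIV_unique[OF this Fd]
  have "(y $ i)\<^sup>2 * L i * (\<Sum>k\<in>UNIV. 1 / (lam i - t k)) =
    (\<Sum>j\<in>UNIV. (y $ j)\<^sup>2 * (if j = i then L i * (\<Sum>j\<in>UNIV - {i}. 1 / (lam i - lam j)) else L i / (lam i - lam j)))" .
  also have "\<dots> = (y $ i)\<^sup>2 * (L i * (\<Sum>j\<in>UNIV - {i}. 1 / (lam i - lam j))) + (\<Sum>j\<in>UNIV - {i}. (y $ j)\<^sup>2 * (L i / (lam i - lam j)))"
    by (subst sum.remove[of _ i]) auto
  also have "\<dots> = (y $ i)\<^sup>2 * L i * root_sum y i"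
  proof -
    have "(y $ i)\<^sup>2 * L i * root_sum y i = (\<Sum>j\<in>UNIV - {i}. (y $ i)\<^sup>2 * (L i * (1 / (lam i - lam j))) + (y $ j)\<^sup>2 * (L i / (lam i - lam j)))"
      unfolding root_sum_def sum_distrib_left
    proof (rule sum.cong[OF refl])
      fix j assume "j \<in> UNIV - {i}"
      then have "lam i - lam j \<noteq> 0" using lam_diff by auto
      then show "(y $ i)\<^sup>2 * L i * ((1 + (y $ j)\<^sup>2 / (y $ i)\<^sup>2) / (lam i - lam j))
        = (y $ i)\<^sup>2 * (L i * (1 / (lam i - lam j))) + (y $ j)\<^sup>2 * (L i / (lam i - lam j))"
        using yi by (simp add: add_divide_distrib distrib_left distrib_right)
    qed
    then show ?thesis by (simp add: sum.distrib sum_distrib_left)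
  qed
  finally show ?thesis using yi L_nonzero by simp
qed

text \<open>The kernel is spanned modulo \<open>y\<close> by the vectors with components \<open>y\<^sub>i \<Sum>\<^sub>k t\<^sub>k\<^sup>m / (lam\<^sub>i - t\<^sub>k)\<close> for
  \<open>m = 0, 1, 2\<close>.  Division with remainder by \<open>lam\<^sub>i - t\<^sub>k\<close> expresses these sums by \<open>root_sum\<close>, \<open>lam\<^sub>i\<close> and
  power sums of the roots; the terms that only contribute multiples of \<open>y\<close> are dropped.\<close>

definition kernel_basis :: "complex^'v \<Rightarrow> 3 \<Rightarrow> complex^'v" where
  "kernel_basis y m = (\<chi> i. if m = 1 then y $ i * root_sum y i else if m = 2 then y $ i * (lam i * root_sum y i)
     else y $ i * ((lam i)\<^sup>2 * root_sum y i - of_nat CARD('n) * lam i))"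

text \<open>The coefficients of the dropped multiples of \<open>y\<close>.\<close>

definition basis_shift :: "('n \<Rightarrow> complex) \<Rightarrow> 3 \<Rightarrow> complex" where
  "basis_shift t m = (if m = 1 then 0 else if m = 2 then of_nat CARD('n) else (\<Sum>k\<in>UNIV. t k))"

lemma kernel_basis_eq:
  assumes rt: "roots_at y t C"
  shows "kernel_basis y m = W y t *v (vander t $ m) + basis_shift t m *s y"
proof -
  have lt: "lam i - t k \<noteq> 0" for i k by (rule lam_t(1)[OF rt])
  have W: "(W y t *v w) $ i = y $ i * (\<Sum>k\<in>UNIV. w $ k / (lam i - t k))" for w i
    by (simp add: W_vec[OF rt] sum_distrib_left)
  have s1: "(\<Sum>k\<in>UNIV. t k / (lam i - t k)) = lam i * root_sum y i - of_nat CARD('n)" for i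
  proof -
    have "t k / (lam i - t k) = lam i * (1 / (lam i - t k)) - 1" for k using lt[of i k] by (simp add: field_simps)
    then show ?thesis by (simp only: sum_subtractf sum_distrib_left[symmetric] sum_inverse_roots[OF rt]) simp
  qed
  have s2: "(\<Sum>k\<in>UNIV. (t k)\<^sup>2 / (lam i - t k)) = (lam i)\<^sup>2 * root_sum y i - of_nat CARD('n) * lam i - (\<Sum>k\<in>UNIV. t k)" for i
  proof -
    have "(t k)\<^sup>2 / (lam i - t k) = (lam i)\<^sup>2 * (1 / (lam i - t k)) - lam i - t k" for k
      using lt[of i k] by (simp add: field_simps power2_eq_square)
    then show ?thesis by (simp only: sum_subtractf sum_distrib_left[symmetric] sum_inverse_roots[OF rt]) simp
  qed
  have s0: "(\<Sum>k\<in>UNIV. 1 / (lam i - t k)) = root_sum y i" for i by (rule sum_inverse_roots[OF rt])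
  show ?thesis
    using exhaust_3[of m] by (auto simp: vec_eq_iff W kernel_basis_def vander_def basis_shift_def s0 s1 s2 algebra_simps)
qed

lemma quadratic_kernel_basis:
  assumes rt: "roots_at y t C"
  shows "quadratic_kernel y t = {\<kappa> *s y + (\<Sum>m\<in>UNIV. a $ m *s kernel_basis y m) | \<kappa> (a :: complex^3). True}"
proof -
  have lin: "W y t *v (\<chi> k. a $ 1 + a $ 2 * t k + a $ 3 * (t k)\<^sup>2) = (\<Sum>m\<in>UNIV. a $ m *s (W y t *v (vander t $ m)))" for a :: "complex^3"
  proof -
    have "(\<chi> k. a $ 1 + a $ 2 * t k + a $ 3 * (t k)\<^sup>2) = (\<Sum>m\<in>UNIV. a $ m *s (vander t $ m))"
      by (simp add: vec_eq_iff sum_3 vander_def)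
    then show ?thesis by (simp add: vec.sum vector_scalar_commute)
  qed
  have e: "\<kappa> *s y + (\<Sum>m\<in>UNIV. a $ m *s kernel_basis y m)
     = (\<kappa> + (\<Sum>m\<in>UNIV. a $ m * basis_shift t m)) *s y + W y t *v (\<chi> k. a $ 1 + a $ 2 * t k + a $ 3 * (t k)\<^sup>2)" for \<kappa> and a :: "complex^3"
    unfolding lin kernel_basis_eq[OF rt]
    by (simp add: sum_3 vec.scale_right_distrib vector_sadd_rdistrib add_ac)
  show ?thesis
  proof (intro equalityI subsetI)
    fix v assume "v \<in> quadratic_kernel y t"
    then obtain \<kappa> a b c where v: "v = \<kappa> *s y + W y t *v (\<chi> k. a + b * t k + c * (t k)\<^sup>2)"
      by (auto simp: quadratic_kernel_def)
    define \<alpha> where "\<alpha> = (vector [a, b, c] :: complex^3)"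
    have "v = (\<kappa> - (\<Sum>m\<in>UNIV. \<alpha> $ m * basis_shift t m)) *s y + (\<Sum>m\<in>UNIV. \<alpha> $ m *s kernel_basis y m)"
      unfolding e v \<alpha>_def by (simp add: vector_3)
    then show "v \<in> {\<kappa> *s y + (\<Sum>m\<in>UNIV. a $ m *s kernel_basis y m) | \<kappa> (a :: complex^3). True}" by blast
  next
    fix v assume "v \<in> {\<kappa> *s y + (\<Sum>m\<in>UNIV. a $ m *s kernel_basis y m) | \<kappa> (a :: complex^3). True}"
    then show "v \<in> quadratic_kernel y t" unfolding e quadratic_kernel_def by blast
  qed
qed

text \<open>The coordinates of \<open>kernel_basis y\<close> in the moved frame.  They are computed at \<open>x\<close>, after applying the
  diagonal matrix with entries \<open>y\<^sub>i / x\<^sub>i\<close>; the correction takes the line of \<open>moved_point x y\<close>, which is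
  the image of the line of \<open>y\<close>, to zero.\<close>

definition kernel_rows :: "complex^'v \<Rightarrow> ('n \<Rightarrow> complex) \<Rightarrow> complex^'v \<Rightarrow> complex^'n^3" where
  "kernel_rows x t y = (\<chi> m k. coord x t (\<chi> i. y $ i / x $ i * kernel_basis y m $ i) k
     - line_coord x t (\<chi> i. y $ i / x $ i * kernel_basis y m $ i) / line_coord x t (moved_point x y) * coord x t (moved_point x y) k)"

lemma kernel_rows_self:
  assumes rt: "roots_at x t C" shows "kernel_rows x t x = vander t"
proof -
  have u: "(\<chi> i. x $ i / x $ i * kernel_basis x m $ i) = W x t *v (vander t $ m) + basis_shift t m *s x" for m
    using roots_at_nonzero[OF rt] by (simp add: kernel_basis_eq[OF rt, symmetric] vec_eq_iff)
  show ?thesis unfolding kernel_rows_def u coord_eq[OF rt] moved_point_self[OF rt] by (simp add: vec_eq_iff)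
qed

lemma kernel_rows_span:
  assumes rt: "roots_at x t C" and ry: "roots_at y t' C'" and eta: "line_coord x t (moved_point x y) \<noteq> 0"
  shows "{w. moved_frame x t y *v w \<in> quadratic_kernel y t'} = vec.span (rows (kernel_rows x t y))"
proof -
  note xn = roots_at_nonzero[OF rt] and yn = roots_at_nonzero[OF ry]
  have yX: "y \<in> X" by (rule in_X[OF ry])
  let ?E = "moved_frame x t y"
  let ?\<eta> = "line_coord x t (moved_point x y)"
  let ?u = "\<lambda>m. \<chi> i. y $ i / x $ i * kernel_basis y m $ i"
  define d where "d m = line_coord x t (?u m) / ?\<eta>" for m
  have fr: "tangent_frame D1 D2 y ?E" by (rule moved_frame_tangent[OF rt yX yn eta])
  have "moved_point x y \<in> perp D1 D2 x" unfolding perp_D using yX xn by (simp add: moved_point_def X_iff mult.assoc)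
  from perp_coord[OF rt this] have sq: "moved_point x y = W x t *v (\<chi> k. coord x t (moved_point x y) k) + ?\<eta> *s x" .
  have row: "kernel_basis y m = ?E *v (kernel_rows x t y $ m) + d m *s y" for m
  proof -
    have "kernel_basis y m \<in> perp D1 D2 y"
      unfolding kernel_basis_eq[OF ry] by (intro perp_add W_perp[OF ry] perp_scale x_perp[OF ry])
    then have "?u m \<in> perp D1 D2 x" by (simp only: perp_moved[OF xn yn])
    from perp_coord[OF rt this] have u: "?u m = W x t *v (\<chi> k. coord x t (?u m) k) + line_coord x t (?u m) *s x" .
    have r: "kernel_rows x t y $ m = (\<chi> k. coord x t (?u m) k) - d m *s (\<chi> k. coord x t (moved_point x y) k)"
      by (simp add: kernel_rows_def vec_eq_iff d_def)
    have "(\<chi> i. y $ i / x $ i * (?E *v (kernel_rows x t y $ m) + d m *s y) $ i) = W x t *v (kernel_rows x t y $ m) + d m *s moved_point x y"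
      using xn yn by (simp add: vec_eq_iff moved_frame_vec moved_point_def field_simps power2_eq_square)
    also have "\<dots> = W x t *v (\<chi> k. coord x t (?u m) k) - d m *s (W x t *v (\<chi> k. coord x t (moved_point x y) k)) + d m *s moved_point x y"
      unfolding r by (simp only: matrix_vector_mult_diff_distrib vector_scalar_commute)
    also have "d m *s moved_point x y = d m *s (W x t *v (\<chi> k. coord x t (moved_point x y) k)) + line_coord x t (?u m) *s x"
      using eta by (subst (1) sq) (simp add: vec.scale_right_distrib d_def)
    finally have "(\<chi> i. y $ i / x $ i * (?E *v (kernel_rows x t y $ m) + d m *s y) $ i) = ?u m"
      using u by simp
    then have "y $ i / x $ i * (?E *v (kernel_rows x t y $ m) + d m *s y) $ i = y $ i / x $ i * kernel_basis y m $ i" for i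
      by (simp only: vec_eq_iff vec_lambda_beta)
    then show ?thesis using xn yn by (simp add: vec_eq_iff)
  qed
  have comb: "?E *v (a v* kernel_rows x t y) = (\<Sum>m\<in>UNIV. a $ m *s kernel_basis y m) - (\<Sum>m\<in>UNIV. a $ m * d m) *s y" for a
  proof -
    have "a v* kernel_rows x t y = (\<Sum>m\<in>UNIV. a $ m *s (kernel_rows x t y $ m))"
      by (simp add: vec_eq_iff vector_matrix_component)
    then have "?E *v (a v* kernel_rows x t y) = (\<Sum>m\<in>UNIV. a $ m *s (?E *v (kernel_rows x t y $ m)))"
      by (simp add: vec.sum vector_scalar_commute)
    moreover have "?E *v (kernel_rows x t y $ m) = kernel_basis y m - d m *s y" for m using row[of m] by simp
    ultimately show ?thesis
      by (simp add: sum_3 vec.scale_right_diff_distrib vector_sadd_rdistrib)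
  qed
  show ?thesis unfolding quadratic_kernel_basis[OF ry] span_rows
  proof (intro equalityI subsetI)
    fix w assume "w \<in> {w. ?E *v w \<in> {\<kappa> *s y + (\<Sum>m\<in>UNIV. a $ m *s kernel_basis y m) | \<kappa> (a :: complex^3). True}}"
    then obtain \<kappa> and a :: "complex^3" where w: "?E *v w = \<kappa> *s y + (\<Sum>m\<in>UNIV. a $ m *s kernel_basis y m)" by blast
    have "(\<Sum>m\<in>UNIV. a $ m *s kernel_basis y m) = ?E *v (a v* kernel_rows x t y) + (\<Sum>m\<in>UNIV. a $ m * d m) *s y"
      unfolding comb by simp
    then have "?E *v w + 0 *s y = ?E *v (a v* kernel_rows x t y) + (\<kappa> + (\<Sum>m\<in>UNIV. a $ m * d m)) *s y"
      unfolding w by (simp only: vector_sadd_rdistrib) simp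
    from tangent_frame_inj[OF fr this] show "w \<in> range (\<lambda>a. a v* kernel_rows x t y)" by blast
  next
    fix w assume "w \<in> range (\<lambda>a. a v* kernel_rows x t y)"
    then obtain a where w: "w = a v* kernel_rows x t y" by blast
    have "?E *v w = (- (\<Sum>m\<in>UNIV. a $ m * d m)) *s y + (\<Sum>m\<in>UNIV. a $ m *s kernel_basis y m)"
      unfolding w comb by (simp only: vec.scale_minus_left) simp
    then show "w \<in> {w. ?E *v w \<in> {\<kappa> *s y + (\<Sum>m\<in>UNIV. a $ m *s kernel_basis y m) | \<kappa> (a :: complex^3). True}}" by blast
  qed
qed

lemma cdiff_root_sum: assumes "x $ i \<noteq> 0" shows "cdiff (*s) U (\<lambda>y. root_sum y i) x"
  unfolding root_sum_def using assms lam_diff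
  by (intro cdiff_sum cdiff_divide cdiff_add cdiff_const cdiff_power cdiff_nth) auto

lemma cdiff_kernel_basis: assumes "x $ i \<noteq> 0" shows "cdiff (*s) U (\<lambda>y. kernel_basis y m $ i) x"
  unfolding kernel_basis_def vec_lambda_beta
  by (cases "m = 1"; cases "m = 2"; simp; intro cdiff_mult cdiff_diff cdiff_nth cdiff_const cdiff_root_sum assms)

lemma cdiff_kernel_rows:
  assumes rt: "roots_at x t C" shows "cdiff (*s) U (\<lambda>y. kernel_rows x t y $ m $ k) x"
proof -
  note xn = roots_at_nonzero[OF rt]
  have u: "cdiff (*s) U (\<lambda>y. (\<chi> i. y $ i / x $ i * kernel_basis y m $ i) $ i) x" for i
    unfolding vec_lambda_beta by (intro cdiff_mult cdiff_divide cdiff_nth cdiff_const cdiff_kernel_basis xn)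
  show ?thesis unfolding kernel_rows_def vec_lambda_beta
    by (intro cdiff_diff cdiff_mult cdiff_divide cdiff_coord[OF rt u] cdiff_coord[OF rt cdiff_moved_point[OF rt]])
      (simp add: moved_point_self[OF rt])
qed

text \<open>The moved frame and the rows of the kernel depend differentiably on the point, so along arcs in the
  regular locus the refined moduli map factors through a differentiable map.\<close>

lemma refined_chain_rule:
  assumes rt: "roots_at x t C" and rig: "rigid_config t (\<lambda>_. 1)" and h: "refined_MPQ_holo h U"
    and U: "refined_moduli_map X D1 D2 x \<in> (U :: ((complex^'n^'n) set \<times> (complex^'n) set) set set)"
  obtains D where "\<And>v \<gamma>. arc_in (X_reg TYPE('n) X D1 D2 e0) x v \<gamma> \<Longrightarrow>
    ((\<lambda>z. h (refined_moduli_map X D1 D2 (\<gamma> z))) has_derivative (\<lambda>z. D (z *s v))) (at 0)"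
proof -
  define Hf where "Hf = (\<lambda>(A, B, p). h (pair_class (form_span A B) (vec.span (rows (p :: complex^'n^3)))))"
  define K where "K y = (pull (moved_frame x t y) D1, pull (moved_frame x t y) D2, kernel_rows x t y)" for y
  define Sp :: "((complex^'n^'n) \<times> (complex^'n^'n) \<times> (complex^'n^3)) set" where "Sp = forms \<times> forms \<times> UNIV"
  define F where "F = {(A, B, p). A \<in> forms \<and> B \<in> forms \<and> nonsingular_pencil (form_span A B) \<and> forms_independent A B \<and>
          vec.dim (vec.span (rows p)) = 3 \<and> pair_class (form_span A B) (vec.span (rows (p :: complex^'n^3))) \<in> U}"
  have K0: "K x = (diagm (\<lambda>k. t k * frame_norm x t k), diagm (frame_norm x t), vander t)"
    by (simp add: K_def moved_frame_self[OF rt] pull_W_D1[OF rt] pull_W_D2[OF rt] kernel_rows_self[OF rt])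
  have c1: "CARD('n) > 1" using card_n by simp
  obtain i j k :: 'n where d: "distinct [i, j, k]" using distinct_indices_n by metis
  have "minor (vander t) i j k \<noteq> 0" unfolding minor_vander using d t_diff[OF rt] by auto
  then have "vec.dim (vec.span (rows (vander t))) = 3"
    by (intro dim_span_rows) (rule minor_nonzero_independent)
  then have "K x \<in> F"
    using U refined_moduli_map_roots[OF rt rig] diagm_nonsingular[OF W_separated[OF rt] c1] diagm_independent[OF W_separated[OF rt] c1]
    by (simp add: K0 F_def)
  moreover have "holo_on_open sc3 Sp Hf F"
    using h unfolding refined_MPQ_holo_def Hf_def F_def Sp_def by (rule conjunct2)
  ultimately obtain DH where DH: "(Hf has_derivative DH) (at (K x) within Sp)"
    unfolding holo_on_open_def by metis
  obtain DP where DP: "(kernel_rows x t has_derivative DP) (at x)"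
    using has_derivative_matrix_entries[of "(*s)" "kernel_rows x t" x] cdiff_kernel_rows[OF rt] by blast
  obtain DK where DK: "(second_form x t has_derivative DK) (at x)" using second_form_derivative[OF rt] by blast
  have Ke: "K = (\<lambda>y. (fst (second_form x t y), snd (second_form x t y), kernel_rows x t y))"
    by (simp add: K_def second_form_def fun_eq_iff)
  have "\<exists>DK. (K has_derivative DK) (at x)" unfolding Ke
    using has_derivative_Pair[OF has_derivative_fst[OF DK] has_derivative_Pair[OF has_derivative_snd[OF DK] DP]] by blast
  then obtain DK where DK: "(K has_derivative DK) (at x)" by blast
  have Kf: "K y \<in> Sp" for y by (simp add: K_def Sp_def pull_forms)
  show thesis
  proof (rule that[of "\<lambda>v. DH (DK v)"])
    fix v \<gamma> assume arc: "arc_in (X_reg TYPE('n) X D1 D2 e0) x v \<gamma>"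
    note a = arc_has_derivative[OF arc]
    have "((\<lambda>z. K (\<gamma> z)) has_derivative (\<lambda>z. DK (z *s v))) (at 0)"
      using has_derivative_compose[OF a(1)] DK a(2) by blast
    from has_derivative_in_compose[OF this, of Hf DH]
    have 1: "((\<lambda>z. Hf (K (\<gamma> z))) has_derivative (\<lambda>z. DH (DK (z *s v)))) (at 0)"
      using has_derivative_subset[OF DH, of "range (\<lambda>z. K (\<gamma> z))"] Kf a(2) by blast
    have ev: "eventually (\<lambda>z. Hf (K (\<gamma> z)) = h (refined_moduli_map X D1 D2 (\<gamma> z))) (nhds 0)"
    proof -
      have "(\<gamma> \<longlongrightarrow> \<gamma> 0) (nhds 0)"
        using has_derivative_continuous[OF a(1)] by (simp add: isCont_def tendsto_at_iff_tendsto_nhds)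
      then have "(\<gamma> \<longlongrightarrow> x) (nhds 0)" using a(2) by simp
      then have "eventually (\<lambda>z. (\<forall>i. \<gamma> z $ i \<noteq> 0) \<and> line_coord x t (moved_point x (\<gamma> z)) \<noteq> 0) (nhds 0)"
        using eventually_moved_frame[OF rt] unfolding filterlim_iff by blast
      with a(3) show ?thesis
      proof eventually_elim
        case (elim z)
        obtain t' C' where ry: "roots_at (\<gamma> z) t' C'" and rig': "rigid_config t' (\<lambda>_. 1)"
          using X_regD[OF elim(1)] by blast
        have X: "\<gamma> z \<in> X" by (rule in_X[OF ry])
        have fr: "tangent_frame D1 D2 (\<gamma> z) (moved_frame x t (\<gamma> z))"
          by (rule moved_frame_tangent[OF rt X]) (use elim in auto)
        have ker: "ker_moduli_map TYPE('n) X D1 D2 (\<gamma> z) = quadratic_kernel (\<gamma> z) t'" by (rule ker_moduli_map_eq[OF ry rig'])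
        have "refined_moduli_map X D1 D2 (\<gamma> z) = pair_class (II D1 D2 (moved_frame x t (\<gamma> z)))
            {w. moved_frame x t (\<gamma> z) *v w \<in> ker_moduli_map TYPE('n) X D1 D2 (\<gamma> z)}"
        proof (rule refined_moduli_map_eq[OF _ _ _ _ fr])
          show "quad D1 (\<gamma> z) = 0" "quad D2 (\<gamma> z) = 0" using X by (simp_all add: X_def)
        qed (simp_all add: ker quadratic_kernel_add)
        also have "\<dots> = pair_class (II D1 D2 (moved_frame x t (\<gamma> z))) (vec.span (rows (kernel_rows x t (\<gamma> z))))"
          unfolding ker using kernel_rows_span[OF rt ry] elim(2) by simp
        finally show ?case by (simp add: Hf_def K_def II_def)
      qed
    qed
    show "((\<lambda>z. h (refined_moduli_map X D1 D2 (\<gamma> z))) has_derivative (\<lambda>z. DH (DK (z *s v)))) (at 0)"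
      by (rule has_derivative_transform_eventually[OF 1 eventually_at_within_if_nhds[OF ev]
        eventually_nhds_x_imp_x[OF ev] UNIV_I])
  qed
qed

lemma roots_at_scale:
  assumes "roots_at x t C" "a \<noteq> 0" shows "roots_at (a *s x) t (a\<^sup>2 * C)"
  using assms by (simp add: roots_at_def power_mult_distrib)

lemma frame_norm_scale: "frame_norm (a *s x) t k = a\<^sup>2 * frame_norm x t k"
  by (simp add: frame_norm_def power_mult_distrib sum_distrib_left)

text \<open>By the chain rule it suffices to consider the arc \<open>(1 + c z) x\<close>, along which the roots do not change.\<close>

lemma line_subset_ker_refined:
  assumes rt: "roots_at x t C" and rig: "rigid_config t (\<lambda>_. 1)" and t0: "\<And>k. t k \<noteq> 0"
  shows "c *s x \<in> ker_refined_moduli_map TYPE('n) X D1 D2 e0 x"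
  unfolding ker_refined_moduli_map_def
proof (intro CollectI conjI perp_scale x_perp[OF rt] allI impI, elim conjE)
  fix h :: "((complex^'n^'n) set \<times> (complex^'n) set) set \<Rightarrow> complex" and U \<gamma>
  assume h: "refined_MPQ_holo h U" "refined_moduli_map X D1 D2 x \<in> U" and \<gamma>: "arc_in (X_reg TYPE('n) X D1 D2 e0) x (c *s x) \<gamma>"
  obtain D where D: "\<And>v \<gamma>. arc_in (X_reg TYPE('n) X D1 D2 e0) x v \<gamma> \<Longrightarrow>
      ((\<lambda>z. h (refined_moduli_map X D1 D2 (\<gamma> z))) has_derivative (\<lambda>z. D (z *s v))) (at 0)"
    by (rule refined_chain_rule[OF rt rig h]) (rule that)
  define \<gamma>0 where "\<gamma>0 z = (1 + c * z) *s x" for z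
  have "eventually (\<lambda>z. 1 + c * z \<noteq> 0) (nhds 0)"
  proof (rule tendsto_imp_eventually_ne)
    show "((\<lambda>z. 1 + c * z) \<longlongrightarrow> 1 + c * 0) (nhds 0)" by (intro tendsto_intros filterlim_ident)
  qed simp
  then obtain r where r: "r > 0" "\<And>z. z \<in> ball 0 r \<Longrightarrow> 1 + c * z \<noteq> 0"
    unfolding eventually_nhds_metric by (auto simp: dist_commute)
  have rtz: "roots_at (\<gamma>0 z) t ((1 + c * z)\<^sup>2 * C)" if "z \<in> ball 0 r" for z
    unfolding \<gamma>0_def by (rule roots_at_scale[OF rt r(2)[OF that]])
  have const: "refined_moduli_map X D1 D2 (\<gamma>0 z)
      = (refined_moduli_map X D1 D2 x :: ((complex^'n^'n) set \<times> (complex^'n) set) set)" if "z \<in> ball 0 r" for z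
  proof -
    let ?a = "(1 + c * z)\<^sup>2"
    have b: "frame_norm (\<gamma>0 z) t = (\<lambda>k. ?a * frame_norm x t k)"
      unfolding \<gamma>0_def fun_eq_iff frame_norm_scale by simp
    have "Pen (\<lambda>k. t k * (?a * frame_norm x t k)) (\<lambda>k. ?a * frame_norm x t k)
      = form_span (mscale ?a (diagm (\<lambda>k. t k * frame_norm x t k)) + mscale 0 (diagm (frame_norm x t)))
         (mscale 0 (diagm (\<lambda>k. t k * frame_norm x t k)) + mscale ?a (diagm (frame_norm x t)))"
      by (simp add: diagm_comb mult.left_commute)
    also have "\<dots> = Pen (\<lambda>k. t k * frame_norm x t k) (frame_norm x t)"
      by (rule form_span_change) (use r(2)[OF that] in simp)
    finally show ?thesis
      unfolding refined_moduli_map_roots[OF rtz[OF that] rig] refined_moduli_map_roots[OF rt rig] b by simp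
  qed
  have arc: "arc_in (X_reg TYPE('n) X D1 D2 e0) x (c *s x) \<gamma>0"
    unfolding arc_in_def
  proof (intro conjI exI[of _ r] ballI allI r(1))
    show "\<gamma>0 0 = x" by (simp add: \<gamma>0_def)
    show "\<gamma>0 z \<in> X_reg TYPE('n) X D1 D2 e0" if "z \<in> ball 0 r" for z
      by (rule in_X_reg[OF rtz[OF that] rig t0])
    show "(\<lambda>z. \<gamma>0 z $ i) holomorphic_on ball 0 r" for i
      unfolding \<gamma>0_def vector_smult_component by (intro holomorphic_intros)
    show "((\<lambda>z. \<gamma>0 z $ i) has_field_derivative (c *s x) $ i) (at 0)" for i
      unfolding \<gamma>0_def vector_smult_component by (auto intro!: derivative_eq_intros)
  qed
  have "((\<lambda>z. h (refined_moduli_map X D1 D2 (\<gamma>0 z))) has_derivative (\<lambda>z. 0)) (at 0)"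
  proof (rule has_derivative_transform_within_open[where s = "ball 0 r" and f = "\<lambda>z. h (refined_moduli_map X D1 D2 x)"])
    show "0 \<in> ball (0 :: complex) r" using r(1) by simp
  qed (auto simp: const)
  from has_derivative_unique[OF D[OF arc] this] have "(\<lambda>z. D (z *s (c *s x))) = (\<lambda>z. 0)" .
  with D[OF \<gamma>] show "((\<lambda>z. h (refined_moduli_map X D1 D2 (\<gamma> z))) has_field_derivative 0) (at 0)"
    by (simp add: has_field_derivative_def mult_zero_left[abs_def])
qed

end

section \<open>The kernel of the differential of the refined moduli map\<close>

lemma cross_ratio_roots:
  assumes "\<And>k. s k \<noteq> 0" shows "cross_ratio (\<lambda>k. t k * s k) s i j k l = cross_ratio t (\<lambda>_. 1) i j k l"
  by (rule cross_ratio_transform[where \<sigma> = "\<lambda>x. x" and c = "\<lambda>k. csqrt (s k)" and \<alpha> = 1 and \<beta> = 0 and \<gamma> = 0 and \<delta> = 1]) (use assms in auto)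

lemma near_config_roots:
  fixes s :: "'n::finite \<Rightarrow> complex"
  assumes n: "near_config \<epsilon> a0 b0 t (\<lambda>_. 1)" and s: "\<And>k. s k \<noteq> 0" shows "near_config \<epsilon> a0 b0 (\<lambda>k. t k * s k) s"
proof -
  have d: "det2 (\<lambda>k. t k * s k) s i j = s i * s j * det2 t (\<lambda>_. 1) i j" for i j by (simp add: det2_def algebra_simps)
  show ?thesis using n s by (simp add: near_config_def separated_def d cross_ratio_roots)
qed

context quadric_pencil
begin

lemma minor_vander_nonzero: "inj t \<Longrightarrow> distinct [i, j, k] \<Longrightarrow> minor (vander t) i j k \<noteq> 0"
  unfolding minor_vander by (auto simp: inj_eq)

text \<open>An invariant of pairs restricts to a function of the roots along an arc of regular points, and
  must be stationary along every arc tangent to the kernel.\<close>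

lemma refined_kernel_stationary:
  assumes rt: "roots_at x t C" and rig: "rigid_config t (\<lambda>_. 1)" and t0: "\<And>k. t k \<noteq> 0"
    and inv: "pair_invariant G" and reg: "pair_regular l j k G" and d: "distinct [l, j, k]"
    and v: "v \<in> ker_refined_moduli_map TYPE('n) X D1 D2 e0 x"
    and r: "r > 0" and g0: "\<gamma> 0 = x" and hol: "\<And>i. (\<lambda>z. \<gamma> z $ i) holomorphic_on ball 0 r"
    and gd: "\<And>i. ((\<lambda>z. \<gamma> z $ i) has_field_derivative v $ i) (at 0)"
    and rtz: "\<And>z. z \<in> ball 0 r \<Longrightarrow> roots_at (\<gamma> z) (\<lambda>k. \<tau> k z) (C' z)"
    and \<tau>0: "\<And>k. \<tau> k 0 = t k" and \<tau>d: "\<And>k. (\<tau> k has_field_derivative \<sigma> k) (at 0)"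
  obtains h where "(h has_field_derivative 0) (at 0)"
    "eventually (\<lambda>z. roots_at (\<gamma> z) (\<lambda>k. \<tau> k z) (C' z) \<and>
       h z = G (\<lambda>k. \<tau> k z * frame_norm (\<gamma> z) (\<lambda>k. \<tau> k z) k) (frame_norm (\<gamma> z) (\<lambda>k. \<tau> k z)) (vander (\<lambda>k. \<tau> k z))) (nhds 0)"
proof -
  have c1: "CARD('n) > 1" using card_n by simp
  note ti = roots_at_inj[OF rt]
  have tend: "((\<lambda>z. \<tau> k z) \<longlongrightarrow> t k) (nhds 0)" for k
  proof -
    have "((\<lambda>z. \<tau> k z) \<longlongrightarrow> \<tau> k 0) (nhds 0)"
      using DERIV_isCont[OF \<tau>d[of k]] by (simp add: isCont_def tendsto_at_iff_tendsto_nhds)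
    then show ?thesis by (simp only: \<tau>0)
  qed
  obtain h U \<epsilon> where e: "\<epsilon> > 0" and h: "refined_MPQ_holo h (U :: ((complex^'n^'n) set \<times> (complex^'n) set) set set)"
    and hU: "\<And>a b p. near_config \<epsilon> t (\<lambda>_. 1) a b \<Longrightarrow> minor p l j k \<noteq> 0 \<Longrightarrow> pair_class (Pen a b) (vec.span (rows p)) \<in> U"
    and hv: "\<And>a b p. near_config \<epsilon> t (\<lambda>_. 1) a b \<Longrightarrow> minor p l j k \<noteq> 0 \<Longrightarrow> h (pair_class (Pen a b) (vec.span (rows p))) = G a b p"
    by (rule pair_invariant_refined_holo[OF rig c1 inv reg]) (rule that)
  have ev0: "eventually (\<lambda>z. z \<in> ball 0 r) (nhds (0 :: complex))"
    by (rule eventually_nhds_in_open) (use r in auto)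
  have ev1: "eventually (\<lambda>z. near_config \<epsilon> t (\<lambda>_. 1) (\<lambda>k. \<tau> k z) (\<lambda>_. 1)) (nhds 0)"
    by (rule eventually_near_config[OF tend ti e])
  have ev2: "eventually (\<lambda>z. rigid_config (\<lambda>k. \<tau> k z) (\<lambda>_. 1)) (nhds 0)"
    by (rule eventually_rigid_config[OF tend ti rig])
  have ev3: "eventually (\<lambda>z. \<forall>k. \<tau> k z \<noteq> 0) (nhds 0)"
    by (intro eventually_all_finite_type tendsto_imp_eventually_ne[OF tend t0])
  have "eventually (\<lambda>z. z \<in> ball 0 r \<and> rigid_config (\<lambda>k. \<tau> k z) (\<lambda>_. 1) \<and> (\<forall>k. \<tau> k z \<noteq> 0)) (nhds 0)"
    by (intro eventually_conj ev0 ev2 ev3)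
  then obtain r1 where r1: "r1 > 0" "\<And>z. z \<in> ball 0 r1 \<Longrightarrow> z \<in> ball 0 r \<and> rigid_config (\<lambda>k. \<tau> k z) (\<lambda>_. 1) \<and> (\<forall>k. \<tau> k z \<noteq> 0)"
    unfolding eventually_nhds_metric by (auto simp: dist_commute)
  have arc: "arc_in (X_reg TYPE('n) X D1 D2 e0) x v \<gamma>"
    unfolding arc_in_def
  proof (intro conjI exI[of _ r1] ballI allI r1(1) g0 gd)
    show "\<gamma> z \<in> X_reg TYPE('n) X D1 D2 e0" if "z \<in> ball 0 r1" for z
      by (rule in_X_reg[OF rtz]) (use r1(2)[OF that] in auto)
    show "(\<lambda>z. \<gamma> z $ i) holomorphic_on ball 0 r1" for i
      by (rule holomorphic_on_subset[OF hol]) (use r1(2) in blast)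
  qed
  have val: "refined_moduli_map X D1 D2 (\<gamma> z) \<in> U \<and> h (refined_moduli_map X D1 D2 (\<gamma> z))
      = G (\<lambda>k. \<tau> k z * frame_norm (\<gamma> z) (\<lambda>k. \<tau> k z) k) (frame_norm (\<gamma> z) (\<lambda>k. \<tau> k z)) (vander (\<lambda>k. \<tau> k z))"
    if z: "z \<in> ball 0 r" and n: "near_config \<epsilon> t (\<lambda>_. 1) (\<lambda>k. \<tau> k z) (\<lambda>_. 1)" and rg: "rigid_config (\<lambda>k. \<tau> k z) (\<lambda>_. 1)" for z
  proof -
    note rz = rtz[OF z]
    have n': "near_config \<epsilon> t (\<lambda>_. 1) (\<lambda>k. \<tau> k z * frame_norm (\<gamma> z) (\<lambda>k. \<tau> k z) k) (frame_norm (\<gamma> z) (\<lambda>k. \<tau> k z))"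
      by (rule near_config_roots[OF n frame_norm_nonzero[OF rz]])
    have m: "minor (vander (\<lambda>k. \<tau> k z)) l j k \<noteq> 0" by (rule minor_vander_nonzero[OF roots_at_inj[OF rz] d])
    show ?thesis unfolding refined_moduli_map_roots[OF rz rg] using hU[OF n' m] hv[OF n' m] by blast
  qed
  have z0: "0 \<in> ball (0 :: complex) r" using r by simp
  have "refined_moduli_map X D1 D2 (\<gamma> 0) \<in> U"
    using val[OF z0 eventually_nhds_x_imp_x[OF ev1] eventually_nhds_x_imp_x[OF ev2]] by blast
  then have "((\<lambda>z. h (refined_moduli_map X D1 D2 (\<gamma> z))) has_field_derivative 0) (at 0)"
    using v h arc g0 unfolding ker_refined_moduli_map_def by auto
  moreover have "eventually (\<lambda>z. roots_at (\<gamma> z) (\<lambda>k. \<tau> k z) (C' z) \<and> h (refined_moduli_map X D1 D2 (\<gamma> z))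
      = G (\<lambda>k. \<tau> k z * frame_norm (\<gamma> z) (\<lambda>k. \<tau> k z) k) (frame_norm (\<gamma> z) (\<lambda>k. \<tau> k z)) (vander (\<lambda>k. \<tau> k z))) (nhds 0)"
    using ev0 ev1 ev2 by eventually_elim (use val rtz in blast)
  ultimately show thesis by (rule that)
qed

text \<open>The refined moduli map determines the moduli map, so the argument with cross ratios applies to it too.\<close>

lemma ker_refined_subset_quadratic_kernel:
  assumes rt: "roots_at x t C" and rig: "rigid_config t (\<lambda>_. 1)" and t0: "\<And>k. t k \<noteq> 0"
    and v: "v \<in> ker_refined_moduli_map TYPE('n) X D1 D2 e0 x"
  shows "v \<in> quadratic_kernel x t"
proof -
  have "v \<in> perp D1 D2 x" using v by (simp add: ker_refined_moduli_map_def)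
  then obtain y \<kappa> where yk: "v = W x t *v y + \<kappa> *s x" using W_surj[OF rt] by blast
  define \<sigma> where "\<sigma> k = - 2 * y $ k" for k
  define \<tau> where "\<tau> k z = t k + z * \<sigma> k" for k z
  have der: "(\<tau> k has_field_derivative \<sigma> k) (at 0)" for k
    unfolding \<tau>_def by (auto intro!: derivative_eq_intros)
  have \<tau>0: "\<tau> k 0 = t k" for k by (simp add: \<tau>_def)
  have hol: "\<tau> k holomorphic_on ball 0 1" for k unfolding \<tau>_def by (intro holomorphic_intros)
  obtain \<gamma> r C' where g: "r > 0" "r \<le> 1" "\<gamma> 0 = x" "\<And>i. (\<lambda>z. \<gamma> z $ i) holomorphic_on ball 0 r"
    "\<And>i. ((\<lambda>z. \<gamma> z $ i) has_field_derivative (\<kappa> *s x + W x t *v (\<chi> k. - \<sigma> k / 2)) $ i) (at 0)"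
    "\<And>z. z \<in> ball 0 r \<Longrightarrow> roots_at (\<gamma> z) (\<lambda>k. \<tau> k z) (C' z)"
    by (rule root_arc[where \<tau> = \<tau> and \<kappa> = \<kappa>, OF rt zero_less_one hol \<tau>0 der]) (rule that)
  have v': "v = \<kappa> *s x + W x t *v (\<chi> k. - \<sigma> k / 2)"
    by (simp add: yk \<sigma>_def add.commute)
  have eq: "(\<sigma> i - \<sigma> j) / (t i - t j) + (\<sigma> k - \<sigma> l) / (t k - t l)
      - ((\<sigma> i - \<sigma> k) / (t i - t k) + (\<sigma> j - \<sigma> l) / (t j - t l)) = 0" if d: "distinct [i, j, k, l]" for i j k l
  proof -
    have d3: "distinct [i, j, k]" using d by auto
    obtain h where h: "(h has_field_derivative 0) (at 0)"
      "eventually (\<lambda>z. roots_at (\<gamma> z) (\<lambda>k. \<tau> k z) (C' z) \<and>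
       h z = cross_ratio (\<lambda>k. \<tau> k z * frame_norm (\<gamma> z) (\<lambda>k. \<tau> k z) k) (frame_norm (\<gamma> z) (\<lambda>k. \<tau> k z)) i j k l) (nhds 0)"
      by (rule refined_kernel_stationary[OF rt rig t0 cross_ratio_pair_invariant cross_ratio_pair_regular[OF d] d3 v g(1,3,4)
            g(5)[folded v'] g(6) \<tau>0 der]) (assumption | rule that)+
    have "eventually (\<lambda>z. h z = cross_ratio (\<lambda>k. \<tau> k z) (\<lambda>_. 1) i j k l) (nhds 0)"
      using h(2)
    proof eventually_elim
      case (elim z)
      then have "\<And>k. frame_norm (\<gamma> z) (\<lambda>k. \<tau> k z) k \<noteq> 0" using frame_norm_nonzero by blast
      from cross_ratio_roots[where t = "\<lambda>k. \<tau> k z", OF this] show ?case using elim by simp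
    qed
    then show ?thesis
      by (rule log_deriv_zero_if_stationary[OF cross_ratio_log_deriv[OF der \<tau>0 roots_at_inj[OF rt] d] h(1)])
  qed
  obtain i j k :: 'n where "distinct [i, j, k]" using distinct_indices_n by metis
  then obtain a b c where abc: "\<And>k. \<sigma> k = a + b * t k + c * (t k)\<^sup>2"
    using cross_ratio_preserving_quadratic[OF roots_at_inj[OF rt] _ eq] by blast
  have "(\<chi> k. - \<sigma> k / 2) = (\<chi> k. (- a / 2) + (- b / 2) * t k + (- c / 2) * (t k)\<^sup>2)"
    by (simp add: vec_eq_iff abc field_simps)
  then have "v = \<kappa> *s x + W x t *v (\<chi> k. (- a / 2) + (- b / 2) * t k + (- c / 2) * (t k)\<^sup>2)"
    unfolding v' by (simp only:)
  then show ?thesis unfolding quadratic_kernel_def by blast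
qed

text \<open>The logarithmic derivative of the product of the \<open>s - lam\<^sub>i\<close>.\<close>

definition lam_log :: "complex \<Rightarrow> complex" where "lam_log s = (\<Sum>i\<in>UNIV. 1 / (s - lam i))"

text \<open>The part of the numerator of \<open>minor_ratio\<close> that is left at a point with given roots once the factors
  common to numerator and denominator are cancelled.\<close>

definition root_weight :: "('n \<Rightarrow> complex \<Rightarrow> complex) \<Rightarrow> 'n \<Rightarrow> 'n \<Rightarrow> 'n \<Rightarrow> complex \<Rightarrow> complex" where
  "root_weight \<tau> j k i z = ((\<tau> j z - \<tau> i z) * (\<tau> k z - \<tau> i z))\<^sup>2 * (\<tau> i z - \<tau> j z)
     * ((\<Prod>m\<in>UNIV - {i}. \<tau> i z - \<tau> m z) / (\<Prod>u\<in>UNIV. \<tau> i z - lam u))"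

lemma minor_ratio_roots:
  assumes rt: "roots_at x (\<lambda>k. \<tau> k z) C" and d: "distinct [i, l, j, k]"
  shows "minor_ratio i l j k (\<lambda>m. \<tau> m z * frame_norm x (\<lambda>k. \<tau> k z) m) (frame_norm x (\<lambda>k. \<tau> k z)) (vander (\<lambda>k. \<tau> k z))
    = root_weight \<tau> j k i z / root_weight \<tau> j k l z"
proof -
  let ?t = "\<lambda>k. \<tau> k z"
  let ?B = "\<lambda>i. (\<Prod>m\<in>UNIV - {i}. ?t i - ?t m) / (\<Prod>u\<in>UNIV. ?t i - lam u)"
  have b: "frame_norm x ?t i = - C * ?B i" for i by (simp add: frame_norm_eq[OF rt])
  define q where "q = (?t k - ?t j)\<^sup>2 * frame_norm x ?t j * (- C)"
  have "?t k \<noteq> ?t j" using injD[OF roots_at_inj[OF rt], of k j] d by auto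
  then have q: "q \<noteq> 0" using frame_norm_nonzero[OF rt, of j] rt by (auto simp: q_def roots_at_def)
  have e: "(minor (vander ?t) i j k)\<^sup>2 * det2 (\<lambda>m. ?t m * frame_norm x ?t m) (frame_norm x ?t) i j = q * root_weight \<tau> j k i z" for i
  proof -
    have "det2 (\<lambda>m. ?t m * frame_norm x ?t m) (frame_norm x ?t) i j = frame_norm x ?t i * frame_norm x ?t j * (?t i - ?t j)"
      by (simp add: det2_def algebra_simps)
    then have "(minor (vander ?t) i j k)\<^sup>2 * det2 (\<lambda>m. ?t m * frame_norm x ?t m) (frame_norm x ?t) i j
      = ((?t j - ?t i) * (?t k - ?t i))\<^sup>2 * (?t k - ?t j)\<^sup>2 * ((- C * ?B i) * frame_norm x ?t j * (?t i - ?t j))"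
      by (simp only: minor_vander power_mult_distrib b[of i])
    also have "\<dots> = q * root_weight \<tau> j k i z"
      unfolding root_weight_def q_def by (simp only: mult_ac)
    finally show ?thesis .
  qed
  show ?thesis unfolding minor_ratio_def e using q by simp
qed

text \<open>If the roots move with quadratic velocity, then the difference of two of them has logarithmic
  derivative \<open>b + c (t\<^sub>x + t\<^sub>y)\<close>.  In the result, the terms are ordered such that only the last two
  depend on \<open>i\<close>.\<close>

lemma root_weight_log_deriv:
  assumes inj: "inj t" and tl: "\<And>k u. t k \<noteq> lam u" and \<tau>0: "\<And>k. \<tau> k 0 = t k"
    and der: "\<And>k. (\<tau> k has_field_derivative a + b * t k + c * (t k)\<^sup>2) (at 0)" and d: "distinct [i, j, k]"
  shows "log_deriv (root_weight \<tau> j k i)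
    ((of_nat CARD('n) + 4) * b + c * (3 * t j + 2 * t k + (\<Sum>m\<in>UNIV. t m)) + of_nat (CARD('n) + 3) * c * t i
      - (a + b * t i + c * (t i)\<^sup>2) * lam_log (t i))"
proof -
  let ?q = "\<lambda>s. a + b * s + c * s\<^sup>2"
  have diff: "log_deriv (\<lambda>z. \<tau> x z - \<tau> y z) (b + c * (t x + t y))" if "x \<noteq> y" for x y
  proof -
    have n: "t x - t y \<noteq> 0" using that inj by (simp add: inj_eq)
    have "log_deriv (\<lambda>z. \<tau> x z - \<tau> y z) ((?q (t x) - ?q (t y)) / (\<tau> x 0 - \<tau> y 0))"
      by (rule log_deriv_diff[OF der der]) (use n in \<open>simp add: \<tau>0\<close>)
    moreover have "?q (t x) - ?q (t y) = (b + c * (t x + t y)) * (t x - t y)"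
      by (simp add: power2_eq_square algebra_simps)
    ultimately show ?thesis using n by (simp add: \<tau>0)
  qed
  have lamf: "log_deriv (\<lambda>z. \<tau> i z - lam u) (?q (t i) * (1 / (t i - lam u)))" for u
  proof -
    have n: "t i - lam u \<noteq> 0" using tl by simp
    have "((\<lambda>z. \<tau> i z - lam u) has_field_derivative ?q (t i)) (at 0)"
      by (auto intro!: derivative_eq_intros der)
    from log_derivI[OF this] show ?thesis using n by (simp add: \<tau>0)
  qed
  have ij: "i \<noteq> j" "j \<noteq> i" "k \<noteq> i" using d by auto
  have l1: "log_deriv (root_weight \<tau> j k i)
    ((of_nat 2 * ((b + c * (t j + t i)) + (b + c * (t k + t i))) + (b + c * (t i + t j)))
     + ((\<Sum>m\<in>UNIV - {i}. b + c * (t i + t m)) - (\<Sum>u\<in>UNIV. ?q (t i) * (1 / (t i - lam u)))))"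
    unfolding root_weight_def[abs_def]
    by (intro log_deriv_mult log_deriv_divide log_deriv_power log_deriv_prod diff lamf ij) auto
  have s1: "(\<Sum>m\<in>UNIV - {i}. b + c * (t i + t m)) = (of_nat CARD('n) - 1) * (b + c * t i) + c * ((\<Sum>m\<in>UNIV. t m) - t i)"
  proof -
    have "(\<Sum>m\<in>UNIV. b + c * (t i + t m)) = (b + c * (t i + t i)) + (\<Sum>m\<in>UNIV - {i}. b + c * (t i + t m))"
      by (rule sum.remove) auto
    moreover have "(\<Sum>m\<in>UNIV. b + c * (t i + t m)) = of_nat CARD('n) * (b + c * t i) + c * (\<Sum>m\<in>UNIV. t m)"
      by (simp add: sum.distrib sum_distrib_left distrib_left algebra_simps)
    ultimately show ?thesis by (simp add: algebra_simps)
  qed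
  have s2: "(\<Sum>u\<in>UNIV. ?q (t i) * (1 / (t i - lam u))) = ?q (t i) * lam_log (t i)"
    unfolding lam_log_def sum_distrib_left ..
  from l1[unfolded s1 s2] show ?thesis
    by (rule back_subst[where P = "log_deriv (root_weight \<tau> j k i)"]) (simp add: algebra_simps)
qed

text \<open>The expression is, up to a constant, the relative rate of change at \<open>t\<^sub>k\<close> of the binary form of degree
  \<open>n + 3\<close> with roots \<open>lam\<^sub>i\<close> under the projective vector field \<open>a + b s + c s\<^sup>2\<close>.  Stationarity of the
  minor ratios says that the rates at any two roots agree.\<close>

lemma ker_refined_quadratic_constraint:
  assumes rt: "roots_at x t C" and rig: "rigid_config t (\<lambda>_. 1)" and t0: "\<And>k. t k \<noteq> 0"
    and v: "v \<in> ker_refined_moduli_map TYPE('n) X D1 D2 e0 x"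
    and v': "v = \<kappa> *s x + W x t *v (\<chi> k. - (a + b * t k + c * (t k)\<^sup>2) / 2)"
  shows "\<exists>\<mu>. \<forall>k. (a + b * t k + c * (t k)\<^sup>2) * lam_log (t k) - of_nat (CARD('n) + 3) * c * t k = \<mu>"
proof -
  define g where "g s = (a + b * s + c * s\<^sup>2) * lam_log s - of_nat (CARD('n) + 3) * c * s" for s
  obtain \<gamma> r C' where m: "r > 0" "\<gamma> 0 = x" "\<And>i. (\<lambda>z. \<gamma> z $ i) holomorphic_on ball 0 r"
    "\<And>i. ((\<lambda>z. \<gamma> z $ i) has_field_derivative (\<kappa> *s x + W x t *v (\<chi> k. - (a + b * t k + c * (t k)\<^sup>2) / 2)) $ i) (at 0)"
    "\<And>z. z \<in> ball 0 r \<Longrightarrow> roots_at (\<gamma> z) (\<lambda>k. moebius_move a b c z (t k)) (C' z)"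
    "\<And>k. ((\<lambda>z. moebius_move a b c z (t k)) has_field_derivative a + b * t k + c * (t k)\<^sup>2) (at 0)"
    by (rule moebius_arc[OF rt, of \<kappa> a b c]) (rule that)
  define \<tau> where "\<tau> k z = moebius_move a b c z (t k)" for k z
  have \<tau>0: "\<tau> k 0 = t k" for k by (simp add: \<tau>_def moebius_move_def)
  have der: "(\<tau> k has_field_derivative a + b * t k + c * (t k)\<^sup>2) (at 0)" for k unfolding \<tau>_def by (rule m(6))
  have rtz: "roots_at (\<gamma> z) (\<lambda>k. \<tau> k z) (C' z)" if "z \<in> ball 0 r" for z unfolding \<tau>_def by (rule m(5)[OF that])
  have tl: "t k \<noteq> lam u" for k u using rt unfolding roots_at_def by blast
  note ti = roots_at_inj[OF rt]
  have eq: "g (t i) = g (t l)" if il: "i \<noteq> l" for i l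
  proof -
    have "CARD('n) - 2 \<ge> 2" using card_n by simp
    then have "card (UNIV - {i, l}) \<ge> 2" using il by (simp add: card_Diff_subset)
    then obtain P where P: "P \<subseteq> UNIV - {i, l}" "card P = 2" using obtain_subset_with_card_n by metis
    then obtain j k where "P = {j, k}" "j \<noteq> k" by (meson card_2_iff)
    then have d: "distinct [i, l, j, k]" and d1: "distinct [i, j, k]" and d2: "distinct [l, j, k]" and lj: "l \<noteq> j"
      using P il by auto
    obtain h where h: "(h has_field_derivative 0) (at 0)"
      "eventually (\<lambda>z. roots_at (\<gamma> z) (\<lambda>k. \<tau> k z) (C' z) \<and>
       h z = minor_ratio i l j k (\<lambda>k. \<tau> k z * frame_norm (\<gamma> z) (\<lambda>k. \<tau> k z) k) (frame_norm (\<gamma> z) (\<lambda>k. \<tau> k z)) (vander (\<lambda>k. \<tau> k z))) (nhds 0)"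
      by (rule refined_kernel_stationary[OF rt rig t0 minor_ratio_pair_invariant[of i l j k] minor_ratio_pair_regular[OF lj] d2 v m(1,2,3)
            m(4)[folded v'] rtz \<tau>0 der]) (assumption | rule that)+
    have ev: "eventually (\<lambda>z. h z = root_weight \<tau> j k i z / root_weight \<tau> j k l z) (nhds 0)"
      using h(2) by eventually_elim (use minor_ratio_roots d in auto)
    have "log_deriv (\<lambda>z. root_weight \<tau> j k i z / root_weight \<tau> j k l z)
     (((of_nat CARD('n) + 4) * b + c * (3 * t j + 2 * t k + (\<Sum>m\<in>UNIV. t m)) + of_nat (CARD('n) + 3) * c * t i
      - (a + b * t i + c * (t i)\<^sup>2) * lam_log (t i)) -
     ((of_nat CARD('n) + 4) * b + c * (3 * t j + 2 * t k + (\<Sum>m\<in>UNIV. t m)) + of_nat (CARD('n) + 3) * c * t l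
      - (a + b * t l + c * (t l)\<^sup>2) * lam_log (t l)))"
      by (intro log_deriv_divide root_weight_log_deriv ti tl \<tau>0 der d1 d2)
    from log_deriv_zero_if_stationary[OF this h(1) ev] show ?thesis
      unfolding g_def by (simp add: algebra_simps)
  qed
  have "\<forall>k. g (t k) = g (t undefined)" using eq by metis
  then show ?thesis unfolding g_def by blast
qed

lemma good_point:
  assumes rt: "roots_at x t C" and rig: "rigid_config t (\<lambda>_. 1)" and t0: "\<And>k. t k \<noteq> 0"
    and gen: "\<And>a b c \<mu>. (\<And>k. (a + b * t k + c * (t k)\<^sup>2) * lam_log (t k) - of_nat (CARD('n) + 3) * c * t k = \<mu>)
       \<Longrightarrow> a = 0 \<and> b = 0 \<and> c = 0"
  shows "x \<in> X_good TYPE('n) X D1 D2 e0"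
proof -
  have "v \<in> vec.span {x}" if v: "v \<in> ker_refined_moduli_map TYPE('n) X D1 D2 e0 x" for v
  proof -
    have "v \<in> quadratic_kernel x t" by (rule ker_refined_subset_quadratic_kernel[OF rt rig t0 v])
    then obtain \<kappa> a b c where v': "v = \<kappa> *s x + W x t *v (\<chi> k. a + b * t k + c * (t k)\<^sup>2)"
      by (auto simp: quadratic_kernel_def)
    have "(\<chi> k. a + b * t k + c * (t k)\<^sup>2) = (\<chi> k. - (- 2 * a + (- 2 * b) * t k + (- 2 * c) * (t k)\<^sup>2) / 2)"
      by (simp add: vec_eq_iff field_simps)
    then have "v = \<kappa> *s x + W x t *v (\<chi> k. - (- 2 * a + (- 2 * b) * t k + (- 2 * c) * (t k)\<^sup>2) / 2)"
      unfolding v' by (simp only:)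
    from ker_refined_quadratic_constraint[OF rt rig t0 v this] obtain \<mu> where
      "\<And>k. (- 2 * a + (- 2 * b) * t k + (- 2 * c) * (t k)\<^sup>2) * lam_log (t k) - of_nat (CARD('n) + 3) * (- 2 * c) * t k = \<mu>" by blast
    from gen[OF this] have abc: "a = 0" "b = 0" "c = 0" by auto
    have "(\<chi> k. a + b * t k + c * (t k)\<^sup>2) = 0" by (simp add: abc vec_eq_iff)
    then have "v = \<kappa> *s x" unfolding v' by simp
    then show ?thesis by (auto simp: vec.span_singleton)
  qed
  moreover have "v \<in> ker_refined_moduli_map TYPE('n) X D1 D2 e0 x" if "v \<in> vec.span {x}" for v
    using that line_subset_ker_refined[OF rt rig t0] by (auto simp: vec.span_singleton)
  ultimately show ?thesis unfolding X_good_def using in_X_reg[OF rt rig t0] by blast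
qed

end

section \<open>Existence of a good configuration of roots\<close>

text \<open>As long as the common zero space of the functionals at the chosen points is nonzero, a further point
  lowers its dimension.\<close>

lemma finite_vanishing_test_set:
  fixes f :: "complex^'m \<Rightarrow> complex \<Rightarrow> complex"
  assumes add: "\<And>u v s. f (u + v) s = f u s + f v s" and scale: "\<And>c u s. f (c *s u) s = c * f u s"
    and ne: "\<And>u. u \<noteq> 0 \<Longrightarrow> \<exists>s\<in>G. f u s \<noteq> 0"
  obtains T where "finite T" "T \<subseteq> G" "card T \<le> CARD('m)" "\<forall>u. (\<forall>s\<in>T. f u s = 0) \<longrightarrow> u = 0"
proof -
  define K where "K T = {u. \<forall>s\<in>T. f u s = 0}" for T
  have f0: "f 0 s = 0" for s using scale[of 0 0 s] by simp
  have sub: "vec.subspace (K T)" for T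
    unfolding vec.subspace_def K_def by (auto simp: add scale f0)
  have "\<exists>T. finite T \<and> T \<subseteq> G \<and> card T \<le> d \<and> vec.dim (K T) \<le> CARD('m) - d" for d
  proof (induction d)
    case 0
    have "vec.dim (K {}) \<le> vec.dim (UNIV :: (complex^'m) set)" by (rule vec.dim_subset) simp
    then show ?case unfolding vec_dim_card by (intro exI[of _ "{}"]) simp
  next
    case (Suc d)
    then obtain T where T: "finite T" "T \<subseteq> G" "card T \<le> d" "vec.dim (K T) \<le> CARD('m) - d" by blast
    show ?case
    proof (cases "K T = {0}")
      case True
      then have "vec.dim (K T) = 0" by simp
      then have "vec.dim (K T) \<le> CARD('m) - Suc d" by (simp only: le0)
      then show ?thesis using T le_SucI by blast
    next
      case False
      have "0 \<in> K T" using sub vec.subspace_0 by blast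
      then obtain u where u: "u \<in> K T" "u \<noteq> 0" using False by blast
      then obtain s where s: "s \<in> G" "f u s \<noteq> 0" using ne by blast
      have "vec.span (K (insert s T)) \<subset> vec.span (K T)"
      proof -
        have "K (insert s T) \<subseteq> K T" "u \<notin> K (insert s T)" using s by (auto simp: K_def)
        then show ?thesis using u(1) sub vec.span_eq_iff by blast
      qed
      then have "vec.dim (K (insert s T)) < vec.dim (K T)" by (rule vec.dim_psubset)
      moreover have "card (insert s T) \<le> Suc d" using T(1,3) card_insert_le_m1[of "Suc d" T s] by simp
      ultimately show ?thesis using T s by (intro exI[of _ "insert s T"]) auto
    qed
  qed
  from this[of "CARD('m)"] obtain T where T: "finite T" "T \<subseteq> G" "card T \<le> CARD('m)" "vec.dim (K T) \<le> 0" by auto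
  have "K T \<subseteq> {0}" using T(4) vec.dim_eq_0 by simp
  then show ?thesis using that[of T] T(1-3) by (auto simp: K_def)
qed

text \<open>For suitable indices, the equation that \<open>\<sigma>\<close> preserves a cross ratio involving the last point is a
  polynomial equation of degree at most two for the position \<open>s\<close> of that point.  Three indices can be
  chosen freely while avoiding two others, since there are more than four.\<close>

lemma finitely_many_symmetric_positions:
  fixes t :: "'n::finite \<Rightarrow> complex"
  assumes card: "CARD('n) > 4" and inj: "inj_on t (UNIV - {k})" and bs: "bij \<sigma>" and ns: "\<sigma> \<noteq> id"
  shows "finite {s. s \<notin> t ` (UNIV - {k}) \<and> (\<forall>i j l m. distinct [i, j, l, m] \<longrightarrow>
    cross_ratio (t(k := s)) (\<lambda>_. 1) (\<sigma> i) (\<sigma> j) (\<sigma> l) (\<sigma> m) = cross_ratio (t(k := s)) (\<lambda>_. 1) i j l m)}" (is "finite ?B")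
proof -
  have ne: "t i \<noteq> t j" if "i \<noteq> j" "i \<noteq> k" "j \<noteq> k" for i j using inj that by (auto dest: inj_onD)
  have si: "\<sigma> i \<noteq> \<sigma> j" if "i \<noteq> j" for i j using bs that by (auto simp: bij_def inj_eq)
  have pick: "\<exists>i j l. distinct [i, j, l] \<and> {i, j, l} \<inter> {x, y} = {}" for x y :: 'n
  proof -
    have "card {x, y} \<le> 2" by (simp add: card_insert_if)
    then have "card (UNIV - {x, y}) \<ge> 3" using card by (simp add: card_Diff_subset)
    then obtain P where P: "P \<subseteq> UNIV - {x, y}" "card P = 3" using obtain_subset_with_card_n by metis
    then obtain i j l where "P = {i, j, l}" "i \<noteq> j" "j \<noteq> l" "i \<noteq> l" unfolding card_3_iff by metis
    then have "distinct [i, j, l] \<and> {i, j, l} \<inter> {x, y} = {}" using P(1) by auto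
    then show ?thesis by blast
  qed
  show ?thesis
  proof (cases "\<sigma> k = k")
    case False
    obtain p where p: "\<sigma> p = k" using bs by (metis bij_pointE)
    obtain i j l where d: "distinct [i, j, l]" "{i, j, l} \<inter> {k, p} = {}" using pick by blast
    then have nk: "i \<noteq> k" "j \<noteq> k" "l \<noteq> k" "i \<noteq> j" "i \<noteq> l" "j \<noteq> l" by auto
    \<comment> \<open>Only the right hand side of the equation of cross ratios involves the last point.\<close>
    have sk: "\<sigma> x \<noteq> k" if "x \<in> {i, j, l, k}" for x
      using that d(2) si p False by (metis IntI empty_iff insertI1 insertI2 insertE)
    define A where "A = (t i - t j) / (t i - t l)"
    define K where "K = (t (\<sigma> i) - t (\<sigma> j)) * (t (\<sigma> l) - t (\<sigma> k)) / ((t (\<sigma> i) - t (\<sigma> l)) * (t (\<sigma> j) - t (\<sigma> k)))"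
    have A: "A \<noteq> 0" using ne nk by (simp add: A_def)
    have "?B \<subseteq> {s. poly [:A * t l - K * t j, K - A:] s = 0}"
    proof
      fix s assume "s \<in> ?B"
      then have s: "s \<notin> t ` (UNIV - {k})" and
        c: "cross_ratio (t(k := s)) (\<lambda>_. 1) (\<sigma> i) (\<sigma> j) (\<sigma> l) (\<sigma> k) = cross_ratio (t(k := s)) (\<lambda>_. 1) i j l k"
        using d nk by auto
      have sj: "t j - s \<noteq> 0" using s nk by auto
      have "K = A * ((t l - s) / (t j - s))"
        using c sk nk by (simp add: cross_ratio_def det2_def K_def A_def)
      then have "A * (t l - s) = K * (t j - s)" using sj by (simp add: field_simps)
      then show "s \<in> {s. poly [:A * t l - K * t j, K - A:] s = 0}" by (simp add: algebra_simps)
    qed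
    moreover have "[:A * t l - K * t j, K - A:] \<noteq> 0"
    proof
      assume "[:A * t l - K * t j, K - A:] = 0"
      then have "A * t l - K * t j = 0" "K = A" by auto
      then have "A * (t l - t j) = 0" by (simp add: algebra_simps)
      then show False using A ne[of l j] nk by auto
    qed
    ultimately show ?thesis using poly_roots_finite finite_subset by blast
  next
    case True
    \<comment> \<open>Now both sides involve the last point.  The quadratic polynomial is nonzero because its vanishing would
       force \<open>\<sigma>\<close> to fix the points with indices \<open>l\<close>, \<open>j\<close> and finally \<open>i\<close>.\<close>
    obtain i where i: "\<sigma> i \<noteq> i" using ns by (auto simp: fun_eq_iff)
    then have ik: "i \<noteq> k" using True by auto
    obtain j l m where d: "distinct [j, l, m]" "{j, l, m} \<inter> {i, k} = {}" using pick by blast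
    then have nk: "j \<noteq> k" "l \<noteq> k" "i \<noteq> j" "i \<noteq> l" "j \<noteq> l" by auto
    have sk: "\<sigma> x \<noteq> k" if "x \<noteq> k" for x using si[OF that] True by simp
    define ti tj tl ui uj ul where "ti = t i" and "tj = t j" and "tl = t l"
      and "ui = t (\<sigma> i)" and "uj = t (\<sigma> j)" and "ul = t (\<sigma> l)"
    note defs = ti_def tj_def tl_def ui_def uj_def ul_def
    have nt: "ti \<noteq> tj" "ti \<noteq> tl" "tj \<noteq> tl" "ui \<noteq> uj" "ui \<noteq> ul" "uj \<noteq> ul"
      unfolding defs using ne nk ik sk si by auto
    define A where "A = (ti - tj) * (ui - ul)"
    define B where "B = (ui - uj) * (ti - tl)"
    have AB: "A \<noteq> 0" "B \<noteq> 0" using nt by (auto simp: A_def B_def)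
    let ?p = "[:A * tl * uj - B * ul * tj, - A * (tl + uj) + B * (ul + tj), A - B:]"
    have pe: "poly ?p s = A * (tl - s) * (uj - s) - B * (ul - s) * (tj - s)" for s
      by (simp add: algebra_simps)
    have "?B \<subseteq> {s. poly ?p s = 0}"
    proof
      fix s assume "s \<in> ?B"
      then have s: "s \<notin> t ` (UNIV - {k})" and
        c: "cross_ratio (t(k := s)) (\<lambda>_. 1) (\<sigma> i) (\<sigma> j) (\<sigma> l) (\<sigma> k) = cross_ratio (t(k := s)) (\<lambda>_. 1) i j l k"
        using d nk ik by auto
      have sj: "tj - s \<noteq> 0" "uj - s \<noteq> 0" unfolding defs using s nk sk by auto
      have "(ui - uj) * (ul - s) / ((ui - ul) * (uj - s)) = (ti - tj) * (tl - s) / ((ti - tl) * (tj - s))"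
        unfolding defs using c sk[of i] sk[of j] sk[of l] True nk ik by (simp add: cross_ratio_def det2_def)
      then have "(ui - uj) * (ul - s) * ((ti - tl) * (tj - s)) = (ti - tj) * (tl - s) * ((ui - ul) * (uj - s))"
        by (subst (asm) frac_eq_eq) (use nt sj in auto)
      then have "A * (tl - s) * (uj - s) - B * (ul - s) * (tj - s) = 0" unfolding A_def B_def by algebra
      then have "poly ?p s = 0" by (simp only: pe)
      then show "s \<in> {s. poly ?p s = 0}" by simp
    qed
    moreover have "?p \<noteq> 0"
    proof
      assume z: "?p = 0"
      have "poly ?p tl = 0" "poly ?p tj = 0" unfolding z by simp_all
      then have "B * (ul - tl) * (tj - tl) = 0" "A * (tl - tj) * (uj - tj) = 0" unfolding pe by simp_all
      then have e: "ul = tl" "uj = tj" using AB nt by auto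
      have "A = B" using z by simp
      then have "(tl - tj) * (ui - ti) = 0" unfolding A_def B_def e by algebra
      then have "ui = ti" using nt by auto
      then show False unfolding defs using ne[of "\<sigma> i" i] i ik sk[OF ik] by blast
    qed
    ultimately show ?thesis using poly_roots_finite finite_subset by blast
  qed
qed

context quadric_pencil
begin

text \<open>The condition of \<open>ker_refined_quadratic_constraint\<close> at a root \<open>s\<close>, as a linear functional of \<open>(a, b, c, \<mu>)\<close>.\<close>

definition constraint :: "complex^4 \<Rightarrow> complex \<Rightarrow> complex" where
  "constraint u s = (u $ 1 + u $ 2 * s + u $ 3 * s\<^sup>2) * lam_log s - of_nat (CARD('n) + 3) * u $ 3 * s - u $ 4"

text \<open>The residue at \<open>lam\<^sub>i\<close> is the value of the quadratic polynomial there, so the quadratic polynomial has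
  more than two zeros.\<close>

lemma constraint_vanishing:
  assumes z: "\<And>s. s \<noteq> 0 \<Longrightarrow> (\<And>i. s \<noteq> lam i) \<Longrightarrow> constraint u s = 0" shows "u = 0"
proof -
  have res: "u $ 3 * (lam i)\<^sup>2 + u $ 2 * lam i + u $ 1 = 0" for i
  proof -
    define g where "g s = (u $ 1 + u $ 2 * s + u $ 3 * s\<^sup>2) * (1 + (\<Sum>j\<in>UNIV - {i}. (s - lam i) / (s - lam j)))
       - (s - lam i) * (of_nat (CARD('n) + 3) * u $ 3 * s + u $ 4)" for s
    have fin: "finite (insert 0 (range lam))" by simp
    have ev: "eventually (\<lambda>s. s \<notin> insert 0 (range lam) - {lam i}) (at (lam i))"
    proof -
      have "open (- (insert 0 (range lam) - {lam i}))" using fin by (intro open_Compl finite_imp_closed) simp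
      from eventually_at_in_open'[OF this, of "lam i"] show ?thesis by (simp only: Compl_iff) simp
    qed
    have ev2: "eventually (\<lambda>s. s \<noteq> lam i) (at (lam i))" by (simp add: eventually_at_filter)
    have "eventually (\<lambda>s. g s = 0) (at (lam i))"
      using ev ev2
    proof eventually_elim
      case (elim s)
      then have sl: "s \<noteq> 0" "s \<noteq> lam j" for j by auto
      have m: "(s - lam i) * lam_log s = 1 + (\<Sum>j\<in>UNIV - {i}. (s - lam i) / (s - lam j))"
      proof -
        have "lam_log s = 1 / (s - lam i) + (\<Sum>j\<in>UNIV - {i}. 1 / (s - lam j))"
          unfolding lam_log_def by (rule sum.remove) auto
        then show ?thesis using sl(2)[of i] by (simp add: distrib_left sum_distrib_left)
      qed
      have "g s = (s - lam i) * constraint u s"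
        unfolding g_def m[symmetric] constraint_def by (simp only: algebra_simps)
      then show ?case using z[of s] sl by simp
    qed
    then have "(g \<longlongrightarrow> 0) (at (lam i))" by (rule tendsto_eventually)
    moreover have "(g \<longlongrightarrow> g (lam i)) (at (lam i))"
      unfolding g_def[abs_def] using lam_diff by (intro tendsto_intros) auto
    ultimately have "g (lam i) = 0" using tendsto_unique[OF trivial_limit_at] by blast
    then show ?thesis by (simp add: g_def algebra_simps)
  qed
  have "CARD('v) \<ge> 3" using card_v by simp
  then obtain i j k :: 'v where d: "distinct [i, j, k]" using three_distinct_indices by metis
  have u: "u $ 3 = 0" "u $ 2 = 0" "u $ 1 = 0" using quadratic_three_zeros[OF inj_lam d res] by auto
  have "infinite (- insert 0 (range lam))" by (simp add: infinite_UNIV_char_0 Compl_eq_Diff_UNIV)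
  then obtain s where "s \<in> - insert 0 (range lam)" by (metis finite.emptyI ex_in_conv)
  then have "constraint u s = 0" by (intro z) auto
  then have "u $ 4 = 0" by (simp add: constraint_def u)
  then show ?thesis using u by (simp add: vec_eq_iff forall_4)
qed

text \<open>At most four roots \<open>T\<close> force the quadratic polynomial to vanish.  They are completed arbitrarily by \<open>E\<close> to
  all roots but one, and the last root \<open>s\<close> avoids the finitely many positions that admit a symmetry.\<close>

lemma exists_good_roots:
  obtains t :: "'n \<Rightarrow> complex" where "inj t" "\<And>k i. t k \<noteq> lam i" "\<And>k. t k \<noteq> 0" "rigid_config t (\<lambda>_. 1)"
    "\<And>a b c \<mu>. (\<And>k. (a + b * t k + c * (t k)\<^sup>2) * lam_log (t k) - of_nat (CARD('n) + 3) * c * t k = \<mu>)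
       \<Longrightarrow> a = 0 \<and> b = 0 \<and> c = 0"
proof -
  define G where "G = - insert 0 (range lam)"
  have infG: "infinite G" by (simp add: G_def infinite_UNIV_char_0 Compl_eq_Diff_UNIV)
  have add: "constraint (u + v) s = constraint u s + constraint v s" for u v s by (simp add: constraint_def algebra_simps)
  have scale: "constraint (c *s u) s = c * constraint u s" for c u s by (simp add: constraint_def algebra_simps)
  have ne: "\<exists>s\<in>G. constraint u s \<noteq> 0" if "u \<noteq> 0" for u
  proof (rule ccontr)
    assume "\<not> (\<exists>s\<in>G. constraint u s \<noteq> 0)"
    then have "u = 0" by (intro constraint_vanishing) (auto simp: G_def)
    then show False using that by simp
  qed
  obtain T where T: "finite T" "T \<subseteq> G" "card T \<le> CARD(4)" and test: "\<forall>u. (\<forall>s\<in>T. constraint u s = 0) \<longrightarrow> u = 0"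
    using finite_vanishing_test_set[of constraint G, OF add scale ne] by metis
  have c4: "card T \<le> CARD('n) - 1" using T(3) card_n by simp
  have "infinite (G - T)" using infG T(1) by simp
  then obtain E where E: "E \<subseteq> G - T" "finite E" "card E = CARD('n) - 1 - card T"
    using infinite_arbitrarily_large by metis
  \<comment> \<open>The index of the last root.\<close>
  define k :: 'n where "k = undefined"
  have "card (T \<union> E) = CARD('n) - 1" using T(1) E c4 by (subst card_Un_disjoint) auto
  moreover have "card (UNIV - {k}) = CARD('n) - 1" by (simp add: card_Diff_singleton)
  ultimately obtain t0 where t0: "bij_betw t0 (UNIV - {k}) (T \<union> E)"
    using finite_same_card_bij[of "UNIV - {k}" "T \<union> E"] T(1) E(2) by auto
  have inj0: "inj_on t0 (UNIV - {k})" and im0: "t0 ` (UNIV - {k}) = T \<union> E" using t0 by (auto simp: bij_betw_def)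
  define B where "B \<sigma> = {s. s \<notin> t0 ` (UNIV - {k}) \<and> (\<forall>i j l m. distinct [i, j, l, m] \<longrightarrow>
    cross_ratio (t0(k := s)) (\<lambda>_. 1) (\<sigma> i) (\<sigma> j) (\<sigma> l) (\<sigma> m) = cross_ratio (t0(k := s)) (\<lambda>_. 1) i j l m)}" for \<sigma>
  have "finite (\<Union>\<sigma>\<in>{\<sigma>. bij \<sigma> \<and> \<sigma> \<noteq> id}. B \<sigma>)"
    by (rule finite_UN_I) (use finitely_many_symmetric_positions[OF card_n inj0] in \<open>auto simp: B_def\<close>)
  then have "finite ((\<Union>\<sigma>\<in>{\<sigma>. bij \<sigma> \<and> \<sigma> \<noteq> id}. B \<sigma>) \<union> (T \<union> E))" using T(1) E(2) by simp
  then have "infinite (G - ((\<Union>\<sigma>\<in>{\<sigma>. bij \<sigma> \<and> \<sigma> \<noteq> id}. B \<sigma>) \<union> (T \<union> E)))" using infG by (rule Diff_infinite_finite)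
  then obtain s where sG: "s \<in> G - ((\<Union>\<sigma>\<in>{\<sigma>. bij \<sigma> \<and> \<sigma> \<noteq> id}. B \<sigma>) \<union> (T \<union> E))"
    using infinite_imp_nonempty by (metis (no_types) equals0I)
  have s: "s \<in> G" "s \<notin> T \<union> E" "\<And>\<sigma>. bij \<sigma> \<Longrightarrow> \<sigma> \<noteq> id \<Longrightarrow> s \<notin> B \<sigma>" using sG by blast+
  define t where "t = t0(k := s)"
  have tG: "t m \<in> G" for m
    using s(1) im0 T(2) E(1) by (cases "m = k") (auto simp: t_def)
  have inj: "inj t"
  proof (rule injI)
    fix x y assume "t x = t y"
    then show "x = y" using s(2) im0 inj0 by (auto simp: t_def inj_on_def split: if_splits)
  qed
  have "rigid_config t (\<lambda>_. 1)" unfolding rigid_config_def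
  proof (intro allI impI, elim conjE, rule ccontr)
    fix \<sigma> :: "'n \<Rightarrow> 'n" assume "bij \<sigma>" "\<forall>i j l m. distinct [i, j, l, m] \<longrightarrow>
      cross_ratio t (\<lambda>_. 1) (\<sigma> i) (\<sigma> j) (\<sigma> l) (\<sigma> m) = cross_ratio t (\<lambda>_. 1) i j l m" "\<sigma> \<noteq> id"
    then have "s \<in> B \<sigma>" using s(2) im0 unfolding B_def t_def by blast
    then show False using s(3) \<open>bij \<sigma>\<close> \<open>\<sigma> \<noteq> id\<close> by blast
  qed
  moreover have "a = 0 \<and> b = 0 \<and> c = 0"
    if *: "\<And>k. (a + b * t k + c * (t k)\<^sup>2) * lam_log (t k) - of_nat (CARD('n) + 3) * c * t k = \<mu>" for a b c \<mu>
  proof -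
    define u :: "complex^4" where "u = (\<chi> i. if i = 1 then a else if i = 2 then b else if i = 3 then c else \<mu>)"
    have u: "u $ 1 = a" "u $ 2 = b" "u $ 3 = c" "u $ 4 = \<mu>" by (simp_all add: u_def)
    have "constraint u x = 0" if x: "x \<in> T" for x
    proof -
      obtain m where "m \<noteq> k" "x = t0 m" using x im0 by (metis DiffE UnI1 imageE singletonI)
      then have "x = t m" by (simp add: t_def)
      then show ?thesis using *[of m] by (simp add: constraint_def u)
    qed
    then have "u = 0" using test by blast
    then show ?thesis using u by simp
  qed
  moreover have "t m \<noteq> lam i" "t m \<noteq> 0" for m i using tG[of m] by (auto simp: G_def)
  ultimately show ?thesis using that[of t] inj by blast
qed

lemma X_good_nonempty: "X_good TYPE('n) X D1 D2 e0 \<noteq> {}"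
proof (rule exists_good_roots)
  fix t :: "'n \<Rightarrow> complex"
  assume t: "inj t" "\<And>k i. t k \<noteq> lam i" "\<And>k. t k \<noteq> 0" "rigid_config t (\<lambda>_. 1)"
    and gen: "\<And>a b c \<mu>. (\<And>k. (a + b * t k + c * (t k)\<^sup>2) * lam_log (t k) - of_nat (CARD('n) + 3) * c * t k = \<mu>)
       \<Longrightarrow> a = 0 \<and> b = 0 \<and> c = 0"
  define x :: "complex^'v" where "x = (\<chi> i. csqrt ((\<Prod>k\<in>UNIV. lam i - t k) / L i))"
  have "roots_at x t 1" unfolding roots_at_def using t(1,2) L_nonzero by (simp add: x_def)
  have "x \<in> X_good TYPE('n) X D1 D2 e0"
    by (rule good_point[OF \<open>roots_at x t 1\<close> t(4,3)]) (rule gen, assumption)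
  then show ?thesis by blast
qed

end

section \<open>Change of coordinates\<close>

lemma arc_in_linear_image:
  fixes Q :: "complex^'a^'b"
  assumes "arc_in Y x v \<gamma>" shows "arc_in ((*v) Q ` Y) (Q *v x) (Q *v v) (\<lambda>z. Q *v \<gamma> z)"
proof -
  obtain r where r: "r > 0" "\<forall>z\<in>ball 0 r. \<gamma> z \<in> Y" "\<And>i. (\<lambda>z. \<gamma> z $ i) holomorphic_on ball 0 r"
    and g0: "\<gamma> 0 = x" and d: "\<And>i. ((\<lambda>z. \<gamma> z $ i) has_field_derivative v $ i) (at 0)"
    using assms unfolding arc_in_def by blast
  show ?thesis unfolding arc_in_def
  proof (intro conjI exI[of _ r] ballI allI r(1))
    show "Q *v \<gamma> 0 = Q *v x" by (simp add: g0)
    show "Q *v \<gamma> z \<in> (*v) Q ` Y" if "z \<in> ball 0 r" for z using r(2) that by blast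
    show "(\<lambda>z. (Q *v \<gamma> z) $ i) holomorphic_on ball 0 r" for i
      unfolding matrix_vector_mult_def vec_lambda_beta by (intro holomorphic_on_sum holomorphic_on_mult holomorphic_on_const r(3))
    show "((\<lambda>z. (Q *v \<gamma> z) $ i) has_field_derivative (Q *v v) $ i) (at 0)" for i
      unfolding matrix_vector_mult_def vec_lambda_beta by (intro DERIV_sum DERIV_cmult d)
  qed
qed

text \<open>Polarization.\<close>

lemma form_eq_if_quad_eq:
  assumes "S \<in> forms" "R \<in> forms" "\<And>v. quad S v = quad R v" shows "S = R"
proof (rule bil_eq_imp_eq)
  have pol: "2 * bil M u v = quad M (u + v) - quad M u - quad M v" if "M \<in> forms" for M :: "complex^'a^'a" and u v
    using bil_commute[OF that, of u v] by (simp add: quad_def bil_add_left bil_add_right)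
  fix u v
  have "2 * bil S u v = 2 * bil R u v" unfolding pol[OF assms(1)] pol[OF assms(2)] assms(3) ..
  then show "bil S u v = bil R u v" by simp
qed

text \<open>All notions are compatible with a linear isomorphism: the point \<open>z\<close> with respect to the forms pulled back by
  \<open>P\<close> corresponds to \<open>P z\<close>.\<close>

locale coordinate_change =
  fixes P P' :: "complex^'v^'v" and A B :: "complex^'v^'v" and X :: "(complex^'v) set"
  assumes PP': "P ** P' = mat 1" and P'P: "P' ** P = mat 1"
begin

definition A' where "A' = pull P A"
definition B' where "B' = pull P B"
definition X' where "X' = {z. P *v z \<in> X}"
definition eP :: "'v \<Rightarrow> complex^'v" where "eP i = P *v axis i 1"

lemma cancel [simp]: "P *v (P' *v v) = v" "P' *v (P *v v) = v"
  by (simp_all add: matrix_vector_mul_assoc PP' P'P)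

lemma inj_P: "P *v u = P *v v \<longleftrightarrow> u = v" by (metis cancel(2))

lemma perp_P: "P *v v \<in> perp A B (P *v z) \<longleftrightarrow> v \<in> perp A' B' z"
  by (simp add: perp_def A'_def B'_def bil_pull)

lemma frame_P: "tangent_frame A B (P *v z) (P ** E) \<longleftrightarrow> tangent_frame A' B' z E"
proof -
  let ?f = "\<lambda>(w, c). E *v w + c *s z"
  have c: "(\<lambda>(w, c). (P ** E) *v w + c *s (P *v z)) = (*v) P \<circ> ?f"
    by (simp add: fun_eq_iff matrix_vector_mul_assoc[symmetric] matrix_vector_right_distrib vector_scalar_commute)
  have im: "perp A B (P *v z) = (*v) P ` perp A' B' z"
  proof (intro equalityI subsetI)
    fix u assume "u \<in> perp A B (P *v z)"
    then have "P' *v u \<in> perp A' B' z" using perp_P[of "P' *v u" z] by simp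
    then show "u \<in> (*v) P ` perp A' B' z" by (metis cancel(1) imageI)
  qed (use perp_P in auto)
  have injP: "inj ((*v) P)" by (rule injI) (simp add: inj_P)
  have "inj ((*v) P \<circ> ?f) \<longleftrightarrow> inj ?f" using injP inj_compose inj_on_imageI2 by blast
  moreover have "range ((*v) P \<circ> ?f) = (*v) P ` perp A' B' z \<longleftrightarrow> range ?f = perp A' B' z"
    unfolding image_comp[symmetric] by (rule inj_image_eq_iff[OF injP])
  ultimately show ?thesis unfolding tangent_frame_def c im bij_betw_def by blast
qed

lemma frame_P': "tangent_frame A B (P *v z) E \<longleftrightarrow> tangent_frame A' B' z (P' ** E)"
  using frame_P[of z "P' ** E"] by (simp add: matrix_mul_assoc PP')

lemma II_P: "II A B (P ** E) = II A' B' E" by (simp add: II_def A'_def B'_def pull_pull)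

lemma frame_ex: "(\<exists>E. tangent_frame A B (P *v z) E \<and> R E) \<longleftrightarrow> (\<exists>E. tangent_frame A' B' z E \<and> R (P ** E))"
  by (metis frame_P frame_P' matrix_mul_assoc PP' matrix_mul_lid)

lemma X_o_P: "P *v z \<in> X_o TYPE('n::finite) X A B \<longleftrightarrow> z \<in> X_o TYPE('n) X' A' B'"
  unfolding X_o_def mem_Collect_eq frame_ex II_P by (simp add: X'_def)

lemma moduli_map_P: "moduli_map A B (P *v z) = moduli_map A' B' z"
proof (rule set_eqI)
  fix \<Phi> show "\<Phi> \<in> moduli_map A B (P *v z) \<longleftrightarrow> \<Phi> \<in> moduli_map A' B' z"
    using frame_ex[of z "\<lambda>E. \<Phi> = II A B E"] unfolding moduli_map_def mem_Collect_eq II_P by metis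
qed

text \<open>Arcs correspond under \<open>P\<close>; the property \<open>R\<close> stands for stationarity of local functions.\<close>

lemma arcs_P:
  assumes Y: "\<And>z. P *v z \<in> Y \<longleftrightarrow> z \<in> Y'"
  shows "(\<forall>\<gamma>. arc_in Y (P *v z) (P *v v) \<gamma> \<longrightarrow> R \<gamma>) \<longleftrightarrow> (\<forall>\<gamma>. arc_in Y' z v \<gamma> \<longrightarrow> R (\<lambda>s. P *v \<gamma> s))"
proof -
  have Y1: "Y = (*v) P ` Y'" using Y by (auto simp: image_iff) (metis cancel(1))
  have Y2: "(*v) P' ` Y = Y'" unfolding Y1 by (simp add: image_image)
  show ?thesis
  proof (intro iffI allI impI)
    fix \<gamma> assume *: "\<forall>\<gamma>. arc_in Y (P *v z) (P *v v) \<gamma> \<longrightarrow> R \<gamma>" and "arc_in Y' z v \<gamma>"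
    then show "R (\<lambda>s. P *v \<gamma> s)" using arc_in_linear_image[of Y' z v \<gamma> P] unfolding Y1 by blast
  next
    fix \<gamma> assume *: "\<forall>\<gamma>. arc_in Y' z v \<gamma> \<longrightarrow> R (\<lambda>s. P *v \<gamma> s)" and "arc_in Y (P *v z) (P *v v) \<gamma>"
    then have "arc_in Y' z v (\<lambda>s. P' *v \<gamma> s)" using arc_in_linear_image[of Y "P *v z" "P *v v" \<gamma> P'] by (simp add: Y2)
    then show "R \<gamma>" using * by fastforce
  qed
qed

lemma ker_moduli_map_P: "P *v v \<in> ker_moduli_map TYPE('n::finite) X A B (P *v z) \<longleftrightarrow> v \<in> ker_moduli_map TYPE('n) X' A' B' z"
proof -
  have "(\<forall>h U \<gamma>. MPQ_holo h (U :: (complex^'n^'n) set set set) \<and> moduli_map A B (P *v z) \<in> U \<and> arc_in (X_o TYPE('n) X A B) (P *v z) (P *v v) \<gamma> \<longrightarrow>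
       ((\<lambda>s. h (moduli_map A B (\<gamma> s))) has_field_derivative 0) (at 0)) \<longleftrightarrow>
     (\<forall>h U. MPQ_holo h (U :: (complex^'n^'n) set set set) \<and> moduli_map A' B' z \<in> U \<longrightarrow> (\<forall>\<gamma>. arc_in (X_o TYPE('n) X A B) (P *v z) (P *v v) \<gamma> \<longrightarrow>
       ((\<lambda>s. h (moduli_map A B (\<gamma> s))) has_field_derivative 0) (at 0)))"
    unfolding moduli_map_P by blast
  also have "\<dots> \<longleftrightarrow> (\<forall>h U. MPQ_holo h (U :: (complex^'n^'n) set set set) \<and> moduli_map A' B' z \<in> U \<longrightarrow> (\<forall>\<gamma>. arc_in (X_o TYPE('n) X' A' B') z v \<gamma> \<longrightarrow>
       ((\<lambda>s. h (moduli_map A' B' (\<gamma> s))) has_field_derivative 0) (at 0)))"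
    unfolding arcs_P[OF X_o_P] moduli_map_P ..
  finally show ?thesis unfolding ker_moduli_map_def mem_Collect_eq perp_P by blast
qed

lemma X_reg_P: "P *v z \<in> X_reg TYPE('n::finite) X A B eP \<longleftrightarrow> z \<in> X_reg TYPE('n) X' A' B' (\<lambda>i. axis i 1)"
proof -
  have "(P *v z = (\<Sum>i\<in>UNIV. y i *s eP i)) \<longleftrightarrow> (z = (\<Sum>i\<in>UNIV. y i *s axis i 1))" for y
  proof -
    have "(\<Sum>i\<in>UNIV. y i *s eP i) = P *v (\<Sum>i\<in>UNIV. y i *s axis i 1)"
      by (simp add: eP_def vec.sum vector_scalar_commute)
    then show ?thesis by (simp add: inj_P)
  qed
  moreover have "pull (P ** E) A = pull E A'" "pull (P ** E) B = pull E B'" for E :: "complex^'n^'v"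
    by (simp_all add: A'_def B'_def pull_pull)
  ultimately show ?thesis unfolding X_reg_def mem_Collect_eq frame_ex II_P by (simp add: X'_def)
qed

lemma refined_moduli_map_P: "refined_moduli_map X A B (P *v z) =
   (refined_moduli_map X' A' B' z :: ((complex^'n::finite^'n) set \<times> (complex^'n) set) set)"
proof -
  have k: "{w. (P ** E) *v w \<in> ker_moduli_map TYPE('n) X A B (P *v z)} = {w. E *v w \<in> ker_moduli_map TYPE('n) X' A' B' z}" for E :: "complex^'n^'v"
    by (simp add: matrix_vector_mul_assoc[symmetric] ker_moduli_map_P)
  show ?thesis
  proof (rule set_eqI)
    fix p :: "(complex^'n^'n) set \<times> (complex^'n) set"
    show "p \<in> refined_moduli_map X A B (P *v z) \<longleftrightarrow> p \<in> refined_moduli_map X' A' B' z"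
      using frame_ex[of z "\<lambda>E. p = (II A B E, {w. E *v w \<in> ker_moduli_map TYPE('n) X A B (P *v z)})"]
      unfolding refined_moduli_map_def mem_Collect_eq II_P k by (simp only: conj_commute)
  qed
qed

lemma ker_refined_moduli_map_P:
  "P *v v \<in> ker_refined_moduli_map TYPE('n::finite) X A B eP (P *v z) \<longleftrightarrow> v \<in> ker_refined_moduli_map TYPE('n) X' A' B' (\<lambda>i. axis i 1) z"
proof -
  have "(\<forall>h U \<gamma>. refined_MPQ_holo h (U :: ((complex^'n^'n) set \<times> (complex^'n) set) set set) \<and> refined_moduli_map X A B (P *v z) \<in> U \<and> arc_in (X_reg TYPE('n) X A B eP) (P *v z) (P *v v) \<gamma> \<longrightarrow>
       ((\<lambda>s. h (refined_moduli_map X A B (\<gamma> s))) has_field_derivative 0) (at 0)) \<longleftrightarrow>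
     (\<forall>h U. refined_MPQ_holo h (U :: ((complex^'n^'n) set \<times> (complex^'n) set) set set) \<and> refined_moduli_map X' A' B' z \<in> U \<longrightarrow> (\<forall>\<gamma>. arc_in (X_reg TYPE('n) X A B eP) (P *v z) (P *v v) \<gamma> \<longrightarrow>
       ((\<lambda>s. h (refined_moduli_map X A B (\<gamma> s))) has_field_derivative 0) (at 0)))"
    unfolding refined_moduli_map_P by blast
  also have "\<dots> \<longleftrightarrow> (\<forall>h U. refined_MPQ_holo h (U :: ((complex^'n^'n) set \<times> (complex^'n) set) set set) \<and> refined_moduli_map X' A' B' z \<in> U \<longrightarrow> (\<forall>\<gamma>. arc_in (X_reg TYPE('n) X' A' B' (\<lambda>i. axis i 1)) z v \<gamma> \<longrightarrow>
       ((\<lambda>s. h (refined_moduli_map X' A' B' (\<gamma> s))) has_field_derivative 0) (at 0)))"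
    unfolding arcs_P[OF X_reg_P] refined_moduli_map_P ..
  finally show ?thesis unfolding ker_refined_moduli_map_def mem_Collect_eq perp_P by blast
qed

lemma X_good_P:
  assumes "z \<in> X_good TYPE('n::finite) X' A' B' (\<lambda>i. axis i 1)" shows "P *v z \<in> X_good TYPE('n) X A B eP"
proof -
  have z: "z \<in> X_reg TYPE('n) X' A' B' (\<lambda>i. axis i 1)" "ker_refined_moduli_map TYPE('n) X' A' B' (\<lambda>i. axis i 1) z = vec.span {z}"
    using assms by (auto simp: X_good_def)
  have "u \<in> ker_refined_moduli_map TYPE('n) X A B eP (P *v z) \<longleftrightarrow> u \<in> vec.span {P *v z}" for u
  proof -
    have "u \<in> ker_refined_moduli_map TYPE('n) X A B eP (P *v z) \<longleftrightarrow> P' *v u \<in> vec.span {z}"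
      using ker_refined_moduli_map_P[of "P' *v u" z, where ?'n = 'n] z(2) by simp
    also have "\<dots> \<longleftrightarrow> (\<exists>c. P' *v u = c *s z)" by (auto simp: vec.span_singleton)
    also have "\<dots> \<longleftrightarrow> (\<exists>c. u = c *s (P *v z))"
      by (metis cancel vector_scalar_commute)
    finally show ?thesis by (auto simp: vec.span_singleton)
  qed
  then show ?thesis using z(1) X_reg_P by (auto simp: X_good_def)
qed

end

theorem theorem1p5:
  fixes X :: "(complex^'v) set"
    and \<phi>1 \<phi>2 :: "complex^'v^'v"
    and e :: "'v \<Rightarrow> complex^'v"
    and lam :: "'v \<Rightarrow> complex"
  assumes "CARD('n::finite) > 4"
    and "CARD('v) = CARD('n) + 3"
    and "nonsingular_intersection_of_two_quadrics X"
    and "diagonalizing_choice X \<phi>1 \<phi>2 e lam"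
  shows "X_good TYPE('n) X \<phi>1 \<phi>2 e \<noteq> {}"
proof -
  from assms(4) have f: "\<phi>1 \<in> forms" "\<phi>2 \<in> forms" and van: "form_span \<phi>1 \<phi>2 = vanishing_forms X"
    and inje: "inj e" and ind: "vec.independent (range e)" and inj: "inj lam"
    and q1: "\<And>z. quad \<phi>1 (\<Sum>i\<in>UNIV. z i *s e i) = (\<Sum>i\<in>UNIV. lam i * (z i)\<^sup>2)"
    and q2: "\<And>z. quad \<phi>2 (\<Sum>i\<in>UNIV. z i *s e i) = (\<Sum>i\<in>UNIV. (z i)\<^sup>2)"
    unfolding diagonalizing_choice_def by auto
  interpret Q: quadric_pencil lam "TYPE('n)" by unfold_locales (fact inj assms(2) assms(1))+
  define P :: "complex^'v^'v" where "P = (\<chi> r i. e i $ r)"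
  have Pz: "P *v z = (\<Sum>i\<in>UNIV. z $ i *s e i)" for z
    by (simp add: vec_eq_iff P_def matrix_vector_mult_def mult.commute)
  have "z = 0" if "P *v z = 0" for z
  proof -
    have "(\<Sum>v\<in>range e. z $ (inv e v) *s v) = 0"
      using that inje unfolding Pz by (simp add: sum.reindex)
    then have "z $ (inv e v) = 0" if "v \<in> range e" for v
      using ind that by (intro vec.independentD[OF ind, of "range e" "\<lambda>v. z $ (inv e v)"]) auto
    then have "z $ i = 0" for i using inje by (metis inv_f_f rangeI)
    then show ?thesis by (simp add: vec_eq_iff)
  qed
  then have "\<exists>P'. P' ** P = mat 1" by (simp add: matrix_left_invertible_ker)
  then obtain P' where P': "P' ** P = mat 1" by blast
  then have "P ** P' = mat 1" by (simp add: matrix_left_right_inverse)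
  then interpret T: coordinate_change P P' \<phi>1 \<phi>2 X using P' by unfold_locales
  have A': "T.A' = diagm lam"
    unfolding T.A'_def
    by (rule form_eq_if_quad_eq) (auto simp: pull_forms f quad_def bil_pull bil_diagm Pz q1[unfolded quad_def] power2_eq_square mult_ac)
  have B': "T.B' = diagm (\<lambda>_. 1)"
    unfolding T.B'_def
    by (rule form_eq_if_quad_eq) (auto simp: pull_forms f quad_def bil_pull bil_diagm Pz q2[unfolded quad_def] power2_eq_square)
  have e: "T.eP = e"
  proof
    fix i
    have "T.eP i $ r = e i $ r" for r unfolding T.eP_def mat_vec_axis by (simp add: P_def column_def)
    then show "T.eP i = e i" by (simp add: vec_eq_iff)
  qed
  \<comment> \<open>The equations of \<open>X\<close> vanish on \<open>X\<close>, so they are combinations of the forms \<open>\<phi>1\<close> and \<open>\<phi>2\<close>.\<close>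
  have X: "x \<in> X \<longleftrightarrow> x \<noteq> 0 \<and> quad \<phi>1 x = 0 \<and> quad \<phi>2 x = 0" for x
  proof
    assume x: "x \<in> X"
    have "\<phi>1 = mscale 1 \<phi>1 + mscale 0 \<phi>2" "\<phi>2 = mscale 0 \<phi>1 + mscale 1 \<phi>2" by (simp_all add: vec_eq_iff)
    then have "\<phi>1 \<in> vanishing_forms X" "\<phi>2 \<in> vanishing_forms X" unfolding van[symmetric] form_span_def by blast+
    then show "x \<noteq> 0 \<and> quad \<phi>1 x = 0 \<and> quad \<phi>2 x = 0"
      using x assms(3) by (auto simp: vanishing_forms_def nonsingular_intersection_of_two_quadrics_def)
  next
    assume x: "x \<noteq> 0 \<and> quad \<phi>1 x = 0 \<and> quad \<phi>2 x = 0"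
    obtain Q1 Q2 where Q: "Q1 \<in> forms" "Q2 \<in> forms" "X = {x. x \<noteq> 0 \<and> quad Q1 x = 0 \<and> quad Q2 x = 0}"
      using assms(3) by (auto simp: nonsingular_intersection_of_two_quadrics_def)
    then have "Q1 \<in> form_span \<phi>1 \<phi>2" "Q2 \<in> form_span \<phi>1 \<phi>2" unfolding van vanishing_forms_def by auto
    then have "quad Q1 x = 0" "quad Q2 x = 0" using x by (auto simp: form_span_def quad_def bil_comb)
    then show "x \<in> X" using x Q(3) by simp
  qed
  have X': "T.X' = Q.X"
  proof -
    have "P *v z = 0 \<longleftrightarrow> z = 0" for z using T.inj_P[of z 0] by simp
    moreover have "quad \<phi>1 (P *v z) = quad (diagm lam) z" "quad \<phi>2 (P *v z) = quad (diagm (\<lambda>_. 1)) z" for z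
      unfolding A'[symmetric] B'[symmetric] T.A'_def T.B'_def by (simp_all add: quad_def bil_pull)
    ultimately show ?thesis by (simp add: T.X'_def Q.X_def X)
  qed
  obtain z where "z \<in> X_good TYPE('n) Q.X (diagm lam) (diagm (\<lambda>_. 1)) (\<lambda>i. axis i 1)"
    using Q.X_good_nonempty by blast
  from T.X_good_P[unfolded A' B' X' e, OF this] show ?thesis by blast
qed

end
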